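(* Let $\tau$ be an analytic expanding circle map and let $A=A_{r,R}\in\mathcal{A}$ be an annulus chosen together with $A_0,A'\in\mathcal{A}$ such that $A_0\subset\subset A'\subset\subset A$ and $\tau(\partial A_0)\cap\mathrm{cl}(A)=\emptyset$. Let $\mathcal{L}\colon H^2(A)\to H^2(A)$ be the transfer operator associated to $\tau$ and $\mathcal{L}^*\colon H^2(A)^*\to H^2(A)^*$ its Banach space adjoint. Then the isomorphism $J\colon H^2(D_r)\oplus H^2_0(D_R^\infty)\to H^2(A)^*$ conjugates $\mathcal{L}^*$ to the operator $$\mathcal{L}'\colon H^2(D_r)\oplus H^2_0(D^\infty_R)\to H^2(D_r)\oplus H^2_0(D^\infty_R)$$ given by $$\mathcal{L}'=\begin{pmatrix}\Pi^{(r)}_+C^{(r)} & \Pi^{(R)}_+C^{(R)}\\ \Pi^{(r)}_-C^{(r)} & \Pi^{(R)}_-C^{(R)}\end{pmatrix},$$ that is, $\mathcal{L}'=J^{-1}\mathcal{L}^*J$.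
   Context: Notation: $\hat{\mathbb{C}}=\mathbb{C}\cup\{\infty\}$, $\mathbb{T}_\rho=\{z\in\mathbb{C}:|z|=\rho\}$, $\mathbb{T}=\mathbb{T}_1$, $D_r=\{z\in\mathbb{C}:|z|<r\}$, $D_R^\infty=\{z\in\hat{\mathbb{C}}:|z|>R\}$, $A_{r,R}=\{z\in\mathbb{C}:r<|z|<R\}$ with $r<1<R$; $\mathrm{cl}(U)$ is the closure of $U$ in $\hat{\mathbb{C}}$, and $U\subset\subset V$ means that $\mathrm{cl}(U)$ is a compact subset of $V$. $L^2(\mathbb{T}_\rho)$ is taken with respect to normalized Lebesgue measure $d\theta/2\pi$. An analytic expanding circle map is a map $\tau\colon\mathbb{T}\to\mathbb{T}$ that is analytic on $\mathbb{T}$ with $|\tau'(z)|>1$ for all $z\in\mathbb{T}$; it is a $K$-fold covering for some $K>1$. Its holomorphic extension to an open annulus $A_{r,R}$ with $r<1<R$ is again denoted $\tau$, and $\mathcal{A}$ is the set of annuli $A_{r,R}$ ($r<1<R$) on which $\tau$ and $1/\tau$ are holomorphic. The transfer operator is $(\mathcal{L}f)(z)=\sum_{k=1}^K\phi_k'(z)(f\circ\phi_k)(z)$, where $\phi_k$ denotes the $k$-th local inverse of $\tau$. For $A$ chosen as in the claim, $\mathcal{L}$ is a well-defined compact operator on $H^2(A)$. Hardy-Hilbert spaces: with $M_\rho(f)=\int_0^{2\pi}|f(\rho e^{i\theta})|^2\frac{d\theta}{2\pi}$, $H^2(D_r)$ is the space of holomorphic $f$ on $D_r$ with $M_\rho(f)$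 bounded as $\rho\nearrow r$; $H^2(D_R^\infty)$ is the space of holomorphic $f$ on $D_R^\infty$ (including at $\infty$) with $M_\rho(f)$ bounded as $\rho\searrow R$, and $H_0^2(D_R^\infty)$ is its subspace of functions vanishing at $\infty$; $H^2(A_{r,R})$ is the space of holomorphic $f$ on $A_{r,R}$ with $M_\rho(f)$ bounded as $\rho\nearrow R$ and as $\rho\searrow r$. Functions in these spaces have a.e. radial boundary values in $L^2$ of the boundary circles (denoted by the same letter). The spaces are Hilbert spaces with the $L^2$ inner product of boundary values (for $A_{r,R}$, the sum of the inner products in $L^2(\mathbb{T}_R)$ and $L^2(\mathbb{T}_r)$). The direct sum has norm $\|(h_1,h_2)\|^2=\|h_1\|^2_{H^2(D_r)}+\|h_2\|^2_{H^2_0(D_R^\infty)}$. $H^2(A)^*$ is the strong dual of $H^2(A)$, and $(\mathcal{L}^*l)(f)=l(\mathcal{L}f)$ for $l\in H^2(A)^*$, $f\in H^2(A)$. The map $J$ is the isomorphism given by $$(J(h_1,h_2))(f)=\frac1{2\pi i}\int_{\mathbb{T}_r}f(z)h_1(z)\,dz+\frac1{2\pi i}\int_{\mathbb{T}_R}f(z)h_2(z)\,dz\qquad(f\in H^2(A)).$$ The operators $C^{(r)}\colon H^2(D_r)\to L^2(\mathbb{T}_r)$ and $C^{(R)}\colon H_0^2(D_R^\infty)\to L^2(\mathbb{T}_R)$ are $(C^{(r)}h)(z)=h(\tau(z))$ for $z\in\mathbb{T}_r$ and $(C^{(R)}h)(z)=h(\tau(z))$ for $z\in\mathbb{T}_R$.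 For $g\in L^2(\mathbb{T}_\rho)$, written as $g(z)=\sum_{n\in\mathbb{Z}}g_nz^n$, the bounded projection operators $\Pi_+^{(\rho)}\colon L^2(\mathbb{T}_\rho)\to H^2(D_\rho)$ and $\Pi_-^{(\rho)}\colon L^2(\mathbb{T}_\rho)\to H_0^2(D_\rho^\infty)$ are $(\Pi_+^{(\rho)}g)(z)=\sum_{n=0}^\infty g_nz^n$ and $(\Pi_-^{(\rho)}g)(z)=\sum_{n=1}^\infty g_{-n}z^{-n}$. In the matrix, $\Pi_+^{(R)}C^{(R)}h_2\in H^2(D_R)$ is regarded as an element of $H^2(D_r)$ by restriction, and $\Pi_-^{(r)}C^{(r)}h_1\in H_0^2(D_r^\infty)$ as an element of $H_0^2(D_R^\infty)$ by restriction. The matrix acts on $(h_1,h_2)$ as a column vector.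
   Formalization: Added so that C^(r) and C^(R) are defined: τ extends continuously to cl(A), τ(T_r) lies in D_r and τ(T_R) lies in D_R^∞. Without these h(τ(z)) can be undefined, e.g. for the orientation-reversing map τ(z)=z^{-2}. *)

theory Defs
  imports "HOL-Complex_Analysis.Complex_Analysis"
begin

text \<open>
  A function on a set \<open>D\<close> is represented by its extension by zero to the whole type. Thus
  elements of function spaces on \<open>D\<close>, and functionals on such spaces, are equal as HOL functions
  iff they agree on their domain, and pointwise addition and scaling stay within the space.
\<close>

definition zero_ext :: "'a set \<Rightarrow> ('a \<Rightarrow> complex) \<Rightarrow> 'a \<Rightarrow> complex" where
  "zero_ext D f = (\<lambda>x. if x \<in> D then f x else 0)"


section \<open>Expanding circle maps and annuli\<close>

definition annulus :: "real \<Rightarrow> real \<Rightarrow> complex set" where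
  "annulus r R = {z. r < norm z \<and> norm z < R}"

text \<open>The finite part of the disc around infinity.\<close>

definition ext_disc :: "real \<Rightarrow> complex set" where
  "ext_disc R = {z. R < norm z}"

definition analytic_expanding_circle_map :: "(complex \<Rightarrow> complex) \<Rightarrow> bool" where
  "analytic_expanding_circle_map \<tau> \<longleftrightarrow>
     \<tau> analytic_on sphere 0 1 \<and> \<tau> ` sphere 0 1 \<subseteq> sphere 0 1 \<and>
     (\<forall>z\<in>sphere 0 1. norm (deriv \<tau> z) > 1)"

text \<open>
  Since \<open>1 / 0 = 0\<close> in HOL, holomorphy of \<open>1 / \<tau>\<close> is stated together with \<open>\<tau>\<close> having no zeros.
\<close>

definition holomorphy_annuli :: "(complex \<Rightarrow> complex) \<Rightarrow> complex set set" where
  "holomorphy_annuli \<tau> = {annulus r R | r R. 0 < r \<and> r < 1 \<and> 1 < R \<and>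
     \<tau> holomorphic_on annulus r R \<and>
     (\<forall>z\<in>annulus r R. \<tau> z \<noteq> 0) \<and> (\<lambda>z. 1 / \<tau> z) holomorphic_on annulus r R}"

definition compactly_contained :: "complex set \<Rightarrow> complex set \<Rightarrow> bool" where
  "compactly_contained U V \<longleftrightarrow> compact (closure U) \<and> closure U \<subseteq> V"

definition covering_degree :: "(complex \<Rightarrow> complex) \<Rightarrow> nat" where
  "covering_degree \<tau> = card {w \<in> sphere 0 1. \<tau> w = 1}"


section \<open>Boundary values and square integrable functions on circles\<close>

text \<open>
  Radial limits at \<open>\<zeta>\<close> along the ray through \<open>\<zeta>\<close>, from smaller and from larger moduli. They exist
  almost everywhere for functions in the spaces below; all integrals ignore null sets.
\<close>

definition bv_inside :: "(complex \<Rightarrow> complex) \<Rightarrow> complex \<Rightarrow> complex" where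
  "bv_inside f \<zeta> = Lim (at_left 1) (\<lambda>s::real. f (of_real s * \<zeta>))"

definition bv_outside :: "(complex \<Rightarrow> complex) \<Rightarrow> complex \<Rightarrow> complex" where
  "bv_outside f \<zeta> = Lim (at_right 1) (\<lambda>s::real. f (of_real s * \<zeta>))"

definition circle_mean_square :: "real \<Rightarrow> (complex \<Rightarrow> complex) \<Rightarrow> real" where
  "circle_mean_square \<rho> f = integral {0..2*pi} (\<lambda>t. (norm (f (rcis \<rho> t)))\<^sup>2) / (2*pi)"

definition L2_circle :: "real \<Rightarrow> (complex \<Rightarrow> complex) set" where
  "L2_circle \<rho> = {g. (\<forall>z. norm z \<noteq> \<rho> \<longrightarrow> g z = 0) \<and>
     (\<lambda>t. g (rcis \<rho> t)) \<in> borel_measurable (lebesgue_on {0..2*pi}) \<and>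
     integrable (lebesgue_on {0..2*pi}) (\<lambda>t. (norm (g (rcis \<rho> t)))\<^sup>2)}"


section \<open>Hardy spaces\<close>

definition H2_disc :: "real \<Rightarrow> (complex \<Rightarrow> complex) set" where
  "H2_disc r = {f. (\<forall>z. z \<notin> ball 0 r \<longrightarrow> f z = 0) \<and> f holomorphic_on ball 0 r \<and>
     (\<exists>B. \<forall>\<^sub>F \<rho> in at_left r. circle_mean_square \<rho> f \<le> B)}"

definition norm_H2_disc :: "real \<Rightarrow> (complex \<Rightarrow> complex) \<Rightarrow> real" where
  "norm_H2_disc r f = sqrt (circle_mean_square r (bv_inside f))"

text \<open>
  Holomorphy on the disc around infinity (with the point at infinity), with value \<open>0\<close> there, is
  expressed in the chart \<open>w = 1 / z\<close>.
\<close>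

definition H2_0_ext :: "real \<Rightarrow> (complex \<Rightarrow> complex) set" where
  "H2_0_ext R = {f. (\<forall>z. z \<notin> ext_disc R \<longrightarrow> f z = 0) \<and>
     (\<lambda>w. if w = 0 then 0 else f (1 / w)) holomorphic_on ball 0 (1 / R) \<and>
     (\<exists>B. \<forall>\<^sub>F \<rho> in at_right R. circle_mean_square \<rho> f \<le> B)}"

definition norm_H2_0_ext :: "real \<Rightarrow> (complex \<Rightarrow> complex) \<Rightarrow> real" where
  "norm_H2_0_ext R f = sqrt (circle_mean_square R (bv_outside f))"

definition H2_annulus :: "real \<Rightarrow> real \<Rightarrow> (complex \<Rightarrow> complex) set" where
  "H2_annulus r R = {f. (\<forall>z. z \<notin> annulus r R \<longrightarrow> f z = 0) \<and> f holomorphic_on annulus r R \<and>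
     (\<exists>B. \<forall>\<^sub>F \<rho> in at_left R. circle_mean_square \<rho> f \<le> B) \<and>
     (\<exists>B. \<forall>\<^sub>F \<rho> in at_right r. circle_mean_square \<rho> f \<le> B)}"

definition norm_H2_annulus :: "real \<Rightarrow> real \<Rightarrow> (complex \<Rightarrow> complex) \<Rightarrow> real" where
  "norm_H2_annulus r R f =
     sqrt (circle_mean_square R (bv_inside f) + circle_mean_square r (bv_outside f))"

definition H2_sum :: "real \<Rightarrow> real \<Rightarrow> ((complex \<Rightarrow> complex) \<times> (complex \<Rightarrow> complex)) set" where
  "H2_sum r R = H2_disc r \<times> H2_0_ext R"

definition norm_H2_sum :: "real \<Rightarrow> real \<Rightarrow> (complex \<Rightarrow> complex) \<times> (complex \<Rightarrow> complex) \<Rightarrow> real" where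
  "norm_H2_sum r R = (\<lambda>(h1, h2). sqrt ((norm_H2_disc r h1)\<^sup>2 + (norm_H2_0_ext R h2)\<^sup>2))"


section \<open>The dual space and the isomorphism\<close>

definition H2_dual :: "real \<Rightarrow> real \<Rightarrow> ((complex \<Rightarrow> complex) \<Rightarrow> complex) set" where
  "H2_dual r R = {l. (\<forall>f. f \<notin> H2_annulus r R \<longrightarrow> l f = 0) \<and>
     (\<forall>f\<in>H2_annulus r R. \<forall>g\<in>H2_annulus r R. l (\<lambda>z. f z + g z) = l f + l g) \<and>
     (\<forall>c. \<forall>f\<in>H2_annulus r R. l (\<lambda>z. c * f z) = c * l f) \<and>
     (\<exists>B. \<forall>f\<in>H2_annulus r R. norm (l f) \<le> B * norm_H2_annulus r R f)}"

definition norm_H2_dual :: "real \<Rightarrow> real \<Rightarrow> ((complex \<Rightarrow> complex) \<Rightarrow> complex) \<Rightarrow> real" where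
  "norm_H2_dual r R l = Sup {norm (l f) | f. f \<in> H2_annulus r R \<and> norm_H2_annulus r R f \<le> 1}"

definition J_map ::
  "real \<Rightarrow> real \<Rightarrow> (complex \<Rightarrow> complex) \<times> (complex \<Rightarrow> complex) \<Rightarrow> (complex \<Rightarrow> complex) \<Rightarrow> complex" where
  "J_map r R = (\<lambda>(h1, h2). zero_ext (H2_annulus r R) (\<lambda>f.
     1 / (2 * of_real pi * \<i>) *
       contour_integral (circlepath 0 r) (\<lambda>z. bv_outside f z * bv_inside h1 z) +
     1 / (2 * of_real pi * \<i>) *
       contour_integral (circlepath 0 R) (\<lambda>z. bv_inside f z * bv_outside h2 z)))"

definition is_H2_dual_isomorphism ::
  "real \<Rightarrow> real \<Rightarrow>
   ((complex \<Rightarrow> complex) \<times> (complex \<Rightarrow> complex) \<Rightarrow> (complex \<Rightarrow> complex) \<Rightarrow> complex) \<Rightarrow> bool" where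
  "is_H2_dual_isomorphism r R J \<longleftrightarrow>
     bij_betw J (H2_sum r R) (H2_dual r R) \<and>
     (\<forall>(h1, h2)\<in>H2_sum r R. \<forall>(k1, k2)\<in>H2_sum r R.
        J (\<lambda>z. h1 z + k1 z, \<lambda>z. h2 z + k2 z) = (\<lambda>f. J (h1, h2) f + J (k1, k2) f)) \<and>
     (\<forall>c. \<forall>(h1, h2)\<in>H2_sum r R.
        J (\<lambda>z. c * h1 z, \<lambda>z. c * h2 z) = (\<lambda>f. c * J (h1, h2) f)) \<and>
     (\<exists>a>0. \<exists>b. \<forall>h\<in>H2_sum r R.
        a * norm_H2_sum r R h \<le> norm_H2_dual r R (J h) \<and>
        norm_H2_dual r R (J h) \<le> b * norm_H2_sum r R h)"


section \<open>The transfer operator and its adjoint\<close>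

text \<open>
  The local inverses of the circle map \<open>\<tau>\<close>, enumerated by \<open>k < K\<close> and continued holomorphically
  from an arc of the unit circle to the region \<open>U\<close>. They are in general not single-valued on the
  whole annulus; only their symmetric sum in the transfer operator is.
\<close>

definition local_inverses ::
  "(complex \<Rightarrow> complex) \<Rightarrow> complex set \<Rightarrow> complex set \<Rightarrow> (nat \<Rightarrow> complex \<Rightarrow> complex) \<Rightarrow> bool" where
  "local_inverses \<tau> A U \<phi> \<longleftrightarrow>
     open U \<and> connected U \<and> U \<subseteq> A \<and> U \<inter> sphere 0 1 \<noteq> {} \<and>
     (\<forall>k<covering_degree \<tau>.
        \<phi> k holomorphic_on U \<and> \<phi> k ` U \<subseteq> A \<and> (\<forall>z\<in>U. \<tau> (\<phi> k z) = z)) \<and>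
     (\<forall>z\<in>U \<inter> sphere 0 1.
        bij_betw (\<lambda>k. \<phi> k z) {..<covering_degree \<tau>} {w \<in> sphere 0 1. \<tau> w = z})"

text \<open>
  The sum does not depend on the choice of \<open>U\<close> and \<open>\<phi>\<close>, as the local inverses are determined up to
  a permutation.
\<close>

definition transfer_operator ::
  "(complex \<Rightarrow> complex) \<Rightarrow> real \<Rightarrow> real \<Rightarrow> (complex \<Rightarrow> complex) \<Rightarrow> complex \<Rightarrow> complex" where
  "transfer_operator \<tau> r R f = zero_ext (annulus r R) (\<lambda>z.
     THE c. \<exists>U \<phi>. z \<in> U \<and> local_inverses \<tau> (annulus r R) U \<phi> \<and>
       c = (\<Sum>k<covering_degree \<tau>. deriv (\<phi> k) z * f (\<phi> k z)))"

definition transfer_adjoint ::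
  "(complex \<Rightarrow> complex) \<Rightarrow> real \<Rightarrow> real \<Rightarrow>
   ((complex \<Rightarrow> complex) \<Rightarrow> complex) \<Rightarrow> (complex \<Rightarrow> complex) \<Rightarrow> complex" where
  "transfer_adjoint \<tau> r R l = zero_ext (H2_annulus r R) (\<lambda>f. l (transfer_operator \<tau> r R f))"


section \<open>Composition and projection operators\<close>

definition composition_operator ::
  "(complex \<Rightarrow> complex) \<Rightarrow> real \<Rightarrow> (complex \<Rightarrow> complex) \<Rightarrow> complex \<Rightarrow> complex" where
  "composition_operator \<tau> \<rho> h = zero_ext (sphere 0 \<rho>) (\<lambda>z. h (\<tau> z))"

text \<open>The coefficient \<open>g\<^sub>n\<close> in \<open>g(z) = \<Sum> g\<^sub>n z\<^sup>n\<close> on the circle of radius \<open>\<rho>\<close>.\<close>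

definition circle_coeff :: "real \<Rightarrow> (complex \<Rightarrow> complex) \<Rightarrow> int \<Rightarrow> complex" where
  "circle_coeff \<rho> g n =
     integral {0..2*pi} (\<lambda>t. g (rcis \<rho> t) * rcis \<rho> t powi (- n)) / (2 * of_real pi)"

definition proj_plus :: "real \<Rightarrow> (complex \<Rightarrow> complex) \<Rightarrow> complex \<Rightarrow> complex" where
  "proj_plus \<rho> g = zero_ext (ball 0 \<rho>) (\<lambda>z. \<Sum>n. circle_coeff \<rho> g (int n) * z ^ n)"

definition proj_minus :: "real \<Rightarrow> (complex \<Rightarrow> complex) \<Rightarrow> complex \<Rightarrow> complex" where
  "proj_minus \<rho> g = zero_ext (ext_disc \<rho>)
     (\<lambda>z. \<Sum>n. circle_coeff \<rho> g (- int (Suc n)) * z powi (- int (Suc n)))"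

text \<open>
  The outer \<open>zero_ext\<close> in the off-diagonal entries is the restriction of functions from the disc of
  radius \<open>R\<close> to that of radius \<open>r\<close>, respectively from the complement of the closed disc of radius
  \<open>r\<close> to that of radius \<open>R\<close>.
\<close>

definition L_prime ::
  "(complex \<Rightarrow> complex) \<Rightarrow> real \<Rightarrow> real \<Rightarrow>
   (complex \<Rightarrow> complex) \<times> (complex \<Rightarrow> complex) \<Rightarrow> (complex \<Rightarrow> complex) \<times> (complex \<Rightarrow> complex)" where
  "L_prime \<tau> r R = (\<lambda>(h1, h2).
     (\<lambda>z. proj_plus r (composition_operator \<tau> r h1) z +
          zero_ext (ball 0 r) (proj_plus R (composition_operator \<tau> R h2)) z,
      \<lambda>z. zero_ext (ext_disc R) (proj_minus r (composition_operator \<tau> r h1)) z +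
          proj_minus R (composition_operator \<tau> R h2) z))"

end

theory Submission
  imports Defs
begin

text \<open>
  Fatou's theorem on radial limits rests on an \<open>L\<^sup>2\<close> maximal inequality for power series, which is
  proved for equidistant points of the circle by a \<open>T T\<^sup>*\<close> argument with the Poisson kernel. It
  identifies the Hardy spaces with spaces of square summable Laurent coefficients, on which \<open>J\<close> is the
  pairing of opposite coefficients; hence \<open>J\<close> is an isomorphism.

  In the coordinate \<open>z = exp \<zeta>\<close> the map \<open>\<tau>\<close> becomes a map \<open>F\<close> with
  \<open>F (\<zeta> + 2 \<pi> i) = F \<zeta> + 2 \<pi> i d\<close>, which has a single inverse \<open>G\<close> over a strip containing that of
  the annulus. The local inverses of \<open>\<tau>\<close> are the functions \<open>exp (G (log z + 2 \<pi> i k))\<close>, and the change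
  of variables \<open>w = \<tau> z\<close> turns the Laurent coefficients of the transfer operator of \<open>f\<close> into integrals of
  \<open>f z * \<tau> z ^ n\<close> over the unit circle. For \<open>n \<ge> 0\<close> this circle is shifted to the inner boundary of
  \<open>A\<^sub>0\<close>, where \<open>h\<^sub>1 \<circ> \<tau>\<close> is holomorphic, and for \<open>n < 0\<close> to the outer one, where \<open>h\<^sub>2 \<circ> \<tau>\<close> is; there the
  series of \<open>h\<^sub>1 \<circ> \<tau>\<close> and \<open>h\<^sub>2 \<circ> \<tau>\<close> may be integrated termwise, and their Laurent coefficients agree with
  those on the boundary of \<open>A\<close>.
\<close>


section \<open>A maximal inequality for power series\<close>

text \<open>Boundary values are bare radial limits (\<open>Lim\<close>), so even evaluating
  \<open>J\<close> needs two facts: the limits exist almost everywhere, and integrals of products of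
  boundary values are limits of integrals over nearby circles. An integrable radial maximal function
  yields both, convergence through its smallness on tails and domination through its size; hence its
  place at the bottom of the proof.

  In the dynamical half the obstacle is that \<open>\<tau>\<close> is known to expand only on the
  unit circle; elsewhere its derivative might vanish, so the local inverses cannot simply be
  continued. The inverse \<open>G\<close> is obtained topologically instead: \<open>F\<close> is
  proper over a strip and takes a simple value on the imaginary axis. That strip is chosen strictly
  wider than the one of \<open>A\<close>. The kernels of the transfer operator are then bounded, and
  its branches land in the closure of \<open>A0\<close>, where point values of a Hardy function are
  controlled by its norm.

  The integrals are moved to the boundary circles of \<open>A0\<close> because there
  \<open>f\<close> still has an absolutely convergent Laurent series while \<open>\<tau>\<close>
  already takes values at positive distance from the boundary of the domain of \<open>h1\<close> or
  \<open>h2\<close>.\<close>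

definition poisson :: "complex \<Rightarrow> real" where
  "poisson z = (1 - (cmod z)\<^sup>2) / (cmod (1 - z))\<^sup>2"

definition fw :: "nat \<Rightarrow> real" where
  "fw n = (if n = 0 then 1 else 2)"

lemma poisson_nonneg: "cmod z < 1 \<Longrightarrow> 0 \<le> poisson z"
  by (simp add: poisson_def power_le_one)

lemma poisson_cnj: "poisson (cnj z) = poisson z"
proof -
  have "cmod (1 - cnj z) = cmod (1 - z)"
    by (metis complex_cnj_diff complex_cnj_one complex_mod_cnj)
  then show ?thesis
    by (simp add: poisson_def)
qed

text \<open>\<open>poisson z\<close> is the real part of (1 + z) / (1 - z) = 2 / (1 - z) - 1, so the
  geometric series produces the weights 1, 2, 2, ... that \<open>fw\<close> records.\<close>

lemma poisson_sums:
  assumes "cmod z < 1"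
  shows "(\<lambda>n. fw n * Re (z ^ n)) sums poisson z"
proof -
  have "(\<lambda>n. z ^ n) sums (1 / (1 - z))"
    using assms by (rule geometric_sums)
  then have "(\<lambda>n. 2 * Re (z ^ n)) sums (2 * Re (1 / (1 - z)))"
    by (intro sums_mult sums_Re)
  moreover have "(\<lambda>n. if n = 0 then 1 else 0 :: real) sums 1"
    using sums_single[of 0 "\<lambda>_. 1::real"] by simp
  ultimately have "(\<lambda>n. 2 * Re (z ^ n) - (if n = 0 then 1 else 0)) sums (2 * Re (1 / (1 - z)) - 1)"
    by (rule sums_diff)
  moreover have "(\<lambda>n. 2 * Re (z ^ n) - (if n = 0 then 1 else 0)) = (\<lambda>n. fw n * Re (z ^ n))"
    by (auto simp: fw_def)
  moreover have "2 * Re (1 / (1 - z)) - 1 = poisson z"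
  proof -
    have "1 - z \<noteq> 0" using assms by auto
    then have "(cmod (1 - z))\<^sup>2 \<noteq> 0" by simp
    then show ?thesis
      unfolding poisson_def Re_divide cmod_power2
      by (simp add: cmod_power2 field_simps) (simp add: power2_eq_square algebra_simps)
  qed
  ultimately show ?thesis by simp
qed

text \<open>A Harnack-type comparison along a ray. From |b - a| <= 1 - a <= |1 - a u| follows |1 - b
  u| <= 2 |1 - a u|, which costs a factor 4 in the denominators; the numerators cost the factor 2 of
  the hypothesis.\<close>

lemma poisson_compare:
  fixes a b :: real
  assumes "0 \<le> a" "a \<le> b" "b < 1" "1 - a \<le> 2 * (1 - b)" "cmod u = 1"
  shows "poisson (of_real a * u) \<le> 8 * poisson (of_real b * u)"
proof -
  have nz: "cmod (1 - of_real a * u) > 0" "cmod (1 - of_real b * u) > 0"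
    using assms by (auto simp: norm_mult dest!: arg_cong[of _ _ cmod])
  have "cmod (1 - of_real b * u) \<le> cmod (1 - of_real a * u) + cmod (of_real (a - b) * u)"
    by (metis (no_types, lifting) add_diff_eq diff_add_cancel left_diff_distrib norm_triangle_ineq of_real_diff)
  also have "cmod (of_real (a - b) * u) \<le> 1 - a"
    using assms by (simp add: norm_mult del: of_real_diff)
  also have "1 - a \<le> cmod (1 - of_real a * u)"
    using norm_triangle_ineq2[of 1 "of_real a * u"] assms by (simp add: norm_mult)
  finally have "cmod (1 - of_real b * u) \<le> 2 * cmod (1 - of_real a * u)" by simp
  then have "(cmod (1 - of_real b * u))\<^sup>2 \<le> 4 * (cmod (1 - of_real a * u))\<^sup>2"
    using power_mono[of "cmod (1 - of_real b * u)" "2 * cmod (1 - of_real a * u)" 2] by (simp add: power_mult_distrib)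
  moreover have "1 - a\<^sup>2 \<le> 2 * (1 - b\<^sup>2)"
  proof -
    have "(1 - a) * (1 + a) \<le> (2 * (1 - b)) * (1 + b)"
      using assms by (intro mult_mono) auto
    then show ?thesis by (simp add: power2_eq_square algebra_simps)
  qed
  ultimately have "(1 - a\<^sup>2) * (cmod (1 - of_real b * u))\<^sup>2 \<le> (2 * (1 - b\<^sup>2)) * (4 * (cmod (1 - of_real a * u))\<^sup>2)"
    using assms by (intro mult_mono) (auto simp: abs_square_le_1)
  then show ?thesis
    using nz assms by (simp add: poisson_def norm_mult divide_simps power_mult_distrib) (simp add: algebra_simps)
qed

text \<open>The Poisson kernel is a Gram kernel of the vectors of powers, with the nonnegative
  weights \<open>fw\<close>. For \<open>y = z\<close> the form is a sum of squares; for different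
  radii it is the mixed term, to which Cauchy-Schwarz applies.\<close>

lemma quad_sums:
  fixes c d :: "'a \<Rightarrow> real" and y z :: "'a \<Rightarrow> complex"
  assumes "finite X" "\<And>x. x \<in> X \<Longrightarrow> cmod (z x) < 1" "\<And>x. x \<in> X \<Longrightarrow> cmod (y x) < 1"
  shows "(\<lambda>n. fw n * Re ((\<Sum>x\<in>X. of_real (c x) * z x ^ n) * cnj (\<Sum>x\<in>X. of_real (d x) * y x ^ n)))
           sums (\<Sum>x\<in>X. \<Sum>x'\<in>X. c x * d x' * poisson (z x * cnj (y x')))"
proof -
  have "(\<lambda>n. \<Sum>x\<in>X. \<Sum>x'\<in>X. c x * d x' * (fw n * Re ((z x * cnj (y x')) ^ n)))
           sums (\<Sum>x\<in>X. \<Sum>x'\<in>X. c x * d x' * poisson (z x * cnj (y x')))"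
  proof (intro sums_sum sums_mult poisson_sums)
    fix x x' assume "x \<in> X" "x' \<in> X"
    then show "cmod (z x * cnj (y x')) < 1"
      using assms mult_strict_mono[of "cmod (z x)" 1 "cmod (y x')" 1]
      by (simp add: norm_mult)
  qed
  moreover have "(\<Sum>x\<in>X. \<Sum>x'\<in>X. c x * d x' * (fw n * Re ((z x * cnj (y x')) ^ n))) =
      fw n * Re ((\<Sum>x\<in>X. of_real (c x) * z x ^ n) * cnj (\<Sum>x\<in>X. of_real (d x) * y x ^ n))" for n
  proof -
    have "(\<Sum>x\<in>X. of_real (c x) * z x ^ n) * cnj (\<Sum>x\<in>X. of_real (d x) * y x ^ n) =
      (\<Sum>x\<in>X. \<Sum>x'\<in>X. of_real (c x * d x') * (z x * cnj (y x')) ^ n)"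
      by (simp add: sum_product power_mult_distrib mult_ac)
    then show ?thesis
      by (simp del: of_real_mult add: Re_sum sum_distrib_left mult_ac)
  qed
  ultimately show ?thesis by simp
qed

text \<open>The linearized maximal operator is bounded by comparing its \<open>T T\<^sup>*\<close> kernel with \<open>T\<close> itself.\<close>

lemma poisson_TTstar:
  fixes c \<rho> :: "'a \<Rightarrow> real" and u :: "'a \<Rightarrow> complex"
  assumes X: "finite X" and u: "\<And>x. x \<in> X \<Longrightarrow> cmod (u x) = 1"
    and \<rho>: "\<And>x. x \<in> X \<Longrightarrow> 0 \<le> \<rho> x \<and> \<rho> x \<le> \<sigma>" and \<sigma>: "0 \<le> \<sigma>" "\<sigma> < 1"
    and c: "\<And>x. x \<in> X \<Longrightarrow> 0 \<le> c x"
    and K: "\<And>x. x \<in> X \<Longrightarrow> (\<Sum>y\<in>X. poisson (of_real (\<sigma>\<^sup>2) * (u x * cnj (u y)))) \<le> K"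
  shows "(\<Sum>x\<in>X. \<Sum>y\<in>X. c x * c y * poisson (of_real (\<rho> x * \<rho> y) * (u x * cnj (u y))))
      \<le> 256 * K * (\<Sum>x\<in>X. (c x)\<^sup>2)"
proof -
  define E where "E = (\<lambda>n. \<Sum>x\<in>X. of_real (c x) * (of_real (\<rho> x) * u x) ^ n)"
  define E' where "E' = (\<lambda>n. \<Sum>x\<in>X. of_real (c x) * (of_real \<sigma> * u x) ^ n)"
  define k where "k = (\<lambda>x y. c x * c y * poisson (of_real (\<rho> x * \<sigma>) * (u x * cnj (u y))))"
  define Q where "Q = (\<Sum>x\<in>X. \<Sum>y\<in>X. c x * c y * poisson (of_real (\<rho> x * \<rho> y) * (u x * cnj (u y))))"
  define Q' where "Q' = (\<Sum>x\<in>X. \<Sum>y\<in>X. c x * c y * poisson (of_real (\<sigma>\<^sup>2) * (u x * cnj (u y))))"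
  have le1: "cmod (of_real (\<rho> x) * u x) < 1" "cmod (of_real \<sigma> * u x) < 1" if "x \<in> X" for x
    using that \<rho>[OF that] u[OF that] \<sigma> by (auto simp: norm_mult)
  have bnd: "a * b < 1" if "0 \<le> a" "a \<le> \<sigma>" "0 \<le> b" "b \<le> \<sigma>" for a b
  proof -
    have "a * b \<le> \<sigma> * 1" using that \<sigma> by (intro mult_mono) auto
    then show ?thesis using \<sigma> by simp
  qed
  have uu: "cmod (u x * cnj (u y)) = 1" if "x \<in> X" "y \<in> X" for x y
    using u that by (simp add: norm_mult)
  have EE: "(\<lambda>n. fw n * Re (E n * cnj (E n))) sums Q"
    using quad_sums[where X=X and c=c and d=c and z="\<lambda>x. of_real (\<rho> x) * u x" and y="\<lambda>x. of_real (\<rho> x) * u x", OF X le1(1) le1(1)]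
    unfolding Q_def E_def by (simp add: mult_ac)
  have EE': "(\<lambda>n. fw n * Re (E n * cnj (E' n))) sums (\<Sum>x\<in>X. \<Sum>y\<in>X. k x y)"
    using quad_sums[where X=X and c=c and d=c and z="\<lambda>x. of_real (\<rho> x) * u x" and y="\<lambda>x. of_real \<sigma> * u x", OF X le1]
    unfolding E_def E'_def k_def by (simp add: mult_ac)
  have E'E': "(\<lambda>n. fw n * Re (E' n * cnj (E' n))) sums Q'"
    using quad_sums[where X=X and c=c and d=c and z="\<lambda>x. of_real \<sigma> * u x" and y="\<lambda>x. of_real \<sigma> * u x", OF X le1(2) le1(2)]
    unfolding E'_def Q'_def by (simp add: mult_ac power2_eq_square)
  have pk: "poisson (of_real (\<rho> x * \<sigma>) * (u x * cnj (u y))) \<ge> 0" if "x \<in> X" "y \<in> X" for x y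
    using that \<rho>[of x] \<sigma> uu[OF that] bnd[of "\<rho> x" \<sigma>] by (intro poisson_nonneg) (simp add: norm_mult)
  \<comment> \<open>The larger of the two radii is replaced by the common bound
    \<open>\<sigma>\<close>. The condition on the distances to the circle reduces to (1 -
    \<open>\<rho> x\<close>)^2 >= 0, which is where \<open>\<rho> x \<le> \<rho> y\<close>
    enters.\<close>
  have cmp: "poisson (of_real (\<rho> x * \<rho> y) * (u x * cnj (u y))) \<le> 8 * poisson (of_real (\<rho> x * \<sigma>) * (u x * cnj (u y)))"
    if "x \<in> X" "y \<in> X" "\<rho> x \<le> \<rho> y" for x y
  proof (rule poisson_compare)
    show "1 - \<rho> x * \<rho> y \<le> 2 * (1 - \<rho> x * \<sigma>)"
    proof -
      have "\<rho> x * \<rho> x \<le> \<rho> x * \<rho> y" using that \<rho> by (intro mult_left_mono) auto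
      moreover have "\<rho> x * \<sigma> \<le> \<rho> x" using that \<rho>[of x] \<sigma> by (simp add: mult_left_le)
      moreover have "0 \<le> (1 - \<rho> x) * (1 - \<rho> x)" by simp
      ultimately show ?thesis by (simp add: algebra_simps)
    qed
  qed (use that \<rho>[of x] \<rho>[of y] \<sigma> bnd[of "\<rho> x" \<sigma>] uu in \<open>auto intro!: mult_left_mono\<close>)
  have kk: "c x * c y * poisson (of_real (\<rho> x * \<rho> y) * (u x * cnj (u y))) \<le> 8 * (k x y + k y x)"
    if xy: "x \<in> X" "y \<in> X" for x y
  proof -
    have sym: "poisson (of_real (\<rho> y * \<sigma>) * (u x * cnj (u y))) = poisson (of_real (\<rho> y * \<sigma>) * (u y * cnj (u x)))"
      using poisson_cnj[of "of_real (\<rho> y * \<sigma>) * (u x * cnj (u y))"] by (simp add: mult_ac)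
    have sym': "poisson (of_real (\<rho> x * \<rho> y) * (u x * cnj (u y))) = poisson (of_real (\<rho> y * \<rho> x) * (u y * cnj (u x)))"
      using poisson_cnj[of "of_real (\<rho> x * \<rho> y) * (u x * cnj (u y))"] by (simp add: mult_ac)
    have "poisson (of_real (\<rho> x * \<rho> y) * (u x * cnj (u y))) \<le>
        8 * (poisson (of_real (\<rho> x * \<sigma>) * (u x * cnj (u y))) + poisson (of_real (\<rho> y * \<sigma>) * (u y * cnj (u x))))"
      using cmp[OF xy] cmp[OF xy(2,1)] pk[OF xy] pk[OF xy(2,1)] sym'
      by (cases "\<rho> x \<le> \<rho> y") auto
    then have "c x * c y * poisson (of_real (\<rho> x * \<rho> y) * (u x * cnj (u y))) \<le>
       c x * c y * (8 * (poisson (of_real (\<rho> x * \<sigma>) * (u x * cnj (u y))) + poisson (of_real (\<rho> y * \<sigma>) * (u y * cnj (u x)))))"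
      using c xy by (intro mult_left_mono) auto
    then show ?thesis by (simp add: k_def algebra_simps)
  qed
  have "Q \<le> (\<Sum>x\<in>X. \<Sum>y\<in>X. 8 * (k x y + k y x))"
    unfolding Q_def by (intro sum_mono kk)
  also have "\<dots> = 8 * ((\<Sum>x\<in>X. \<Sum>y\<in>X. k x y) + (\<Sum>x\<in>X. \<Sum>y\<in>X. k y x))"
    by (simp add: sum.distrib sum_distrib_left[symmetric])
  also have "(\<Sum>x\<in>X. \<Sum>y\<in>X. k y x) = (\<Sum>x\<in>X. \<Sum>y\<in>X. k x y)"
    by (rule sum.swap)
  finally have Q16: "Q \<le> 16 * (\<Sum>x\<in>X. \<Sum>y\<in>X. k x y)" by simp
  \<comment> \<open>Cauchy-Schwarz in the form 16 a b <= a^2 / 2 + 128 b^2. Half of \<open>Q\<close>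
    is then absorbed by the left-hand side, which leaves the constant 256.\<close>
  have "16 * (\<Sum>x\<in>X. \<Sum>y\<in>X. k x y) \<le> 1/2 * Q + 128 * Q'"
  proof (rule sums_le)
    show "(\<lambda>n. 16 * (fw n * Re (E n * cnj (E' n)))) sums (16 * (\<Sum>x\<in>X. \<Sum>y\<in>X. k x y))"
      by (intro sums_mult EE')
    show "(\<lambda>n. 1/2 * (fw n * Re (E n * cnj (E n))) + 128 * (fw n * Re (E' n * cnj (E' n)))) sums (1/2 * Q + 128 * Q')"
      by (intro sums_add sums_mult EE E'E')
    fix n
    have *: "16 * Re (a * cnj b) \<le> 1/2 * Re (a * cnj a) + 128 * Re (b * cnj b)" for a b
    proof -
      have "0 \<le> (Re a - 16 * Re b)\<^sup>2 + (Im a - 16 * Im b)\<^sup>2" by simp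
      then show ?thesis by (simp add: power2_eq_square algebra_simps)
    qed
    show "16 * (fw n * Re (E n * cnj (E' n))) \<le> 1/2 * (fw n * Re (E n * cnj (E n))) + 128 * (fw n * Re (E' n * cnj (E' n)))"
      using mult_left_mono[OF *[of "E n" "E' n"], of "fw n"] by (simp add: fw_def algebra_simps)
  qed
  with Q16 have "Q \<le> 256 * Q'" by simp
  also have "Q' \<le> K * (\<Sum>x\<in>X. (c x)\<^sup>2)"
  proof -
    \<comment> \<open>Schur test: at the fixed radius the kernel is symmetric and nonnegative with
      row sums at most \<open>K\<close>.\<close>
    define p where "p = (\<lambda>x y. poisson (of_real (\<sigma>\<^sup>2) * (u x * cnj (u y))))"
    have p0: "p x y \<ge> 0" if "x \<in> X" "y \<in> X" for x y
      unfolding p_def using that \<sigma> uu[OF that] bnd[of \<sigma> \<sigma>]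
      by (intro poisson_nonneg) (simp add: norm_mult power2_eq_square)
    have psym: "p x y = p y x" for x y
      unfolding p_def using poisson_cnj[of "of_real (\<sigma>\<^sup>2) * (u x * cnj (u y))"] by (simp add: mult_ac)
    have "Q' \<le> (\<Sum>x\<in>X. \<Sum>y\<in>X. ((c x)\<^sup>2 / 2 * p x y + (c y)\<^sup>2 / 2 * p y x))"
    proof -
      have "(\<Sum>x\<in>X. \<Sum>y\<in>X. c x * c y * p x y) \<le> (\<Sum>x\<in>X. \<Sum>y\<in>X. ((c x)\<^sup>2 / 2 * p x y + (c y)\<^sup>2 / 2 * p y x))"
    proof (intro sum_mono)
      fix x y assume xy: "x \<in> X" "y \<in> X"
      have "0 \<le> (c x - c y)\<^sup>2" by simp
      then have "c x * c y \<le> (c x)\<^sup>2 / 2 + (c y)\<^sup>2 / 2"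
        by (simp add: power2_eq_square algebra_simps)
      then show "c x * c y * p x y \<le> (c x)\<^sup>2 / 2 * p x y + (c y)\<^sup>2 / 2 * p y x"
        using mult_right_mono[of _ _ "p x y"] p0[OF xy] psym[of x y] by (metis distrib_right)
    qed
      then show ?thesis by (simp add: Q'_def p_def)
    qed
    also have "\<dots> = (\<Sum>x\<in>X. \<Sum>y\<in>X. (c x)\<^sup>2 / 2 * p x y) + (\<Sum>x\<in>X. \<Sum>y\<in>X. (c y)\<^sup>2 / 2 * p y x)"
      by (simp add: sum.distrib)
    also have "(\<Sum>x\<in>X. \<Sum>y\<in>X. (c y)\<^sup>2 / 2 * p y x) = (\<Sum>x\<in>X. \<Sum>y\<in>X. (c x)\<^sup>2 / 2 * p x y)"
      by (rule sum.swap)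
    also have "(\<Sum>x\<in>X. \<Sum>y\<in>X. (c x)\<^sup>2 / 2 * p x y) = (\<Sum>x\<in>X. (c x)\<^sup>2 / 2 * (\<Sum>y\<in>X. p x y))"
      by (simp add: sum_distrib_left)
    also have "\<dots> + \<dots> = (\<Sum>x\<in>X. (c x)\<^sup>2 * (\<Sum>y\<in>X. p x y))"
      by (simp add: sum.distrib[symmetric] mult_ac)
    also have "\<dots> \<le> (\<Sum>x\<in>X. (c x)\<^sup>2 * K)"
      using K by (intro sum_mono mult_left_mono) (auto simp: p_def)
    finally show ?thesis by (simp add: sum_distrib_left mult_ac)
  qed
  finally show ?thesis unfolding Q_def by simp
qed

section \<open>Square summable sequences, their power series and the discrete maximal
  inequality\<close>

definition l2 :: "(nat \<Rightarrow> complex) \<Rightarrow> bool" where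
  "l2 a \<longleftrightarrow> summable (\<lambda>n. (cmod (a n))\<^sup>2)"

definition n2 :: "(nat \<Rightarrow> complex) \<Rightarrow> real" where
  "n2 a = (\<Sum>n. (cmod (a n))\<^sup>2)"

definition pw :: "(nat \<Rightarrow> complex) \<Rightarrow> complex \<Rightarrow> complex" where
  "pw a z = (\<Sum>n. a n * z ^ n)"

lemma l2_bounded: assumes "l2 a" shows "cmod (a n) \<le> 1 + n2 a"
proof -
  have "(cmod (a n))\<^sup>2 \<le> n2 a"
    using assms sum_le_suminf[of "\<lambda>n. (cmod (a n))\<^sup>2" "{n}"] by (simp add: l2_def n2_def)
  moreover have "0 \<le> (cmod (a n) - 1/2)\<^sup>2" by simp
  ultimately show ?thesis by (simp add: power2_eq_square algebra_simps)
qed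

lemma n2_nonneg: "l2 a \<Longrightarrow> 0 \<le> n2 a"
  by (simp add: l2_def n2_def suminf_nonneg)

lemma l2_summable:
  assumes "l2 a" "0 \<le> s" "s < 1"
  shows "summable (\<lambda>n. cmod (a n) * s ^ n)"
proof (rule summable_comparison_test')
  show "summable (\<lambda>n. (1 + n2 a) * s ^ n)"
    using assms by (intro summable_mult summable_geometric) auto
  show "norm (cmod (a n) * s ^ n) \<le> (1 + n2 a) * s ^ n" if "n \<ge> 0" for n
    using l2_bounded[OF assms(1), of n] assms by (auto intro!: mult_right_mono)
qed

lemma pw_abs_summable:
  assumes "l2 a" "cmod z < 1"
  shows "summable (\<lambda>n. cmod (a n * z ^ n))"
  using l2_summable[OF assms(1) norm_ge_zero assms(2)] by (simp add: norm_mult norm_power)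

lemma pw_sums:
  assumes "l2 a" "cmod z < 1"
  shows "(\<lambda>n. a n * z ^ n) sums pw a z"
  unfolding pw_def using pw_abs_summable[OF assms]
  by (simp add: summable_norm_cancel summable_sums)

text \<open>Duality with the values themselves as weights \<open>c\<close>: their square sum equals
  the real part of the sum of \<open>a n * E n\<close>, and \<open>poisson_TTstar\<close> controls
  \<open>E\<close>. Since the radii may vary with the point, maximizing radii can be inserted
  later.\<close>

lemma discrete_maximal_Re:
  fixes \<rho> :: "'a \<Rightarrow> real" and u :: "'a \<Rightarrow> complex"
  assumes X: "finite X" and u: "\<And>x. x \<in> X \<Longrightarrow> cmod (u x) = 1"
    and \<rho>: "\<And>x. x \<in> X \<Longrightarrow> 0 \<le> \<rho> x \<and> \<rho> x \<le> \<sigma>" and \<sigma>: "0 \<le> \<sigma>" "\<sigma> < 1"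
    and K: "\<And>x. x \<in> X \<Longrightarrow> (\<Sum>y\<in>X. poisson (of_real (\<sigma>\<^sup>2) * (u x * cnj (u y)))) \<le> K" "0 < K"
    and a: "l2 a"
  shows "(\<Sum>x\<in>X. (Re (pw a (of_real (\<rho> x) * u x)))\<^sup>2) \<le> 256 * K * n2 a"
proof -
  define c where "c = (\<lambda>x. Re (pw a (of_real (\<rho> x) * u x)))"
  define E where "E = (\<lambda>n. \<Sum>x\<in>X. of_real (c x) * (of_real (\<rho> x) * u x) ^ n)"
  define S where "S = (\<Sum>x\<in>X. (c x)\<^sup>2)"
  have le1: "cmod (of_real (\<rho> x) * u x) < 1" if "x \<in> X" for x
    using that \<rho>[OF that] u[OF that] \<sigma> by (auto simp: norm_mult)
  define Q where "Q = (\<Sum>x\<in>X. \<Sum>y\<in>X. c x * c y * poisson (of_real (\<rho> x * \<rho> y) * (u x * cnj (u y))))"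
  have EE: "(\<lambda>n. fw n * Re (E n * cnj (E n))) sums Q"
    using quad_sums[where X=X and c=c and d=c and z="\<lambda>x. of_real (\<rho> x) * u x" and y="\<lambda>x. of_real (\<rho> x) * u x", OF X le1 le1]
    unfolding E_def Q_def by (simp add: mult_ac)
  \<comment> \<open>\<open>poisson_TTstar\<close> asks for nonnegative weights; passing to absolute
    values only enlarges the form, because the kernel is nonnegative.\<close>
  have "Q \<le> (\<Sum>x\<in>X. \<Sum>y\<in>X. \<bar>c x\<bar> * \<bar>c y\<bar> * poisson (of_real (\<rho> x * \<rho> y) * (u x * cnj (u y))))"
    unfolding Q_def
  proof (intro sum_mono mult_right_mono)
    fix x y assume xy: "x \<in> X" "y \<in> X"
    show "c x * c y \<le> \<bar>c x\<bar> * \<bar>c y\<bar>"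
      by (metis abs_ge_self abs_mult)
    have "\<rho> x * \<rho> y \<le> \<sigma> * 1" using xy \<rho> \<sigma> by (intro mult_mono) force+
    then show "0 \<le> poisson (complex_of_real (\<rho> x * \<rho> y) * (u x * cnj (u y)))"
      using xy \<rho> \<sigma> u by (intro poisson_nonneg) (auto simp: norm_mult)
  qed
  also have "\<dots> \<le> 256 * K * (\<Sum>x\<in>X. \<bar>c x\<bar>\<^sup>2)"
    by (rule poisson_TTstar[OF X u \<rho> \<sigma> _ K(1)]) auto
  finally have Q: "Q \<le> 256 * K * S" by (simp add: S_def)
  have "(\<lambda>n. \<Sum>x\<in>X. c x * Re (a n * (of_real (\<rho> x) * u x) ^ n)) sums (\<Sum>x\<in>X. c x * Re (pw a (of_real (\<rho> x) * u x)))"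
    by (intro sums_sum sums_mult sums_Re pw_sums a le1)
  also have "(\<lambda>n. \<Sum>x\<in>X. c x * Re (a n * (of_real (\<rho> x) * u x) ^ n)) = (\<lambda>n. Re (a n * E n))"
    by (auto simp: E_def sum_distrib_left Re_sum intro!: sum.cong) (simp add: algebra_simps)
  also have "(\<Sum>x\<in>X. c x * Re (pw a (of_real (\<rho> x) * u x))) = S"
    by (simp add: S_def c_def power2_eq_square)
  finally have S: "(\<lambda>n. Re (a n * E n)) sums S" .
  \<comment> \<open>Young's inequality with weights 128 K and 1 / (512 K), whose product is 1/4. The
    second one turns \<open>Q <= 256 K S\<close> into \<open>S / 2\<close>, which is
    absorbed.\<close>
  have "S \<le> 128 * K * n2 a + 1 / (512 * K) * Q"
  proof (rule sums_le[OF _ S])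
    show "(\<lambda>n. 128 * K * (cmod (a n))\<^sup>2 + 1 / (512 * K) * (fw n * Re (E n * cnj (E n)))) sums (128 * K * n2 a + 1 / (512 * K) * Q)"
      using a by (intro sums_add sums_mult EE) (simp add: n2_def l2_def summable_sums)
    fix n
    have "Re (a n * E n) \<le> cmod (a n) * cmod (E n)"
      using complex_Re_le_cmod[of "a n * E n"] by (simp add: norm_mult)
    also have "\<dots> \<le> 128 * K * (cmod (a n))\<^sup>2 + 1 / (512 * K) * (cmod (E n))\<^sup>2"
    proof -
      have "0 \<le> (256 * K * cmod (a n) - cmod (E n))\<^sup>2 / (512 * K)" using K(2) by simp
      also have "\<dots> = 128 * K * (cmod (a n))\<^sup>2 + 1 / (512 * K) * (cmod (E n))\<^sup>2 - cmod (a n) * cmod (E n)"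
        using K(2) by (simp add: power2_eq_square field_simps)
      finally show ?thesis by simp
    qed
    also have "(cmod (E n))\<^sup>2 \<le> fw n * Re (E n * cnj (E n))"
      unfolding cmod_power2 by (simp add: fw_def power2_eq_square)
    finally show "Re (a n * E n) \<le> 128 * K * (cmod (a n))\<^sup>2 + 1 / (512 * K) * (fw n * Re (E n * cnj (E n)))"
      using K(2) by (simp add: divide_right_mono)
  qed
  also have "1 / (512 * K) * Q \<le> 1 / (512 * K) * (256 * K * S)"
    using Q K(2) by (intro mult_left_mono) auto
  also have "\<dots> = S / 2" using K(2) by simp
  finally show ?thesis unfolding S_def c_def by simp
qed

lemma pw_cmult: "l2 a \<Longrightarrow> cmod z < 1 \<Longrightarrow> pw (\<lambda>n. c * a n) z = c * pw a z"
  using sums_mult[OF pw_sums, of a z c] by (simp add: pw_def sums_iff mult.assoc)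

text \<open>The imaginary part is the real part of the series with coefficients
  \<open>- \<i> * a n\<close>, which has the same norm; adding the two estimates doubles the
  constant.\<close>

lemma discrete_maximal:
  fixes \<rho> :: "'a \<Rightarrow> real" and u :: "'a \<Rightarrow> complex"
  assumes X: "finite X" and u: "\<And>x. x \<in> X \<Longrightarrow> cmod (u x) = 1"
    and \<rho>: "\<And>x. x \<in> X \<Longrightarrow> 0 \<le> \<rho> x \<and> \<rho> x \<le> \<sigma>" and \<sigma>: "0 \<le> \<sigma>" "\<sigma> < 1"
    and K: "\<And>x. x \<in> X \<Longrightarrow> (\<Sum>y\<in>X. poisson (of_real (\<sigma>\<^sup>2) * (u x * cnj (u y)))) \<le> K" "0 < K"
    and a: "l2 a"
  shows "(\<Sum>x\<in>X. (cmod (pw a (of_real (\<rho> x) * u x)))\<^sup>2) \<le> 512 * K * n2 a"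
proof -
  have a': "l2 (\<lambda>n. - \<i> * a n)" "n2 (\<lambda>n. - \<i> * a n) = n2 a"
    using a by (simp_all add: l2_def n2_def norm_mult)
  have "Im (pw a (of_real (\<rho> x) * u x)) = Re (pw (\<lambda>n. - \<i> * a n) (of_real (\<rho> x) * u x))" if "x \<in> X" for x
    using that \<rho>[OF that] u[OF that] \<sigma> by (subst pw_cmult[OF a]) (auto simp: norm_mult)
  then have "(\<Sum>x\<in>X. (cmod (pw a (of_real (\<rho> x) * u x)))\<^sup>2) =
      (\<Sum>x\<in>X. (Re (pw a (of_real (\<rho> x) * u x)))\<^sup>2) + (\<Sum>x\<in>X. (Re (pw (\<lambda>n. - \<i> * a n) (of_real (\<rho> x) * u x)))\<^sup>2)"
    by (simp add: cmod_power2 sum.distrib)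
  also have "\<dots> \<le> 256 * K * n2 a + 256 * K * n2 (\<lambda>n. - \<i> * a n)"
    by (intro add_mono discrete_maximal_Re[OF X u \<rho> \<sigma> K] a a')
  finally show ?thesis using a' by simp
qed

lemma sum_roots_of_unity_power:
  fixes n M :: nat
  assumes "0 < n" "n < M"
  shows "(\<Sum>y<M. cis (2 * pi * real y / real M) ^ n) = 0"
proof -
  define w where "w = cis (2 * pi * real n / real M)"
  have "w = exp (2 * of_real pi * \<i> * of_nat n / of_nat M)"
    unfolding w_def cis_conv_exp by (simp add: mult_ac)
  then have "w \<noteq> 1"
    using complex_root_unity_eq_1[of M n] assms by (auto dest: nat_dvd_not_less)
  moreover have "w ^ M = 1"
  proof -
    have "w ^ M = cis (2 * pi * real n)" proof -
      have "real M * (2 * pi * real n / real M) = 2 * pi * real n" using assms by simp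
      then show ?thesis unfolding w_def Complex.DeMoivre by (simp only:)
    qed
    then show ?thesis using cis_multiple_2pi[of "real n"] by simp
  qed
  moreover have "(\<Sum>y<M. cis (2 * pi * real y / real M) ^ n) = (\<Sum>y<M. w ^ y)"
    by (intro sum.cong) (auto simp: w_def Complex.DeMoivre mult_ac)
  ultimately show ?thesis
    by (simp add: geometric_sum)
qed

text \<open>Summing over \<open>M\<close> equidistant points kills the frequencies 0 < n < M. The
  constant term contributes \<open>M\<close> and the remaining ones the geometric tail; the bound is
  the same for every rotation \<open>t\<close>.\<close>

lemma sum_poisson_equidistant:
  fixes M :: nat and s t :: real
  assumes "0 < M" "0 \<le> s" "s < 1"
  shows "(\<Sum>y<M. poisson (of_real s * (cis (t + 2 * pi * real x / real M) * cnj (cis (t + 2 * pi * real y / real M)))))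
     \<le> real M * (1 + 2 * s ^ M / (1 - s))"
proof -
  define v where "v = (\<lambda>y. cis (t + 2 * pi * real x / real M) * cnj (cis (t + 2 * pi * real y / real M)))"
  have v: "v y = cis (2 * pi * real x / real M) * cnj (cis (2 * pi * real y / real M))" for y
    unfolding v_def by (simp add: cis_cnj cis_mult)
  have nv: "cmod (v y) = 1" for y by (simp add: v_def norm_mult)
  define b where "b = (\<lambda>n. (if n = 0 then real M else 0) + (if n < M then 0 else 2 * s ^ n * real M))"
  have sums: "(\<lambda>n. \<Sum>y<M. fw n * Re ((of_real s * v y) ^ n)) sums (\<Sum>y<M. poisson (of_real s * v y))"
    using assms nv by (intro sums_sum poisson_sums) (simp add: norm_mult)
  have "(\<lambda>n. (if n = 0 then real M else 0)) sums real M"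
    using sums_single[of 0 "\<lambda>_. real M"] by simp
  moreover have "(\<lambda>n. (if n < M then 0 else 2 * s ^ n * real M)) sums (2 * s ^ M * real M / (1 - s))"
  proof -
    have "(\<lambda>n. 2 * s ^ M * real M * s ^ n) sums (2 * s ^ M * real M * (1 / (1 - s)))"
      using assms by (intro sums_mult geometric_sums) auto
    then show ?thesis
      by (subst sums_zero_iff_shift[where n=M, symmetric]) (simp_all add: power_add mult_ac)
  qed
  ultimately have b: "b sums (real M + 2 * s ^ M * real M / (1 - s))"
    unfolding b_def by (rule sums_add)
  have "(\<Sum>y<M. poisson (of_real s * v y)) \<le> real M + 2 * s ^ M * real M / (1 - s)"
  proof (rule sums_le[OF _ sums b])
    fix n
    consider "n = 0" | "0 < n" "n < M" | "M \<le> n" by linarith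
    then show "(\<Sum>y<M. fw n * Re ((of_real s * v y) ^ n)) \<le> b n"
    proof cases
      case 1 then show ?thesis using assms by (simp add: fw_def b_def)
    next
      case 2
      have "(\<Sum>y<M. v y ^ n) = cis (2 * pi * real x / real M) ^ n * cnj (\<Sum>y<M. cis (2 * pi * real y / real M) ^ n)"
        by (simp add: v power_mult_distrib sum_distrib_left)
      then have "(\<Sum>y<M. v y ^ n) = 0" using sum_roots_of_unity_power[OF 2] by simp
      then have "(\<Sum>y<M. (of_real s * v y) ^ n) = 0"
        by (simp add: power_mult_distrib sum_distrib_left[symmetric])
      then have "fw n * Re (\<Sum>y<M. (of_real s * v y) ^ n) = 0" by simp
      then show ?thesis using 2 by (simp add: b_def Re_sum sum_distrib_left)
    next
      case 3
      have "fw n * Re ((of_real s * v y) ^ n) \<le> 2 * s ^ n" for y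
      proof -
        have "Re ((of_real s * v y) ^ n) \<le> cmod ((of_real s * v y) ^ n)" by (rule complex_Re_le_cmod)
        also have "\<dots> = s ^ n" using assms nv by (simp add: norm_mult norm_power)
        finally show ?thesis using assms by (auto simp: fw_def intro: order_trans[of _ 1])
      qed
      then have "(\<Sum>y<M. fw n * Re ((of_real s * v y) ^ n)) \<le> (\<Sum>y<M. 2 * s ^ n)" by (intro sum_mono)
      then show ?thesis using 3 assms by (simp add: b_def mult_ac)
    qed
  qed
  then show ?thesis by (simp add: v_def algebra_simps)
qed

lemma integral_periodic_shift:
  fixes G :: "real \<Rightarrow> 'a :: banach"
  assumes G: "continuous_on UNIV G" "\<And>t. G (t + 2 * pi) = G t" and c: "0 \<le> c" "c \<le> 2 * pi"
  shows "integral {0..2*pi} (\<lambda>t. G (t + c)) = integral {0..2*pi} G"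
proof -
  have int: "G integrable_on {a..b}" for a b
    using G(1) by (intro integrable_continuous_real) (rule continuous_on_subset, auto)
  have "integral {0..2*pi} (\<lambda>t. G (t + c)) = integral {c..2*pi+c} G"
    using integral_shift_Icc_real[of 0 "2*pi" G c] by (simp add: o_def add.commute)
  also have "\<dots> = integral {c..2*pi} G + integral {2*pi..2*pi+c} G"
    using Henstock_Kurzweil_Integration.integral_combine[of c "2*pi" "2*pi+c" G] c int by simp
  also have "integral {2*pi..2*pi+c} G = integral {0..c} (\<lambda>t. G (t + 2*pi))"
    using integral_shift_Icc_real[of 0 c G "2*pi"] by (simp add: o_def add.commute)
  also have "\<dots> = integral {0..c} G" by (simp add: G(2))
  also have "integral {c..2*pi} G + integral {0..c} G = integral {0..2*pi} G"
    using Henstock_Kurzweil_Integration.integral_combine[OF c int] by (simp add: add.commute)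
  finally show ?thesis .
qed

lemma pw_holomorphic: "l2 a \<Longrightarrow> pw a holomorphic_on ball 0 1"
  by (rule power_series_holomorphic[where a=a]) (auto intro: pw_sums)

lemma pw_continuous_radius:
  assumes "l2 a" "0 \<le> s" "s < 1"
  shows "continuous_on UNIV (\<lambda>t. pw a (of_real s * cis t))"
  using assms
  by (intro continuous_on_compose2[OF holomorphic_on_imp_continuous_on[OF pw_holomorphic[OF assms(1)]]] continuous_intros)
     (auto simp: norm_mult)

lemma Max_continuous:
  fixes g :: "'b \<Rightarrow> real \<Rightarrow> real"
  assumes "finite S" "S \<noteq> {}" "\<And>s. s \<in> S \<Longrightarrow> continuous_on UNIV (g s)"
  shows "continuous_on UNIV (\<lambda>t. Max ((\<lambda>s. g s t) ` S))"
  using assms by (induction rule: finite_ne_induct) (auto intro!: continuous_on_max)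

text \<open>The integral is an average over rotations of sums over \<open>M\<close> equidistant
  points. At each rotation \<open>\<rho>\<close> picks the maximizing radii, and the discrete
  inequality applies with \<open>K = 3 M\<close>; the constant is 512 * 3 * 2 pi.\<close>

lemma maximal_finite:
  assumes S: "finite S" "S \<noteq> {}" "S \<subseteq> {0..<1}" and a: "l2 a"
  shows "integral {0..2*pi} (\<lambda>t. Max ((\<lambda>s. (cmod (pw a (of_real s * cis t)))\<^sup>2) ` S)) \<le> 3072 * pi * n2 a"
proof -
  define G where "G = (\<lambda>t. Max ((\<lambda>s. (cmod (pw a (of_real s * cis t)))\<^sup>2) ` S))"
  have G: "continuous_on UNIV G"
    unfolding G_def using S a by (intro Max_continuous continuous_intros pw_continuous_radius) auto
  have Gper: "G (t + 2 * pi) = G t" for t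
    by (simp add: G_def cis_mult[symmetric] cis_2pi)
  define \<sigma> where "\<sigma> = Max S"
  have \<sigma>: "0 \<le> \<sigma>" "\<sigma> < 1" "\<And>s. s \<in> S \<Longrightarrow> 0 \<le> s \<and> s \<le> \<sigma>"
  proof -
    have *: "Max S \<in> {0..<1}" using Max_in[OF S(1,2)] S(3) by blast
    then show "0 \<le> \<sigma>" "\<sigma> < 1" by (auto simp: \<sigma>_def)
    show "0 \<le> s \<and> s \<le> \<sigma>" if "s \<in> S" for s
      using Max_ge[OF S(1) that] S(3) that by (auto simp: \<sigma>_def)
  qed
  have \<sigma>2: "\<sigma>\<^sup>2 < 1" using \<sigma> by (simp add: abs_square_less_1)
  \<comment> \<open>\<open>M\<close> is taken so large, depending on the largest radius, that
    aliasing adds at most 2 to the row sums divided by \<open>M\<close>. How large is immaterial,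
    since \<open>M\<close> cancels at the end.\<close>
  have "(\<lambda>M. 2 * (\<sigma>\<^sup>2) ^ M / (1 - \<sigma>\<^sup>2)) \<longlonglongrightarrow> 2 * 0 / (1 - \<sigma>\<^sup>2)"
    using \<sigma>2 by (intro tendsto_intros LIMSEQ_power_zero) auto
  then have "\<forall>\<^sub>F M in sequentially. 2 * (\<sigma>\<^sup>2) ^ M / (1 - \<sigma>\<^sup>2) < 2"
    by (rule order_tendstoD) simp
  then have "\<forall>\<^sub>F M in sequentially. 2 * (\<sigma>\<^sup>2) ^ M / (1 - \<sigma>\<^sup>2) < 2 \<and> 0 < M"
    using eventually_gt_at_top[of 0] by eventually_elim auto
  then obtain M where M: "2 * (\<sigma>\<^sup>2) ^ M / (1 - \<sigma>\<^sup>2) < 2" "0 < M"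
    unfolding eventually_sequentially by blast
  have pt: "(\<Sum>x<M. G (t + 2 * pi * real x / real M)) \<le> 512 * (3 * real M) * n2 a" for t
  proof -
    have "\<exists>s\<in>S. G (t + 2 * pi * real x / real M) = (cmod (pw a (of_real s * cis (t + 2 * pi * real x / real M))))\<^sup>2" for x
      using Max_in[of "(\<lambda>s. (cmod (pw a (of_real s * cis (t + 2 * pi * real x / real M))))\<^sup>2) ` S"] S
      unfolding G_def by blast
    then obtain \<rho> where \<rho>: "\<And>x. \<rho> x \<in> S"
      "\<And>x. G (t + 2 * pi * real x / real M) = (cmod (pw a (of_real (\<rho> x) * cis (t + 2 * pi * real x / real M))))\<^sup>2"
      by metis
    have "(\<Sum>x<M. G (t + 2 * pi * real x / real M)) = (\<Sum>x<M. (cmod (pw a (of_real (\<rho> x) * cis (t + 2 * pi * real x / real M))))\<^sup>2)"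
      by (simp add: \<rho>(2))
    also have "\<dots> \<le> 512 * (3 * real M) * n2 a"
    proof (rule discrete_maximal[OF _ _ _ \<sigma>(1,2) _ _ a])
      fix x
      have "(\<Sum>y<M. poisson (of_real (\<sigma>\<^sup>2) * (cis (t + 2 * pi * real x / real M) * cnj (cis (t + 2 * pi * real y / real M)))))
        \<le> real M * (1 + 2 * (\<sigma>\<^sup>2) ^ M / (1 - \<sigma>\<^sup>2))"
        by (rule sum_poisson_equidistant) (use M \<sigma>2 in auto)
      also have "\<dots> \<le> real M * 3" using M by (intro mult_left_mono) auto
      finally show "(\<Sum>y<M. poisson (of_real (\<sigma>\<^sup>2) * (cis (t + 2 * pi * real x / real M) * cnj (cis (t + 2 * pi * real y / real M))))) \<le> 3 * real M"
        by simp
    qed (use \<rho> \<sigma> M in auto)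
    finally show ?thesis .
  qed
  have int: "(\<lambda>t. G (t + c)) integrable_on {0..2*pi}" for c
    by (intro integrable_continuous_real continuous_on_compose2[OF G] continuous_intros) auto
  have "real M * integral {0..2*pi} G = (\<Sum>x<M. integral {0..2*pi} (\<lambda>t. G (t + 2 * pi * real x / real M)))"
  proof -
    have "integral {0..2*pi} (\<lambda>t. G (t + 2 * pi * real x / real M)) = integral {0..2*pi} G" if "x < M" for x
      using that by (intro integral_periodic_shift[OF G Gper]) (auto simp: field_simps)
    then show ?thesis by simp
  qed
  also have "\<dots> = integral {0..2*pi} (\<lambda>t. \<Sum>x<M. G (t + 2 * pi * real x / real M))"
    by (intro integral_sum[symmetric] int) auto
  also have "\<dots> \<le> integral {0..2*pi} (\<lambda>t. 512 * (3 * real M) * n2 a)"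
    by (intro integral_le pt integrable_sum int) auto
  also have "\<dots> = real M * (3072 * pi * n2 a)" by simp
  finally show ?thesis using M by (simp add: G_def)
qed

text \<open>Countable and dense in [0, 1), so that the supremum over it is measurable and an
  increasing limit of finite maxima.\<close>

definition radii :: "real set" where
  "radii = \<rat> \<inter> {0..<1}"

lemma radii: "countable radii" "0 \<in> radii" "radii \<subseteq> {0..<1}"
  by (auto simp: radii_def countable_rat)

definition maxf :: "(nat \<Rightarrow> complex) \<Rightarrow> real \<Rightarrow> ennreal" where
  "maxf a t = (SUP s\<in>radii. ennreal ((cmod (pw a (of_real s * cis t)))\<^sup>2))"

lemma maxf_measurable [measurable]:
  assumes "l2 a"
  shows "maxf a \<in> borel_measurable borel"
  unfolding maxf_def
proof (rule borel_measurable_SUP)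
    fix s assume "s \<in> radii"
    then have "(\<lambda>t. (cmod (pw a (of_real s * cis t)))\<^sup>2) \<in> borel_measurable borel"
      using radii assms by (intro borel_measurable_continuous_onI continuous_intros pw_continuous_radius) auto
    then show "(\<lambda>t. ennreal ((cmod (pw a (of_real s * cis t)))\<^sup>2)) \<in> borel_measurable borel"
      by measurable
  qed (use radii in auto)

text \<open>Monotone convergence along the maxima over initial segments of an enumeration; the
  constant in \<open>maximal_finite\<close> does not depend on the number of radii.\<close>

lemma nn_integral_maxf:
  assumes a: "l2 a"
  shows "(\<integral>\<^sup>+t. maxf a t * indicator {0..2*pi} t \<partial>lborel) \<le> ennreal (3072 * pi * n2 a)"
proof -
  define q where "q = from_nat_into radii"
  have q: "range q = radii" using radii unfolding q_def by (intro range_from_nat_into) auto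
  have q01: "0 \<le> q j" "q j < 1" for j
  proof -
    have "q j \<in> {0..<1}" using q radii(3) by blast
    then show "0 \<le> q j" "q j < 1" by auto
  qed
  define g where "g = (\<lambda>J t. Max ((\<lambda>s. (cmod (pw a (of_real s * cis t)))\<^sup>2) ` (q ` {..J})))"
  have gc: "continuous_on UNIV (g J)" for J
    unfolding g_def using a q01 by (intro Max_continuous continuous_intros pw_continuous_radius) auto
  have g0: "0 \<le> g J t" for J t
    unfolding g_def by (subst Max_ge_iff) auto
  have gmono: "g J t \<le> g J' t" if "J \<le> J'" for J J' t
    unfolding g_def using that by (intro Max_mono) auto
  have eq: "maxf a t = (SUP J. ennreal (g J t))" for t
  proof (rule antisym)
    show "maxf a t \<le> (SUP J. ennreal (g J t))"
      unfolding maxf_def q[symmetric]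
    proof (safe intro!: SUP_least)
      fix j
      have "(cmod (pw a (of_real (q j) * cis t)))\<^sup>2 \<le> g j t"
        unfolding g_def by (intro Max_ge) auto
      then show "ennreal ((cmod (pw a (of_real (q j) * cis t)))\<^sup>2) \<le> (SUP J. ennreal (g J t))"
        by (intro SUP_upper2[of j]) (auto intro: ennreal_leI)
    qed
    show "(SUP J. ennreal (g J t)) \<le> maxf a t"
    proof (rule SUP_least)
      fix J
      have "g J t \<in> (\<lambda>s. (cmod (pw a (of_real s * cis t)))\<^sup>2) ` (q ` {..J})"
        unfolding g_def by (intro Max_in) auto
      then obtain j where "g J t = (cmod (pw a (of_real (q j) * cis t)))\<^sup>2" by auto
      moreover have "ennreal ((cmod (pw a (of_real (q j) * cis t)))\<^sup>2) \<le> maxf a t"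
        unfolding maxf_def using q by (intro SUP_upper) auto
      ultimately show "ennreal (g J t) \<le> maxf a t" by simp
    qed
  qed
  have "(\<integral>\<^sup>+t. maxf a t * indicator {0..2*pi} t \<partial>lborel) = (\<integral>\<^sup>+t. (SUP J. ennreal (g J t) * indicator {0..2*pi} t) \<partial>lborel)"
    by (simp add: eq SUP_mult_right_ennreal)
  also have "\<dots> = (SUP J. \<integral>\<^sup>+t. ennreal (g J t) * indicator {0..2*pi} t \<partial>lborel)"
  proof (rule nn_integral_monotone_convergence_SUP)
    show "incseq (\<lambda>J t. ennreal (g J t) * indicator {0..2*pi} t)"
      by (auto simp: incseq_def le_fun_def intro!: mult_right_mono ennreal_leI gmono)
    fix J
    have "g J \<in> borel_measurable borel"
      using gc[of J] by (rule borel_measurable_continuous_onI)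
    then show "(\<lambda>t. ennreal (g J t) * indicator {0..2*pi} t) \<in> borel_measurable lborel"
      by measurable
  qed
  also have "\<dots> \<le> ennreal (3072 * pi * n2 a)"
  proof (rule SUP_least)
    fix J
    have "(g J has_integral integral {0..2*pi} (g J)) {0..2*pi}"
      using gc[of J] by (intro integrable_integral integrable_continuous_real) (rule continuous_on_subset, auto)
    then have "(\<integral>\<^sup>+t. ennreal (indicator {0..2*pi} t * g J t) \<partial>lborel) = ennreal (integral {0..2*pi} (g J))"
      by (intro nn_integral_has_integral_lebesgue g0)
    then have "(\<integral>\<^sup>+t. ennreal (g J t) * indicator {0..2*pi} t \<partial>lborel) = ennreal (integral {0..2*pi} (g J))"
    proof -
      have "(\<integral>\<^sup>+t. ennreal (g J t) * indicator {0..2*pi} t \<partial>lborel) = (\<integral>\<^sup>+t. ennreal (indicator {0..2*pi} t * g J t) \<partial>lborel)"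
        by (intro nn_integral_cong) (auto split: split_indicator)
      then show ?thesis using \<open>(\<integral>\<^sup>+t. ennreal (indicator {0..2*pi} t * g J t) \<partial>lborel) = _\<close> by simp
    qed
    moreover have "integral {0..2*pi} (g J) \<le> 3072 * pi * n2 a"
      unfolding g_def using a q01 by (intro maximal_finite) auto
    ultimately show "(\<integral>\<^sup>+t. ennreal (g J t) * indicator {0..2*pi} t \<partial>lborel) \<le> ennreal (3072 * pi * n2 a)"
      by (simp add: ennreal_leI)
  qed
  finally show ?thesis .
qed

text \<open>Radial continuity extends the bound from rational radii to all radii.\<close>

lemma maxf_bound:
  assumes a: "l2 a" and s: "0 \<le> s" "s < 1"
  shows "ennreal ((cmod (pw a (of_real s * cis t)))\<^sup>2) \<le> maxf a t"
proof (cases "maxf a t = top")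
  case False
  define B where "B = enn2real (maxf a t)"
  have B: "ennreal B = maxf a t" "0 \<le> B" using False by (auto simp: B_def less_top)
  have le: "(cmod (pw a (of_real q * cis t)))\<^sup>2 \<le> B" if "q \<in> radii" for q
  proof -
    have "ennreal ((cmod (pw a (of_real q * cis t)))\<^sup>2) \<le> ennreal B"
      unfolding B maxf_def by (rule SUP_upper[OF that])
    then show ?thesis using B(2) by (simp only: ennreal_le_iff)
  qed
  have c: "continuous_on {0..<1} (\<lambda>s. (cmod (pw a (of_real s * cis t)))\<^sup>2)"
    by (intro continuous_intros continuous_on_compose2[OF holomorphic_on_imp_continuous_on[OF pw_holomorphic[OF a]]])
       (auto simp: norm_mult)
  have "(cmod (pw a (of_real s * cis t)))\<^sup>2 \<le> B"
  proof (rule ccontr)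
    assume "\<not> ?thesis"
    then have gt: "B < (cmod (pw a (of_real s * cis t)))\<^sup>2" by simp
    have "continuous (at s within {0..<1}) (\<lambda>s. (cmod (pw a (of_real s * cis t)))\<^sup>2)"
      using c s by (simp add: continuous_on_eq_continuous_within)
    then have "\<forall>\<^sub>F x in at s within {0..<1}. B < (cmod (pw a (of_real x * cis t)))\<^sup>2"
      unfolding continuous_within using gt by (rule order_tendstoD)
    then obtain d where d: "d > 0" "\<And>x. x \<in> {0..<1} \<Longrightarrow> x \<noteq> s \<Longrightarrow> dist x s < d \<Longrightarrow> B < (cmod (pw a (of_real x * cis t)))\<^sup>2"
      unfolding eventually_at by auto
    obtain x where x: "x \<in> \<rat>" "s < x" "x < min 1 (s + d)"
      using Rats_dense_in_real[of s "min 1 (s + d)"] s d by auto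
    then have "x \<in> radii" using s by (auto simp: radii_def)
    then show False using le[of x] d(2)[of x] x s by (auto simp: dist_real_def)
  qed
  then show ?thesis using B by (metis ennreal_leI)
qed auto

section \<open>Radial limits\<close>

definition tl2 :: "nat \<Rightarrow> (nat \<Rightarrow> complex) \<Rightarrow> nat \<Rightarrow> complex" where
  "tl2 N a = (\<lambda>n. if n < N then 0 else a n)"

lemma tl2_l2 [simp, intro]: "l2 a \<Longrightarrow> l2 (tl2 N a)"
  unfolding l2_def by (rule summable_comparison_test'[where g="\<lambda>n. (cmod (a n))\<^sup>2"]) (auto simp: tl2_def)

lemma n2_tl2:
  assumes "l2 a"
  shows "n2 (tl2 N a) = n2 a - (\<Sum>n<N. (cmod (a n))\<^sup>2)"
proof -
  have "(\<lambda>n. (cmod (a n))\<^sup>2) sums n2 a"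
    using assms by (simp add: l2_def n2_def summable_sums)
  then have "(\<lambda>n. (cmod (a (n + N)))\<^sup>2) sums (n2 a - (\<Sum>n<N. (cmod (a n))\<^sup>2))"
    by (rule sums_split_initial_segment)
  then have "(\<lambda>n. (cmod (tl2 N a (n + N)))\<^sup>2) sums (n2 a - (\<Sum>n<N. (cmod (a n))\<^sup>2))"
    by (simp add: tl2_def)
  then have "(\<lambda>n. (cmod (tl2 N a n))\<^sup>2) sums (n2 a - (\<Sum>n<N. (cmod (a n))\<^sup>2))"
    by (subst (asm) sums_zero_iff_shift) (auto simp: tl2_def)
  then show ?thesis by (simp add: n2_def sums_iff)
qed

lemma n2_tl2_tendsto: "l2 a \<Longrightarrow> (\<lambda>N. n2 (tl2 N a)) \<longlonglongrightarrow> 0"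
proof -
  assume a: "l2 a"
  then have "(\<lambda>N. \<Sum>n<N. (cmod (a n))\<^sup>2) \<longlonglongrightarrow> n2 a"
    unfolding l2_def n2_def by (rule summable_LIMSEQ)
  then have "(\<lambda>N. n2 a - (\<Sum>n<N. (cmod (a n))\<^sup>2)) \<longlonglongrightarrow> n2 a - n2 a"
    by (intro tendsto_intros)
  then show ?thesis by (simp add: n2_tl2[OF a])
qed

lemma pw_split:
  assumes "l2 a" "cmod z < 1"
  shows "pw a z = (\<Sum>n<N. a n * z ^ n) + pw (tl2 N a) z"
proof -
  have "(\<lambda>n. (if n < N then a n * z ^ n else 0) + tl2 N a n * z ^ n) sums ((\<Sum>n<N. a n * z ^ n) + pw (tl2 N a) z)"
    using sums_If_finite_set[of "{..<N}" "\<lambda>n. a n * z ^ n"] assms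
    by (intro sums_add pw_sums tl2_l2) auto
  moreover have "(\<lambda>n. (if n < N then a n * z ^ n else 0) + tl2 N a n * z ^ n) = (\<lambda>n. a n * z ^ n)"
    by (auto simp: tl2_def)
  ultimately show ?thesis by (simp add: pw_def sums_iff)
qed

text \<open>Being eventually within e of a convergent function for every e makes \<open>f\<close>
  Cauchy along the filter; the limits of the approximants are never compared with each
  other.\<close>

lemma limit_of_uniform_approx:
  fixes f :: "'b \<Rightarrow> complex"
  assumes F: "F \<noteq> bot"
    and approx: "\<And>e. e > 0 \<Longrightarrow> \<exists>g l. (g \<longlongrightarrow> l) F \<and> (\<forall>\<^sub>F s in F. dist (f s) (g s) \<le> e)"
  shows "\<exists>l. (f \<longlongrightarrow> l) F"
proof -
  have "cauchy_filter (filtermap f F)"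
    unfolding cauchy_filter_metric_filtermap
  proof (intro allI impI)
    fix e :: real assume e: "e > 0"
    then obtain g l where g: "(g \<longlongrightarrow> l) F" "\<forall>\<^sub>F s in F. dist (f s) (g s) \<le> e / 8"
      using approx[of "e / 8"] by auto
    have "\<forall>\<^sub>F s in F. dist (g s) l < e / 8"
      using tendstoD[OF g(1), of "e / 8"] e by simp
    with g(2) have ev: "\<forall>\<^sub>F s in F. dist (f s) l < e / 2"
    proof eventually_elim
      case (elim s)
      then show ?case using dist_triangle[of "f s" l "g s"] e by simp
    qed
    show "\<exists>P. eventually P F \<and> (\<forall>x y. P x \<and> P y \<longrightarrow> dist (f x) (f y) < e)"
      using ev by (intro exI[of _ "\<lambda>s. dist (f s) l < e / 2"]) (blast intro: dist_triangle_half_l)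
  qed
  then obtain l where "filtermap f F \<le> nhds l"
    using cauchy_filter_complete_converges[of "filtermap f F" UNIV] F
    by (auto simp: complete_UNIV filtermap_bot_iff)
  then show ?thesis unfolding filterlim_def by blast
qed

text \<open>Polynomials converge trivially, and the error of a truncation is controlled at all radii
  simultaneously by the maximal function of the tail, whose integral tends to 0. The maximal
  function of the whole series is the majorant \<open>D\<close>.\<close>

theorem fatou_radial_limits:
  assumes a: "l2 a"
  obtains N D where "negligible N" "D integrable_on {0..2*pi}"
    "\<And>t. t \<in> {0..2*pi} - N \<Longrightarrow> \<exists>l. ((\<lambda>s. pw a (of_real s * cis t)) \<longlongrightarrow> l) (at_left 1)"
    "\<And>t s. t \<in> {0..2*pi} - N \<Longrightarrow> s \<in> {0..<1} \<Longrightarrow> (cmod (pw a (of_real s * cis t)))\<^sup>2 \<le> D t"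
proof -
  \<comment> \<open>\<open>enn2real\<close> sends infinity to 0, so \<open>D\<close> dominates only
    where \<open>maxf a\<close> is finite; the exceptional points are put into the null set
    \<open>N\<close>.\<close>
  define D where "D = (\<lambda>t. enn2real (maxf a t * indicator {0..2*pi} t))"
  note [measurable] = maxf_measurable[OF a] maxf_measurable[OF tl2_l2[OF a]]
  have fin: "(\<integral>\<^sup>+t. maxf a t * indicator {0..2*pi} t \<partial>lborel) < \<infinity>"
    using nn_integral_maxf[OF a] by (rule le_less_trans) simp
  have Dint: "D integrable_on {0..2*pi}"
  proof (rule integrable_on_subinterval)
    show "D integrable_on UNIV"
    proof (rule nn_integral_integrable_on)
      have "(\<integral>\<^sup>+x. ennreal (D x) \<partial>lborel) \<le> (\<integral>\<^sup>+t. maxf a t * indicator {0..2*pi} t \<partial>lborel)"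
        unfolding D_def by (intro nn_integral_mono) (simp add: enn2real_le ennreal_enn2real_if)
      then show "(\<integral>\<^sup>+x. ennreal (D x) \<partial>lborel) < \<infinity>" using fin by (rule le_less_trans)
    qed (auto simp: D_def)
  qed auto
  have AE1: "AE t in lborel. maxf a t * indicator {0..2*pi} t \<noteq> \<infinity>"
    by (rule nn_integral_PInf_AE) (use fin in auto)
  have "(\<integral>\<^sup>+t. (INF N. maxf (tl2 N a) t) * indicator {0..2*pi} t \<partial>lborel) \<le> 0"
  proof (rule tendsto_lowerbound)
    show "((\<lambda>N. ennreal (3072 * pi * n2 (tl2 N a))) \<longlongrightarrow> 0) sequentially"
      using tendsto_ennrealI[OF tendsto_mult_left[OF n2_tl2_tendsto[OF a], of "3072 * pi"]] by simp
    show "\<forall>\<^sub>F N in sequentially. (\<integral>\<^sup>+t. (INF N. maxf (tl2 N a) t) * indicator {0..2*pi} t \<partial>lborel) \<le> ennreal (3072 * pi * n2 (tl2 N a))"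
    proof (intro always_eventually allI)
      fix N
      have "(\<integral>\<^sup>+t. (INF N. maxf (tl2 N a) t) * indicator {0..2*pi} t \<partial>lborel) \<le> (\<integral>\<^sup>+t. maxf (tl2 N a) t * indicator {0..2*pi} t \<partial>lborel)"
        by (intro nn_integral_mono mult_right_mono INF_lower) auto
      also have "\<dots> \<le> ennreal (3072 * pi * n2 (tl2 N a))"
        by (intro nn_integral_maxf tl2_l2 a)
      finally show "(\<integral>\<^sup>+t. (INF N. maxf (tl2 N a) t) * indicator {0..2*pi} t \<partial>lborel) \<le> ennreal (3072 * pi * n2 (tl2 N a))" .
    qed
  qed simp
  then have "AE t in lborel. (INF N. maxf (tl2 N a) t) * indicator {0..2*pi} t = 0"
    by (subst (asm) le_zero_eq, subst (asm) nn_integral_0_iff_AE) auto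
  with AE1 have "AE t in lborel. t \<in> {0..2*pi} \<longrightarrow> maxf a t \<noteq> \<infinity> \<and> (INF N. maxf (tl2 N a) t) = 0"
    by eventually_elim (auto split: split_indicator_asm)
  then obtain N where N: "N \<in> null_sets lborel"
    "\<And>t. t \<in> {0..2*pi} - N \<Longrightarrow> maxf a t \<noteq> \<infinity> \<and> (INF N. maxf (tl2 N a) t) = 0"
    by (auto simp: eventually_ae_filter)
  show ?thesis
  proof (rule that[of N D])
    show "negligible N"
      unfolding negligible_iff_null_sets by (rule null_sets_completionI[OF N(1)])
    show "D integrable_on {0..2*pi}" by fact
    fix t assume t: "t \<in> {0..2*pi} - N"
    show "(cmod (pw a (of_real s * cis t)))\<^sup>2 \<le> D t" if "s \<in> {0..<1}" for s
    proof -
      have "ennreal ((cmod (pw a (of_real s * cis t)))\<^sup>2) \<le> maxf a t"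
        using that a by (intro maxf_bound) auto
      then have "enn2real (ennreal ((cmod (pw a (of_real s * cis t)))\<^sup>2)) \<le> enn2real (maxf a t)"
        using N(2)[OF t] by (intro enn2real_mono) (auto simp: less_top)
      then show ?thesis using t by (simp add: D_def)
    qed
    show "\<exists>l. ((\<lambda>s. pw a (of_real s * cis t)) \<longlongrightarrow> l) (at_left 1)"
    proof (rule limit_of_uniform_approx)
      fix e :: real assume e: "e > 0"
      \<comment> \<open>For each e a single good truncation \<open>m\<close> suffices at the given
        \<open>t\<close>. This is why the infimum over the tails was shown to vanish almost
        everywhere, rather than a limit.\<close>
      have "(INF N. maxf (tl2 N a) t) < ennreal (e\<^sup>2)" using N(2)[OF t] e by simp
      then obtain m where m: "maxf (tl2 m a) t < ennreal (e\<^sup>2)" by (auto simp: INF_less_iff)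
      have small: "dist (pw a (of_real s * cis t)) (\<Sum>n<m. a n * (of_real s * cis t) ^ n) \<le> e"
        if s: "0 \<le> s" "s < 1" for s
      proof -
        have "ennreal ((cmod (pw (tl2 m a) (of_real s * cis t)))\<^sup>2) \<le> maxf (tl2 m a) t"
          by (intro maxf_bound tl2_l2 a s)
        also have "\<dots> \<le> ennreal (e\<^sup>2)" using m by simp
        finally have "(cmod (pw (tl2 m a) (of_real s * cis t)))\<^sup>2 \<le> e\<^sup>2" by (simp add: ennreal_le_iff)
        then have "cmod (pw (tl2 m a) (of_real s * cis t)) \<le> e" using e by (simp add: power2_le_iff_abs_le)
        then show ?thesis
          using pw_split[OF a, of "of_real s * cis t" m] s by (simp add: dist_norm norm_mult)
      qed
      have "((\<lambda>s::real. \<Sum>n<m. a n * (of_real s * cis t) ^ n) \<longlongrightarrow> (\<Sum>n<m. a n * (of_real 1 * cis t) ^ n)) (at_left 1)"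
        by (intro tendsto_intros)
      moreover have "\<forall>\<^sub>F s in at_left (1::real). dist (pw a (of_real s * cis t)) (\<Sum>n<m. a n * (of_real s * cis t) ^ n) \<le> e"
        unfolding eventually_at_left_field by (intro exI[of _ 0]) (auto intro: small)
      ultimately show "\<exists>g l. (g \<longlongrightarrow> l) (at_left (1::real)) \<and> (\<forall>\<^sub>F s in at_left 1. dist (pw a (of_real s * cis t)) (g s) \<le> e)"
        by blast
    qed simp
  qed
qed

text \<open>
  Convergence almost everywhere with an integrable majorant of the squares: it is stable under products
  and allows passing to the limit under the integral.
\<close>

definition bconv :: "(real \<Rightarrow> real \<Rightarrow> complex) \<Rightarrow> (real \<Rightarrow> complex) \<Rightarrow> bool" where
  "bconv F u \<longleftrightarrow> (\<exists>N D. negligible N \<and> D integrable_on {0..2*pi} \<and>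
     (\<forall>\<^sub>F s in at_left 1. continuous_on {0..2*pi} (F s) \<and> (\<forall>t\<in>{0..2*pi} - N. (cmod (F s t))\<^sup>2 \<le> D t)) \<and>
     (\<forall>t\<in>{0..2*pi} - N. ((\<lambda>s. F s t) \<longlongrightarrow> u t) (at_left 1)))"

text \<open>Dominated convergence: the modulus of the product is at most the sum of the squared
  moduli, hence at most \<open>D1 + D2\<close>.\<close>

lemma bconv_integral:
  assumes "bconv F u" "bconv G v"
  shows "((\<lambda>s. integral {0..2*pi} (\<lambda>t. F s t * G s t)) \<longlongrightarrow> integral {0..2*pi} (\<lambda>t. u t * v t)) (at_left 1)"
proof -
  obtain N1 D1 where 1: "negligible N1" "D1 integrable_on {0..2*pi}"
     "\<forall>\<^sub>F s in at_left 1. continuous_on {0..2*pi} (F s) \<and> (\<forall>t\<in>{0..2*pi} - N1. (cmod (F s t))\<^sup>2 \<le> D1 t)"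
     "\<forall>t\<in>{0..2*pi} - N1. ((\<lambda>s. F s t) \<longlongrightarrow> u t) (at_left 1)"
    using assms(1) unfolding bconv_def by blast
  obtain N2 D2 where 2: "negligible N2" "D2 integrable_on {0..2*pi}"
     "\<forall>\<^sub>F s in at_left 1. continuous_on {0..2*pi} (G s) \<and> (\<forall>t\<in>{0..2*pi} - N2. (cmod (G s t))\<^sup>2 \<le> D2 t)"
     "\<forall>t\<in>{0..2*pi} - N2. ((\<lambda>s. G s t) \<longlongrightarrow> v t) (at_left 1)"
    using assms(2) unfolding bconv_def by blast
  \<comment> \<open>Cutting the null sets out of the interval turns the bounds and limits into
    statements at every point of the domain, as dominated convergence asks for, without changing any
    integral.\<close>
  define T where "T = {0..2*pi} - (N1 \<union> N2)"
  have neg: "negligible (({0..2*pi} - T) \<union> (T - {0..2*pi}))"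
    by (rule negligible_subset[of "N1 \<union> N2"]) (use 1 2 in \<open>auto simp: T_def\<close>)
  have Tint: "integral T f = integral {0..2*pi} f" for f :: "real \<Rightarrow> complex"
    by (rule integral_spike_set) (auto intro!: negligible_subset[OF neg])
  have Tion: "f integrable_on T" if "f integrable_on {0..2*pi}" for f :: "real \<Rightarrow> 'c :: euclidean_space"
    using that integrable_spike_set_eq[OF neg] by blast
  obtain b where b: "b < 1" "\<And>s. b < s \<Longrightarrow> s < 1 \<Longrightarrow>
      (continuous_on {0..2*pi} (F s) \<and> (\<forall>t\<in>{0..2*pi} - N1. (cmod (F s t))\<^sup>2 \<le> D1 t)) \<and>
      (continuous_on {0..2*pi} (G s) \<and> (\<forall>t\<in>{0..2*pi} - N2. (cmod (G s t))\<^sup>2 \<le> D2 t))"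
    using eventually_conj[OF 1(3) 2(3)] unfolding eventually_at_left_field by blast
  show ?thesis
  proof (rule tendsto_at_left_sequentially[OF b(1)])
    fix S assume S: "\<And>n. S n < 1" "\<And>n. b < S n" "S \<longlonglongrightarrow> 1"
    have left: "filterlim S (at_left 1) sequentially"
      using S by (auto simp: filterlim_at intro!: always_eventually less_imp_neq)
    have "(\<lambda>n. integral T (\<lambda>t. F (S n) t * G (S n) t)) \<longlonglongrightarrow> integral T (\<lambda>t. u t * v t)"
    proof (rule dominated_convergence(2))
      show "(\<lambda>t. F (S n) t * G (S n) t) integrable_on T" for n
        using b(2)[OF S(2,1)] by (intro Tion integrable_continuous_real continuous_intros) auto
      show "(\<lambda>t. D1 t + D2 t) integrable_on T"
        by (intro Tion integrable_add 1 2)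
      show "(\<lambda>n. F (S n) t * G (S n) t) \<longlonglongrightarrow> u t * v t" if "t \<in> T" for t
        using that 1(4) 2(4) by (intro tendsto_mult filterlim_compose[OF _ left]) (auto simp: T_def)
      fix n t assume t: "t \<in> T"
      have "(cmod (F (S n) t))\<^sup>2 \<le> D1 t" "(cmod (G (S n) t))\<^sup>2 \<le> D2 t"
        using b(2)[OF S(2,1), of n] t by (auto simp: T_def)
      moreover have "0 \<le> (cmod (F (S n) t) - cmod (G (S n) t))\<^sup>2 + (cmod (F (S n) t))\<^sup>2 + (cmod (G (S n) t))\<^sup>2"
        by simp
      ultimately show "norm (F (S n) t * G (S n) t) \<le> D1 t + D2 t"
        unfolding norm_mult by (simp add: power2_eq_square algebra_simps)
    qed
    then show "(\<lambda>n. integral {0..2*pi} (\<lambda>t. F (S n) t * G (S n) t)) \<longlonglongrightarrow> integral {0..2*pi} (\<lambda>t. u t * v t)"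
      by (simp add: Tint)
  qed
qed

lemma bconv_add:
  assumes "bconv F u" "bconv G v"
  shows "bconv (\<lambda>s t. F s t + G s t) (\<lambda>t. u t + v t)"
proof -
  obtain N1 D1 where 1: "negligible N1" "D1 integrable_on {0..2*pi}"
     "\<forall>\<^sub>F s in at_left 1. continuous_on {0..2*pi} (F s) \<and> (\<forall>t\<in>{0..2*pi} - N1. (cmod (F s t))\<^sup>2 \<le> D1 t)"
     "\<forall>t\<in>{0..2*pi} - N1. ((\<lambda>s. F s t) \<longlongrightarrow> u t) (at_left 1)"
    using assms(1) unfolding bconv_def by blast
  obtain N2 D2 where 2: "negligible N2" "D2 integrable_on {0..2*pi}"
     "\<forall>\<^sub>F s in at_left 1. continuous_on {0..2*pi} (G s) \<and> (\<forall>t\<in>{0..2*pi} - N2. (cmod (G s t))\<^sup>2 \<le> D2 t)"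
     "\<forall>t\<in>{0..2*pi} - N2. ((\<lambda>s. G s t) \<longlongrightarrow> v t) (at_left 1)"
    using assms(2) unfolding bconv_def by blast
  show ?thesis unfolding bconv_def
  proof (intro exI conjI ballI)
    show "negligible (N1 \<union> N2)" using 1 2 by simp
    show "(\<lambda>t. 2 * D1 t + 2 * D2 t) integrable_on {0..2*pi}"
      using 1 2 by (intro integrable_add integrable_on_mult_right) auto
    show "\<forall>\<^sub>F s in at_left 1. continuous_on {0..2*pi} (\<lambda>t. F s t + G s t) \<and>
       (\<forall>t\<in>{0..2*pi} - (N1 \<union> N2). (cmod (F s t + G s t))\<^sup>2 \<le> 2 * D1 t + 2 * D2 t)"
      using 1(3) 2(3)
    proof (eventually_elim, intro conjI ballI)
      fix s t
      assume A: "continuous_on {0..2 * pi} (F s) \<and> (\<forall>t\<in>{0..2 * pi} - N1. (cmod (F s t))\<^sup>2 \<le> D1 t)"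
        "continuous_on {0..2 * pi} (G s) \<and> (\<forall>t\<in>{0..2 * pi} - N2. (cmod (G s t))\<^sup>2 \<le> D2 t)"
      then show "continuous_on {0..2*pi} (\<lambda>t. F s t + G s t)" by (intro continuous_intros) auto
      assume t: "t \<in> {0..2*pi} - (N1 \<union> N2)"
      have "(cmod (F s t + G s t))\<^sup>2 \<le> (cmod (F s t) + cmod (G s t))\<^sup>2"
        by (intro power_mono norm_triangle_ineq) auto
      also have "\<dots> \<le> 2 * (cmod (F s t))\<^sup>2 + 2 * (cmod (G s t))\<^sup>2"
        using zero_le_power2[of "cmod (F s t) - cmod (G s t)"] by (simp add: power2_eq_square algebra_simps)
      also have "\<dots> \<le> 2 * D1 t + 2 * D2 t" using A t by (intro add_mono mult_left_mono) auto
      finally show "(cmod (F s t + G s t))\<^sup>2 \<le> 2 * D1 t + 2 * D2 t" .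
    qed
    fix t assume "t \<in> {0..2*pi} - (N1 \<union> N2)"
    then show "((\<lambda>s. F s t + G s t) \<longlongrightarrow> u t + v t) (at_left 1)"
      using 1(4) 2(4) by (intro tendsto_add) auto
  qed
qed

lemma bconv_cnj:
  assumes "bconv F u"
  shows "bconv (\<lambda>s t. cnj (F s t)) (\<lambda>t. cnj (u t))"
  using assms unfolding bconv_def
  by (elim exE conjE, intro exI conjI) (auto intro!: continuous_on_cnj tendsto_cnj elim!: eventually_mono)

text \<open>If the function extends continuously to the boundary circle, a constant serves as
  majorant. This takes care of the half of a Laurent series that is holomorphic across the circle in
  question.\<close>

lemma bconv_uniform:
  assumes b: "b < 1" and c: "continuous_on ({b..1} \<times> {0..2*pi}) (\<lambda>(s, t). F s t)"
  shows "bconv F (F 1)"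
proof -
  have "compact ((\<lambda>(s, t). F s t) ` ({b..1} \<times> {0..2*pi}))"
    using c by (intro compact_continuous_image compact_Times) auto
  then have "bounded ((\<lambda>(s, t). F s t) ` ({b..1} \<times> {0..2*pi}))"
    by (rule compact_imp_bounded)
  then obtain B where B': "\<forall>x\<in>(\<lambda>(s, t). F s t) ` ({b..1} \<times> {0..2*pi}). cmod x \<le> B"
    unfolding bounded_iff by auto
  have B: "cmod (F s t) \<le> B" if "s \<in> {b..1}" "t \<in> {0..2*pi}" for s t
    using B'[rule_format, of "F s t"] that by force
  show ?thesis unfolding bconv_def
  proof (intro exI conjI ballI)
    show "negligible {}" by simp
    show "(\<lambda>t::real. B\<^sup>2) integrable_on {0..2*pi}" by auto
    have "continuous_on {0..2*pi} (F s) \<and> (\<forall>t\<in>{0..2*pi} - {}. (cmod (F s t))\<^sup>2 \<le> B\<^sup>2)" if "b < s" "s < 1" for s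
    proof (intro conjI ballI)
      show "continuous_on {0..2*pi} (F s)"
      proof -
        have "continuous_on {0..2*pi} (\<lambda>t. (\<lambda>(s, t). F s t) (s, t))"
          using that by (intro continuous_on_compose2[OF c] continuous_on_Pair continuous_intros) auto
        then show ?thesis by simp
      qed
      show "(cmod (F s t))\<^sup>2 \<le> B\<^sup>2" if "t \<in> {0..2*pi} - {}" for t
        using that \<open>b < s\<close> \<open>s < 1\<close> B[of s t] by (intro power_mono) auto
    qed
    then show "\<forall>\<^sub>F s in at_left 1. continuous_on {0..2*pi} (F s) \<and> (\<forall>t\<in>{0..2*pi} - {}. (cmod (F s t))\<^sup>2 \<le> B\<^sup>2)"
      unfolding eventually_at_left_field using b by blast
    fix t :: real assume t: "t \<in> {0..2*pi} - {}"
    have "continuous_on {b..1} (\<lambda>s. F s t)"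
    proof -
      have "continuous_on {b..1} (\<lambda>s. (\<lambda>(s, t). F s t) (s, t))"
        using t by (intro continuous_on_compose2[OF c] continuous_on_Pair continuous_intros) auto
      then show ?thesis by simp
    qed
    then have "((\<lambda>s. F s t) \<longlongrightarrow> F 1 t) (at 1 within {b..1})"
      using b by (auto simp: continuous_on_def)
    moreover have "at 1 within {b..1} = at_left 1"
      using b by (rule at_within_Icc_at_left)
    ultimately show "((\<lambda>s. F s t) \<longlongrightarrow> F 1 t) (at_left 1)" by simp
  qed
qed

lemma bconv_mult_cont:
  assumes "bconv F u" "continuous_on {0..2*pi} w"
  shows "bconv (\<lambda>s t. w t * F s t) (\<lambda>t. w t * u t)"
proof -
  obtain N1 D1 where 1: "negligible N1" "D1 integrable_on {0..2*pi}"
     "\<forall>\<^sub>F s in at_left 1. continuous_on {0..2*pi} (F s) \<and> (\<forall>t\<in>{0..2*pi} - N1. (cmod (F s t))\<^sup>2 \<le> D1 t)"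
     "\<forall>t\<in>{0..2*pi} - N1. ((\<lambda>s. F s t) \<longlongrightarrow> u t) (at_left 1)"
    using assms(1) unfolding bconv_def by blast
  have "compact (w ` {0..2*pi})"
    using assms by (intro compact_continuous_image) auto
  then have "bounded (w ` {0..2*pi})"
    by (rule compact_imp_bounded)
  then obtain B where B': "\<forall>x\<in>w ` {0..2*pi}. cmod x \<le> B"
    unfolding bounded_iff by auto
  have B: "cmod (w t) \<le> B" if "t \<in> {0..2*pi}" for t
    using B'[rule_format, of "w t"] that by blast
  show ?thesis unfolding bconv_def
  proof (intro exI conjI ballI)
    show "negligible N1" by fact
    show "(\<lambda>t. B\<^sup>2 * D1 t) integrable_on {0..2*pi}"
      using 1 by (intro integrable_on_mult_right) auto
    show "\<forall>\<^sub>F s in at_left 1. continuous_on {0..2*pi} (\<lambda>t. w t * F s t) \<and>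
       (\<forall>t\<in>{0..2*pi} - N1. (cmod (w t * F s t))\<^sup>2 \<le> B\<^sup>2 * D1 t)"
      using 1(3)
    proof (eventually_elim, intro conjI ballI)
      fix s t
      assume A: "continuous_on {0..2 * pi} (F s) \<and> (\<forall>t\<in>{0..2 * pi} - N1. (cmod (F s t))\<^sup>2 \<le> D1 t)"
      then show "continuous_on {0..2*pi} (\<lambda>t. w t * F s t)" using assms(2) by (intro continuous_intros) auto
      assume t: "t \<in> {0..2*pi} - N1"
      show "(cmod (w t * F s t))\<^sup>2 \<le> B\<^sup>2 * D1 t"
        unfolding norm_mult power_mult_distrib using A t B by (intro mult_mono power_mono) auto
    qed
    fix t assume "t \<in> {0..2*pi} - N1"
    then show "((\<lambda>s. w t * F s t) \<longlongrightarrow> w t * u t) (at_left 1)"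
      using 1(4) by (intro tendsto_mult tendsto_const) auto
  qed
qed

text \<open>\<open>Lim\<close> is an arbitrary value where no limit exists, but it agrees with
  \<open>u\<close> off a null set; this is how the boundary values \<open>bv_inside\<close> and
  \<open>bv_outside\<close> enter.\<close>

lemma bconv_Lim:
  assumes "bconv F u"
  shows "bconv F (\<lambda>t. Lim (at_left 1) (\<lambda>s. F s t))"
proof -
  have "Lim (at_left 1) (\<lambda>s. F s t) = u t" if "((\<lambda>s. F s t) \<longlongrightarrow> u t) (at_left 1)" for t
    using that by (intro tendsto_Lim) auto
  moreover obtain N D where "negligible N" "D integrable_on {0..2*pi}"
     "\<forall>\<^sub>F s in at_left 1. continuous_on {0..2*pi} (F s) \<and> (\<forall>t\<in>{0..2*pi} - N. (cmod (F s t))\<^sup>2 \<le> D t)"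
     "\<forall>t\<in>{0..2*pi} - N. ((\<lambda>s. F s t) \<longlongrightarrow> u t) (at_left 1)"
    using assms unfolding bconv_def by blast
  ultimately show ?thesis
    unfolding bconv_def by (intro exI[of _ N] exI[of _ D] conjI ballI) simp_all
qed

lemma bconv_cong:
  assumes "bconv F u" "\<forall>\<^sub>F s in at_left 1. \<forall>t. F s t = G s t"
  shows "bconv G u"
proof -
  have *: "((\<lambda>s. F s t) \<longlongrightarrow> u t) (at_left 1) \<longleftrightarrow> ((\<lambda>s. G s t) \<longlongrightarrow> u t) (at_left 1)" for t
    by (rule tendsto_cong) (use assms(2) in \<open>auto elim: eventually_mono\<close>)
  obtain N1 D1 where 1: "negligible N1" "D1 integrable_on {0..2*pi}"
     "\<forall>\<^sub>F s in at_left 1. continuous_on {0..2*pi} (F s) \<and> (\<forall>t\<in>{0..2*pi} - N1. (cmod (F s t))\<^sup>2 \<le> D1 t)"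
     "\<forall>t\<in>{0..2*pi} - N1. ((\<lambda>s. F s t) \<longlongrightarrow> u t) (at_left 1)"
    using assms(1) unfolding bconv_def by blast
  have "\<forall>\<^sub>F s in at_left 1. continuous_on {0..2*pi} (G s) \<and> (\<forall>t\<in>{0..2*pi} - N1. (cmod (G s t))\<^sup>2 \<le> D1 t)"
    using 1(3) assms(2)
  proof eventually_elim
    case (elim s)
    then have "F s = G s" by auto
    then show ?case using elim by simp
  qed
  then show ?thesis unfolding bconv_def using 1 * by blast
qed

lemma bconv_pw:
  assumes a: "l2 a"
  shows "bconv (\<lambda>s t. pw a (of_real s * cis t)) (\<lambda>t. Lim (at_left 1) (\<lambda>s. pw a (of_real s * cis t)))"
proof -
  obtain N D where ND: "negligible N" "D integrable_on {0..2*pi}"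
    "\<And>t. t \<in> {0..2*pi} - N \<Longrightarrow> \<exists>l. ((\<lambda>s. pw a (of_real s * cis t)) \<longlongrightarrow> l) (at_left 1)"
    "\<And>t s. t \<in> {0..2*pi} - N \<Longrightarrow> s \<in> {0..<1} \<Longrightarrow> (cmod (pw a (of_real s * cis t)))\<^sup>2 \<le> D t"
    using fatou_radial_limits[OF a] by metis
  show ?thesis unfolding bconv_def
  proof (intro exI conjI ballI)
    show "\<forall>\<^sub>F s in at_left 1. continuous_on {0..2*pi} (\<lambda>t. pw a (of_real s * cis t)) \<and>
       (\<forall>t\<in>{0..2*pi} - N. (cmod (pw a (of_real s * cis t)))\<^sup>2 \<le> D t)"
      unfolding eventually_at_left_field
      by (intro exI[of _ 0] conjI impI allI continuous_on_subset[OF pw_continuous_radius[OF a]] ballI ND(4)) auto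
    show "((\<lambda>s. pw a (of_real s * cis t)) \<longlongrightarrow> Lim (at_left 1) (\<lambda>s. pw a (of_real s * cis t))) (at_left 1)"
      if "t \<in> {0..2*pi} - N" for t
      using ND(3)[OF that] by (metis tendsto_Lim trivial_limit_at_left_real)
  qed (use ND in auto)
qed

section \<open>Fourier series on circles\<close>

definition circ :: "(real \<Rightarrow> complex) \<Rightarrow> complex" where
  "circ v = integral {0..2*pi} v / (2 * of_real pi)"

lemma circ_cong: "(\<And>t. t \<in> {0..2*pi} \<Longrightarrow> u t = v t) \<Longrightarrow> circ u = circ v"
  unfolding circ_def by (metis integral_cong)

lemma circ_add:
  "continuous_on {0..2*pi} u \<Longrightarrow> continuous_on {0..2*pi} v \<Longrightarrow> circ (\<lambda>t. u t + v t) = circ u + circ v"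
  unfolding circ_def by (simp add: integral_add integrable_continuous_real add_divide_distrib)

lemma circ_cmult: "circ (\<lambda>t. c * v t) = c * circ v"
  unfolding circ_def by simp

lemma circ_cnj: "circ (\<lambda>t. cnj (v t)) = cnj (circ v)"
  unfolding circ_def by (simp add: integral_cnj)

lemma circ_const: "circ (\<lambda>t. c) = c"
  unfolding circ_def by (simp add: scaleR_conv_of_real)

lemma circ_bound:
  assumes "continuous_on {0..2*pi} v" "\<And>t. t \<in> {0..2*pi} \<Longrightarrow> cmod (v t) \<le> B"
  shows "cmod (circ v) \<le> B"
proof -
  have "cmod (integral {0..2*pi} v) \<le> B * (2 * pi - 0)"
    by (rule integral_bound) (use assms in auto)
  then show ?thesis unfolding circ_def by (simp add: norm_divide field_simps)
qed

text \<open>Holds without integrability, both sides being 0 otherwise; so means of boundary values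
  can be rewritten before anything is known about them.\<close>

lemma integral_of_real_complex:
  fixes g :: "real \<Rightarrow> real"
  shows "integral S (\<lambda>t. complex_of_real (g t)) = of_real (integral S g)"
proof (cases "g integrable_on S")
  case True
  then show ?thesis
    by (intro integral_unique has_integral_of_real integrable_integral)
next
  case False
  have "\<not> (\<lambda>t. complex_of_real (g t)) integrable_on S"
  proof
    assume "(\<lambda>t. complex_of_real (g t)) integrable_on S"
    then have "(\<lambda>t. Re (complex_of_real (g t))) integrable_on S"
      using integrable_linear[OF \<open>(\<lambda>t. complex_of_real (g t)) integrable_on S\<close> bounded_linear_Re] by (simp add: o_def)
    then show False using False by simp
  qed
  then show ?thesis using False by (simp add: not_integrable_integral)
qed

lemma circle_mean_square_circ:
  "complex_of_real (circle_mean_square \<rho> f) = circ (\<lambda>t. f (rcis \<rho> t) * cnj (f (rcis \<rho> t)))"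
  unfolding circle_mean_square_def circ_def
  by (simp add: integral_of_real_complex[symmetric] complex_norm_square[symmetric] del: of_real_power)

text \<open>Negative frequencies are written as powers of \<open>cis (-t)\<close>, which keeps both
  exponents natural numbers.\<close>

lemma circ_powers: "circ (\<lambda>t. cis t ^ n * cis (-t) ^ m) = (if n = m then 1 else 0)"
proof (cases "n = m")
  case True
  have "(\<lambda>t. cis t ^ n * cis (-t) ^ m) = (\<lambda>t. 1)"
    using True by (simp add: power_mult_distrib[symmetric] cis_mult)
  then show ?thesis using True by (simp add: circ_const)
next
  case False
  define k where "k = real n - real m"
  have k: "k \<noteq> 0" using False by (simp add: k_def)
  have eq: "cis t ^ n * cis (-t) ^ m = cis (k * t)" for t
    unfolding k_def Complex.DeMoivre cis_mult by (simp add: algebra_simps)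
  have "((\<lambda>t. cis (k * t)) has_integral (cis (k * (2*pi)) / (\<i> * k) - cis (k * 0) / (\<i> * k))) {0..2*pi}"
  proof (rule fundamental_theorem_of_calculus)
    fix x
    have "((\<lambda>z. exp (\<i> * of_real k * z) / (\<i> * of_real k)) has_field_derivative exp (\<i> * of_real k * of_real x)) (at (of_real x))"
      using k by (auto intro!: derivative_eq_intros)
    then have "((\<lambda>x. exp (\<i> * of_real k * of_real x) / (\<i> * of_real k)) has_vector_derivative exp (\<i> * of_real k * of_real x)) (at x)"
      by (rule has_vector_derivative_real_field)
    then have "((\<lambda>x. cis (k * x) / (\<i> * k)) has_vector_derivative cis (k * x)) (at x)"
      by (simp add: cis_conv_exp mult_ac)
    then show "((\<lambda>x. cis (k * x) / (\<i> * k)) has_vector_derivative cis (k * x)) (at x within {0..2*pi})"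
      by (rule has_vector_derivative_at_within)
  qed simp
  moreover have "cis (k * (2*pi)) = 1"
    using cis_multiple_2pi[of k] by (simp add: k_def mult_ac)
  ultimately have "((\<lambda>t. cis (k * t)) has_integral 0) {0..2*pi}" by simp
  then show ?thesis using False unfolding circ_def eq by (simp add: integral_unique)
qed

text \<open>Termwise integration, the partial sums being dominated by the sum of the |P n| times a
  bound of \<open>v\<close>.\<close>

lemma circ_series:
  assumes P: "summable (\<lambda>n. cmod (P n))" and w: "\<And>n. continuous_on {0..2*pi} (w n)"
    "\<And>n t. cmod (w n t) \<le> 1" and v: "continuous_on {0..2*pi} v"
  shows "(\<lambda>n. P n * circ (\<lambda>t. w n t * v t)) sums circ (\<lambda>t. (\<Sum>n. P n * w n t) * v t)"
proof -
  have "compact (v ` {0..2*pi})"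
    using v by (intro compact_continuous_image) auto
  then have "bounded (v ` {0..2*pi})" by (rule compact_imp_bounded)
  then obtain B where B': "\<forall>x\<in>v ` {0..2*pi}. cmod x \<le> B"
    unfolding bounded_iff by auto
  have B: "cmod (v t) \<le> B" if "t \<in> {0..2*pi}" for t
    using B'[rule_format, of "v t"] that by blast
  have le: "cmod (P n * w n t) \<le> cmod (P n)" for n t
    using w(2)[of n t] by (simp add: norm_mult mult_left_le)
  have abs: "summable (\<lambda>n. cmod (P n * w n t))" for t
    by (rule summable_comparison_test'[OF P]) (use le in auto)
  have "(\<lambda>k. integral {0..2*pi} (\<lambda>t. (\<Sum>n<k. P n * w n t) * v t)) \<longlonglongrightarrow> integral {0..2*pi} (\<lambda>t. (\<Sum>n. P n * w n t) * v t)"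
  proof (rule dominated_convergence(2))
    show "(\<lambda>t. (\<Sum>n<k. P n * w n t) * v t) integrable_on {0..2*pi}" for k
      using w v by (intro integrable_continuous_real continuous_intros) auto
    show "(\<lambda>t::real. (\<Sum>n. cmod (P n)) * B) integrable_on {0..2*pi}" by auto
    show "(\<lambda>k. (\<Sum>n<k. P n * w n t) * v t) \<longlonglongrightarrow> (\<Sum>n. P n * w n t) * v t" for t
      using abs[of t] by (intro tendsto_mult summable_LIMSEQ tendsto_const) (rule summable_norm_cancel)
    fix k t assume t: "t \<in> {0..2*pi}"
    have "cmod (\<Sum>n<k. P n * w n t) \<le> (\<Sum>n<k. cmod (P n))"
      using le by (intro order_trans[OF norm_sum] sum_mono)
    also have "\<dots> \<le> (\<Sum>n. cmod (P n))" using P by (intro sum_le_suminf) auto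
    finally show "norm ((\<Sum>n<k. P n * w n t) * v t) \<le> (\<Sum>n. cmod (P n)) * B"
      unfolding norm_mult using B[OF t] P by (intro mult_mono suminf_nonneg) auto
  qed
  then have "(\<lambda>k. circ (\<lambda>t. (\<Sum>n<k. P n * w n t) * v t)) \<longlonglongrightarrow> circ (\<lambda>t. (\<Sum>n. P n * w n t) * v t)"
    unfolding circ_def by (intro tendsto_intros) auto
  moreover have "circ (\<lambda>t. (\<Sum>n<k. P n * w n t) * v t) = (\<Sum>n<k. P n * circ (\<lambda>t. w n t * v t))" for k
  proof -
    have "integral {0..2*pi} (\<lambda>t. \<Sum>n<k. P n * (w n t * v t)) = (\<Sum>n<k. integral {0..2*pi} (\<lambda>t. P n * (w n t * v t)))"
      using w v by (intro integral_sum integrable_continuous_real continuous_intros) auto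
    then show ?thesis unfolding circ_def
      by (simp add: sum_distrib_right sum_divide_distrib mult.assoc)
  qed
  ultimately show ?thesis by (simp add: sums_def)
qed

lemma series_continuous:
  fixes w :: "nat \<Rightarrow> real \<Rightarrow> complex"
  assumes P: "summable (\<lambda>n. cmod (P n))" and w: "\<And>n. continuous_on S (w n)" "\<And>n t. cmod (w n t) \<le> 1"
  shows "continuous_on S (\<lambda>t. \<Sum>n. P n * w n t)"
proof (rule uniform_limit_theorem)
  show "uniform_limit S (\<lambda>k t. \<Sum>n<k. P n * w n t) (\<lambda>t. \<Sum>n. P n * w n t) sequentially"
    by (rule Weierstrass_m_test[OF _ P]) (use w in \<open>simp add: norm_mult mult_left_le\<close>)
  show "\<forall>\<^sub>F n in sequentially. continuous_on S (\<lambda>t. \<Sum>n<n. P n * w n t)"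
    using w by (intro always_eventually allI continuous_intros) auto
qed simp

lemma cis_pow_cont: "continuous_on S (\<lambda>t. cis t ^ n)" "continuous_on S (\<lambda>t. cis (-t) ^ n)"
  by (intro continuous_intros)+

lemma cis_pow_norm: "cmod (cis t ^ n) \<le> 1"
  by (simp add: norm_power)

text \<open>A Fourier series split by the sign of the frequency: \<open>P n\<close> belongs to
  \<open>n\<close> and \<open>Q n\<close> to \<open>- n - 1\<close>, so the constant term occurs
  once.\<close>

definition tf :: "(nat \<Rightarrow> complex) \<Rightarrow> (nat \<Rightarrow> complex) \<Rightarrow> real \<Rightarrow> complex" where
  "tf P Q t = (\<Sum>n. P n * cis t ^ n) + (\<Sum>n. Q n * cis (-t) ^ Suc n)"

definition asum :: "(nat \<Rightarrow> complex) \<Rightarrow> bool" where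
  "asum P \<longleftrightarrow> summable (\<lambda>n. cmod (P n))"

lemma tf_continuous: "asum P \<Longrightarrow> asum Q \<Longrightarrow> continuous_on S (tf P Q)"
  unfolding tf_def [abs_def] asum_def
  by (intro continuous_on_add series_continuous cis_pow_cont cis_pow_norm)

lemma tf_circ_sums:
  assumes "asum P" "asum Q" and v: "continuous_on {0..2*pi} v"
  shows "(\<lambda>n. P n * circ (\<lambda>t. cis t ^ n * v t) + Q n * circ (\<lambda>t. cis (-t) ^ Suc n * v t)) sums circ (\<lambda>t. tf P Q t * v t)"
proof -
  have "circ (\<lambda>t. tf P Q t * v t) = circ (\<lambda>t. (\<Sum>n. P n * cis t ^ n) * v t) + circ (\<lambda>t. (\<Sum>n. Q n * cis (-t) ^ Suc n) * v t)"
    unfolding tf_def distrib_right using assms unfolding asum_def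
    by (intro circ_add continuous_on_mult series_continuous cis_pow_cont cis_pow_norm v)
  then show ?thesis
    using assms unfolding asum_def
    by (auto intro!: sums_add circ_series cis_pow_cont cis_pow_norm simp del: power_Suc)
qed

lemma tf_coeff_pos:
  assumes "asum P" "asum Q"
  shows "circ (\<lambda>t. cis (-t) ^ m * tf P Q t) = P m"
proof -
  have "(\<lambda>n. P n * circ (\<lambda>t. cis t ^ n * cis (-t) ^ m) + Q n * circ (\<lambda>t. cis (-t) ^ Suc n * cis (-t) ^ m)) sums circ (\<lambda>t. tf P Q t * cis (-t) ^ m)"
    using assms by (intro tf_circ_sums cis_pow_cont)
  moreover have "circ (\<lambda>t. cis (-t) ^ Suc n * cis (-t) ^ m) = 0" for n
  proof -
    have "(\<lambda>t. cis (-t) ^ Suc n * cis (-t) ^ m) = (\<lambda>t. cis t ^ 0 * cis (-t) ^ (Suc n + m))"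
      by (simp only: power_add power_0 mult_1)
    then show ?thesis by (simp only: circ_powers) simp
  qed
  ultimately have "(\<lambda>n. P n * (if n = m then 1 else 0)) sums circ (\<lambda>t. tf P Q t * cis (-t) ^ m)"
    by (simp add: circ_powers del: power_Suc)
  moreover have "(\<lambda>n. P n * (if n = m then 1 else 0)) sums P m"
    using sums_single[of m P] by (simp add: if_distrib cong: if_cong)
  ultimately have "circ (\<lambda>t. tf P Q t * cis (-t) ^ m) = P m" by (rule sums_unique2)
  then show ?thesis by (simp add: mult.commute)
qed

lemma tf_coeff_neg:
  assumes "asum P" "asum Q"
  shows "circ (\<lambda>t. cis t ^ Suc m * tf P Q t) = Q m"
proof -
  have "(\<lambda>n. P n * circ (\<lambda>t. cis t ^ n * cis t ^ Suc m) + Q n * circ (\<lambda>t. cis (-t) ^ Suc n * cis t ^ Suc m)) sums circ (\<lambda>t. tf P Q t * cis t ^ Suc m)"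
    using assms by (intro tf_circ_sums cis_pow_cont)
  moreover have "circ (\<lambda>t. cis t ^ n * cis t ^ Suc m) = 0" for n
  proof -
    have "(\<lambda>t. cis t ^ n * cis t ^ Suc m) = (\<lambda>t. cis t ^ (n + Suc m) * cis (-t) ^ 0)"
      by (simp only: power_add power_0 mult_1_right)
    then show ?thesis by (simp only: circ_powers) simp
  qed
  moreover have "circ (\<lambda>t. cis (-t) ^ Suc n * cis t ^ Suc m) = (if n = m then 1 else 0)" for n
    using circ_powers[of "Suc m" "Suc n"] by (auto simp: mult.commute simp del: power_Suc)
  ultimately have "(\<lambda>n. Q n * (if n = m then 1 else 0)) sums circ (\<lambda>t. tf P Q t * cis t ^ Suc m)"
    by (simp del: power_Suc)
  moreover have "(\<lambda>n. Q n * (if n = m then 1 else 0)) sums Q m"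
    using sums_single[of m Q] by (simp add: if_distrib cong: if_cong)
  ultimately have "circ (\<lambda>t. tf P Q t * cis t ^ Suc m) = Q m" by (rule sums_unique2)
  then show ?thesis by (simp add: mult.commute del: power_Suc)
qed

text \<open>The factor \<open>cis t\<close> stems from dz. It raises frequencies by one, which
  compensates the offset in the negative part, so that equal indices of opposite halves
  meet.\<close>

lemma tf_pairing:
  assumes "asum P" "asum Q" "asum P'" "asum Q'"
  shows "(\<lambda>n. P n * Q' n + Q n * P' n) sums circ (\<lambda>t. tf P Q t * (cis t * tf P' Q' t))"
proof -
  have "(\<lambda>n. P n * circ (\<lambda>t. cis t ^ n * (cis t * tf P' Q' t)) + Q n * circ (\<lambda>t. cis (-t) ^ Suc n * (cis t * tf P' Q' t)))
      sums circ (\<lambda>t. tf P Q t * (cis t * tf P' Q' t))"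
    using assms by (intro tf_circ_sums continuous_intros tf_continuous)
  moreover have "circ (\<lambda>t. cis t ^ n * (cis t * tf P' Q' t)) = Q' n" for n
    using tf_coeff_neg[OF assms(3,4), of n] by (simp add: mult_ac)
  moreover
  have "cis (-t) ^ Suc n * (cis t * x) = cis (-t) ^ n * x" for n t x
  proof -
    have "cis (-t) ^ Suc n * (cis t * x) = cis (-t) ^ n * (cis (-t) * cis t) * x"
      by (simp add: mult_ac)
    then show ?thesis by (simp add: cis_mult)
  qed
  then have "circ (\<lambda>t. cis (-t) ^ Suc n * (cis t * tf P' Q' t)) = P' n" for n
    by (simp only: tf_coeff_pos[OF assms(3,4)])
  ultimately show ?thesis by (simp del: power_Suc)
qed

lemma tf_parseval:
  assumes "asum P" "asum Q"
  shows "(\<lambda>n. of_real ((cmod (P n))\<^sup>2 + (cmod (Q n))\<^sup>2)) sums circ (\<lambda>t. tf P Q t * cnj (tf P Q t))"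
proof -
  have "(\<lambda>n. P n * circ (\<lambda>t. cis t ^ n * cnj (tf P Q t)) + Q n * circ (\<lambda>t. cis (-t) ^ Suc n * cnj (tf P Q t)))
      sums circ (\<lambda>t. tf P Q t * cnj (tf P Q t))"
    using assms by (intro tf_circ_sums continuous_on_cnj tf_continuous)
  moreover have "circ (\<lambda>t. cis t ^ n * cnj (tf P Q t)) = cnj (P n)" for n
    using tf_coeff_pos[OF assms, of n] circ_cnj[of "\<lambda>t. cis (-t) ^ n * tf P Q t"] by (simp add: cis_cnj)
  moreover have "circ (\<lambda>t. cis (-t) ^ Suc n * cnj (tf P Q t)) = cnj (Q n)" for n
    using tf_coeff_neg[OF assms, of n] circ_cnj[of "\<lambda>t. cis t ^ Suc n * tf P Q t"] by (simp add: cis_cnj del: power_Suc)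
  ultimately show ?thesis by (simp add: complex_norm_square del: power_Suc of_real_power)
qed

section \<open>Laurent series on an annulus\<close>

text \<open>The preimage of the annulus under \<open>exp\<close>, phrased through
  \<open>exp (Re \<zeta>)\<close> so that membership in the strip and in the annulus translate into
  each other directly.\<close>

definition strip :: "real \<Rightarrow> real \<Rightarrow> complex set" where
  "strip r R = {\<zeta>. r < exp (Re \<zeta>) \<and> exp (Re \<zeta>) < R}"

lemma strip_iff: "\<zeta> \<in> strip r R \<longleftrightarrow> exp \<zeta> \<in> annulus r R"
  by (simp add: strip_def annulus_def)

lemma strip_eq: "0 < r \<Longrightarrow> r < R \<Longrightarrow> strip r R = {\<zeta>. ln r < Re \<zeta>} \<inter> {\<zeta>. Re \<zeta> < ln R}"
  by (auto simp: strip_def) (metis exp_less_mono exp_ln less_trans ln_exp ln_less_cancel_iff exp_gt_zero)+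

lemma open_annulus: "open (annulus r R)"
  unfolding annulus_def by (intro open_Collect_conj open_Collect_less continuous_intros)

lemma open_strip: "open (strip r R)"
  unfolding strip_def by (intro open_Collect_conj open_Collect_less continuous_intros)

lemma convex_strip: "0 < r \<Longrightarrow> r < R \<Longrightarrow> convex (strip r R)"
  by (simp add: strip_eq convex_Int convex_halfspace_Re_lt convex_halfspace_Re_gt)

lemma strip_2pi [simp]: "\<zeta> + 2 * of_real pi * \<i> \<in> strip r R \<longleftrightarrow> \<zeta> \<in> strip r R"
  "\<zeta> - 2 * of_real pi * \<i> \<in> strip r R \<longleftrightarrow> \<zeta> \<in> strip r R"
  by (simp_all add: strip_def)

text \<open>The convex strip supplies a primitive, and periodicity of \<open>h\<close> makes its
  increment over one period a constant. That constant is the integral over every circle of the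
  annulus, so independence of the radius comes without any homotopy. The change of variables for the
  transfer operator uses the same constant.\<close>

lemma periodic_primitive:
  assumes r: "0 < r" "r < R" and h: "h holomorphic_on strip r R"
    and per: "\<And>\<zeta>. \<zeta> \<in> strip r R \<Longrightarrow> h (\<zeta> + 2 * of_real pi * \<i>) = h \<zeta>"
  obtains H c where "\<And>\<zeta>. \<zeta> \<in> strip r R \<Longrightarrow> (H has_field_derivative h \<zeta>) (at \<zeta>)"
    "\<And>\<zeta>. \<zeta> \<in> strip r R \<Longrightarrow> H (\<zeta> + 2 * of_real pi * \<i>) = H \<zeta> + c"
    "\<And>\<rho>. r < \<rho> \<Longrightarrow> \<rho> < R \<Longrightarrow> c = 2 * of_real pi * \<i> * circ (\<lambda>t. h (of_real (ln \<rho>) + \<i> * of_real t))"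
proof -
  obtain H where "\<And>\<zeta>. \<zeta> \<in> strip r R \<Longrightarrow> (H has_field_derivative h \<zeta>) (at \<zeta> within strip r R)"
    using holomorphic_convex_primitive'[OF convex_strip[OF r] open_strip h] by auto
  then have H: "(H has_field_derivative h \<zeta>) (at \<zeta>)" if "\<zeta> \<in> strip r R" for \<zeta>
    using that by (metis at_within_open open_strip)
  have "\<exists>c. \<forall>\<zeta>\<in>strip r R. H (\<zeta> + 2 * of_real pi * \<i>) - H \<zeta> = c"
  proof (rule has_field_derivative_zero_constant[OF convex_strip[OF r]])
    fix \<zeta> assume z: "\<zeta> \<in> strip r R"
    have "((\<lambda>\<zeta>. H (\<zeta> + 2 * of_real pi * \<i>)) has_field_derivative h (\<zeta> + 2 * of_real pi * \<i>) * 1) (at \<zeta>)"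
      by (rule DERIV_chain2[OF H]) (use z in \<open>auto intro!: derivative_eq_intros\<close>)
    then have "((\<lambda>\<zeta>. H (\<zeta> + 2 * of_real pi * \<i>) - H \<zeta>) has_field_derivative h (\<zeta> + 2 * of_real pi * \<i>) * 1 - h \<zeta>) (at \<zeta>)"
      using H[OF z] by (rule DERIV_diff)
    then show "((\<lambda>\<zeta>. H (\<zeta> + 2 * of_real pi * \<i>) - H \<zeta>) has_field_derivative 0) (at \<zeta> within strip r R)"
      using per[OF z] by (simp add: has_field_derivative_at_within)
  qed
  then obtain c where c: "\<And>\<zeta>. \<zeta> \<in> strip r R \<Longrightarrow> H (\<zeta> + 2 * of_real pi * \<i>) = H \<zeta> + c"
    by (metis add.commute diff_eq_eq)
  show ?thesis
  proof (rule that[OF H c])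
    fix \<rho> assume \<rho>: "r < \<rho>" "\<rho> < R"
    have in_strip: "of_real (ln \<rho>) + \<i> * of_real t \<in> strip r R" for t
      using r \<rho> by (simp add: strip_def)
    have "((\<lambda>t. h (of_real (ln \<rho>) + \<i> * of_real t)) has_integral
        (H (of_real (ln \<rho>) + \<i> * of_real (2*pi)) / \<i> - H (of_real (ln \<rho>) + \<i> * of_real 0) / \<i>)) {0..2*pi}"
    proof (rule fundamental_theorem_of_calculus)
      fix t :: real
      have "((\<lambda>z. H (of_real (ln \<rho>) + \<i> * z) / \<i>) has_field_derivative h (of_real (ln \<rho>) + \<i> * of_real t)) (at (of_real t))"
      proof -
        have "((\<lambda>z. of_real (ln \<rho>) + \<i> * z) has_field_derivative \<i>) (at (of_real t))"
          by (auto intro!: derivative_eq_intros)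
        from DERIV_cdivide[OF DERIV_chain2[OF H[OF in_strip[of t]] this], of \<i>] show ?thesis
          by (simp only: nonzero_mult_div_cancel_right[OF complex_i_not_zero])
      qed
      from has_vector_derivative_real_field[OF this]
      show "((\<lambda>t. H (of_real (ln \<rho>) + \<i> * of_real t) / \<i>) has_vector_derivative h (of_real (ln \<rho>) + \<i> * of_real t)) (at t within {0..2*pi})"
        by (simp add: has_vector_derivative_at_within)
    qed simp
    moreover have "H (of_real (ln \<rho>) + \<i> * of_real (2*pi)) = H (of_real (ln \<rho>)) + c"
      using c[OF in_strip[of 0]] by (simp add: mult_ac)
    ultimately have "((\<lambda>t. h (of_real (ln \<rho>) + \<i> * of_real t)) has_integral (c / \<i>)) {0..2*pi}"
      by (simp add: add_divide_distrib algebra_simps)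
    then show "c = 2 * of_real pi * \<i> * circ (\<lambda>t. h (of_real (ln \<rho>) + \<i> * of_real t))"
      unfolding circ_def by (simp add: integral_unique)
  qed
qed

lemma exp_ln_rcis: "0 < \<rho> \<Longrightarrow> exp (of_real (ln \<rho>) + \<i> * of_real t) = rcis \<rho> t"
  by (simp add: exp_add rcis_def cis_conv_exp exp_of_real)

lemma circ_radius_independent:
  assumes r: "0 < r" and g: "g holomorphic_on annulus r R" and \<rho>: "r < \<rho>" "\<rho> < R" and \<sigma>: "r < \<sigma>" "\<sigma> < R"
  shows "circ (\<lambda>t. g (rcis \<rho> t)) = circ (\<lambda>t. g (rcis \<sigma> t))"
proof -
  have hol: "(\<lambda>\<zeta>. g (exp \<zeta>)) holomorphic_on strip r R"
    by (rule holomorphic_on_compose_gen[OF _ g, unfolded o_def]) (auto intro!: holomorphic_intros simp: strip_iff)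
  obtain H c where Hc:
    "\<And>\<rho>. r < \<rho> \<Longrightarrow> \<rho> < R \<Longrightarrow> c = 2 * of_real pi * \<i> * circ (\<lambda>t. g (exp (of_real (ln \<rho>) + \<i> * of_real t)))"
    using periodic_primitive[OF r _ hol] \<rho> by (auto simp: exp_add)
  have "circ (\<lambda>t. g (exp (of_real (ln \<rho>) + \<i> * of_real t))) = circ (\<lambda>t. g (exp (of_real (ln \<sigma>) + \<i> * of_real t)))"
    using Hc[OF \<rho>] Hc[OF \<sigma>] by simp
  then show ?thesis using r \<rho> \<sigma> by (simp add: exp_ln_rcis)
qed

lemma circ_rcis_continuous:
  assumes "continuous_on (sphere 0 \<rho>) g" "0 \<le> \<rho>"
  shows "continuous_on S (\<lambda>t. g (rcis \<rho> t))"
  by (rule continuous_on_compose2[OF assms(1)]) (use assms(2) in \<open>auto simp: rcis_def norm_mult intro!: continuous_intros\<close>)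

lemma sphere_subset_annulus: "r < \<rho> \<Longrightarrow> \<rho> < R \<Longrightarrow> sphere 0 \<rho> \<subseteq> annulus r R"
  by (auto simp: annulus_def)

text \<open>Laurent coefficients on the circle of radius \<open>\<rho>\<close>: \<open>lcp f \<rho> n\<close> has index \<open>n\<close>, \<open>lcn f \<rho> n\<close> index \<open>- n - 1\<close>.\<close>

definition lcp :: "(complex \<Rightarrow> complex) \<Rightarrow> real \<Rightarrow> nat \<Rightarrow> complex" where
  "lcp f \<rho> n = circ (\<lambda>t. f (rcis \<rho> t) * inverse (rcis \<rho> t) ^ n)"

definition lcn :: "(complex \<Rightarrow> complex) \<Rightarrow> real \<Rightarrow> nat \<Rightarrow> complex" where
  "lcn f \<rho> n = circ (\<lambda>t. f (rcis \<rho> t) * rcis \<rho> t ^ Suc n)"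

lemma lc_radius_independent:
  assumes r: "0 < r" and f: "f holomorphic_on annulus r R" and \<rho>: "r < \<rho>" "\<rho> < R" and \<sigma>: "r < \<sigma>" "\<sigma> < R"
  shows "lcp f \<rho> n = lcp f \<sigma> n" "lcn f \<rho> n = lcn f \<sigma> n"
proof -
  have nz: "z \<noteq> 0" if "z \<in> annulus r R" for z using that r by (auto simp: annulus_def)
  show "lcp f \<rho> n = lcp f \<sigma> n"
    unfolding lcp_def using nz
    by (intro circ_radius_independent[of r "\<lambda>z. f z * inverse z ^ n", OF r _ \<rho> \<sigma>] holomorphic_intros f) auto
  show "lcn f \<rho> n = lcn f \<sigma> n"
    unfolding lcn_def
    by (intro circ_radius_independent[of r "\<lambda>z. f z * z ^ Suc n", OF r _ \<rho> \<sigma>] holomorphic_intros f)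
qed

lemma lc_bound:
  assumes c: "continuous_on (sphere 0 \<rho>) f" and \<rho>: "0 < \<rho>" and B: "\<And>z. cmod z = \<rho> \<Longrightarrow> cmod (f z) \<le> B"
  shows "cmod (lcp f \<rho> n) \<le> B * inverse \<rho> ^ n" "cmod (lcn f \<rho> n) \<le> B * \<rho> ^ Suc n"
proof -
  have fc: "continuous_on S (\<lambda>t. f (rcis \<rho> t))" for S
    using c \<rho> by (intro circ_rcis_continuous) auto
  have rc: "continuous_on S (\<lambda>t. rcis \<rho> t)" for S
    unfolding rcis_def by (intro continuous_intros)
  have nz: "rcis \<rho> t \<noteq> 0" for t using \<rho> by simp
  show "cmod (lcp f \<rho> n) \<le> B * inverse \<rho> ^ n" unfolding lcp_def
    by (intro circ_bound continuous_intros fc rc)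
       (use nz \<rho> B in \<open>auto simp: norm_mult norm_power norm_inverse intro!: mult_right_mono\<close>)
  show "cmod (lcn f \<rho> n) \<le> B * \<rho> ^ Suc n" unfolding lcn_def
    by (intro circ_bound continuous_intros fc rc)
       (use \<rho> B in \<open>auto simp: norm_mult norm_power intro!: mult_right_mono\<close>)
qed

text \<open>Cauchy estimates: a slightly larger circle gives geometric decay for the nonnegative
  indices, a slightly smaller one for the negative indices.\<close>

lemma lc_summable:
  assumes r: "0 < r" and f: "f holomorphic_on annulus r R" and \<rho>: "r < \<rho>" "\<rho> < R" and \<sigma>: "r < \<sigma>" "\<sigma> < R"
  shows "summable (\<lambda>n. cmod (lcp f \<sigma> n) * \<rho> ^ n)" "summable (\<lambda>n. cmod (lcn f \<sigma> n) * inverse \<rho> ^ Suc n)"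
proof -
  have bd: "\<exists>B. \<forall>z. cmod z = \<tau> \<longrightarrow> cmod (f z) \<le> B" if "r < \<tau>" "\<tau> < R" for \<tau>
  proof -
    have "compact (f ` sphere 0 \<tau>)"
      using f sphere_subset_annulus[OF that]
      by (intro compact_continuous_image) (auto intro: holomorphic_on_imp_continuous_on holomorphic_on_subset)
    then have "bounded (f ` sphere 0 \<tau>)" by (rule compact_imp_bounded)
    then obtain B where "\<forall>x\<in>f ` sphere 0 \<tau>. cmod x \<le> B" unfolding bounded_iff by auto
    then show ?thesis by (intro exI[of _ B]) auto
  qed
  have cont: "continuous_on (sphere 0 \<tau>) f" if "r < \<tau>" "\<tau> < R" for \<tau>
    using f sphere_subset_annulus[OF that] by (auto intro: holomorphic_on_imp_continuous_on holomorphic_on_subset)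
  obtain \<tau> where \<tau>: "\<rho> < \<tau>" "\<tau> < R" using \<rho> dense by blast
  obtain B where B: "\<And>z. cmod z = \<tau> \<Longrightarrow> cmod (f z) \<le> B" using bd[of \<tau>] \<tau> \<rho> by auto
  show "summable (\<lambda>n. cmod (lcp f \<sigma> n) * \<rho> ^ n)"
  proof (rule summable_comparison_test')
    show "summable (\<lambda>n. B * (\<rho> / \<tau>) ^ n)"
      using r \<rho> \<tau> by (intro summable_mult summable_geometric) auto
    fix n
    have "cmod (lcp f \<sigma> n) \<le> B * inverse \<tau> ^ n"
      using lc_radius_independent(1)[OF r f \<sigma>, of \<tau> n] lc_bound(1)[of \<tau> f B n] cont[of \<tau>] B r \<rho> \<tau> by simp
    then have "cmod (lcp f \<sigma> n) * \<rho> ^ n \<le> B * inverse \<tau> ^ n * \<rho> ^ n"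
      using r \<rho> by (intro mult_right_mono) auto
    then show "norm (cmod (lcp f \<sigma> n) * \<rho> ^ n) \<le> B * (\<rho> / \<tau>) ^ n"
      using r \<rho> by (simp add: power_divide field_simps)
  qed
  obtain \<tau>' where \<tau>': "r < \<tau>'" "\<tau>' < \<rho>" using \<rho> dense by blast
  obtain B' where B': "\<And>z. cmod z = \<tau>' \<Longrightarrow> cmod (f z) \<le> B'" using bd[of \<tau>'] \<tau>' \<rho> by auto
  show "summable (\<lambda>n. cmod (lcn f \<sigma> n) * inverse \<rho> ^ Suc n)"
  proof (rule summable_comparison_test')
    show "summable (\<lambda>n. B' * (\<tau>' / \<rho>) ^ Suc n)"
      using r \<rho> \<tau>' by (intro summable_mult) (subst summable_Suc_iff, auto intro!: summable_geometric)
    fix n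
    have "cmod (lcn f \<sigma> n) \<le> B' * \<tau>' ^ Suc n"
      using lc_radius_independent(2)[OF r f \<sigma>, of \<tau>' n] lc_bound(2)[of \<tau>' f B' n] cont[of \<tau>'] B' r \<rho> \<tau>' by simp
    then have "cmod (lcn f \<sigma> n) * inverse \<rho> ^ Suc n \<le> B' * \<tau>' ^ Suc n * inverse \<rho> ^ Suc n"
      using r \<rho> by (intro mult_right_mono) auto
    then show "norm (cmod (lcn f \<sigma> n) * inverse \<rho> ^ Suc n) \<le> B' * (\<tau>' / \<rho>) ^ Suc n"
      using r \<rho> by (simp add: power_divide field_simps)
  qed
qed

text \<open>Integrating the difference quotient \<open>(f z - f z\<^sub>0) / (z - z\<^sub>0)\<close> over two circles separated by \<open>z\<^sub>0\<close>.\<close>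

theorem laurent_series:
  assumes r: "0 < r" and f: "f holomorphic_on annulus r R" and \<sigma>: "r < \<sigma>" "\<sigma> < R" and z: "z \<in> annulus r R"
  shows "f z = (\<Sum>n. lcp f \<sigma> n * z ^ n) + (\<Sum>n. lcn f \<sigma> n * inverse z ^ Suc n)"
proof -
  \<comment> \<open>The singularity at \<open>z\<close> is removable, so the integral of
    \<open>q\<close> is the same over the circles of radius \<open>a\<close> and \<open>b\<close> on
    either side of \<open>z\<close>.\<close>
  define q where "q = (\<lambda>w. if w = z then deriv f z else (f w - f z) / (w - z))"
  have q: "q holomorphic_on annulus r R"
    unfolding q_def by (rule pole_lemma[OF f]) (use z open_annulus in \<open>simp add: interior_open\<close>)
  have nz: "z \<noteq> 0" using z r by (auto simp: annulus_def)
  obtain b where b: "cmod z < b" "b < R" using z dense[of "cmod z" R] by (auto simp: annulus_def)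
  obtain a where a: "r < a" "a < cmod z" using z dense[of r "cmod z"] by (auto simp: annulus_def)
  have fc: "continuous_on S (\<lambda>t. f (rcis \<rho> t))" if "r < \<rho>" "\<rho> < R" for \<rho> S
    by (rule circ_rcis_continuous)
       (use that r f sphere_subset_annulus[OF that] in \<open>auto intro: holomorphic_on_imp_continuous_on holomorphic_on_subset\<close>)
  \<comment> \<open>The factor w / (w - z) is expanded in z / w on the outer circle and in w / z on
    the inner one, which produces the two halves of the series. A general weight \<open>v\<close>
    allows the choices \<open>f\<close> and 1.\<close>
  have outer: "(\<lambda>n. circ (\<lambda>t. inverse (rcis b t) ^ n * v t) * z ^ n) sums circ (\<lambda>t. v t * (rcis b t / (rcis b t - z)))"
    if v: "continuous_on {0..2*pi} v" for v
  proof -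
    have b0: "b > 0" using b by (smt (verit) norm_ge_zero)
    have lt: "cmod (z / of_real b) < 1" using b b0 by (simp add: norm_divide)
    have "(\<lambda>n. (z / of_real b) ^ n * circ (\<lambda>t. cis (-t) ^ n * v t)) sums circ (\<lambda>t. (\<Sum>n. (z / of_real b) ^ n * cis (-t) ^ n) * v t)"
    proof (rule circ_series[OF _ _ _ v])
      show "summable (\<lambda>n. cmod ((z / of_real b) ^ n))"
        using lt by (simp add: norm_power summable_geometric)
    qed (auto intro: cis_pow_cont cis_pow_norm)
    moreover have "(\<Sum>n. (z / of_real b) ^ n * cis (-t) ^ n) * v t = v t * (rcis b t / (rcis b t - z))" for t
    proof -
      have "z / of_real b * cis (-t) = z / rcis b t"
        by (simp add: rcis_def cis_inverse[symmetric] field_simps)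
      then have "(\<Sum>n. (z / of_real b) ^ n * cis (-t) ^ n) = (\<Sum>n. (z / rcis b t) ^ n)"
        by (simp add: power_mult_distrib[symmetric])
      also have "\<dots> = 1 / (1 - z / rcis b t)"
        using b b0 by (intro suminf_geometric) (simp add: norm_divide)
      also have "\<dots> = rcis b t / (rcis b t - z)"
        using b0 by (simp add: field_simps)
      finally show ?thesis by simp
    qed
    moreover have "(z / of_real b) ^ n * circ (\<lambda>t. cis (-t) ^ n * v t) = circ (\<lambda>t. inverse (rcis b t) ^ n * v t) * z ^ n" for n
    proof -
      have "inverse (rcis b t) ^ n * v t = inverse (of_real b) ^ n * (cis (-t) ^ n * v t)" for t
        by (simp add: rcis_def cis_inverse[symmetric] field_simps)
      then have "circ (\<lambda>t. inverse (rcis b t) ^ n * v t) = inverse (of_real b) ^ n * circ (\<lambda>t. cis (-t) ^ n * v t)"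
        by (simp only: circ_cmult)
      then show ?thesis by (simp add: field_simps)
    qed
    ultimately show ?thesis by simp
  qed
  have inner: "(\<lambda>n. circ (\<lambda>t. rcis a t ^ Suc n * v t) * inverse z ^ Suc n) sums (- circ (\<lambda>t. v t * (rcis a t / (rcis a t - z))))"
    if v: "continuous_on {0..2*pi} v" for v
  proof -
    have a0: "a > 0" using a r by simp
    have "cmod z > 0" using nz by simp
    then have lt: "cmod (of_real a / z) < 1" using a a0 by (simp add: norm_divide del: zero_less_norm_iff)
    have "(\<lambda>n. (of_real a / z) ^ Suc n * circ (\<lambda>t. cis t ^ Suc n * v t)) sums circ (\<lambda>t. (\<Sum>n. (of_real a / z) ^ Suc n * cis t ^ Suc n) * v t)"
    proof (rule circ_series[OF _ _ _ v])
      have "summable (\<lambda>n. cmod (of_real a / z) ^ Suc n)"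
        using lt by (subst summable_Suc_iff) (simp add: summable_geometric)
      then show "summable (\<lambda>n. cmod ((of_real a / z) ^ Suc n))" by (simp only: norm_power)
    qed (auto intro!: continuous_intros simp: norm_mult norm_power)
    moreover have "(\<Sum>n. (of_real a / z) ^ Suc n * cis t ^ Suc n) * v t = - (v t * (rcis a t / (rcis a t - z)))" for t
    proof -
      have lt': "cmod (rcis a t / z) < 1" using a a0 \<open>cmod z > 0\<close> by (simp add: norm_divide del: zero_less_norm_iff)
      have "(\<Sum>n. (of_real a / z) ^ Suc n * cis t ^ Suc n) = (\<Sum>n. rcis a t / z * (rcis a t / z) ^ n)"
      proof -
        have "of_real a / z * cis t = rcis a t / z" by (simp add: rcis_def)
        then have "(of_real a / z) ^ Suc n * cis t ^ Suc n = rcis a t / z * (rcis a t / z) ^ n" for n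
          unfolding power_mult_distrib[symmetric] by (simp only: power_Suc)
        then show ?thesis by (simp only:)
      qed
      also have "\<dots> = rcis a t / z * (1 / (1 - rcis a t / z))"
        by (subst suminf_mult[OF summable_geometric[OF lt']]) (simp only: suminf_geometric[OF lt'])
      also have "\<dots> = - (rcis a t / (rcis a t - z))"
      proof -
        have "rcis a t \<noteq> z" using lt' nz by auto
        then show ?thesis using nz by (simp add: divide_simps) (simp add: algebra_simps)
      qed
      finally show ?thesis by simp
    qed
    moreover have "(of_real a / z) ^ Suc n * circ (\<lambda>t. cis t ^ Suc n * v t) = circ (\<lambda>t. rcis a t ^ Suc n * v t) * inverse z ^ Suc n" for n
    proof -
      have "rcis a t ^ Suc n * v t = of_real a ^ Suc n * (cis t ^ Suc n * v t)" for t
        by (simp add: rcis_def power_mult_distrib del: power_Suc)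
      then have "circ (\<lambda>t. rcis a t ^ Suc n * v t) = of_real a ^ Suc n * circ (\<lambda>t. cis t ^ Suc n * v t)"
        by (simp only: circ_cmult)
      then show ?thesis by (simp add: power_divide field_simps del: power_Suc)
    qed
    moreover have "circ (\<lambda>t. - w t) = - circ w" for w
      using circ_cmult[of "-1" w] by simp
    ultimately show ?thesis by (simp del: power_Suc)
  qed
  have ab: "r < a" "a < R" "r < b" "b < R" using a b by auto
  have quot: "circ (\<lambda>t. f (rcis \<rho> t) * (rcis \<rho> t / (rcis \<rho> t - z))) =
     circ (\<lambda>t. rcis \<rho> t * q (rcis \<rho> t)) + f z * circ (\<lambda>t. 1 * (rcis \<rho> t / (rcis \<rho> t - z)))"
    if \<rho>: "r < \<rho>" "\<rho> < R" "\<rho> \<noteq> cmod z" for \<rho>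
  proof -
    have ne: "rcis \<rho> t \<noteq> z" for t using \<rho> r by auto
    have cont: "continuous_on {0..2*pi} (\<lambda>t. rcis \<rho> t / (rcis \<rho> t - z))"
      using ne unfolding rcis_def by (intro continuous_intros) auto
    have "circ (\<lambda>t. f (rcis \<rho> t) * (rcis \<rho> t / (rcis \<rho> t - z))) =
        circ (\<lambda>t. rcis \<rho> t * q (rcis \<rho> t) + f z * (1 * (rcis \<rho> t / (rcis \<rho> t - z))))"
      using ne by (intro circ_cong) (simp add: q_def divide_simps, simp add: algebra_simps)
    also have "\<dots> = circ (\<lambda>t. rcis \<rho> t * q (rcis \<rho> t)) + circ (\<lambda>t. f z * (1 * (rcis \<rho> t / (rcis \<rho> t - z))))"
    proof (rule circ_add)
      have "continuous_on (sphere 0 \<rho>) q"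
        using q sphere_subset_annulus[OF \<rho>(1,2)] by (auto intro: holomorphic_on_imp_continuous_on holomorphic_on_subset)
      then have "continuous_on {0..2*pi} (\<lambda>t. q (rcis \<rho> t))"
        using r \<rho> by (intro circ_rcis_continuous) auto
      then show "continuous_on {0..2*pi} (\<lambda>t. rcis \<rho> t * q (rcis \<rho> t))"
        unfolding rcis_def by (intro continuous_intros) auto
      show "continuous_on {0..2*pi} (\<lambda>t. f z * (1 * (rcis \<rho> t / (rcis \<rho> t - z))))"
        by (intro continuous_on_mult continuous_on_const cont)
    qed
    finally show ?thesis by (simp only: circ_cmult)
  qed
  \<comment> \<open>The means of w / (w - z) are winding numbers: 1 for the circle outside
    \<open>z\<close> and 0 for the one inside. Both are read off from the expansions above with
    \<open>v = 1\<close>.\<close>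
  have one_b: "circ (\<lambda>t. 1 * (rcis b t / (rcis b t - z))) = 1"
  proof -
    have "circ (\<lambda>t. inverse (rcis b t) ^ n * 1) = (if n = 0 then 1 else 0)" for n
    proof -
      have "inverse (rcis b t) ^ n * 1 = inverse (of_real b) ^ n * (cis t ^ 0 * cis (-t) ^ n)" for t
        by (simp add: rcis_def cis_inverse[symmetric] field_simps)
      then have "circ (\<lambda>t. inverse (rcis b t) ^ n * 1) = inverse (of_real b) ^ n * circ (\<lambda>t. cis t ^ 0 * cis (-t) ^ n)"
        by (simp only: circ_cmult)
      then show ?thesis by (simp only: circ_powers) auto
    qed
    then have "(\<lambda>n. (if n = 0 then 1 else 0) * z ^ n) sums circ (\<lambda>t. 1 * (rcis b t / (rcis b t - z)))"
      using outer[of "\<lambda>t. 1"] by simp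
    moreover have "(\<lambda>n. (if n = 0 then 1 else 0) * z ^ n) sums 1"
      using sums_single[of 0 "\<lambda>n. z ^ n"] by (simp add: if_distrib if_distribR cong: if_cong)
    ultimately show ?thesis by (rule sums_unique2)
  qed
  have one_a: "circ (\<lambda>t. 1 * (rcis a t / (rcis a t - z))) = 0"
  proof -
    have "circ (\<lambda>t. rcis a t ^ Suc n * 1) = 0" for n
    proof -
      have "rcis a t ^ Suc n * 1 = of_real a ^ Suc n * (cis t ^ Suc n * cis (-t) ^ 0)" for t
        by (simp add: rcis_def power_mult_distrib del: power_Suc)
      then have "circ (\<lambda>t. rcis a t ^ Suc n * 1) = of_real a ^ Suc n * circ (\<lambda>t. cis t ^ Suc n * cis (-t) ^ 0)"
        by (simp only: circ_cmult)
      then show ?thesis by (simp only: circ_powers) auto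
    qed
    then have "(\<lambda>n. 0) sums (- circ (\<lambda>t. 1 * (rcis a t / (rcis a t - z))))"
      using inner[of "\<lambda>t. 1"] by (simp del: power_Suc)
    then show ?thesis using sums_unique2[OF _ sums_zero] by fastforce
  qed
  have same: "circ (\<lambda>t. rcis b t * q (rcis b t)) = circ (\<lambda>t. rcis a t * q (rcis a t))"
    by (rule circ_radius_independent[of r "\<lambda>w. w * q w" R b a]) (use r ab in \<open>auto intro!: holomorphic_on_mult holomorphic_on_ident q\<close>)
  have "f z = circ (\<lambda>t. f (rcis b t) * (rcis b t / (rcis b t - z))) - circ (\<lambda>t. f (rcis a t) * (rcis a t / (rcis a t - z)))"
    using quot[of b] quot[of a] ab a b same one_a one_b by simp
  moreover have "(\<lambda>n. lcp f \<sigma> n * z ^ n) sums circ (\<lambda>t. f (rcis b t) * (rcis b t / (rcis b t - z)))"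
    using outer[OF fc[OF ab(3,4)]] lc_radius_independent(1)[OF r f \<sigma> ab(3,4)]
    by (simp add: lcp_def mult.commute)
  moreover have "(\<lambda>n. lcn f \<sigma> n * inverse z ^ Suc n) sums (- circ (\<lambda>t. f (rcis a t) * (rcis a t / (rcis a t - z))))"
    using inner[OF fc[OF ab(1,2)]] lc_radius_independent(2)[OF r f \<sigma> ab(1,2)]
    by (simp add: lcn_def mult.commute del: power_Suc)
  ultimately show ?thesis by (simp add: sums_iff del: power_Suc)
qed

section \<open>Operations on square summable sequences and Abel limits\<close>

lemma l2_scaled_asum:
  assumes "l2 a" "0 \<le> s" "s < 1"
  shows "asum (\<lambda>n. a n * of_real s ^ n)" "asum (\<lambda>n. a n * of_real s ^ Suc n)"
proof -
  show *: "asum (\<lambda>n. a n * of_real s ^ n)"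
    using l2_summable[OF assms] assms by (simp add: asum_def norm_mult norm_power)
  have "summable (\<lambda>n. s * (cmod (a n) * s ^ n))"
    using l2_summable[OF assms] by (rule summable_mult)
  then show "asum (\<lambda>n. a n * of_real s ^ Suc n)"
    using assms by (simp add: asum_def norm_mult norm_power mult_ac)
qed

lemma asum_zero [simp]: "asum (\<lambda>n. 0)"
  by (simp add: asum_def)

lemma l2_zero [simp]: "l2 (\<lambda>n. 0)" "n2 (\<lambda>n. 0) = 0"
  by (simp_all add: l2_def n2_def)

lemma l2_cnj [simp]: "l2 (\<lambda>n. cnj (a n)) \<longleftrightarrow> l2 a" "n2 (\<lambda>n. cnj (a n)) = n2 a"
  by (simp_all add: l2_def n2_def)

lemma l2_cmult: "l2 a \<Longrightarrow> l2 (\<lambda>n. c * a n)" "l2 a \<Longrightarrow> n2 (\<lambda>n. c * a n) = (cmod c)\<^sup>2 * n2 a"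
  by (simp_all add: l2_def n2_def norm_mult power_mult_distrib summable_mult suminf_mult)

lemma l2_add: assumes "l2 a" "l2 b" shows "l2 (\<lambda>n. a n + b n)"
  unfolding l2_def
proof (rule summable_comparison_test')
  show "summable (\<lambda>n. 2 * (cmod (a n))\<^sup>2 + 2 * (cmod (b n))\<^sup>2)"
    using assms by (intro summable_add summable_mult) (auto simp: l2_def)
  fix n
  have "(cmod (a n + b n))\<^sup>2 \<le> (cmod (a n) + cmod (b n))\<^sup>2"
    by (intro power_mono norm_triangle_ineq) auto
  also have "\<dots> \<le> 2 * (cmod (a n))\<^sup>2 + 2 * (cmod (b n))\<^sup>2"
    using zero_le_power2[of "cmod (a n) - cmod (b n)"] by (simp add: power2_eq_square algebra_simps)
  finally show "norm ((cmod (a n + b n))\<^sup>2) \<le> 2 * (cmod (a n))\<^sup>2 + 2 * (cmod (b n))\<^sup>2" by simp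
qed

lemma l2_comparison: assumes "l2 a" "\<And>n. cmod (b n) \<le> cmod (a n)" shows "l2 b"
  unfolding l2_def
  by (rule summable_comparison_test'[where g="\<lambda>n. (cmod (a n))\<^sup>2"])
     (use assms in \<open>auto simp: l2_def intro!: power_mono\<close>)

lemma l2_from_bounded_sums:
  assumes "\<And>N. (\<Sum>n<N. (cmod (a n))\<^sup>2) \<le> B"
  shows "l2 a" "n2 a \<le> B"
proof -
  show "l2 a" unfolding l2_def by (rule summableI_nonneg_bounded[OF _ assms]) auto
  then show "n2 a \<le> B"
    unfolding l2_def n2_def by (rule suminf_le_const[OF _ assms])
qed

lemma l2_sums: "l2 a \<Longrightarrow> (\<lambda>n. (cmod (a n))\<^sup>2) sums n2 a"
  by (simp add: l2_def n2_def summable_sums)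

lemma sum_le_n2: "l2 a \<Longrightarrow> (\<Sum>n<N. (cmod (a n))\<^sup>2) \<le> n2 a"
  unfolding l2_def n2_def by (rule sum_le_suminf) auto

lemma l2_mult:
  assumes "l2 a" "l2 b"
  shows "asum (\<lambda>n. a n * b n)" "(\<Sum>n. cmod (a n * b n)) \<le> sqrt (n2 a) * sqrt (n2 b)"
proof -
  have *: "(\<Sum>n<N. cmod (a n * b n)) \<le> sqrt (n2 a) * sqrt (n2 b)" for N
  proof -
    have "(\<Sum>n<N. \<bar>cmod (a n)\<bar> * \<bar>cmod (b n)\<bar>) \<le> L2_set (\<lambda>n. cmod (a n)) {..<N} * L2_set (\<lambda>n. cmod (b n)) {..<N}"
      by (rule L2_set_mult_ineq)
    also have "\<dots> \<le> sqrt (n2 a) * sqrt (n2 b)"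
      unfolding L2_set_def using assms
      by (intro mult_mono real_sqrt_le_mono sum_le_n2) (auto simp: n2_nonneg intro!: sum_nonneg)
    finally show ?thesis by (simp add: norm_mult)
  qed
  show "asum (\<lambda>n. a n * b n)"
    unfolding asum_def by (rule summableI_nonneg_bounded[OF _ *]) auto
  then show "(\<Sum>n. cmod (a n * b n)) \<le> sqrt (n2 a) * sqrt (n2 b)"
    unfolding asum_def by (rule suminf_le_const[OF _ *])
qed

lemma asum_summable: "asum a \<Longrightarrow> summable a"
  unfolding asum_def by (rule summable_norm_cancel)

text \<open>Tannery's theorem with the terms |c n| as majorant. The exponent is left general because
  pairing two series at radius s produces s^(2 n + 1).\<close>

lemma abel_limit:
  fixes k :: "nat \<Rightarrow> nat"
  assumes "asum c"
  shows "((\<lambda>s. \<Sum>n. c n * of_real s ^ k n) \<longlongrightarrow> (\<Sum>n. c n)) (at_left (1::real))"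
proof -
  have ev: "\<forall>\<^sub>F s in at_left (1::real). 0 \<le> s \<and> s \<le> 1"
    unfolding eventually_at_left_field by (intro exI[of _ 0]) auto
  have "eventually (\<lambda>(n, s). norm (c n * of_real s ^ k n) \<le> cmod (c n)) (at_top \<times>\<^sub>F at_left (1::real))"
    unfolding eventually_prod_filter
    using ev by (intro exI[of _ "\<lambda>_. True"] exI[of _ "\<lambda>s. 0 \<le> s \<and> s \<le> 1"])
      (auto simp: norm_mult norm_power intro!: mult_left_le power_le_one)
  moreover have "((\<lambda>s. c n * of_real s ^ k n) \<longlongrightarrow> c n * of_real 1 ^ k n) (at_left (1::real))" for n
    by (intro tendsto_intros)
  then have "((\<lambda>s. c n * of_real s ^ k n) \<longlongrightarrow> c n) (at_left (1::real))" for n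
    by simp
  ultimately show ?thesis
    using tannerys_theorem[of "\<lambda>n s. c n * of_real s ^ k n" c "at_left 1" "\<lambda>n. cmod (c n)"] assms(1)
    unfolding asum_def by (simp add: trivial_limit_at_left_real)
qed

lemma partial_sum_le_sums:
  fixes f :: "nat \<Rightarrow> real"
  assumes "f sums s" "\<And>n. 0 \<le> f n"
  shows "(\<Sum>n<N. f n) \<le> s"
  using sum_le_suminf[of f "{..<N}"] assms by (simp add: sums_iff)

section \<open>Boundary values of circle functions\<close>

text \<open>Parseval is available at radii s < 1, where the coefficients are absolutely summable.
  The squared means converge to that of \<open>w\<close>, and the bound by \<open>p\<close> and
  \<open>q\<close> does not depend on s.\<close>

lemma bconv_tf_upper:
  assumes F: "bconv F w"
    and ev: "\<forall>\<^sub>F s in at_left 1. asum (P s) \<and> asum (Q s) \<and> (\<forall>t. F s t = tf (P s) (Q s) t) \<and>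
        (\<forall>n. cmod (P s n) \<le> cmod (p n) \<and> cmod (Q s n) \<le> cmod (q n))"
    and pq: "l2 p" "l2 q"
  shows "Re (circ (\<lambda>t. w t * cnj (w t))) \<le> n2 p + n2 q"
proof -
  have lim: "((\<lambda>s. Re (circ (\<lambda>t. F s t * cnj (F s t)))) \<longlongrightarrow> Re (circ (\<lambda>t. w t * cnj (w t)))) (at_left 1)"
    unfolding circ_def by (intro tendsto_intros bconv_integral F bconv_cnj) auto
  show ?thesis
  proof (rule tendsto_upperbound[OF lim])
    show "\<forall>\<^sub>F s in at_left 1. Re (circ (\<lambda>t. F s t * cnj (F s t))) \<le> n2 p + n2 q"
      using ev
    proof eventually_elim
      case (elim s)
      then have "(\<lambda>n. of_real ((cmod (P s n))\<^sup>2 + (cmod (Q s n))\<^sup>2)) sums circ (\<lambda>t. F s t * cnj (F s t))"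
        using tf_parseval[of "P s" "Q s"] by simp
      from sums_Re[OF this]
      have "(\<lambda>n. (cmod (P s n))\<^sup>2 + (cmod (Q s n))\<^sup>2) sums Re (circ (\<lambda>t. F s t * cnj (F s t)))" by simp
      then show ?case
        by (rule sums_le[OF _ _ sums_add[OF l2_sums[OF pq(1)] l2_sums[OF pq(2)]], rotated])
           (use elim in \<open>auto intro!: add_mono power_mono\<close>)
    qed
  qed simp
qed

text \<open>The coefficients are assumed to converge only one by one, so Parseval is cut off after
  finitely many terms before s tends to 1.\<close>

lemma bconv_tf_lower:
  assumes F: "bconv F w"
    and ev: "\<forall>\<^sub>F s in at_left 1. asum (P s) \<and> asum (Q s) \<and> (\<forall>t. F s t = tf (P s) (Q s) t)"
    and lim: "\<And>n. ((\<lambda>s. P s n) \<longlongrightarrow> p n) (at_left 1)" "\<And>n. ((\<lambda>s. Q s n) \<longlongrightarrow> q n) (at_left 1)"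
  shows "(\<Sum>n<N. (cmod (p n))\<^sup>2 + (cmod (q n))\<^sup>2) \<le> Re (circ (\<lambda>t. w t * cnj (w t)))"
proof -
  have lim': "((\<lambda>s. Re (circ (\<lambda>t. F s t * cnj (F s t)))) \<longlongrightarrow> Re (circ (\<lambda>t. w t * cnj (w t)))) (at_left 1)"
    unfolding circ_def by (intro tendsto_intros bconv_integral F bconv_cnj) auto
  have lim2: "((\<lambda>s. \<Sum>n<N. (cmod (P s n))\<^sup>2 + (cmod (Q s n))\<^sup>2) \<longlongrightarrow> (\<Sum>n<N. (cmod (p n))\<^sup>2 + (cmod (q n))\<^sup>2)) (at_left 1)"
    by (intro tendsto_intros lim)
  show ?thesis
  proof (rule tendsto_le[OF _ lim' lim2])
    show "\<forall>\<^sub>F s in at_left 1. (\<Sum>n<N. (cmod (P s n))\<^sup>2 + (cmod (Q s n))\<^sup>2) \<le> Re (circ (\<lambda>t. F s t * cnj (F s t)))"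
      using ev
    proof eventually_elim
      case (elim s)
      then have "(\<lambda>n. of_real ((cmod (P s n))\<^sup>2 + (cmod (Q s n))\<^sup>2)) sums circ (\<lambda>t. F s t * cnj (F s t))"
        using tf_parseval[of "P s" "Q s"] by simp
      from sums_Re[OF this]
      have "(\<lambda>n. (cmod (P s n))\<^sup>2 + (cmod (Q s n))\<^sup>2) sums Re (circ (\<lambda>t. F s t * cnj (F s t)))" by simp
      then show ?case by (rule partial_sum_le_sums) simp
    qed
  qed simp
qed

text \<open>The pairing is computed at radii s < 1, where it is an absolutely convergent series, and
  both the integral and the series are then taken to s = 1.\<close>

lemma bconv_tf_pairing:
  assumes F: "bconv F w" and G: "bconv G w'"
    and ev: "\<forall>\<^sub>F s in at_left 1. asum (P s) \<and> asum (Q s) \<and> (\<forall>t. F s t = tf (P s) (Q s) t) \<and>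
        asum (P' s) \<and> asum (Q' s) \<and> (\<forall>t. G s t = tf (P' s) (Q' s) t) \<and>
        (\<forall>n. P s n * Q' s n + Q s n * P' s n = c n * of_real s ^ k n)"
    and c: "asum c"
  shows "circ (\<lambda>t. w t * (cis t * w' t)) = (\<Sum>n. c n)"
proof -
  have lim: "((\<lambda>s. circ (\<lambda>t. F s t * (cis t * G s t))) \<longlongrightarrow> circ (\<lambda>t. w t * (cis t * w' t))) (at_left 1)"
    unfolding circ_def by (intro tendsto_intros bconv_integral F bconv_mult_cont G continuous_intros) auto
  have "\<forall>\<^sub>F s in at_left 1. (\<Sum>n. c n * of_real s ^ k n) = circ (\<lambda>t. F s t * (cis t * G s t))"
    using ev
  proof eventually_elim
    case (elim s)
    then have "(\<lambda>n. P s n * Q' s n + Q s n * P' s n) sums circ (\<lambda>t. tf (P s) (Q s) t * (cis t * tf (P' s) (Q' s) t))"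
      by (intro tf_pairing) auto
    then show ?case using elim by (simp add: sums_iff)
  qed
  then have "((\<lambda>s. circ (\<lambda>t. F s t * (cis t * G s t))) \<longlongrightarrow> (\<Sum>n. c n)) (at_left 1)"
    using abel_limit[OF c, of k] by (simp add: tendsto_cong)
  then show ?thesis using lim by (intro tendsto_unique[OF _ lim]) auto
qed

lemma at_right_1_eq: "at_right (1::real) = filtermap inverse (at_left 1)"
proof (rule filtermap_fun_inverse[symmetric])
  show "filterlim inverse (at_left (1::real)) (at_right 1)"
  proof (rule filterlim_at_withinI)
    show "(inverse \<longlongrightarrow> (1::real)) (at_right 1)"
      using tendsto_inverse[OF tendsto_ident_at[of "1::real" "{1<..}"]] by simp
    show "\<forall>\<^sub>F x in at_right (1::real). inverse x \<in> {..<1} - {1}"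
      unfolding eventually_at_right_field by (intro exI[of _ 2]) (auto simp: field_simps)
  qed
  show "filterlim inverse (at_right (1::real)) (at_left 1)"
  proof (rule filterlim_at_withinI)
    show "(inverse \<longlongrightarrow> (1::real)) (at_left 1)"
      using tendsto_inverse[OF tendsto_ident_at[of "1::real" "{..<1}"]] by simp
    show "\<forall>\<^sub>F x in at_left (1::real). inverse x \<in> {1<..} - {1}"
      unfolding eventually_at_left_field by (intro exI[of _ 0]) (auto simp: field_simps)
  qed
qed simp

text \<open>Inverting the parameter turns the approach from outside into one from below 1, so the
  filter \<open>at_left 1\<close> serves both kinds of boundary values.\<close>

lemma bv_outside_eq: "bv_outside f z = Lim (at_left 1) (\<lambda>s. f (of_real (inverse s) * z))"
  unfolding bv_outside_def t2_space_class.Lim_def at_right_1_eq tendsto_compose_filtermap filterlim_filtermap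
  by (simp add: filterlim_def filtermap_filtermap)

definition shift1 :: "(nat \<Rightarrow> complex) \<Rightarrow> nat \<Rightarrow> complex" where
  "shift1 u n = (case n of 0 \<Rightarrow> 0 | Suc m \<Rightarrow> u m)"

lemma shift1_simps [simp]: "shift1 u 0 = 0" "shift1 u (Suc n) = u n"
  by (simp_all add: shift1_def)

lemma l2_shift1: "l2 u \<Longrightarrow> l2 (shift1 u)"
  unfolding l2_def by (subst summable_Suc_iff[symmetric]) simp

lemma pw_shift1:
  assumes "l2 u" "cmod z < 1"
  shows "pw (shift1 u) z = z * pw u z"
proof -
  have "(\<lambda>n. z * (u n * z ^ n)) sums (z * pw u z)"
    by (intro sums_mult pw_sums assms)
  then have "(\<lambda>n. shift1 u (Suc n) * z ^ Suc n) sums (z * pw u z)"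
    by (simp add: mult_ac)
  then have "(\<lambda>n. shift1 u n * z ^ n) sums (z * pw u z)"
    by (subst (asm) sums_Suc_iff) simp
  then show ?thesis by (simp add: pw_def sums_iff)
qed

lemma pw_cnj:
  assumes "l2 a" "cmod z < 1"
  shows "pw (\<lambda>n. cnj (a n)) (cnj z) = cnj (pw a z)"
  using sums_cnj[THEN iffD2, OF pw_sums[OF assms]] by (simp add: pw_def sums_iff)

text \<open>A series in \<open>cis (-t)\<close> is the conjugate of one in \<open>cis t\<close> with
  conjugated coefficients; \<open>shift1\<close> absorbs the extra factor in front.\<close>

lemma bconv_pw_neg:
  assumes "l2 u"
  shows "bconv (\<lambda>s t. (of_real s * cis (-t)) * pw u (of_real s * cis (-t)))
     (\<lambda>t. Lim (at_left 1) (\<lambda>s. (of_real s * cis (-t)) * pw u (of_real s * cis (-t))))"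
proof -
  have "bconv (\<lambda>s t. pw (\<lambda>n. cnj (shift1 u n)) (of_real s * cis t)) (\<lambda>t. Lim (at_left 1) (\<lambda>s. pw (\<lambda>n. cnj (shift1 u n)) (of_real s * cis t)))"
    using assms by (intro bconv_pw) (simp add: l2_shift1)
  from bconv_cnj[OF this] have
    "bconv (\<lambda>s t. (of_real s * cis (-t)) * pw u (of_real s * cis (-t))) (\<lambda>t. cnj (Lim (at_left 1) (\<lambda>s. pw (\<lambda>n. cnj (shift1 u n)) (of_real s * cis t))))"
  proof (rule bconv_cong)
    show "\<forall>\<^sub>F s in at_left 1. \<forall>t. cnj (pw (\<lambda>n. cnj (shift1 u n)) (of_real s * cis t)) = (of_real s * cis (-t)) * pw u (of_real s * cis (-t))"
      unfolding eventually_at_left_field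
    proof (intro exI[of _ 0] conjI impI allI)
      fix s t :: real assume s: "0 < s" "s < 1"
      have "cnj (pw (\<lambda>n. cnj (shift1 u n)) (of_real s * cis t)) = pw (shift1 u) (of_real s * cis (-t))"
        using pw_cnj[of "\<lambda>n. cnj (shift1 u n)" "of_real s * cis t"] s l2_shift1[OF assms] by (simp add: norm_mult cis_cnj)
      also have "\<dots> = (of_real s * cis (-t)) * pw u (of_real s * cis (-t))"
        using s assms by (intro pw_shift1) (auto simp: norm_mult)
      finally show "cnj (pw (\<lambda>n. cnj (shift1 u n)) (of_real s * cis t)) = (of_real s * cis (-t)) * pw u (of_real s * cis (-t))" .
    qed auto
  qed
  then show ?thesis by (rule bconv_Lim)
qed

section \<open>Hardy spaces as sequence spaces\<close>

text \<open>The scaling makes the \<open>l2\<close> norms of the coefficient sequences the norms of the boundary values.\<close>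

definition hdisc :: "real \<Rightarrow> (nat \<Rightarrow> complex) \<Rightarrow> complex \<Rightarrow> complex" where
  "hdisc r x = zero_ext (ball 0 r) (\<lambda>z. pw x (z / of_real r))"

text \<open>The factor in front enforces the zero at infinity: \<open>y n\<close> multiplies (R /
  z)^(n + 1).\<close>

definition hext :: "real \<Rightarrow> (nat \<Rightarrow> complex) \<Rightarrow> complex \<Rightarrow> complex" where
  "hext R y = zero_ext (ext_disc R) (\<lambda>z. (of_real R / z) * pw y (of_real R / z))"

text \<open>Each half is normalized on the circle up to which it merely has square summable
  coefficients: \<open>v\<close> on the outer one, \<open>u\<close> on the inner one.\<close>

definition hann :: "real \<Rightarrow> real \<Rightarrow> (nat \<Rightarrow> complex) \<Rightarrow> (nat \<Rightarrow> complex) \<Rightarrow> complex \<Rightarrow> complex" where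
  "hann r R v u = zero_ext (annulus r R) (\<lambda>z. pw v (z / of_real R) + (of_real r / z) * pw u (of_real r / z))"

lemma pw_circle: "pw a (of_real s * cis t) = tf (\<lambda>n. a n * of_real s ^ n) (\<lambda>n. 0) t"
  by (simp add: pw_def tf_def power_mult_distrib mult.assoc)

lemma pw_circle_neg:
  assumes "l2 a" "0 \<le> s" "s < 1"
  shows "(of_real s * cis (-t)) * pw a (of_real s * cis (-t)) = tf (\<lambda>n. 0) (\<lambda>n. a n * of_real s ^ Suc n) t"
proof -
  have "(\<lambda>n. (of_real s * cis (-t)) * (a n * (of_real s * cis (-t)) ^ n)) sums ((of_real s * cis (-t)) * pw a (of_real s * cis (-t)))"
    using assms by (intro sums_mult pw_sums) (auto simp: norm_mult)
  then show ?thesis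
    by (simp add: tf_def sums_iff power_mult_distrib mult_ac)
qed

lemma tf_add_parts: "tf P (\<lambda>n. 0) t + tf (\<lambda>n. 0) Q t = tf P Q t"
  by (simp add: tf_def)

lemma hdisc_circle: "0 < r \<Longrightarrow> 0 \<le> \<rho> \<Longrightarrow> \<rho> < r \<Longrightarrow> hdisc r x (rcis \<rho> t) = pw x (of_real (\<rho> / r) * cis t)"
  by (simp add: hdisc_def zero_ext_def rcis_def norm_mult)

lemma hext_circle:
  "0 < R \<Longrightarrow> R < \<rho> \<Longrightarrow> hext R y (rcis \<rho> t) = (of_real (R / \<rho>) * cis (-t)) * pw y (of_real (R / \<rho>) * cis (-t))"
  by (auto simp: hext_def zero_ext_def rcis_def norm_mult ext_disc_def divide_inverse cis_inverse mult_ac)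

lemma hann_circle:
  "0 < r \<Longrightarrow> r < \<rho> \<Longrightarrow> \<rho> < R \<Longrightarrow> hann r R v u (rcis \<rho> t) =
     pw v (of_real (\<rho> / R) * cis t) + (of_real (r / \<rho>) * cis (-t)) * pw u (of_real (r / \<rho>) * cis (-t))"
  by (auto simp: hann_def zero_ext_def rcis_def norm_mult annulus_def divide_inverse cis_inverse mult_ac)

lemma hann_tf:
  assumes "0 < r" "r < \<rho>" "\<rho> < R" "l2 v" "l2 u"
  shows "hann r R v u (rcis \<rho> t) = tf (\<lambda>n. v n * of_real (\<rho> / R) ^ n) (\<lambda>n. u n * of_real (r / \<rho>) ^ Suc n) t"
    "asum (\<lambda>n. v n * of_real (\<rho> / R) ^ n)" "asum (\<lambda>n. u n * of_real (r / \<rho>) ^ Suc n)"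
proof -
  have b: "0 \<le> \<rho> / R" "\<rho> / R < 1" "0 \<le> r / \<rho>" "r / \<rho> < 1" using assms by auto
  show "hann r R v u (rcis \<rho> t) = tf (\<lambda>n. v n * of_real (\<rho> / R) ^ n) (\<lambda>n. u n * of_real (r / \<rho>) ^ Suc n) t"
    unfolding hann_circle[OF assms(1-3)] pw_circle_neg[OF assms(5) b(3,4)]
    unfolding pw_circle tf_add_parts ..
  show "asum (\<lambda>n. v n * of_real (\<rho> / R) ^ n)" "asum (\<lambda>n. u n * of_real (r / \<rho>) ^ Suc n)"
    by (intro l2_scaled_asum assms b)+
qed

lemma hdisc_tf:
  assumes "0 < r" "0 \<le> \<rho>" "\<rho> < r" "l2 x"
  shows "hdisc r x (rcis \<rho> t) = tf (\<lambda>n. x n * of_real (\<rho> / r) ^ n) (\<lambda>n. 0) t"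
    "asum (\<lambda>n. x n * of_real (\<rho> / r) ^ n)"
proof -
  show "hdisc r x (rcis \<rho> t) = tf (\<lambda>n. x n * of_real (\<rho> / r) ^ n) (\<lambda>n. 0) t"
    unfolding hdisc_circle[OF assms(1-3)] pw_circle ..
  show "asum (\<lambda>n. x n * of_real (\<rho> / r) ^ n)"
    using assms by (intro l2_scaled_asum) auto
qed

lemma hext_tf:
  assumes "0 < R" "R < \<rho>" "l2 y"
  shows "hext R y (rcis \<rho> t) = tf (\<lambda>n. 0) (\<lambda>n. y n * of_real (R / \<rho>) ^ Suc n) t"
    "asum (\<lambda>n. y n * of_real (R / \<rho>) ^ Suc n)"
proof -
  have b: "0 \<le> R / \<rho>" "R / \<rho> < 1" using assms by auto
  show "hext R y (rcis \<rho> t) = tf (\<lambda>n. 0) (\<lambda>n. y n * of_real (R / \<rho>) ^ Suc n) t"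
    unfolding hext_circle[OF assms(1,2)] by (rule pw_circle_neg[OF assms(3) b])
  show "asum (\<lambda>n. y n * of_real (R / \<rho>) ^ Suc n)" by (rule l2_scaled_asum(2)[OF assms(3) b])
qed

lemma tf_mean_square:
  assumes "asum P" "asum Q" "\<And>t. f (rcis \<rho> t) = tf P Q t"
  shows "(\<lambda>n. (cmod (P n))\<^sup>2 + (cmod (Q n))\<^sup>2) sums circle_mean_square \<rho> f"
proof -
  have "(\<lambda>n. of_real ((cmod (P n))\<^sup>2 + (cmod (Q n))\<^sup>2)) sums complex_of_real (circle_mean_square \<rho> f)"
    unfolding circle_mean_square_circ assms(3) by (rule tf_parseval[OF assms(1,2)])
  from sums_Re[OF this] show ?thesis by simp
qed

lemma tf_mean_square_le:
  assumes "asum P" "asum Q" "\<And>t. f (rcis \<rho> t) = tf P Q t" "l2 p" "l2 q"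
    "\<And>n. cmod (P n) \<le> cmod (p n)" "\<And>n. cmod (Q n) \<le> cmod (q n)"
  shows "circle_mean_square \<rho> f \<le> n2 p + n2 q"
  by (rule sums_le[OF _ tf_mean_square[OF assms(1-3)] sums_add[OF l2_sums[OF assms(4)] l2_sums[OF assms(5)]]])
     (auto intro!: add_mono power_mono assms)

lemma norm_scaled_le: "0 \<le> s \<Longrightarrow> s \<le> 1 \<Longrightarrow> cmod (a * of_real s ^ n) \<le> cmod a"
  by (simp add: norm_mult norm_power mult_left_le power_le_one)

lemma pw_compose_holomorphic:
  assumes "l2 a" "g holomorphic_on S" "\<And>z. z \<in> S \<Longrightarrow> cmod (g z) < 1"
  shows "(\<lambda>z. pw a (g z)) holomorphic_on S"
proof -
  have "g ` S \<subseteq> ball 0 1" using assms(3) by auto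
  from holomorphic_on_compose_gen[OF assms(2) pw_holomorphic[OF assms(1)] this]
  show ?thesis by (simp add: o_def)
qed

lemma hann_mem:
  assumes "0 < r" "r < R" "l2 v" "l2 u"
  shows "hann r R v u \<in> H2_annulus r R"
  unfolding H2_annulus_def
proof (intro CollectI conjI allI impI)
  show "hann r R v u z = 0" if "z \<notin> annulus r R" for z using that by (simp add: hann_def zero_ext_def)
  have nz: "z \<noteq> 0" if "z \<in> annulus r R" for z using that assms by (auto simp: annulus_def)
  have "(\<lambda>z. pw v (z / of_real R) + (of_real r / z) * pw u (of_real r / z)) holomorphic_on annulus r R"
    using assms nz by (intro holomorphic_intros pw_compose_holomorphic) (auto simp: annulus_def norm_divide)
  then show "hann r R v u holomorphic_on annulus r R"
    by (rule holomorphic_transform) (simp add: hann_def zero_ext_def)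
  have b: "circle_mean_square \<rho> (hann r R v u) \<le> n2 v + n2 u" if "r < \<rho>" "\<rho> < R" for \<rho>
    using assms that
    by (intro tf_mean_square_le[OF hann_tf(2,3,1)[OF _ that]] norm_scaled_le) (auto intro: norm_scaled_le)
  show "\<exists>B. \<forall>\<^sub>F \<rho> in at_left R. circle_mean_square \<rho> (hann r R v u) \<le> B"
    unfolding eventually_at_left_field using b assms by (intro exI[of _ "n2 v + n2 u"] exI[of _ r]) auto
  show "\<exists>B. \<forall>\<^sub>F \<rho> in at_right r. circle_mean_square \<rho> (hann r R v u) \<le> B"
    unfolding eventually_at_right_field using b assms by (intro exI[of _ "n2 v + n2 u"] exI[of _ R]) auto
qed

lemma hdisc_mem:
  assumes "0 < r" "l2 x"
  shows "hdisc r x \<in> H2_disc r"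
  unfolding H2_disc_def
proof (intro CollectI conjI allI impI)
  show "hdisc r x z = 0" if "z \<notin> ball 0 r" for z using that by (simp add: hdisc_def zero_ext_def)
  have "(\<lambda>z. pw x (z / of_real r)) holomorphic_on ball 0 r"
    using assms by (intro pw_compose_holomorphic holomorphic_intros) (auto simp: norm_divide)
  then show "hdisc r x holomorphic_on ball 0 r"
    by (rule holomorphic_transform) (simp add: hdisc_def zero_ext_def)
  have b: "circle_mean_square \<rho> (hdisc r x) \<le> n2 x + n2 (\<lambda>n. 0)" if "0 < \<rho>" "\<rho> < r" for \<rho>
    using assms that
    by (intro tf_mean_square_le[OF hdisc_tf(2) asum_zero hdisc_tf(1)] norm_scaled_le) auto
  show "\<exists>B. \<forall>\<^sub>F \<rho> in at_left r. circle_mean_square \<rho> (hdisc r x) \<le> B"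
    unfolding eventually_at_left_field using b assms by (intro exI[of _ "n2 x + n2 (\<lambda>n. 0)"] exI[of _ 0]) auto
qed

lemma hext_mem:
  assumes "0 < R" "l2 y"
  shows "hext R y \<in> H2_0_ext R"
  unfolding H2_0_ext_def
proof (intro CollectI conjI allI impI)
  show "hext R y z = 0" if "z \<notin> ext_disc R" for z using that by (simp add: hext_def zero_ext_def)
  have "(\<lambda>w. (of_real R * w) * pw y (of_real R * w)) holomorphic_on ball 0 (1 / R)"
    using assms by (intro holomorphic_intros pw_compose_holomorphic) (auto simp: norm_mult field_simps)
  then show "(\<lambda>w. if w = 0 then 0 else hext R y (1 / w)) holomorphic_on ball 0 (1 / R)"
  proof (rule holomorphic_transform)
    fix w :: complex assume w: "w \<in> ball 0 (1 / R)"
    show "(of_real R * w) * pw y (of_real R * w) = (if w = 0 then 0 else hext R y (1 / w))"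
      using w assms by (auto simp: hext_def zero_ext_def ext_disc_def norm_divide field_simps)
  qed
  have b: "circle_mean_square \<rho> (hext R y) \<le> n2 (\<lambda>n. 0) + n2 y" if "R < \<rho>" for \<rho>
    using assms that
    by (intro tf_mean_square_le[OF asum_zero hext_tf(2,1)[OF _ that]])
       (auto intro!: norm_scaled_le simp del: power_Suc of_real_divide)
  show "\<exists>B. \<forall>\<^sub>F \<rho> in at_right R. circle_mean_square \<rho> (hext R y) \<le> B"
    unfolding eventually_at_right_field using b by (intro exI[of _ "n2 (\<lambda>n. 0) + n2 y"] exI[of _ "R + 1"]) auto
qed

text \<open>By Parseval the bound on the means bounds every partial sum, and a finite sum passes to
  the limit of the radius. The two halves are separate because at either circle of the annulus only
  one of them is wanted.\<close>

lemma means_bounded_l2: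
  assumes tf: "\<forall>\<^sub>F \<rho> in F. asum (P \<rho>) \<and> asum (Q \<rho>) \<and> (\<forall>t. f (rcis \<rho> t) = tf (P \<rho>) (Q \<rho>) t)"
    and B: "\<forall>\<^sub>F \<rho> in F. circle_mean_square \<rho> f \<le> B" and F: "F \<noteq> bot"
  shows "(\<And>n. ((\<lambda>\<rho>. P \<rho> n) \<longlongrightarrow> p n) F) \<Longrightarrow> l2 p" "(\<And>n. ((\<lambda>\<rho>. Q \<rho> n) \<longlongrightarrow> q n) F) \<Longrightarrow> l2 q"
proof -
  have ev: "\<forall>\<^sub>F \<rho> in F. (\<Sum>n<N. (cmod (P \<rho> n))\<^sup>2) \<le> B \<and> (\<Sum>n<N. (cmod (Q \<rho> n))\<^sup>2) \<le> B" for N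
    using tf B
  proof eventually_elim
    case (elim \<rho>)
    have s: "(\<lambda>n. (cmod (P \<rho> n))\<^sup>2 + (cmod (Q \<rho> n))\<^sup>2) sums circle_mean_square \<rho> f"
      using elim by (intro tf_mean_square) auto
    have "(\<Sum>n<N. (cmod (P \<rho> n))\<^sup>2 + (cmod (Q \<rho> n))\<^sup>2) \<le> circle_mean_square \<rho> f"
      using s by (rule partial_sum_le_sums) simp
    then have "(\<Sum>n<N. (cmod (P \<rho> n))\<^sup>2) + (\<Sum>n<N. (cmod (Q \<rho> n))\<^sup>2) \<le> B"
      using elim by (simp add: sum.distrib)
    moreover have "0 \<le> (\<Sum>n<N. (cmod (P \<rho> n))\<^sup>2)" "0 \<le> (\<Sum>n<N. (cmod (Q \<rho> n))\<^sup>2)"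
      by (intro sum_nonneg; simp)+
    ultimately show ?case by linarith
  qed
  show "l2 p" if "\<And>n. ((\<lambda>\<rho>. P \<rho> n) \<longlongrightarrow> p n) F"
  proof (rule l2_from_bounded_sums(1))
    show "(\<Sum>n<N. (cmod (p n))\<^sup>2) \<le> B" for N
      by (rule tendsto_upperbound[of "\<lambda>\<rho>. \<Sum>n<N. (cmod (P \<rho> n))\<^sup>2" _ F])
         (use ev[of N] F in \<open>auto intro!: tendsto_intros that elim: eventually_mono\<close>)
  qed
  show "l2 q" if "\<And>n. ((\<lambda>\<rho>. Q \<rho> n) \<longlongrightarrow> q n) F"
  proof (rule l2_from_bounded_sums(1))
    show "(\<Sum>n<N. (cmod (q n))\<^sup>2) \<le> B" for N
      by (rule tendsto_upperbound[of "\<lambda>\<rho>. \<Sum>n<N. (cmod (Q \<rho> n))\<^sup>2" _ F])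
         (use ev[of N] F in \<open>auto intro!: tendsto_intros that elim: eventually_mono\<close>)
  qed
qed

lemma pw_add: "l2 a \<Longrightarrow> l2 b \<Longrightarrow> cmod z < 1 \<Longrightarrow> pw (\<lambda>n. a n + b n) z = pw a z + pw b z"
  using sums_add[OF pw_sums pw_sums, of a z b z] by (simp add: pw_def sums_iff distrib_right)

text \<open>Bounded means near the outer circle make \<open>v\<close> square summable, those near
  the inner circle make \<open>u\<close> so. The radius \<open>\<sigma>\<close> is free, since
  Laurent coefficients do not depend on it; later it is 1.\<close>

lemma H2_annulus_repr:
  assumes r: "0 < r" "r < R" and f: "f \<in> H2_annulus r R" and \<sigma>: "r < \<sigma>" "\<sigma> < R"
  defines "v \<equiv> \<lambda>n. lcp f \<sigma> n * of_real R ^ n" and "u \<equiv> \<lambda>n. lcn f \<sigma> n * of_real (inverse r) ^ Suc n"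
  shows "l2 v" "l2 u" "f = hann r R v u"
proof -
  have hol: "f holomorphic_on annulus r R" and zero: "\<And>z. z \<notin> annulus r R \<Longrightarrow> f z = 0"
    using f by (auto simp: H2_annulus_def)
  obtain B where B: "\<forall>\<^sub>F \<rho> in at_left R. circle_mean_square \<rho> f \<le> B"
    using f by (auto simp: H2_annulus_def)
  obtain B' where B': "\<forall>\<^sub>F \<rho> in at_right r. circle_mean_square \<rho> f \<le> B'"
    using f by (auto simp: H2_annulus_def)
  define P where "P = (\<lambda>\<rho> n. lcp f \<sigma> n * of_real \<rho> ^ n)"
  define Q where "Q = (\<lambda>\<rho> n. lcn f \<sigma> n * of_real (inverse \<rho>) ^ Suc n)"
  have tf: "asum (P \<rho>) \<and> asum (Q \<rho>) \<and> (\<forall>t. f (rcis \<rho> t) = tf (P \<rho>) (Q \<rho>) t)" if \<rho>: "r < \<rho>" "\<rho> < R" for \<rho>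
  proof (intro conjI allI)
    show "asum (P \<rho>)" "asum (Q \<rho>)"
      using lc_summable[OF r(1) hol \<rho> \<sigma>] r \<rho>
      by (simp_all add: asum_def P_def Q_def norm_mult norm_power norm_inverse)
    fix t
    have "rcis \<rho> t \<in> annulus r R" using \<rho> r by (simp add: annulus_def)
    from laurent_series[OF r(1) hol \<sigma> this]
    have "f (rcis \<rho> t) = (\<Sum>n. lcp f \<sigma> n * rcis \<rho> t ^ n) + (\<Sum>n. lcn f \<sigma> n * inverse (rcis \<rho> t) ^ Suc n)" .
    also have "inverse (rcis \<rho> t) = of_real (inverse \<rho>) * cis (-t)"
      by (simp add: rcis_def)
    finally show "f (rcis \<rho> t) = tf (P \<rho>) (Q \<rho>) t"
      by (simp add: tf_def P_def Q_def rcis_def power_mult_distrib mult.assoc del: power_Suc of_real_inverse)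
  qed
  show v: "l2 v"
  proof (rule means_bounded_l2(1)[OF _ B])
    show "\<forall>\<^sub>F \<rho> in at_left R. asum (P \<rho>) \<and> asum (Q \<rho>) \<and> (\<forall>t. f (rcis \<rho> t) = tf (P \<rho>) (Q \<rho>) t)"
      unfolding eventually_at_left_field using tf r by blast
    show "((\<lambda>\<rho>. P \<rho> n) \<longlongrightarrow> v n) (at_left R)" for n
      unfolding P_def v_def by (intro tendsto_intros)
  qed simp
  show u: "l2 u"
  proof (rule means_bounded_l2(2)[OF _ B'])
    show "\<forall>\<^sub>F \<rho> in at_right r. asum (P \<rho>) \<and> asum (Q \<rho>) \<and> (\<forall>t. f (rcis \<rho> t) = tf (P \<rho>) (Q \<rho>) t)"
      unfolding eventually_at_right_field using tf r by blast
    show "((\<lambda>\<rho>. Q \<rho> n) \<longlongrightarrow> u n) (at_right r)" for n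
      unfolding Q_def u_def using r by (intro tendsto_intros) auto
  qed simp
  show "f = hann r R v u"
  proof
    fix z
    show "f z = hann r R v u z"
    proof (cases "z \<in> annulus r R")
      case True
      then have z: "r < cmod z" "cmod z < R" by (auto simp: annulus_def)
      then have nz: "z \<noteq> 0" using r by auto
      have "pw v (z / of_real R) = (\<Sum>n. lcp f \<sigma> n * z ^ n)"
        unfolding pw_def v_def using r by (simp add: power_divide)
      moreover have "(of_real r / z) * pw u (of_real r / z) = (\<Sum>n. lcn f \<sigma> n * inverse z ^ Suc n)"
      proof -
        have "cmod (of_real r / z) < 1" using z r by (simp add: norm_divide divide_less_eq)
        then have "(\<lambda>n. (of_real r / z) * (u n * (of_real r / z) ^ n)) sums ((of_real r / z) * pw u (of_real r / z))"
          by (intro sums_mult pw_sums u)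
        moreover have "(of_real r / z) * (u n * (of_real r / z) ^ n) = lcn f \<sigma> n * inverse z ^ Suc n" for n
        proof -
          have "of_real (inverse r) * (of_real r / z) = inverse z"
            using r by (simp add: field_simps)
          then have "of_real (inverse r) ^ Suc n * (of_real r / z) ^ Suc n = inverse z ^ Suc n"
            by (simp only: power_mult_distrib[symmetric])
          moreover have "(of_real r / z) * (u n * (of_real r / z) ^ n) =
              lcn f \<sigma> n * (of_real (inverse r) ^ Suc n * (of_real r / z) ^ Suc n)"
            unfolding u_def by (simp only: power_Suc mult_ac)
          ultimately show ?thesis by simp
        qed
        ultimately show ?thesis by (simp add: sums_iff del: power_Suc)
      qed
      ultimately show ?thesis
        using laurent_series[OF r(1) hol \<sigma> True] True by (simp add: hann_def zero_ext_def del: power_Suc)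
    qed (simp add: zero hann_def zero_ext_def)
  qed
qed

lemma H2_disc_repr:
  assumes r: "0 < r" and f: "f \<in> H2_disc r"
  obtains x where "l2 x" "f = hdisc r x"
proof -
  have hol: "f holomorphic_on ball 0 r" and zero: "\<And>z. z \<notin> ball 0 r \<Longrightarrow> f z = 0"
    using f by (auto simp: H2_disc_def)
  obtain B where B: "\<forall>\<^sub>F \<rho> in at_left r. circle_mean_square \<rho> f \<le> B"
    using f by (auto simp: H2_disc_def)
  define a where "a = (\<lambda>n. (deriv ^^ n) f 0 / fact n)"
  have sums: "(\<lambda>n. a n * z ^ n) sums f z" if "z \<in> ball 0 r" for z
    using holomorphic_power_series[OF hol that] by (simp add: a_def)
  define x where "x = (\<lambda>n. a n * of_real r ^ n)"
  define P where "P = (\<lambda>\<rho> n. a n * of_real \<rho> ^ n)"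
  have tf: "asum (P \<rho>) \<and> asum (\<lambda>n. 0) \<and> (\<forall>t. f (rcis \<rho> t) = tf (P \<rho>) (\<lambda>n. 0) t)" if \<rho>: "0 < \<rho>" "\<rho> < r" for \<rho>
  proof (intro conjI allI)
    obtain \<rho>' where \<rho>': "\<rho> < \<rho>'" "\<rho>' < r" using \<rho> dense by blast
    have "summable (\<lambda>n. a n * of_real \<rho>' ^ n)"
      using sums[of "of_real \<rho>'"] \<rho> \<rho>' by (auto simp: sums_iff)
    then have "summable (\<lambda>n. norm (a n * of_real \<rho> ^ n))"
      by (rule powser_insidea) (use \<rho> \<rho>' in auto)
    then show "asum (P \<rho>)" by (simp add: asum_def P_def)
    fix t
    show "f (rcis \<rho> t) = tf (P \<rho>) (\<lambda>n. 0) t"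
      using sums[of "rcis \<rho> t"] \<rho> by (simp add: sums_iff tf_def P_def rcis_def power_mult_distrib mult.assoc norm_mult)
  qed simp
  have x: "l2 x"
  proof (rule means_bounded_l2(1)[OF _ B])
    show "\<forall>\<^sub>F \<rho> in at_left r. asum (P \<rho>) \<and> asum (\<lambda>n. 0) \<and> (\<forall>t. f (rcis \<rho> t) = tf (P \<rho>) (\<lambda>n. 0) t)"
      unfolding eventually_at_left_field using tf r by blast
    show "((\<lambda>\<rho>. P \<rho> n) \<longlongrightarrow> x n) (at_left r)" for n
      unfolding P_def x_def by (intro tendsto_intros)
  qed simp
  have "f = hdisc r x"
  proof
    fix z show "f z = hdisc r x z"
    proof (cases "z \<in> ball 0 r")
      case True
      have "pw x (z / of_real r) = (\<Sum>n. a n * z ^ n)"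
        unfolding pw_def x_def using r by (simp add: power_divide)
      then show ?thesis using sums[OF True] True by (simp add: sums_iff hdisc_def zero_ext_def)
    qed (simp add: zero hdisc_def zero_ext_def)
  qed
  then show ?thesis using that x by blast
qed

lemma H2_0_ext_repr:
  assumes R: "0 < R" and f: "f \<in> H2_0_ext R"
  obtains y where "l2 y" "f = hext R y"
proof -
  define g where "g = (\<lambda>w. if w = 0 then 0 else f (1 / w))"
  have hol: "g holomorphic_on ball 0 (1 / R)" and zero: "\<And>z. z \<notin> ext_disc R \<Longrightarrow> f z = 0"
    using f by (auto simp: H2_0_ext_def g_def)
  obtain B where B: "\<forall>\<^sub>F \<rho> in at_right R. circle_mean_square \<rho> f \<le> B"
    using f by (auto simp: H2_0_ext_def)
  define a where "a = (\<lambda>n. (deriv ^^ n) g 0 / fact n)"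
  have sums: "(\<lambda>n. a n * z ^ n) sums g z" if "z \<in> ball 0 (1 / R)" for z
    using holomorphic_power_series[OF hol that] by (simp add: a_def)
  \<comment> \<open>The value 0 at infinity removes the constant coefficient in the chart 1 / z,
    which explains the shift of the index in \<open>b\<close>.\<close>
  have a0: "a 0 = 0" by (simp add: a_def g_def)
  define b where "b = (\<lambda>n. a (Suc n))"
  have sumsb: "(\<lambda>n. b n * inverse z ^ Suc n) sums f z" if "R < cmod z" for z
  proof -
    have nz: "z \<noteq> 0" using that R by auto
    have "inverse z \<in> ball 0 (1 / R)" using less_imp_inverse_less[OF that R] by (simp add: norm_inverse norm_divide inverse_eq_divide)
    then have "(\<lambda>n. a n * inverse z ^ n) sums g (inverse z)" by (rule sums)
    then have "(\<lambda>n. a (Suc n) * inverse z ^ Suc n) sums g (inverse z)"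
      by (subst sums_Suc_iff) (simp add: a0)
    then show ?thesis using nz by (simp add: b_def g_def inverse_eq_divide)
  qed
  define y where "y = (\<lambda>n. b n * of_real (inverse R) ^ Suc n)"
  define Q where "Q = (\<lambda>\<rho> n. b n * of_real (inverse \<rho>) ^ Suc n)"
  have tf: "asum (\<lambda>n. 0) \<and> asum (Q \<rho>) \<and> (\<forall>t. f (rcis \<rho> t) = tf (\<lambda>n. 0) (Q \<rho>) t)" if \<rho>: "R < \<rho>" for \<rho>
  proof (intro conjI allI)
    obtain \<rho>' where \<rho>': "R < \<rho>'" "\<rho>' < \<rho>" using \<rho> dense by blast
    have "summable (\<lambda>n. b n * inverse (of_real \<rho>') ^ Suc n)"
      using sumsb[of "of_real \<rho>'"] R \<rho>' by (auto simp: sums_iff)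
    then have "summable (\<lambda>n. b n * inverse (of_real \<rho>') ^ n)"
    proof -
      have "summable (\<lambda>n. inverse (of_real \<rho>') * (b n * inverse (of_real \<rho>') ^ n))"
        using \<open>summable (\<lambda>n. b n * inverse (of_real \<rho>') ^ Suc n)\<close> by (simp add: mult_ac)
      then show ?thesis by (rule summable_mult_D) (use R \<rho>' in auto)
    qed
    then have "summable (\<lambda>n. norm (b n * inverse (of_real \<rho>) ^ n))"
      by (rule powser_insidea) (use R \<rho>' in \<open>auto simp: norm_inverse\<close>)
    then have "summable (\<lambda>n. inverse \<rho> * norm (b n * inverse (of_real \<rho>) ^ n))"
      by (rule summable_mult)
    then show "asum (Q \<rho>)" using R \<rho> by (simp add: asum_def Q_def norm_mult norm_power norm_inverse mult_ac)
    fix t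
    have "inverse (rcis \<rho> t) = of_real (inverse \<rho>) * cis (-t)"
      by (simp add: rcis_def)
    then show "f (rcis \<rho> t) = tf (\<lambda>n. 0) (Q \<rho>) t"
      using sumsb[of "rcis \<rho> t"] R \<rho>
      by (simp add: sums_iff tf_def Q_def power_mult_distrib mult.assoc del: power_Suc of_real_inverse)
  qed simp
  have y: "l2 y"
  proof (rule means_bounded_l2(2)[OF _ B])
    show "\<forall>\<^sub>F \<rho> in at_right R. asum (\<lambda>n. 0) \<and> asum (Q \<rho>) \<and> (\<forall>t. f (rcis \<rho> t) = tf (\<lambda>n. 0) (Q \<rho>) t)"
      unfolding eventually_at_right_field using tf by (intro exI[of _ "R + 1"]) auto
    show "((\<lambda>\<rho>. Q \<rho> n) \<longlongrightarrow> y n) (at_right R)" for n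
      unfolding Q_def y_def using R by (intro tendsto_intros) auto
  qed simp
  have "f = hext R y"
  proof
    fix z show "f z = hext R y z"
    proof (cases "z \<in> ext_disc R")
      case True
      then have z: "R < cmod z" by (simp add: ext_disc_def)
      have "cmod (of_real R / z) < 1" using z R by (simp add: norm_divide divide_less_eq)
      then have "(\<lambda>n. (of_real R / z) * (y n * (of_real R / z) ^ n)) sums ((of_real R / z) * pw y (of_real R / z))"
        by (intro sums_mult pw_sums y)
      moreover have "(of_real R / z) * (y n * (of_real R / z) ^ n) = b n * inverse z ^ Suc n" for n
      proof -
        have "of_real (inverse R) * (of_real R / z) = inverse z"
          using R by (simp add: field_simps)
        then have "of_real (inverse R) ^ Suc n * (of_real R / z) ^ Suc n = inverse z ^ Suc n"
          by (simp only: power_mult_distrib[symmetric])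
        moreover have "(of_real R / z) * (y n * (of_real R / z) ^ n) =
            b n * (of_real (inverse R) ^ Suc n * (of_real R / z) ^ Suc n)"
          unfolding y_def by (simp only: power_Suc mult_ac)
        ultimately show ?thesis by simp
      qed
      ultimately have "(\<lambda>n. b n * inverse z ^ Suc n) sums ((of_real R / z) * pw y (of_real R / z))" by (simp del: power_Suc)
      then show ?thesis using sumsb[OF z] True
        by (simp add: hext_def zero_ext_def sums_iff del: power_Suc)
    qed (simp add: zero hext_def zero_ext_def)
  qed
  then show ?thesis using that y by blast
qed

section \<open>Boundary values and norms\<close>

lemma of_real_mult_rcis: "of_real s * rcis \<rho> t = rcis (s * \<rho>) t"
  by (simp add: rcis_def)

lemma eventually_left_1: "b < 1 \<Longrightarrow> (\<And>s. b < s \<Longrightarrow> s < 1 \<Longrightarrow> P s) \<Longrightarrow> eventually P (at_left (1::real))"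
  unfolding eventually_at_left_field by blast

text \<open>The bound \<open>r / R < s\<close> keeps the circle of radius \<open>s * R\<close>
  inside the annulus; the same bound serves the circle of radius \<open>r / s\<close> near the inner
  boundary.\<close>

lemma hann_tf_outer:
  assumes r: "0 < r" "r < R" and vu: "l2 v" "l2 u" and s: "r / R < s" "s < 1"
  shows "hann r R v u (of_real s * rcis R t) = tf (\<lambda>n. v n * of_real s ^ n) (\<lambda>n. u n * of_real (r / (s * R)) ^ Suc n) t"
    "asum (\<lambda>n. v n * of_real s ^ n)" "asum (\<lambda>n. u n * of_real (r / (s * R)) ^ Suc n)"
proof -
  have "0 < r / R" using r by simp
  then have "0 < s" using s by linarith
  then have s': "r < s * R" "s * R < R" using r s by (simp_all add: field_simps)
  show "hann r R v u (of_real s * rcis R t) = tf (\<lambda>n. v n * of_real s ^ n) (\<lambda>n. u n * of_real (r / (s * R)) ^ Suc n) t"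
    "asum (\<lambda>n. v n * of_real s ^ n)" "asum (\<lambda>n. u n * of_real (r / (s * R)) ^ Suc n)"
    using hann_tf[OF r(1) s' vu] r unfolding of_real_mult_rcis by (simp_all del: power_Suc of_real_divide of_real_mult)
qed

lemma hann_tf_inner:
  assumes r: "0 < r" "r < R" and vu: "l2 v" "l2 u" and s: "r / R < s" "s < 1"
  shows "hann r R v u (of_real (inverse s) * rcis r t) = tf (\<lambda>n. v n * of_real (r / (s * R)) ^ n) (\<lambda>n. u n * of_real s ^ Suc n) t"
    "asum (\<lambda>n. v n * of_real (r / (s * R)) ^ n)" "asum (\<lambda>n. u n * of_real s ^ Suc n)"
proof -
  have "0 < r / R" using r by simp
  then have s0: "0 < s" using s by linarith
  then have s': "r < inverse s * r" "inverse s * r < R" using r s by (simp_all add: field_simps)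
  have eq: "r / (inverse s * r) = s" "inverse s * r / R = r / (s * R)" using r s0 by (simp_all add: field_simps)
  show "hann r R v u (of_real (inverse s) * rcis r t) = tf (\<lambda>n. v n * of_real (r / (s * R)) ^ n) (\<lambda>n. u n * of_real s ^ Suc n) t"
    "asum (\<lambda>n. v n * of_real (r / (s * R)) ^ n)" "asum (\<lambda>n. u n * of_real s ^ Suc n)"
    using hann_tf[OF r(1) s' vu] unfolding of_real_mult_rcis eq by this
qed

lemma hdisc_tf_bv:
  assumes r: "0 < r" and x: "l2 x" and s: "0 < s" "s < 1"
  shows "hdisc r x (of_real s * rcis r t) = tf (\<lambda>n. x n * of_real s ^ n) (\<lambda>n. 0) t"
    "asum (\<lambda>n. x n * of_real s ^ n)"
  using hdisc_tf[OF r _ _ x, of "s * r"] r s unfolding of_real_mult_rcis by simp_all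

lemma hext_tf_bv:
  assumes R: "0 < R" and y: "l2 y" and s: "0 < s" "s < 1"
  shows "hext R y (of_real (inverse s) * rcis R t) = tf (\<lambda>n. 0) (\<lambda>n. y n * of_real s ^ Suc n) t"
    "asum (\<lambda>n. y n * of_real s ^ Suc n)"
proof -
  have s': "R < inverse s * R" using R s by (simp_all add: field_simps)
  have eq: "R / (inverse s * R) = s" using R s by (simp_all add: field_simps)
  show "hext R y (of_real (inverse s) * rcis R t) = tf (\<lambda>n. 0) (\<lambda>n. y n * of_real s ^ Suc n) t"
    "asum (\<lambda>n. y n * of_real s ^ Suc n)"
    using hext_tf[OF R s' y] unfolding of_real_mult_rcis eq by this
qed

text \<open>The half of the Laurent series belonging to the opposite circle: its argument still has
  modulus \<open>r / R < 1\<close> at s = 1, so convergence is uniform. The two choices of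
  \<open>w\<close> are the two boundary circles.\<close>

lemma pw_bconv_inside:
  assumes r: "0 < r" "r < R" and a: "l2 a" and w: "w = (\<lambda>t. cis t) \<or> w = (\<lambda>t. cis (-t))"
  shows "bconv (\<lambda>s t. pw a (of_real (r / (s * R)) * w t)) (\<lambda>t. pw a (of_real (r / (1 * R)) * w t))"
proof (rule bconv_uniform[where F="\<lambda>s t. pw a (of_real (r / (s * R)) * w t)"])
  have rR: "r / R < 1" "0 < r / R" using r by auto
  define b where "b = (SOME b. r / R < b \<and> b < 1)"
  have "\<exists>b. r / R < b \<and> b < 1" using rR dense by blast
  then have "r / R < b \<and> b < 1" unfolding b_def by (rule someI_ex)
  then have b': "r / R < b" and "b < 1" by auto
  then show "b < 1" by simp
  have b: "0 < b" using rR(2) b' by (rule less_trans)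
  have wn: "cmod (w t) = 1" "continuous_on S w" for t S using w by (auto intro!: continuous_intros)
  have "continuous_on ({b..1} \<times> {0..2*pi}) (\<lambda>p. pw a (of_real (r / (fst p * R)) * w (snd p)))"
  proof (rule continuous_on_compose2[OF holomorphic_on_imp_continuous_on[OF pw_holomorphic[OF a]]])
    show "continuous_on ({b..1} \<times> {0..2*pi}) (\<lambda>p. of_real (r / (fst p * R)) * w (snd p))"
      using b r by (intro continuous_intros continuous_on_compose2[OF wn(2)[of UNIV]]) auto
    show "(\<lambda>p. of_real (r / (fst p * R)) * w (snd p)) ` ({b..1} \<times> {0..2*pi}) \<subseteq> ball 0 1"
    proof (rule image_subsetI)
      fix p assume p: "p \<in> {b..1} \<times> {0..2*pi}"
      define s where "s = fst p"
      have s: "b \<le> s" using p by (auto simp: s_def)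
      have "r / R < s" using s b' by linarith
      then have "r < s * R" using r by (simp add: divide_less_eq)
      then have "\<bar>r / (s * R)\<bar> < 1" using s b r by simp
      then show "of_real (r / (fst p * R)) * w (snd p) \<in> ball 0 1"
        by (simp only: mem_ball_0 norm_mult wn norm_of_real s_def mult_1_right)
    qed
  qed
  then show "continuous_on ({b..1} \<times> {0..2*pi}) (\<lambda>(s, t). pw a (of_real (r / (s * R)) * w t))"
    by (simp add: case_prod_beta)
qed

text \<open>At each boundary circle one half of the Laurent series needs the radial limit theorem,
  while the other extends continuously.\<close>

lemma hann_bconv:
  assumes r: "0 < r" "r < R" and vu: "l2 v" "l2 u"
  shows "bconv (\<lambda>s t. hann r R v u (of_real s * rcis R t)) (\<lambda>t. bv_inside (hann r R v u) (rcis R t))"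
    and "bconv (\<lambda>s t. hann r R v u (of_real (inverse s) * rcis r t)) (\<lambda>t. bv_outside (hann r R v u) (rcis r t))"
proof -
  have rR: "r / R < 1" "0 < r / R" using r by auto
  have "bconv (\<lambda>s t. pw v (of_real s * cis t) + pw (shift1 u) (of_real (r / (s * R)) * cis (-t)))
     (\<lambda>t. Lim (at_left 1) (\<lambda>s. pw v (of_real s * cis t)) + pw (shift1 u) (of_real (r / (1 * R)) * cis (-t)))"
    by (intro bconv_add bconv_pw vu pw_bconv_inside r l2_shift1) auto
  then have "bconv (\<lambda>s t. hann r R v u (of_real s * rcis R t))
     (\<lambda>t. Lim (at_left 1) (\<lambda>s. pw v (of_real s * cis t)) + pw (shift1 u) (of_real (r / (1 * R)) * cis (-t)))"
  proof (rule bconv_cong, intro eventually_left_1[OF rR(1)] allI)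
    fix s t :: real assume s: "r / R < s" "s < 1"
    have s0: "0 < s" using s rR by linarith
    have s': "r < s * R" "s * R < R" using r s s0 by (simp_all add: field_simps)
    have "cmod (of_real (r / (s * R)) * cis (-t)) < 1"
      using s' r s0 by (simp add: norm_mult norm_divide)
    then show "pw v (of_real s * cis t) + pw (shift1 u) (of_real (r / (s * R)) * cis (-t)) = hann r R v u (of_real s * rcis R t)"
      unfolding of_real_mult_rcis hann_circle[OF r(1) s'] using r by (simp add: pw_shift1[OF vu(2)] del: of_real_divide of_real_mult)
  qed
  then show "bconv (\<lambda>s t. hann r R v u (of_real s * rcis R t)) (\<lambda>t. bv_inside (hann r R v u) (rcis R t))"
    unfolding bv_inside_def by (rule bconv_Lim)
  have "bconv (\<lambda>s t. pw v (of_real (r / (s * R)) * cis t) + (of_real s * cis (-t)) * pw u (of_real s * cis (-t)))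
     (\<lambda>t. pw v (of_real (r / (1 * R)) * cis t) + Lim (at_left 1) (\<lambda>s. (of_real s * cis (-t)) * pw u (of_real s * cis (-t))))"
    by (intro bconv_add bconv_pw_neg vu pw_bconv_inside r) auto
  then have "bconv (\<lambda>s t. hann r R v u (of_real (inverse s) * rcis r t))
     (\<lambda>t. pw v (of_real (r / (1 * R)) * cis t) + Lim (at_left 1) (\<lambda>s. (of_real s * cis (-t)) * pw u (of_real s * cis (-t))))"
  proof (rule bconv_cong, intro eventually_left_1[OF rR(1)] allI)
    fix s t :: real assume s: "r / R < s" "s < 1"
    have s0: "0 < s" using s rR by linarith
    have s': "r < inverse s * r" "inverse s * r < R" using r s s0 by (simp_all add: field_simps)
    have eq: "r / (inverse s * r) = s" "inverse s * r / R = r / (s * R)" using r s0 by (simp_all add: field_simps)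
    show "pw v (of_real (r / (s * R)) * cis t) + (of_real s * cis (-t)) * pw u (of_real s * cis (-t)) = hann r R v u (of_real (inverse s) * rcis r t)"
      unfolding of_real_mult_rcis hann_circle[OF r(1) s'] eq ..
  qed
  then show "bconv (\<lambda>s t. hann r R v u (of_real (inverse s) * rcis r t)) (\<lambda>t. bv_outside (hann r R v u) (rcis r t))"
    unfolding bv_outside_eq by (rule bconv_Lim)
qed

lemma hdisc_bconv:
  assumes r: "0 < r" and x: "l2 x"
  shows "bconv (\<lambda>s t. hdisc r x (of_real s * rcis r t)) (\<lambda>t. bv_inside (hdisc r x) (rcis r t))"
proof -
  have "bconv (\<lambda>s t. hdisc r x (of_real s * rcis r t)) (\<lambda>t. Lim (at_left 1) (\<lambda>s. pw x (of_real s * cis t)))"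
    by (rule bconv_cong[OF bconv_pw[OF x] eventually_left_1[of 0]])
       (use r in \<open>auto simp: hdisc_tf_bv[OF r x] pw_circle\<close>)
  then show ?thesis unfolding bv_inside_def by (rule bconv_Lim)
qed

lemma hext_bconv:
  assumes R: "0 < R" and y: "l2 y"
  shows "bconv (\<lambda>s t. hext R y (of_real (inverse s) * rcis R t)) (\<lambda>t. bv_outside (hext R y) (rcis R t))"
proof -
  have "bconv (\<lambda>s t. hext R y (of_real (inverse s) * rcis R t))
     (\<lambda>t. Lim (at_left 1) (\<lambda>s. (of_real s * cis (-t)) * pw y (of_real s * cis (-t))))"
  proof (rule bconv_cong[OF bconv_pw_neg[OF y]], intro eventually_left_1[of 0] allI)
    fix s t :: real assume s: "0 < s" "s < 1"
    show "(of_real s * cis (-t)) * pw y (of_real s * cis (-t)) = hext R y (of_real (inverse s) * rcis R t)"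
      unfolding hext_tf_bv[OF R y s] using s by (intro pw_circle_neg y) auto
  qed simp
  then show ?thesis unfolding bv_outside_eq by (rule bconv_Lim)
qed

lemma circle_mean_square_Re: "circle_mean_square \<rho> f = Re (circ (\<lambda>t. f (rcis \<rho> t) * cnj (f (rcis \<rho> t))))"
  unfolding circle_mean_square_circ[symmetric] by simp

lemma circle_mean_square_nonneg: "0 \<le> circle_mean_square \<rho> f"
proof -
  have "0 \<le> integral {0..2*pi} (\<lambda>t. (cmod (f (rcis \<rho> t)))\<^sup>2)"
    by (cases "(\<lambda>t. (cmod (f (rcis \<rho> t)))\<^sup>2) integrable_on {0..2*pi}")
       (auto intro: integral_nonneg simp: not_integrable_integral)
  then show ?thesis by (simp add: circle_mean_square_def)
qed

text \<open>The norm adds the mean squares over both circles, and each of these is at most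
  \<open>n2 v + n2 u\<close>. On the annulus the coefficient norm is thus only compared with the
  norm, whereas on the discs the two coincide.\<close>

lemma norm_hann_upper:
  assumes r: "0 < r" "r < R" and vu: "l2 v" "l2 u"
  shows "(norm_H2_annulus r R (hann r R v u))\<^sup>2 \<le> 2 * (n2 v + n2 u)"
proof -
  have rR: "r / R < 1" "0 < r / R" using r by auto
  have sc: "0 \<le> r / (s * R) \<and> r / (s * R) \<le> 1 \<and> 0 \<le> s" if "r / R < s" for s
  proof -
    have "0 < s" using that rR by linarith
    then show ?thesis using that r by (simp add: divide_simps mult_ac)
  qed
  have "circle_mean_square R (bv_inside (hann r R v u)) \<le> n2 v + n2 u"
    unfolding circle_mean_square_Re
  proof (rule bconv_tf_upper[OF hann_bconv(1)[OF r vu]])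
    show "\<forall>\<^sub>F s in at_left 1. asum (\<lambda>n. v n * of_real s ^ n) \<and> asum (\<lambda>n. u n * of_real (r / (s * R)) ^ Suc n) \<and>
        (\<forall>t. hann r R v u (of_real s * rcis R t) = tf (\<lambda>n. v n * of_real s ^ n) (\<lambda>n. u n * of_real (r / (s * R)) ^ Suc n) t) \<and>
        (\<forall>n. cmod (v n * of_real s ^ n) \<le> cmod (v n) \<and> cmod (u n * of_real (r / (s * R)) ^ Suc n) \<le> cmod (u n))" (is "eventually ?P _")
    proof (rule eventually_left_1[OF rR(1)])
      fix s assume s: "r / R < s" "s < 1"
      note T = hann_tf_outer[OF r vu s]
      show "?P s" by (intro conjI allI T norm_scaled_le) (use sc[OF s(1)] s in auto)
    qed
  qed (use vu in auto)
  moreover have "circle_mean_square r (bv_outside (hann r R v u)) \<le> n2 v + n2 u"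
    unfolding circle_mean_square_Re
  proof (rule bconv_tf_upper[OF hann_bconv(2)[OF r vu]])
    show "\<forall>\<^sub>F s in at_left 1. asum (\<lambda>n. v n * of_real (r / (s * R)) ^ n) \<and> asum (\<lambda>n. u n * of_real s ^ Suc n) \<and>
        (\<forall>t. hann r R v u (of_real (inverse s) * rcis r t) = tf (\<lambda>n. v n * of_real (r / (s * R)) ^ n) (\<lambda>n. u n * of_real s ^ Suc n) t) \<and>
        (\<forall>n. cmod (v n * of_real (r / (s * R)) ^ n) \<le> cmod (v n) \<and> cmod (u n * of_real s ^ Suc n) \<le> cmod (u n))" (is "eventually ?P _")
    proof (rule eventually_left_1[OF rR(1)])
      fix s assume s: "r / R < s" "s < 1"
      note T = hann_tf_inner[OF r vu s]
      show "?P s" by (intro conjI allI T norm_scaled_le) (use sc[OF s(1)] s in auto)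
    qed
  qed (use vu in auto)
  ultimately show ?thesis
    using circle_mean_square_nonneg by (simp add: norm_H2_annulus_def)
qed

lemma tendsto_scaled:
  fixes c :: complex
  shows "((\<lambda>s. c * of_real s ^ n) \<longlongrightarrow> c) (at_left (1::real))"
proof -
  have "((\<lambda>s. c * of_real s ^ n) \<longlongrightarrow> c * of_real 1 ^ n) (at_left (1::real))" by (intro tendsto_intros)
  then show ?thesis by simp
qed

lemma tendsto_scaled':
  fixes c :: complex
  shows "0 < R \<Longrightarrow> ((\<lambda>s. c * of_real (r / (s * R)) ^ n) \<longlongrightarrow> c * of_real (r / (1 * R)) ^ n) (at_left (1::real))"
  by (intro tendsto_intros) auto

text \<open>Each half appears undamped on one of the circles: \<open>v\<close> on the outer one,
  \<open>u\<close> on the inner one.\<close>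

lemma norm_hann_lower:
  assumes r: "0 < r" "r < R" and vu: "l2 v" "l2 u"
  shows "n2 v + n2 u \<le> (norm_H2_annulus r R (hann r R v u))\<^sup>2"
proof -
  have rR: "r / R < 1" "0 < r / R" "0 < R" using r by auto
  have "n2 v \<le> circle_mean_square R (bv_inside (hann r R v u))"
  proof (rule l2_from_bounded_sums(2))
    fix N
    have "(\<Sum>n<N. (cmod (v n))\<^sup>2) \<le> (\<Sum>n<N. (cmod (v n))\<^sup>2 + (cmod (u n * of_real (r / (1 * R)) ^ Suc n))\<^sup>2)"
      by (intro sum_mono) auto
    also have "\<dots> \<le> circle_mean_square R (bv_inside (hann r R v u))"
      unfolding circle_mean_square_Re
    proof (rule bconv_tf_lower[OF hann_bconv(1)[OF r vu] _ tendsto_scaled tendsto_scaled'[OF rR(3)]])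
      show "\<forall>\<^sub>F s in at_left 1. asum (\<lambda>n. v n * of_real s ^ n) \<and> asum (\<lambda>n. u n * of_real (r / (s * R)) ^ Suc n) \<and>
        (\<forall>t. hann r R v u (of_real s * rcis R t) = tf (\<lambda>n. v n * of_real s ^ n) (\<lambda>n. u n * of_real (r / (s * R)) ^ Suc n) t)"
        using hann_tf_outer[OF r vu] by (intro eventually_left_1[OF rR(1)]) blast
    qed
    finally show "(\<Sum>n<N. (cmod (v n))\<^sup>2) \<le> circle_mean_square R (bv_inside (hann r R v u))" .
  qed
  moreover have "n2 u \<le> circle_mean_square r (bv_outside (hann r R v u))"
  proof (rule l2_from_bounded_sums(2))
    fix N
    have "(\<Sum>n<N. (cmod (u n))\<^sup>2) \<le> (\<Sum>n<N. (cmod (v n * of_real (r / (1 * R)) ^ n))\<^sup>2 + (cmod (u n))\<^sup>2)"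
      by (intro sum_mono) auto
    also have "\<dots> \<le> circle_mean_square r (bv_outside (hann r R v u))"
      unfolding circle_mean_square_Re
    proof (rule bconv_tf_lower[OF hann_bconv(2)[OF r vu] _ tendsto_scaled'[OF rR(3)] tendsto_scaled])
      show "\<forall>\<^sub>F s in at_left 1. asum (\<lambda>n. v n * of_real (r / (s * R)) ^ n) \<and> asum (\<lambda>n. u n * of_real s ^ Suc n) \<and>
        (\<forall>t. hann r R v u (of_real (inverse s) * rcis r t) = tf (\<lambda>n. v n * of_real (r / (s * R)) ^ n) (\<lambda>n. u n * of_real s ^ Suc n) t)"
        using hann_tf_inner[OF r vu] by (intro eventually_left_1[OF rR(1)]) blast
    qed
    finally show "(\<Sum>n<N. (cmod (u n))\<^sup>2) \<le> circle_mean_square r (bv_outside (hann r R v u))" .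
  qed
  ultimately show ?thesis
    using circle_mean_square_nonneg by (simp add: norm_H2_annulus_def)
qed

lemma norm_H2_annulus_nonneg: "0 \<le> norm_H2_annulus r R f"
  by (simp add: norm_H2_annulus_def circle_mean_square_nonneg)

lemma norm_hdisc:
  assumes r: "0 < r" and x: "l2 x"
  shows "(norm_H2_disc r (hdisc r x))\<^sup>2 = n2 x"
proof -
  have "circle_mean_square r (bv_inside (hdisc r x)) \<le> n2 x + n2 (\<lambda>n. 0)"
    unfolding circle_mean_square_Re
  proof (rule bconv_tf_upper[OF hdisc_bconv[OF r x]])
    show "\<forall>\<^sub>F s in at_left 1. asum (\<lambda>n. x n * of_real s ^ n) \<and> asum (\<lambda>n. 0) \<and>
        (\<forall>t. hdisc r x (of_real s * rcis r t) = tf (\<lambda>n. x n * of_real s ^ n) (\<lambda>n. 0) t) \<and>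
        (\<forall>n. cmod (x n * of_real s ^ n) \<le> cmod (x n) \<and> cmod 0 \<le> cmod 0)"
      by (intro eventually_left_1[of 0] conjI allI hdisc_tf_bv r x norm_scaled_le) auto
  qed (use x in auto)
  moreover have "n2 x \<le> circle_mean_square r (bv_inside (hdisc r x))"
  proof (rule l2_from_bounded_sums(2))
    fix N
    have "(\<Sum>n<N. (cmod (x n))\<^sup>2 + (cmod 0)\<^sup>2) \<le> circle_mean_square r (bv_inside (hdisc r x))"
      unfolding circle_mean_square_Re
    proof (rule bconv_tf_lower[OF hdisc_bconv[OF r x] _ tendsto_scaled tendsto_const])
      show "\<forall>\<^sub>F s in at_left 1. asum (\<lambda>n. x n * of_real s ^ n) \<and> asum (\<lambda>n. 0) \<and>
        (\<forall>t. hdisc r x (of_real s * rcis r t) = tf (\<lambda>n. x n * of_real s ^ n) (\<lambda>n. 0) t)"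
        by (intro eventually_left_1[of 0] conjI allI hdisc_tf_bv r x) auto
    qed
    then show "(\<Sum>n<N. (cmod (x n))\<^sup>2) \<le> circle_mean_square r (bv_inside (hdisc r x))" by simp
  qed
  ultimately show ?thesis
    using circle_mean_square_nonneg n2_nonneg[OF x] by (simp add: norm_H2_disc_def)
qed

lemma norm_hext:
  assumes R: "0 < R" and y: "l2 y"
  shows "(norm_H2_0_ext R (hext R y))\<^sup>2 = n2 y"
proof -
  have "circle_mean_square R (bv_outside (hext R y)) \<le> n2 (\<lambda>n. 0) + n2 y"
    unfolding circle_mean_square_Re
  proof (rule bconv_tf_upper[OF hext_bconv[OF R y]])
    show "\<forall>\<^sub>F s in at_left 1. asum (\<lambda>n. 0) \<and> asum (\<lambda>n. y n * of_real s ^ Suc n) \<and>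
        (\<forall>t. hext R y (of_real (inverse s) * rcis R t) = tf (\<lambda>n. 0) (\<lambda>n. y n * of_real s ^ Suc n) t) \<and>
        (\<forall>n. cmod 0 \<le> cmod 0 \<and> cmod (y n * of_real s ^ Suc n) \<le> cmod (y n))"
      by (intro eventually_left_1[of 0] conjI allI hext_tf_bv R y norm_scaled_le) auto
  qed (use y in auto)
  moreover have "n2 y \<le> circle_mean_square R (bv_outside (hext R y))"
  proof (rule l2_from_bounded_sums(2))
    fix N
    have "(\<Sum>n<N. (cmod 0)\<^sup>2 + (cmod (y n))\<^sup>2) \<le> circle_mean_square R (bv_outside (hext R y))"
      unfolding circle_mean_square_Re
    proof (rule bconv_tf_lower[OF hext_bconv[OF R y] _ tendsto_const tendsto_scaled])
      show "\<forall>\<^sub>F s in at_left 1. asum (\<lambda>n. 0) \<and> asum (\<lambda>n. y n * of_real s ^ Suc n) \<and>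
        (\<forall>t. hext R y (of_real (inverse s) * rcis R t) = tf (\<lambda>n. 0) (\<lambda>n. y n * of_real s ^ Suc n) t)"
        by (intro eventually_left_1[of 0] conjI allI hext_tf_bv R y) auto
    qed
    then show "(\<Sum>n<N. (cmod (y n))\<^sup>2) \<le> circle_mean_square R (bv_outside (hext R y))" by simp
  qed
  ultimately show ?thesis
    using circle_mean_square_nonneg n2_nonneg[OF y] by (simp add: norm_H2_0_ext_def)
qed

lemma norm_sum_sq:
  assumes "0 < r" "0 < R" "l2 x" "l2 y"
  shows "(norm_H2_sum r R (hdisc r x, hext R y))\<^sup>2 = n2 x + n2 y"
  using assms by (simp add: norm_H2_sum_def norm_hdisc norm_hext n2_nonneg)

section \<open>The duality map in coordinates\<close>

text \<open>With dz = i z dt and normalization by 2 pi i, what remains of the differential is the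
  radius and one factor \<open>cis t\<close>.\<close>

lemma contour_integral_circ:
  "1 / (2 * of_real pi * \<i>) * contour_integral (circlepath 0 \<rho>) g = of_real \<rho> * circ (\<lambda>t. g (rcis \<rho> t) * cis t)"
proof -
  have "contour_integral (circlepath 0 \<rho>) g = integral {0..2*pi} (\<lambda>t. g (0 + of_real \<rho> * cis t) * of_real \<rho> * \<i> * cis t)"
    unfolding circlepath_def by (rule contour_integral_part_circlepath_eq) simp
  also have "\<dots> = integral {0..2*pi} (\<lambda>t. (of_real \<rho> * \<i>) * (g (rcis \<rho> t) * cis t))"
    by (simp add: rcis_def mult_ac)
  also have "\<dots> = (of_real \<rho> * \<i>) * integral {0..2*pi} (\<lambda>t. g (rcis \<rho> t) * cis t)"
    by simp
  finally show ?thesis by (simp add: circ_def field_simps)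
qed

text \<open>Only opposite frequencies pair. On the inner circle \<open>h1\<close> has no negative
  index, so the \<open>v\<close> half of \<open>f\<close> drops out; on the outer circle
  \<open>h2\<close> has only negative ones, and the \<open>u\<close> half drops out.\<close>

lemma J_map_hann:
  assumes r: "0 < r" "r < R" and vu: "l2 v" "l2 u" and xy: "l2 x" "l2 y"
  shows "J_map r R (hdisc r x, hext R y) (hann r R v u) = of_real r * (\<Sum>n. u n * x n) + of_real R * (\<Sum>n. v n * y n)"
proof -
  have rR: "r / R < 1" "0 < r / R" "0 < R" using r by auto
  have "circ (\<lambda>t. bv_outside (hann r R v u) (rcis r t) * (cis t * bv_inside (hdisc r x) (rcis r t))) = (\<Sum>n. u n * x n)"
  proof (rule bconv_tf_pairing[OF hann_bconv(2)[OF r vu] hdisc_bconv[OF r(1) xy(1)]])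
    show "\<forall>\<^sub>F s in at_left 1. asum (\<lambda>n. v n * of_real (r / (s * R)) ^ n) \<and> asum (\<lambda>n. u n * of_real s ^ Suc n) \<and>
        (\<forall>t. hann r R v u (of_real (inverse s) * rcis r t) = tf (\<lambda>n. v n * of_real (r / (s * R)) ^ n) (\<lambda>n. u n * of_real s ^ Suc n) t) \<and>
        asum (\<lambda>n. x n * of_real s ^ n) \<and> asum (\<lambda>n. 0) \<and>
        (\<forall>t. hdisc r x (of_real s * rcis r t) = tf (\<lambda>n. x n * of_real s ^ n) (\<lambda>n. 0) t) \<and>
        (\<forall>n. (v n * of_real (r / (s * R)) ^ n) * 0 + (u n * of_real s ^ Suc n) * (x n * of_real s ^ n) = (u n * x n) * of_real s ^ (Suc n + n))" (is "eventually ?P _")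
    proof (rule eventually_left_1[OF rR(1)])
      fix s assume s: "r / R < s" "s < 1"
      have s0: "0 < s" using rR(2) s(1) by (rule less_trans)
      note T = hann_tf_inner[OF r vu s] hdisc_tf_bv[OF r(1) xy(1) s0 s(2)]
      show "?P s" by (intro conjI allI T asum_zero) (simp add: power_add)
    qed
    show "asum (\<lambda>n. u n * x n)" by (intro l2_mult vu xy)
  qed
  moreover have "circ (\<lambda>t. bv_inside (hann r R v u) (rcis R t) * (cis t * bv_outside (hext R y) (rcis R t))) = (\<Sum>n. v n * y n)"
  proof (rule bconv_tf_pairing[OF hann_bconv(1)[OF r vu] hext_bconv[OF rR(3) xy(2)]])
    show "\<forall>\<^sub>F s in at_left 1. asum (\<lambda>n. v n * of_real s ^ n) \<and> asum (\<lambda>n. u n * of_real (r / (s * R)) ^ Suc n) \<and>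
        (\<forall>t. hann r R v u (of_real s * rcis R t) = tf (\<lambda>n. v n * of_real s ^ n) (\<lambda>n. u n * of_real (r / (s * R)) ^ Suc n) t) \<and>
        asum (\<lambda>n. 0) \<and> asum (\<lambda>n. y n * of_real s ^ Suc n) \<and>
        (\<forall>t. hext R y (of_real (inverse s) * rcis R t) = tf (\<lambda>n. 0) (\<lambda>n. y n * of_real s ^ Suc n) t) \<and>
        (\<forall>n. (v n * of_real s ^ n) * (y n * of_real s ^ Suc n) + (u n * of_real (r / (s * R)) ^ Suc n) * 0 = (v n * y n) * of_real s ^ (Suc n + n))" (is "eventually ?P _")
    proof (rule eventually_left_1[OF rR(1)])
      fix s assume s: "r / R < s" "s < 1"
      have s0: "0 < s" using rR(2) s(1) by (rule less_trans)
      note T = hann_tf_outer[OF r vu s] hext_tf_bv[OF rR(3) xy(2) s0 s(2)]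
      show "?P s" by (intro conjI allI T asum_zero) (simp add: power_add)
    qed
    show "asum (\<lambda>n. v n * y n)" by (intro l2_mult vu xy)
  qed
  moreover have "J_map r R (hdisc r x, hext R y) (hann r R v u) =
      of_real r * circ (\<lambda>t. (bv_outside (hann r R v u) (rcis r t) * bv_inside (hdisc r x) (rcis r t)) * cis t) +
      of_real R * circ (\<lambda>t. (bv_inside (hann r R v u) (rcis R t) * bv_outside (hext R y) (rcis R t)) * cis t)"
    unfolding J_map_def zero_ext_def prod.case contour_integral_circ using hann_mem[OF r vu] by simp
  ultimately show ?thesis by (simp add: mult_ac)
qed

lemma J_map_zero: "f \<notin> H2_annulus r R \<Longrightarrow> J_map r R h f = 0"
  by (cases h) (simp add: J_map_def zero_ext_def)

lemma H2_annulus_cases: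
  assumes "0 < r" "r < R" "f \<in> H2_annulus r R"
  obtains v u where "l2 v" "l2 u" "f = hann r R v u"
  using H2_annulus_repr[OF assms, of "(r + R) / 2"] assms(2) that by simp

lemma H2_sum_cases:
  assumes "0 < r" "0 < R" "h \<in> H2_sum r R"
  obtains x y where "l2 x" "l2 y" "h = (hdisc r x, hext R y)"
proof -
  obtain h1 h2 where h: "h = (h1, h2)" "h1 \<in> H2_disc r" "h2 \<in> H2_0_ext R"
    using assms(3) by (auto simp: H2_sum_def)
  obtain x where "l2 x" "h1 = hdisc r x" using H2_disc_repr[OF assms(1) h(2)] .
  moreover obtain y where "l2 y" "h2 = hext R y" using H2_0_ext_repr[OF assms(2) h(3)] .
  ultimately show ?thesis using that h by blast
qed

lemma hann_add:
  assumes "0 < r" "r < R" "l2 v" "l2 u" "l2 v'" "l2 u'"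
  shows "(\<lambda>z. hann r R v u z + hann r R v' u' z) = hann r R (\<lambda>n. v n + v' n) (\<lambda>n. u n + u' n)"
proof
  fix z
  show "hann r R v u z + hann r R v' u' z = hann r R (\<lambda>n. v n + v' n) (\<lambda>n. u n + u' n) z"
  proof (cases "z \<in> annulus r R")
    case True
    then have z: "r < cmod z" "cmod z < R" by (auto simp: annulus_def)
    then have "cmod z > 0" using assms(1) by linarith
    then have "cmod (z / of_real R) < 1" "cmod (of_real r / z) < 1"
      using z assms by (simp_all add: norm_divide divide_less_eq)
    then show ?thesis using assms True
      by (simp add: hann_def zero_ext_def pw_add distrib_left add_divide_distrib)
  qed (simp add: hann_def zero_ext_def)
qed

lemma hann_cmult:
  assumes "0 < r" "r < R" "l2 v" "l2 u"
  shows "(\<lambda>z. c * hann r R v u z) = hann r R (\<lambda>n. c * v n) (\<lambda>n. c * u n)"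
proof
  fix z
  show "c * hann r R v u z = hann r R (\<lambda>n. c * v n) (\<lambda>n. c * u n) z"
  proof (cases "z \<in> annulus r R")
    case True
    then have z: "r < cmod z" "cmod z < R" by (auto simp: annulus_def)
    then have "cmod z > 0" using assms(1) by linarith
    then have "cmod (z / of_real R) < 1" "cmod (of_real r / z) < 1"
      using z assms by (simp_all add: norm_divide divide_less_eq)
    then show ?thesis using assms True
      by (simp add: hann_def zero_ext_def pw_cmult distrib_left mult_ac)
  qed (simp add: hann_def zero_ext_def)
qed

lemma hdisc_add: "0 < r \<Longrightarrow> l2 x \<Longrightarrow> l2 x' \<Longrightarrow> (\<lambda>z. hdisc r x z + hdisc r x' z) = hdisc r (\<lambda>n. x n + x' n)"
  by (rule ext) (simp add: hdisc_def zero_ext_def pw_add norm_divide)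

lemma hdisc_cmult: "0 < r \<Longrightarrow> l2 x \<Longrightarrow> (\<lambda>z. c * hdisc r x z) = hdisc r (\<lambda>n. c * x n)"
  by (rule ext) (simp add: hdisc_def zero_ext_def pw_cmult norm_divide)

lemma ext_disc_ratio: "0 < R \<Longrightarrow> z \<in> ext_disc R \<Longrightarrow> cmod (of_real R / z) < 1"
proof -
  assume "0 < R" "z \<in> ext_disc R"
  then have "R < cmod z" "0 < R" by (simp_all add: ext_disc_def)
  moreover have "0 < cmod z" using calculation by linarith
  ultimately show ?thesis by (simp add: norm_divide divide_less_eq)
qed

lemma hext_add: "0 < R \<Longrightarrow> l2 y \<Longrightarrow> l2 y' \<Longrightarrow> (\<lambda>z. hext R y z + hext R y' z) = hext R (\<lambda>n. y n + y' n)"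
  by (rule ext) (simp add: hext_def zero_ext_def pw_add ext_disc_ratio distrib_left add_divide_distrib)

lemma hext_cmult: "0 < R \<Longrightarrow> l2 y \<Longrightarrow> (\<lambda>z. c * hext R y z) = hext R (\<lambda>n. c * y n)"
  by (rule ext) (simp add: hext_def zero_ext_def pw_cmult ext_disc_ratio mult_ac)

text \<open>Cauchy-Schwarz bounds both coefficient series by the product of the norms, and
  \<open>r < R\<close> makes \<open>R\<close> a common factor for them.\<close>

lemma J_map_bound:
  assumes r: "0 < r" "r < R" and h: "h \<in> H2_sum r R" and f: "f \<in> H2_annulus r R"
  shows "cmod (J_map r R h f) \<le> (2 * R * norm_H2_sum r R h) * norm_H2_annulus r R f"
proof -
  have R: "0 < R" using r by simp
  obtain v u where vu: "l2 v" "l2 u" "f = hann r R v u" using H2_annulus_cases[OF r f] .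
  obtain x y where xy: "l2 x" "l2 y" "h = (hdisc r x, hext R y)" using H2_sum_cases[OF r(1) R h] .
  define N where "N = norm_H2_annulus r R f"
  define H where "H = norm_H2_sum r R h"
  have "H\<^sup>2 = n2 x + n2 y"
    using norm_sum_sq[OF r(1) R xy(1,2)] unfolding H_def xy(3) .
  moreover have "0 \<le> H"
    unfolding H_def xy(3) by (simp add: norm_H2_sum_def)
  ultimately have H: "H\<^sup>2 = n2 x + n2 y" "0 \<le> H" by auto
  have N: "n2 v + n2 u \<le> N\<^sup>2" "0 \<le> N"
    using norm_hann_lower[OF r vu(1,2)] unfolding N_def vu(3) by (simp_all add: norm_H2_annulus_nonneg)
  have nn: "0 \<le> n2 x" "0 \<le> n2 y" "0 \<le> n2 v" "0 \<le> n2 u" using xy vu by (auto intro: n2_nonneg)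
  have le: "sqrt (n2 u) \<le> N" "sqrt (n2 v) \<le> N" "sqrt (n2 x) \<le> H" "sqrt (n2 y) \<le> H"
    using N H nn by (auto intro!: real_le_lsqrt)
  have sb: "cmod (\<Sum>n. a n * b n) \<le> N * H" if "l2 a" "l2 b" "sqrt (n2 a) \<le> N" "sqrt (n2 b) \<le> H" for a b
  proof -
    have "cmod (\<Sum>n. a n * b n) \<le> (\<Sum>n. cmod (a n * b n))"
      using l2_mult(1)[OF that(1,2)] by (intro summable_norm) (simp add: asum_def)
    also have "\<dots> \<le> sqrt (n2 a) * sqrt (n2 b)" by (rule l2_mult(2)[OF that(1,2)])
    also have "\<dots> \<le> N * H" using that N n2_nonneg by (intro mult_mono) auto
    finally show ?thesis .
  qed
  have "cmod (J_map r R h f) \<le> cmod (of_real r * (\<Sum>n. u n * x n)) + cmod (of_real R * (\<Sum>n. v n * y n))"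
    unfolding xy(3) vu(3) J_map_hann[OF r vu(1,2) xy(1,2)] by (rule norm_triangle_ineq)
  also have "\<dots> \<le> R * (N * H) + R * (N * H)"
    unfolding norm_mult using r R sb[OF vu(2) xy(1)] sb[OF vu(1) xy(2)] le N H
    by (intro add_mono mult_mono) auto
  finally show ?thesis unfolding N_def H_def by (simp add: algebra_simps)
qed

lemma J_map_dual:
  assumes r: "0 < r" "r < R" and h: "h \<in> H2_sum r R"
  shows "J_map r R h \<in> H2_dual r R"
  unfolding H2_dual_def
proof (intro CollectI conjI allI impI ballI)
  have R: "0 < R" using r by simp
  obtain x y where xy: "l2 x" "l2 y" "h = (hdisc r x, hext R y)" using H2_sum_cases[OF r(1) R h] .
  show "J_map r R h f = 0" if "f \<notin> H2_annulus r R" for f using that by (rule J_map_zero)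
  show "\<exists>B. \<forall>f\<in>H2_annulus r R. cmod (J_map r R h f) \<le> B * norm_H2_annulus r R f"
    using J_map_bound[OF r h] by blast
  fix f assume f: "f \<in> H2_annulus r R"
  obtain v u where vu: "l2 v" "l2 u" "f = hann r R v u" using H2_annulus_cases[OF r f] .
  show "J_map r R h (\<lambda>z. c * f z) = c * J_map r R h f" for c
    unfolding vu(3) hann_cmult[OF r vu(1,2)] xy(3)
    using suminf_mult[OF asum_summable[OF l2_mult(1)[OF vu(1) xy(2)]], of c]
          suminf_mult[OF asum_summable[OF l2_mult(1)[OF vu(2) xy(1)]], of c]
    by (simp add: J_map_hann r vu xy l2_cmult algebra_simps)
  fix g assume g: "g \<in> H2_annulus r R"
  obtain v' u' where vu': "l2 v'" "l2 u'" "g = hann r R v' u'" using H2_annulus_cases[OF r g] .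
  show "J_map r R h (\<lambda>z. f z + g z) = J_map r R h f + J_map r R h g"
    unfolding vu(3) vu'(3) hann_add[OF r vu(1,2) vu'(1,2)] xy(3)
    using suminf_add[OF asum_summable[OF l2_mult(1)[OF vu(1) xy(2)]] asum_summable[OF l2_mult(1)[OF vu'(1) xy(2)]], symmetric]
          suminf_add[OF asum_summable[OF l2_mult(1)[OF vu(2) xy(1)]] asum_summable[OF l2_mult(1)[OF vu'(2) xy(1)]], symmetric]
    by (simp add: J_map_hann r vu vu' xy l2_add algebra_simps)
qed

definition dl :: "nat \<Rightarrow> nat \<Rightarrow> complex" where
  "dl m = (\<lambda>n. if n = m then 1 else 0)"

lemma dl_l2 [simp]: "l2 (dl m)"
proof -
  have "(\<lambda>n. (cmod (dl m n))\<^sup>2) = (\<lambda>n. if n = m then 1 else 0)"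
    by (auto simp: dl_def)
  then show ?thesis
    unfolding l2_def using sums_single[of m "\<lambda>_. 1 :: real"] by (simp add: sums_iff)
qed

lemma suminf_dl: "(\<Sum>n. dl m n * x n) = x m"
  using sums_single[of m x] by (simp add: dl_def sums_iff if_distribR if_distrib cong: if_cong)

lemma J_map_dl:
  assumes r: "0 < r" "r < R" and xy: "l2 x" "l2 y"
  shows "J_map r R (hdisc r x, hext R y) (hann r R (\<lambda>n. 0) (dl m)) = of_real r * x m"
    "J_map r R (hdisc r x, hext R y) (hann r R (dl m) (\<lambda>n. 0)) = of_real R * y m"
  by (simp_all add: J_map_hann r xy suminf_dl)

text \<open>Functionals are tested on single Laurent monomials, which read off one coordinate
  each.\<close>

lemma J_map_inj:
  assumes r: "0 < r" "r < R"
  shows "inj_on (J_map r R) (H2_sum r R)"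
proof (rule inj_onI)
  have R: "0 < R" using r by simp
  fix h k assume h: "h \<in> H2_sum r R" and k: "k \<in> H2_sum r R" and eq: "J_map r R h = J_map r R k"
  obtain x y where xy: "l2 x" "l2 y" "h = (hdisc r x, hext R y)" using H2_sum_cases[OF r(1) R h] .
  obtain x' y' where xy': "l2 x'" "l2 y'" "k = (hdisc r x', hext R y')" using H2_sum_cases[OF r(1) R k] .
  have "x m = x' m" for m
    using fun_cong[OF eq, of "hann r R (\<lambda>n. 0) (dl m)"] r unfolding xy(3) xy'(3) by (simp add: J_map_dl r xy xy')
  moreover have "y m = y' m" for m
    using fun_cong[OF eq, of "hann r R (dl m) (\<lambda>n. 0)"] R unfolding xy(3) xy'(3) by (simp add: J_map_dl r xy xy')
  ultimately have "x = x'" "y = y'" by auto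
  then show "h = k" using xy xy' by simp
qed

definition trunc :: "nat \<Rightarrow> (nat \<Rightarrow> complex) \<Rightarrow> nat \<Rightarrow> complex" where
  "trunc N a = (\<lambda>n. if n < N then a n else 0)"

lemma trunc_sums: "f 0 = 0 \<Longrightarrow> (\<lambda>n. f (trunc N a n)) sums (\<Sum>n<N. f (a n))"
proof -
  assume "f 0 = 0"
  then have "(\<lambda>n. f (trunc N a n)) = (\<lambda>n. if n \<in> {..<N} then f (a n) else 0)"
    by (auto simp: trunc_def)
  then show ?thesis using sums_If_finite_set[of "{..<N}" "\<lambda>n. f (a n)"] by simp
qed

lemma trunc_l2 [simp]: "l2 (trunc N a)" "n2 (trunc N a) = (\<Sum>n<N. (cmod (a n))\<^sup>2)"
  using trunc_sums[of "\<lambda>c. (cmod c)\<^sup>2" N a] by (auto simp: l2_def n2_def sums_iff)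

lemma dual_trunc:
  assumes r: "0 < r" "r < R" and l: "l \<in> H2_dual r R"
  shows "l (hann r R (trunc N v) (trunc N u)) =
    (\<Sum>n<N. v n * l (hann r R (dl n) (\<lambda>n. 0)) + u n * l (hann r R (\<lambda>n. 0) (dl n)))"
proof (induction N)
  have add: "l (\<lambda>z. f z + g z) = l f + l g" if "f \<in> H2_annulus r R" "g \<in> H2_annulus r R" for f g
    using l that by (auto simp: H2_dual_def)
  have cm: "l (\<lambda>z. c * f z) = c * l f" if "f \<in> H2_annulus r R" for f c
    using l that by (auto simp: H2_dual_def)
  {
    case 0
    \<comment> \<open>The dual space has no clause for the zero function; that \<open>l\<close>
      vanishes there comes from homogeneity with the factor 0.\<close>
    have "hann r R (trunc 0 v) (trunc 0 u) = (\<lambda>z. 0 * hann r R (trunc 0 v) (trunc 0 u) z)"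
      by (subst hann_cmult[OF r]) (simp_all add: trunc_def)
    then have "l (hann r R (trunc 0 v) (trunc 0 u)) = 0 * l (hann r R (trunc 0 v) (trunc 0 u))"
      using cm[OF hann_mem[OF r], of "trunc 0 v" "trunc 0 u" 0] by simp
    then show ?case by simp
  next
    case (Suc N)
    have "hann r R (trunc (Suc N) v) (trunc (Suc N) u) =
      hann r R (\<lambda>n. trunc N v n + (v N * dl N n + u N * 0)) (\<lambda>n. trunc N u n + (v N * 0 + u N * dl N n))"
      by (rule arg_cong2[where f="hann r R"]) (auto simp: trunc_def dl_def fun_eq_iff less_Suc_eq)
    also have "\<dots> = (\<lambda>z. hann r R (trunc N v) (trunc N u) z +
        hann r R (\<lambda>n. v N * dl N n + u N * 0) (\<lambda>n. v N * 0 + u N * dl N n) z)"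
      by (rule hann_add[OF r, symmetric]) (auto intro!: l2_add l2_cmult(1) l2_zero(1))
    finally have "l (hann r R (trunc (Suc N) v) (trunc (Suc N) u)) = l (hann r R (trunc N v) (trunc N u)) +
        l (hann r R (\<lambda>n. v N * dl N n + u N * 0) (\<lambda>n. v N * 0 + u N * dl N n))"
      by (simp only:) (intro add hann_mem r l2_add l2_cmult(1) l2_zero(1) dl_l2 trunc_l2(1))
    also have "hann r R (\<lambda>n. v N * dl N n + u N * 0) (\<lambda>n. v N * 0 + u N * dl N n) =
        (\<lambda>z. hann r R (\<lambda>n. v N * dl N n) (\<lambda>n. v N * 0) z + hann r R (\<lambda>n. u N * 0) (\<lambda>n. u N * dl N n) z)"
      by (intro hann_add[OF r, symmetric] l2_cmult(1) l2_zero(1) dl_l2)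
    also have "l \<dots> = l (hann r R (\<lambda>n. v N * dl N n) (\<lambda>n. v N * 0)) + l (hann r R (\<lambda>n. u N * 0) (\<lambda>n. u N * dl N n))"
      by (intro add hann_mem r l2_cmult(1) l2_zero(1) dl_l2)
    also have "hann r R (\<lambda>n. v N * dl N n) (\<lambda>n. v N * 0) = (\<lambda>z. v N * hann r R (dl N) (\<lambda>n. 0) z)"
      by (intro hann_cmult[OF r, symmetric] l2_zero(1) dl_l2)
    also have "l \<dots> = v N * l (hann r R (dl N) (\<lambda>n. 0))"
      by (intro cm hann_mem r l2_zero(1) dl_l2)
    also have "hann r R (\<lambda>n. u N * 0) (\<lambda>n. u N * dl N n) = (\<lambda>z. u N * hann r R (\<lambda>n. 0) (dl N) z)"
      by (intro hann_cmult[OF r, symmetric] l2_zero(1) dl_l2)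
    also have "l \<dots> = u N * l (hann r R (\<lambda>n. 0) (dl N))"
      by (intro cm hann_mem r l2_zero(1) dl_l2)
    finally show ?case using Suc by simp
  }
qed


text \<open>Riesz representation in coordinates: the values of \<open>l\<close> on monomials are the
  only candidates for \<open>x\<close> and \<open>y\<close>. They are square summable because
  \<open>l\<close> is bounded, and they represent \<open>l\<close> because truncations are
  dense.\<close>

lemma J_map_surj:
  assumes r: "0 < r" "r < R" and l: "l \<in> H2_dual r R"
  shows "\<exists>h\<in>H2_sum r R. J_map r R h = l"
proof -
  have R: "0 < R" using r by simp
  define x where "x = (\<lambda>n. l (hann r R (\<lambda>n. 0) (dl n)) / of_real r)"
  define y where "y = (\<lambda>n. l (hann r R (dl n) (\<lambda>n. 0)) / of_real R)"
  have add: "l (\<lambda>z. f z + g z) = l f + l g" if "f \<in> H2_annulus r R" "g \<in> H2_annulus r R" for f g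
    using l that by (auto simp: H2_dual_def)
  obtain B0 where "\<forall>f\<in>H2_annulus r R. cmod (l f) \<le> B0 * norm_H2_annulus r R f"
    using l unfolding H2_dual_def by blast
  then have B0: "cmod (l f) \<le> B0 * norm_H2_annulus r R f" if "f \<in> H2_annulus r R" for f
    using that by blast
  define B where "B = \<bar>B0\<bar>"
  have B: "cmod (l f) \<le> B * norm_H2_annulus r R f" if "f \<in> H2_annulus r R" for f
    unfolding B_def by (rule order_trans[OF B0[OF that]]) (simp add: mult_right_mono norm_H2_annulus_nonneg)
  have tr: "l (hann r R (trunc N v) (trunc N u)) = (\<Sum>n<N. of_real R * (v n * y n) + of_real r * (u n * x n))" for N v u
    unfolding dual_trunc[OF r l] using r R by (intro sum.cong) (simp_all add: x_def y_def)
  \<comment> \<open>Testing on the truncated conjugates gives r S <= B |f| and |f|^2 <= 2 S, where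
    |f| is the norm on the annulus; squaring and cancelling S leaves a bound uniform in
    \<open>N\<close>.\<close>
  have bound: "(\<Sum>n<N. (cmod (y n))\<^sup>2 + (cmod (x n))\<^sup>2) \<le> 2 * B\<^sup>2 / r\<^sup>2" for N
  proof -
    define S where "S = (\<Sum>n<N. (cmod (y n))\<^sup>2 + (cmod (x n))\<^sup>2)"
    define f where "f = hann r R (trunc N (\<lambda>n. cnj (y n))) (trunc N (\<lambda>n. cnj (x n)))"
    have f: "f \<in> H2_annulus r R" unfolding f_def by (intro hann_mem r) auto
    have S0: "0 \<le> S" unfolding S_def by (intro sum_nonneg) auto
    have "l f = of_real (\<Sum>n<N. R * (cmod (y n))\<^sup>2 + r * (cmod (x n))\<^sup>2)"
      unfolding f_def tr by (simp add: complex_norm_square mult.commute del: of_real_power)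
    then have "cmod (l f) = (\<Sum>n<N. R * (cmod (y n))\<^sup>2 + r * (cmod (x n))\<^sup>2)"
      using r R by (simp only: norm_of_real) (intro abs_of_nonneg sum_nonneg, auto)
    moreover have "r * S \<le> (\<Sum>n<N. R * (cmod (y n))\<^sup>2 + r * (cmod (x n))\<^sup>2)"
      unfolding S_def sum_distrib_left using r by (intro sum_mono) (auto simp: distrib_left intro!: mult_right_mono)
    ultimately have 1: "r * S \<le> B * norm_H2_annulus r R f" using B[OF f] by linarith
    have "(norm_H2_annulus r R f)\<^sup>2 \<le> 2 * S"
      unfolding f_def S_def using norm_hann_upper[OF r trunc_l2(1) trunc_l2(1), of N "\<lambda>n. cnj (y n)" N "\<lambda>n. cnj (x n)"]
      by (simp add: sum.distrib)
    then have "B\<^sup>2 * (norm_H2_annulus r R f)\<^sup>2 \<le> B\<^sup>2 * (2 * S)" by (intro mult_left_mono) auto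
    moreover have "(r * S)\<^sup>2 \<le> (B * norm_H2_annulus r R f)\<^sup>2"
      using 1 r S0 by (intro power_mono) auto
    ultimately have "r\<^sup>2 * S * S \<le> 2 * B\<^sup>2 * S" by (simp add: power_mult_distrib power2_eq_square mult_ac)
    then have "r\<^sup>2 * S \<le> 2 * B\<^sup>2" using S0 by (cases "S = 0") (auto simp: mult_le_cancel_right)
    then show ?thesis unfolding S_def using r by (simp add: field_simps)
  qed
  have x: "l2 x"
  proof (rule l2_from_bounded_sums(1))
    show "(\<Sum>n<N. (cmod (x n))\<^sup>2) \<le> 2 * B\<^sup>2 / r\<^sup>2" for N
      by (rule order_trans[OF _ bound[of N]]) (auto intro: sum_mono)
  qed
  have y: "l2 y"
  proof (rule l2_from_bounded_sums(1))
    show "(\<Sum>n<N. (cmod (y n))\<^sup>2) \<le> 2 * B\<^sup>2 / r\<^sup>2" for N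
      by (rule order_trans[OF _ bound[of N]]) (auto intro: sum_mono)
  qed
  have "J_map r R (hdisc r x, hext R y) f = l f" for f
  proof (cases "f \<in> H2_annulus r R")
    case False
    then show ?thesis using l by (simp add: J_map_zero H2_dual_def)
  next
    case True
    obtain v u where vu: "l2 v" "l2 u" "f = hann r R v u" using H2_annulus_cases[OF r True] .
    have split: "l f - l (hann r R (trunc N v) (trunc N u)) = l (hann r R (tl2 N v) (tl2 N u))" for N
    proof -
      have "f = hann r R (\<lambda>n. trunc N v n + tl2 N v n) (\<lambda>n. trunc N u n + tl2 N u n)"
        unfolding vu(3) by (rule arg_cong2[where f="hann r R"]) (auto simp: trunc_def tl2_def)
      also have "\<dots> = (\<lambda>z. hann r R (trunc N v) (trunc N u) z + hann r R (tl2 N v) (tl2 N u) z)"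
        using vu r by (simp add: hann_add)
      finally have "l f = l (hann r R (trunc N v) (trunc N u)) + l (hann r R (tl2 N v) (tl2 N u))"
        using vu r by (simp add: add hann_mem)
      then show ?thesis by simp
    qed
    \<comment> \<open>Continuity of \<open>l\<close> along truncations: the remainder is the
      function of the tails, whose norm tends to 0.\<close>
    have "(\<lambda>N. l f - l (hann r R (trunc N v) (trunc N u))) \<longlonglongrightarrow> 0"
    proof (rule Lim_null_comparison)
      show "\<forall>\<^sub>F N in sequentially. norm (l f - l (hann r R (trunc N v) (trunc N u))) \<le> B * sqrt (2 * (n2 (tl2 N v) + n2 (tl2 N u)))"
      proof (intro always_eventually allI)
        fix N
        have "norm_H2_annulus r R (hann r R (tl2 N v) (tl2 N u)) \<le> sqrt (2 * (n2 (tl2 N v) + n2 (tl2 N u)))"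
          using vu by (intro real_le_rsqrt norm_hann_upper r tl2_l2)
        then have "B * norm_H2_annulus r R (hann r R (tl2 N v) (tl2 N u)) \<le> B * sqrt (2 * (n2 (tl2 N v) + n2 (tl2 N u)))"
          by (intro mult_left_mono) (auto simp: B_def)
        then show "norm (l f - l (hann r R (trunc N v) (trunc N u))) \<le> B * sqrt (2 * (n2 (tl2 N v) + n2 (tl2 N u)))"
          unfolding split using vu by (intro order_trans[OF B] hann_mem r tl2_l2)
      qed
      have "(\<lambda>N. B * sqrt (2 * (n2 (tl2 N v) + n2 (tl2 N u)))) \<longlonglongrightarrow> B * sqrt (2 * (0 + 0))"
        by (intro tendsto_intros n2_tl2_tendsto vu)
      then show "(\<lambda>N. B * sqrt (2 * (n2 (tl2 N v) + n2 (tl2 N u)))) \<longlonglongrightarrow> 0" by simp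
    qed
    then have "(\<lambda>N. l f - (l f - l (hann r R (trunc N v) (trunc N u)))) \<longlonglongrightarrow> l f - 0"
      by (intro tendsto_intros)
    then have "(\<lambda>N. \<Sum>n<N. of_real R * (v n * y n) + of_real r * (u n * x n)) \<longlonglongrightarrow> l f"
      by (simp add: tr)
    then have "(\<lambda>n. of_real R * (v n * y n) + of_real r * (u n * x n)) sums l f"
      by (simp add: sums_def)
    moreover have "(\<lambda>n. of_real R * (v n * y n) + of_real r * (u n * x n)) sums
        (of_real R * (\<Sum>n. v n * y n) + of_real r * (\<Sum>n. u n * x n))"
      using vu x y by (intro sums_add sums_mult summable_sums asum_summable l2_mult)
    ultimately have "l f = of_real R * (\<Sum>n. v n * y n) + of_real r * (\<Sum>n. u n * x n)"
      by (rule sums_unique2)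
    then show ?thesis unfolding vu(3) J_map_hann[OF r vu(1,2) x y] by simp
  qed
  then have "J_map r R (hdisc r x, hext R y) = l" by (rule ext)
  moreover have "(hdisc r x, hext R y) \<in> H2_sum r R"
    using x y r R by (simp add: H2_sum_def hdisc_mem hext_mem)
  ultimately show ?thesis by blast
qed

theorem J_map_isomorphism:
  assumes r: "0 < r" "r < R"
  shows "is_H2_dual_isomorphism r R (J_map r R)"
  unfolding is_H2_dual_isomorphism_def
proof (intro conjI)
  have R: "0 < R" using r by simp
  show "bij_betw (J_map r R) (H2_sum r R) (H2_dual r R)"
    unfolding bij_betw_def using J_map_inj[OF r] J_map_dual[OF r] J_map_surj[OF r] by blast
  show "\<forall>(h1, h2)\<in>H2_sum r R. \<forall>(k1, k2)\<in>H2_sum r R.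
        J_map r R (\<lambda>z. h1 z + k1 z, \<lambda>z. h2 z + k2 z) = (\<lambda>f. J_map r R (h1, h2) f + J_map r R (k1, k2) f)"
  proof (clarify, rule ext)
    fix h1 h2 k1 k2 f assume "(h1, h2) \<in> H2_sum r R" "(k1, k2) \<in> H2_sum r R"
    then obtain x y x' y' where xy: "l2 x" "l2 y" "h1 = hdisc r x" "h2 = hext R y"
       and xy': "l2 x'" "l2 y'" "k1 = hdisc r x'" "k2 = hext R y'"
      by (metis H2_sum_cases[OF r(1) R] prod.inject)
    show "J_map r R (\<lambda>z. h1 z + k1 z, \<lambda>z. h2 z + k2 z) f = J_map r R (h1, h2) f + J_map r R (k1, k2) f"
    proof (cases "f \<in> H2_annulus r R")
      case True
      obtain v u where vu: "l2 v" "l2 u" "f = hann r R v u" using H2_annulus_cases[OF r True] .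
      show ?thesis
        unfolding xy(3,4) xy'(3,4) vu(3) hdisc_add[OF r(1) xy(1) xy'(1)] hext_add[OF R xy(2) xy'(2)]
        using suminf_add[OF asum_summable[OF l2_mult(1)[OF vu(1) xy(2)]] asum_summable[OF l2_mult(1)[OF vu(1) xy'(2)]], symmetric]
          suminf_add[OF asum_summable[OF l2_mult(1)[OF vu(2) xy(1)]] asum_summable[OF l2_mult(1)[OF vu(2) xy'(1)]], symmetric]
        by (simp add: J_map_hann r vu xy xy' l2_add algebra_simps)
    qed (simp add: J_map_zero)
  qed
  show "\<forall>c. \<forall>(h1, h2)\<in>H2_sum r R. J_map r R (\<lambda>z. c * h1 z, \<lambda>z. c * h2 z) = (\<lambda>f. c * J_map r R (h1, h2) f)"
  proof (clarify, rule ext)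
    fix c h1 h2 f assume "(h1, h2) \<in> H2_sum r R"
    then obtain x y where xy: "l2 x" "l2 y" "h1 = hdisc r x" "h2 = hext R y"
      by (metis H2_sum_cases[OF r(1) R] prod.inject)
    show "J_map r R (\<lambda>z. c * h1 z, \<lambda>z. c * h2 z) f = c * J_map r R (h1, h2) f"
    proof (cases "f \<in> H2_annulus r R")
      case True
      obtain v u where vu: "l2 v" "l2 u" "f = hann r R v u" using H2_annulus_cases[OF r True] .
      show ?thesis
        unfolding xy(3,4) vu(3) hdisc_cmult[OF r(1) xy(1)] hext_cmult[OF R xy(2)]
        using suminf_mult[OF asum_summable[OF l2_mult(1)[OF vu(1) xy(2)]], of c]
          suminf_mult[OF asum_summable[OF l2_mult(1)[OF vu(2) xy(1)]], of c]
        by (simp add: J_map_hann r vu xy l2_cmult algebra_simps)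
    qed (simp add: J_map_zero)
  qed
  show "\<exists>a>0. \<exists>b. \<forall>h\<in>H2_sum r R. a * norm_H2_sum r R h \<le> norm_H2_dual r R (J_map r R h) \<and>
        norm_H2_dual r R (J_map r R h) \<le> b * norm_H2_sum r R h"
  proof (rule exI[of _ "r / 2"], rule conjI, use r in simp, rule exI[of _ "2 * R"], intro ballI conjI)
    fix h assume h: "h \<in> H2_sum r R"
    define W where "W = {norm (J_map r R h f) | f. f \<in> H2_annulus r R \<and> norm_H2_annulus r R f \<le> 1}"
    have dn: "norm_H2_dual r R (J_map r R h) = Sup W" by (simp add: norm_H2_dual_def W_def)
    have H0: "0 \<le> norm_H2_sum r R h" by (cases h) (simp add: norm_H2_sum_def)
    have up: "w \<le> 2 * R * norm_H2_sum r R h" if w: "w \<in> W" for w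
    proof -
      obtain f where f: "f \<in> H2_annulus r R" "norm_H2_annulus r R f \<le> 1" "w = norm (J_map r R h f)"
        using w by (auto simp: W_def)
      have "w \<le> (2 * R * norm_H2_sum r R h) * norm_H2_annulus r R f"
        unfolding f(3) by (rule J_map_bound[OF r h f(1)])
      also have "\<dots> \<le> (2 * R * norm_H2_sum r R h) * 1"
        using f(2) R H0 by (intro mult_left_mono) auto
      finally show ?thesis by simp
    qed
    then have bdd: "bdd_above W" by (auto simp: bdd_above_def)
    have inW: "norm (J_map r R h (hann r R v u)) \<in> W" if "l2 v" "l2 u" "2 * (n2 v + n2 u) \<le> 1" for v u
    proof -
      have "(norm_H2_annulus r R (hann r R v u))\<^sup>2 \<le> 1\<^sup>2"
        using norm_hann_upper[OF r that(1,2)] that(3) by simp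
      then have "norm_H2_annulus r R (hann r R v u) \<le> 1"
        by (rule power2_le_imp_le) simp
      then show ?thesis using hann_mem[OF r that(1,2)] by (auto simp: W_def)
    qed
    have ne: "W \<noteq> {}" using inW[of "\<lambda>n. 0" "\<lambda>n. 0"] by auto
    show "norm_H2_dual r R (J_map r R h) \<le> 2 * R * norm_H2_sum r R h"
      unfolding dn using ne up by (rule cSup_least)
    show "r / 2 * norm_H2_sum r R h \<le> norm_H2_dual r R (J_map r R h)"
    proof (cases "norm_H2_sum r R h = 0")
      case True
      have "0 \<le> Sup W"
        using inW[of "\<lambda>n. 0" "\<lambda>n. 0"] by (intro cSup_upper2[OF _ _ bdd]) auto
      then show ?thesis using True dn by simp
    next
      case False
      define H where "H = norm_H2_sum r R h"
      have H: "H > 0" using False H0 by (simp add: H_def)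
      obtain x y where xy: "l2 x" "l2 y" "h = (hdisc r x, hext R y)" using H2_sum_cases[OF r(1) R h] .
      have H2: "H\<^sup>2 = n2 x + n2 y" unfolding H_def xy(3) by (rule norm_sum_sq[OF r(1) R xy(1,2)])
      \<comment> \<open>With this factor 2 (n2 v + n2 u) = 1/2, so the test function lies in the
        unit ball, while \<open>J\<close> takes the value (r n2 x + R n2 y) / (2 H) >= r H / 2 on
        it.\<close>
      define c where "c = complex_of_real (1 / (2 * H))"
      define v where "v = (\<lambda>n. c * cnj (y n))"
      define u where "u = (\<lambda>n. c * cnj (x n))"
      have vu: "l2 v" "l2 u" "n2 v = (cmod c)\<^sup>2 * n2 y" "n2 u = (cmod c)\<^sup>2 * n2 x"
        unfolding v_def u_def using xy by (simp_all add: l2_cmult)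
      have c2: "(cmod c)\<^sup>2 = 1 / (4 * H\<^sup>2)" using H by (simp add: c_def norm_divide power_divide power_mult_distrib)
      have "2 * (n2 v + n2 u) = 2 * (cmod c)\<^sup>2 * H\<^sup>2" unfolding vu H2 by (simp add: algebra_simps)
      also have "\<dots> \<le> 1" unfolding c2 using H by simp
      finally have w: "norm (J_map r R h (hann r R v u)) \<in> W" by (intro inW vu)
      have sq: "(\<Sum>n. v n * y n) = c * of_real (n2 y)" "(\<Sum>n. u n * x n) = c * of_real (n2 x)"
      proof -
        have "(\<lambda>n. c * complex_of_real ((cmod (a n))\<^sup>2)) sums (c * of_real (n2 a))" if "l2 a" for a
          by (intro sums_mult sums_of_real l2_sums that)
        then have "(\<lambda>n. c * cnj (a n) * a n) sums (c * of_real (n2 a))" if "l2 a" for a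
          using that by (simp add: complex_norm_square mult_ac del: of_real_power)
        then show "(\<Sum>n. v n * y n) = c * of_real (n2 y)" "(\<Sum>n. u n * x n) = c * of_real (n2 x)"
          using xy by (simp_all add: v_def u_def sums_iff)
      qed
      have "J_map r R h (hann r R v u) = of_real (1 / (2 * H) * (r * n2 x + R * n2 y))"
        unfolding xy(3) J_map_hann[OF r vu(1,2) xy(1,2)] sq c_def by (simp add: algebra_simps add_divide_distrib)
      then have "norm (J_map r R h (hann r R v u)) = \<bar>1 / (2 * H) * (r * n2 x + R * n2 y)\<bar>"
        by (simp only: norm_of_real)
      also have eqH: "\<dots> = 1 / (2 * H) * (r * n2 x + R * n2 y)"
        using H r R n2_nonneg[OF xy(1)] n2_nonneg[OF xy(2)] by (intro abs_of_nonneg) (auto intro!: mult_nonneg_nonneg add_nonneg_nonneg)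
      finally have "norm (J_map r R h (hann r R v u)) = 1 / (2 * H) * (r * n2 x + R * n2 y)" .
      moreover have "1 / (2 * H) * (r * n2 x + r * n2 y) \<le> 1 / (2 * H) * (r * n2 x + R * n2 y)"
        using H r n2_nonneg[OF xy(2)] by (intro mult_left_mono add_left_mono mult_right_mono) auto
      moreover have "1 / (2 * H) * (r * n2 x + r * n2 y) = r / 2 * H"
        using H by (simp add: distrib_left[symmetric] H2[symmetric] power2_eq_square)
      ultimately have "r / 2 * H \<le> norm (J_map r R h (hann r R v u))" by linarith
      also have "\<dots> \<le> Sup W" by (rule cSup_upper[OF w bdd])
      finally show ?thesis unfolding dn H_def .
    qed
  qed
qed

section \<open>The logarithmic lift of an expanding circle map\<close>

lemma strip_line: "\<i> * of_real t \<in> strip r R \<longleftrightarrow> r < 1 \<and> 1 < R"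
  by (simp add: strip_def)

lemma connected_annulus: "0 < r \<Longrightarrow> r < R \<Longrightarrow> connected (annulus r R)"
proof -
  assume r: "0 < r" "r < R"
  have "annulus r R = exp ` strip r R"
  proof (intro subset_antisym subsetI)
    fix z assume z: "z \<in> annulus r R"
    then have "z \<noteq> 0" using r by (auto simp: annulus_def)
    then have "z = exp (Ln z)" "Ln z \<in> strip r R" using z by (simp_all add: strip_iff)
    then show "z \<in> exp ` strip r R" by blast
  qed (auto simp: strip_iff)
  then show ?thesis
    using connected_continuous_image[OF continuous_on_exp[OF continuous_on_id] convex_connected[OF convex_strip[OF r]]]
    by simp
qed

text \<open>\<open>r0\<close> and \<open>R0\<close> are the radii of \<open>A0\<close>. The
  assumption \<open>escape\<close> leaves open to which side the image avoids the closed annulus;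
  \<open>bdry\<close> settles the side on the boundary of \<open>A\<close>, and the maximum
  principle carries it to \<open>A0\<close>.\<close>

locale expanding_annulus =
  fixes \<tau> :: "complex \<Rightarrow> complex" and r R r0 R0 :: real
  assumes radii_order: "0 < r" "r < r0" "r0 < 1" "1 < R0" "R0 < R"
    and hol: "\<tau> holomorphic_on annulus r R"
    and nonzero: "\<And>z. z \<in> annulus r R \<Longrightarrow> \<tau> z \<noteq> 0"
    and circle: "\<And>z. cmod z = 1 \<Longrightarrow> cmod (\<tau> z) = 1"
    and expanding: "\<And>z. cmod z = 1 \<Longrightarrow> 1 < cmod (deriv \<tau> z)"
    and cont: "continuous_on {z. r \<le> cmod z \<and> cmod z \<le> R} \<tau>"
    and bdry: "\<And>z. cmod z = r \<Longrightarrow> cmod (\<tau> z) < r" "\<And>z. cmod z = R \<Longrightarrow> R < cmod (\<tau> z)"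
    and escape: "\<And>z. cmod z = r0 \<or> cmod z = R0 \<Longrightarrow> cmod (\<tau> z) < r \<or> R < cmod (\<tau> z)"
begin

lemma radii_facts: "0 < R" "r < 1" "1 < R" "r < R" "0 < r0" "0 < R0" "r0 < R0" "r0 < R" "r < R0"
  using radii_order by auto

lemma not_constant: "\<not> \<tau> constant_on annulus r R"
proof
  assume "\<tau> constant_on annulus r R"
  then obtain c where c: "\<And>z. z \<in> annulus r R \<Longrightarrow> \<tau> z = c" by (auto simp: constant_on_def)
  have one: "1 \<in> annulus r R" using radii_facts by (simp add: annulus_def)
  have "deriv \<tau> 1 = deriv (\<lambda>_. c) 1"
  proof (rule deriv_cong_ev)
    show "\<forall>\<^sub>F x in nhds 1. \<tau> x = c"
      using eventually_nhds_in_open[OF open_annulus one] by eventually_elim (rule c)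
  qed simp
  then show False using expanding[of 1] by simp
qed

text \<open>Maximum principle between the circle of radius \<open>r\<close>, where |\<tau>| < r, and
  the unit circle, where |\<tau>| = 1.\<close>

lemma tau_le_1: assumes "r \<le> cmod z" "cmod z \<le> 1" shows "cmod (\<tau> z) \<le> 1"
proof (cases "z \<in> annulus r 1")
  case True
  have cl: "closure (annulus r 1) \<subseteq> {z. r \<le> cmod z \<and> cmod z \<le> 1}"
    by (intro closure_minimal closed_Collect_conj closed_Collect_le continuous_intros) (auto simp: annulus_def)
  show ?thesis
  proof (rule maximum_modulus_frontier[of \<tau> "annulus r 1"])
    show "\<tau> holomorphic_on interior (annulus r 1)"
      using radii_facts by (intro holomorphic_on_subset[OF hol]) (auto simp: annulus_def dest!: interior_subset[THEN subsetD])
    show "continuous_on (closure (annulus r 1)) \<tau>"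
      using cl radii_facts by (intro continuous_on_subset[OF cont]) auto
    show "bounded (annulus r 1)" by (rule bounded_subset[of "cball 0 1"]) (auto simp: annulus_def)
    fix w assume "w \<in> frontier (annulus r 1)"
    then have "w \<in> closure (annulus r 1)" "w \<notin> annulus r 1"
      using open_annulus by (auto simp: frontier_def interior_open)
    then have "cmod w = r \<or> cmod w = 1" using cl by (auto simp: annulus_def)
    then show "cmod (\<tau> w) \<le> 1" using bdry(1)[of w] circle[of w] radii_facts by auto
  qed (use True in auto)
next
  case False
  then have "cmod z = r \<or> cmod z = 1" using assms by (auto simp: annulus_def)
  then show ?thesis using bdry(1)[of z] circle[of z] radii_facts by auto
qed

text \<open>The maximum principle for 1 / \<tau>, which is continuous up to the outer circle because
  there |\<tau>| > R.\<close>

lemma tau_ge_1: assumes "1 \<le> cmod z" "cmod z \<le> R" shows "1 \<le> cmod (\<tau> z)"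
proof (cases "z \<in> annulus 1 R")
  case True
  have nz: "\<tau> w \<noteq> 0" if "1 \<le> cmod w" "cmod w \<le> R" for w
    using that nonzero[of w] bdry(2)[of w] radii_facts by (cases "cmod w = R") (auto simp: annulus_def)
  have cl: "closure (annulus 1 R) \<subseteq> {z. 1 \<le> cmod z \<and> cmod z \<le> R}"
    by (intro closure_minimal closed_Collect_conj closed_Collect_le continuous_intros) (auto simp: annulus_def)
  have "cmod (inverse (\<tau> z)) \<le> 1"
  proof (rule maximum_modulus_frontier[of "\<lambda>z. inverse (\<tau> z)" "annulus 1 R"])
    have sub: "annulus 1 R \<subseteq> annulus r R" using radii_facts by (auto simp: annulus_def)
    show "(\<lambda>z. inverse (\<tau> z)) holomorphic_on interior (annulus 1 R)"
      using open_annulus[of 1 R] sub nonzero by (simp add: interior_open) (intro holomorphic_intros holomorphic_on_subset[OF hol], auto)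
    show "continuous_on (closure (annulus 1 R)) (\<lambda>z. inverse (\<tau> z))"
      using cl radii_facts nz by (intro continuous_on_inverse continuous_on_subset[OF cont]) auto
    show "bounded (annulus 1 R)" by (rule bounded_subset[of "cball 0 R"]) (auto simp: annulus_def)
    fix w assume "w \<in> frontier (annulus 1 R)"
    then have "w \<in> closure (annulus 1 R)" "w \<notin> annulus 1 R"
      using open_annulus by (auto simp: frontier_def interior_open)
    then have "cmod w = 1 \<or> cmod w = R" using cl by (auto simp: annulus_def)
    then have "1 \<le> cmod (\<tau> w)" using bdry(2)[of w] circle[of w] radii_facts by auto
    then show "cmod (inverse (\<tau> w)) \<le> 1" by (simp add: norm_inverse inverse_le_1_iff)
  qed (use True in auto)
  moreover have "0 < cmod (\<tau> z)" using nz assms by simp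
  ultimately show ?thesis by (simp add: norm_inverse inverse_le_1_iff)
next
  case False
  then have "cmod z = 1 \<or> cmod z = R" using assms by (auto simp: annulus_def)
  then show ?thesis using bdry(2)[of z] circle[of z] radii_facts by auto
qed

text \<open>By the two preceding bounds, |\<tau>| = 1 off the unit circle would be an interior
  extremum of |\<tau>| on one side of it. Then \<tau> would be constant, against the expansion at
  1.\<close>

lemma tau_circle_only: assumes "z \<in> annulus r R" "cmod (\<tau> z) = 1" shows "cmod z = 1"
proof (rule ccontr)
  assume "cmod z \<noteq> 1"
  then consider "z \<in> annulus r 1" | "z \<in> annulus 1 R" using assms(1) by (force simp: annulus_def)
  then show False
  proof cases
    case 1
    have "\<tau> constant_on annulus r R"
    proof (rule maximum_modulus_principle[OF hol open_annulus connected_annulus open_annulus _ 1])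
      show "annulus r 1 \<subseteq> annulus r R" using radii_facts by (auto simp: annulus_def)
      show "cmod (\<tau> w) \<le> cmod (\<tau> z)" if "w \<in> annulus r 1" for w
        using that assms tau_le_1[of w] by (auto simp: annulus_def)
    qed (use radii_facts radii_order in auto)
    then show False using not_constant by simp
  next
    case 2
    have "(\<lambda>z. inverse (\<tau> z)) constant_on annulus r R"
    proof (rule maximum_modulus_principle[OF _ open_annulus connected_annulus open_annulus _ 2])
      show "(\<lambda>z. inverse (\<tau> z)) holomorphic_on annulus r R"
        by (intro holomorphic_intros hol nonzero)
      show "annulus 1 R \<subseteq> annulus r R" using radii_facts by (auto simp: annulus_def)
      show "cmod (inverse (\<tau> w)) \<le> cmod (inverse (\<tau> z))" if "w \<in> annulus 1 R" for w
        using that assms tau_ge_1[of w] by (auto simp: annulus_def norm_inverse inverse_le_1_iff)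
    qed (use radii_facts radii_order in auto)
    then obtain c where c: "\<And>z. z \<in> annulus r R \<Longrightarrow> inverse (\<tau> z) = c" by (auto simp: constant_on_def)
    then have "\<tau> w = inverse c" if "w \<in> annulus r R" for w using that by (metis inverse_inverse_eq)
    then have "\<tau> constant_on annulus r R" by (auto simp: constant_on_def)
    then show False using not_constant by simp
  qed
qed

text \<open>Inside the unit circle |\<tau>| <= 1 < R, which rules out the outward alternative of
  \<open>escape\<close>.\<close>

lemma escape_inner: "cmod z = r0 \<Longrightarrow> cmod (\<tau> z) < r"
  using escape[of z] tau_le_1[of z] radii_order radii_facts by auto

lemma escape_outer: "cmod z = R0 \<Longrightarrow> R < cmod (\<tau> z)"
  using escape[of z] tau_ge_1[of z] radii_order radii_facts by auto

text \<open>By compactness the images of the circles of \<open>A0\<close> even avoid a slightly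
  larger closed annulus. This room makes \<open>G\<close> available on a neighbourhood of the closed
  strip of \<open>A\<close>.\<close>

lemma wider_radii: "\<exists>r1 R1. 0 < r1 \<and> r1 < r \<and> R < R1 \<and>
   (\<forall>z. cmod z = r0 \<longrightarrow> cmod (\<tau> z) < r1) \<and> (\<forall>z. cmod z = R0 \<longrightarrow> R1 < cmod (\<tau> z))"
proof -
  have c: "continuous_on (sphere 0 \<rho>) (\<lambda>z. cmod (\<tau> z))" if "r < \<rho>" "\<rho> < R" for \<rho>
    using that by (intro continuous_intros continuous_on_subset[OF cont]) auto
  have ne: "sphere (0::complex) \<rho> \<noteq> {}" if "0 < \<rho>" for \<rho> :: real
    using that by (auto intro!: exI[of _ "of_real \<rho>"])
  obtain a where a: "a \<in> sphere 0 r0" "\<And>z. z \<in> sphere 0 r0 \<Longrightarrow> cmod (\<tau> z) \<le> cmod (\<tau> a)"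
    using continuous_attains_sup[OF compact_sphere ne c, of r0] radii_order radii_facts by blast
  obtain b where b: "b \<in> sphere 0 R0" "\<And>z. z \<in> sphere 0 R0 \<Longrightarrow> cmod (\<tau> b) \<le> cmod (\<tau> z)"
    using continuous_attains_inf[OF compact_sphere ne c, of R0] radii_order radii_facts by blast
  have "cmod (\<tau> a) < r" using escape_inner[of a] a by simp
  then obtain r1 where r1: "cmod (\<tau> a) < r1" "r1 < r" using dense by blast
  have "R < cmod (\<tau> b)" using escape_outer[of b] b by simp
  then obtain R1 where R1: "R < R1" "R1 < cmod (\<tau> b)" using dense by blast
  have "0 < r1" using r1 by (smt (verit) norm_ge_zero)
  moreover have "\<forall>z. cmod z = r0 \<longrightarrow> cmod (\<tau> z) < r1" using a(2) r1 by force
  moreover have "\<forall>z. cmod z = R0 \<longrightarrow> R1 < cmod (\<tau> z)" using b(2) R1 by force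
  ultimately show ?thesis using r1 R1 by blast
qed

definition r1 where "r1 = (SOME r1. \<exists>R1. 0 < r1 \<and> r1 < r \<and> R < R1 \<and>
   (\<forall>z. cmod z = r0 \<longrightarrow> cmod (\<tau> z) < r1) \<and> (\<forall>z. cmod z = R0 \<longrightarrow> R1 < cmod (\<tau> z)))"

definition R1 where "R1 = (SOME R1. 0 < r1 \<and> r1 < r \<and> R < R1 \<and>
   (\<forall>z. cmod z = r0 \<longrightarrow> cmod (\<tau> z) < r1) \<and> (\<forall>z. cmod z = R0 \<longrightarrow> R1 < cmod (\<tau> z)))"

lemma r1R1: "0 < r1" "r1 < r" "R < R1" "cmod z = r0 \<Longrightarrow> cmod (\<tau> z) < r1" "cmod z = R0 \<Longrightarrow> R1 < cmod (\<tau> z)"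
proof -
  have "\<exists>R1. 0 < r1 \<and> r1 < r \<and> R < R1 \<and>
    (\<forall>z. cmod z = r0 \<longrightarrow> cmod (\<tau> z) < r1) \<and> (\<forall>z. cmod z = R0 \<longrightarrow> R1 < cmod (\<tau> z))"
    unfolding r1_def using wider_radii by (rule someI_ex)
  then have *: "0 < r1 \<and> r1 < r \<and> R < R1 \<and>
    (\<forall>z. cmod z = r0 \<longrightarrow> cmod (\<tau> z) < r1) \<and> (\<forall>z. cmod z = R0 \<longrightarrow> R1 < cmod (\<tau> z))"
    unfolding R1_def by (rule someI_ex)
  show "0 < r1" "r1 < r" "R < R1" "cmod z = r0 \<Longrightarrow> cmod (\<tau> z) < r1" "cmod z = R0 \<Longrightarrow> R1 < cmod (\<tau> z)"
    using * by blast+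
qed

section \<open>The lift \<open>F\<close> and its period\<close>

lemma lift_exists: "\<exists>F. F holomorphic_on strip r R \<and> (\<forall>\<zeta>\<in>strip r R. exp (F \<zeta>) = \<tau> (exp \<zeta>))"
proof -
  have 1: "(\<lambda>\<zeta>. \<tau> (exp \<zeta>)) holomorphic_on strip r R"
    by (rule holomorphic_on_compose_gen[OF _ hol, unfolded o_def]) (auto intro!: holomorphic_intros simp: strip_iff)
  have 2: "\<tau> (exp \<zeta>) \<noteq> 0" if "\<zeta> \<in> strip r R" for \<zeta>
    using that by (intro nonzero) (simp add: strip_iff)
  have 3: "0 \<in> strip r R" using radii_facts by (simp add: strip_def)
  obtain g where "g holomorphic_on strip r R" "\<And>x. x \<in> strip r R \<Longrightarrow> exp (g x) = \<tau> (exp x)"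
    using holomorphic_logarithm_exists[OF convex_strip[OF radii_order(1) radii_facts(4)] open_strip 1 2 3] by auto
  then show ?thesis by blast
qed

definition F where "F = (SOME F. F holomorphic_on strip r R \<and> (\<forall>\<zeta>\<in>strip r R. exp (F \<zeta>) = \<tau> (exp \<zeta>)))"

lemma F_hol: "F holomorphic_on strip r R" and F_exp: "\<zeta> \<in> strip r R \<Longrightarrow> exp (F \<zeta>) = \<tau> (exp \<zeta>)"
  using someI_ex[OF lift_exists] unfolding F_def by auto

lemma F_deriv: "\<zeta> \<in> strip r R \<Longrightarrow> (F has_field_derivative deriv F \<zeta>) (at \<zeta>)"
  by (rule holomorphic_derivI[OF F_hol open_strip])

lemma F_Re: assumes "\<zeta> \<in> strip r R" shows "exp (Re (F \<zeta>)) = cmod (\<tau> (exp \<zeta>))"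
  unfolding F_exp[OF assms, symmetric] by simp

text \<open>The derivative of \<open>F\<close> is the logarithmic derivative z \<tau>'(z) /
  \<tau>(z) at z = exp \<zeta>. Hence it is periodic, and its modulus on the imaginary axis is
  |\<tau>'|.\<close>

lemma F_deriv_eq: assumes z: "\<zeta> \<in> strip r R" shows "deriv F \<zeta> * \<tau> (exp \<zeta>) = deriv \<tau> (exp \<zeta>) * exp \<zeta>"
proof -
  have "((\<lambda>\<zeta>. exp (F \<zeta>)) has_field_derivative exp (F \<zeta>) * deriv F \<zeta>) (at \<zeta>)"
    by (rule DERIV_chain2[OF DERIV_exp F_deriv[OF z]])
  moreover have "((\<lambda>\<zeta>. \<tau> (exp \<zeta>)) has_field_derivative deriv \<tau> (exp \<zeta>) * exp \<zeta>) (at \<zeta>)"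
    by (rule DERIV_chain2[OF holomorphic_derivI[OF hol open_annulus] DERIV_exp]) (use z in \<open>simp add: strip_iff\<close>)
  then have "((\<lambda>\<zeta>. exp (F \<zeta>)) has_field_derivative deriv \<tau> (exp \<zeta>) * exp \<zeta>) (at \<zeta>)"
    by (rule has_field_derivative_transform_within_open[OF _ open_strip z]) (simp add: F_exp)
  ultimately have "exp (F \<zeta>) * deriv F \<zeta> = deriv \<tau> (exp \<zeta>) * exp \<zeta>" by (rule DERIV_unique)
  then show ?thesis using F_exp[OF z] by (simp add: mult.commute)
qed

lemma F_deriv_periodic: assumes z: "\<zeta> \<in> strip r R" shows "deriv F (\<zeta> + 2 * of_real pi * \<i>) = deriv F \<zeta>"
proof -
  have e: "exp (\<zeta> + 2 * of_real pi * \<i>) = exp \<zeta>" by (simp add: exp_add)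
  have "deriv F (\<zeta> + 2 * of_real pi * \<i>) * \<tau> (exp \<zeta>) = deriv F \<zeta> * \<tau> (exp \<zeta>)"
    using F_deriv_eq[of "\<zeta> + 2 * of_real pi * \<i>"] F_deriv_eq[OF z] z by (simp add: e)
  moreover have "\<tau> (exp \<zeta>) \<noteq> 0" using z by (intro nonzero) (simp add: strip_iff)
  ultimately show ?thesis by simp
qed

text \<open>A periodic derivative leaves a constant increment, and \<open>exp\<close> sends it to 1
  because \<open>\<tau> (exp \<zeta>)\<close> is periodic.\<close>

lemma F_shift_exists: "\<exists>d::int. \<forall>\<zeta>\<in>strip r R. F (\<zeta> + 2 * of_real pi * \<i>) = F \<zeta> + 2 * of_real pi * \<i> * of_int d"
proof -
  have "\<exists>c. \<forall>\<zeta>\<in>strip r R. F (\<zeta> + 2 * of_real pi * \<i>) - F \<zeta> = c"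
  proof (rule has_field_derivative_zero_constant[OF convex_strip[OF radii_order(1) radii_facts(4)]])
    fix \<zeta> assume z: "\<zeta> \<in> strip r R"
    have "((\<lambda>\<zeta>. F (\<zeta> + 2 * of_real pi * \<i>)) has_field_derivative deriv F (\<zeta> + 2 * of_real pi * \<i>) * 1) (at \<zeta>)"
      by (rule DERIV_chain2[OF F_deriv]) (use z in \<open>auto intro!: derivative_eq_intros\<close>)
    then have "((\<lambda>\<zeta>. F (\<zeta> + 2 * of_real pi * \<i>) - F \<zeta>) has_field_derivative deriv F (\<zeta> + 2 * of_real pi * \<i>) * 1 - deriv F \<zeta>) (at \<zeta>)"
      using F_deriv[OF z] by (rule DERIV_diff)
    then show "((\<lambda>\<zeta>. F (\<zeta> + 2 * of_real pi * \<i>) - F \<zeta>) has_field_derivative 0) (at \<zeta> within strip r R)"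
      using F_deriv_periodic[OF z] by (simp add: has_field_derivative_at_within)
  qed
  then obtain c where c: "\<And>\<zeta>. \<zeta> \<in> strip r R \<Longrightarrow> F (\<zeta> + 2 * of_real pi * \<i>) = F \<zeta> + c"
    by (metis add.commute diff_eq_eq)
  have 0: "0 \<in> strip r R" using radii_facts by (simp add: strip_def)
  have "exp (F 0 + c) = exp (F 0)"
    using F_exp[of "0 + 2 * of_real pi * \<i>"] F_exp[OF 0] c[OF 0] 0 by (simp add: exp_add[of 0] strip_def)
  then have "exp c = 1" by (simp add: exp_add)
  then obtain d :: int where d: "Re c = 0" "Im c = of_int (2 * d) * pi" unfolding exp_eq_1 by auto
  then have "c = 2 * of_real pi * \<i> * of_int d" by (simp add: complex_eq_iff)
  then show ?thesis using c by blast
qed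

definition d where "d = (SOME d::int. \<forall>\<zeta>\<in>strip r R. F (\<zeta> + 2 * of_real pi * \<i>) = F \<zeta> + 2 * of_real pi * \<i> * of_int d)"

lemma F_shift: "\<zeta> \<in> strip r R \<Longrightarrow> F (\<zeta> + 2 * of_real pi * \<i>) = F \<zeta> + 2 * of_real pi * \<i> * of_int d"
  using someI_ex[OF F_shift_exists] unfolding d_def by blast

definition per :: "int \<Rightarrow> complex" where
  "per n = 2 * of_real pi * \<i> * of_int n"

lemma per_simps [simp]: "Re (per n) = 0" "Im (per n) = 2 * pi * of_int n" "exp (per n) = 1" "per 0 = 0"
  by (simp_all add: per_def exp_eq_1 mult_ac)

lemma per_add: "per (m + n) = per m + per n" "per (m - n) = per m - per n"
  by (simp_all add: per_def algebra_simps)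

lemma per_eq_iff [simp]: "per m = per n \<longleftrightarrow> m = n"
  by (auto simp: per_def)

lemma strip_per [simp]: "\<zeta> + per n \<in> strip a b \<longleftrightarrow> \<zeta> \<in> strip a b" "\<zeta> - per n \<in> strip a b \<longleftrightarrow> \<zeta> \<in> strip a b"
  by (simp_all add: strip_def)

lemma F_per: "\<zeta> \<in> strip r R \<Longrightarrow> F (\<zeta> + per n) = F \<zeta> + per (d * n)"
proof (induction n rule: int_induct[where k=0])
  case (step1 i)
  have "F (\<zeta> + per (i + 1)) = F ((\<zeta> + per i) + 2 * of_real pi * \<i>)"
    by (simp add: per_def algebra_simps)
  also have "\<dots> = F (\<zeta> + per i) + 2 * of_real pi * \<i> * of_int d"
    using step1 by (intro F_shift) simp
  finally show ?case using step1 by (simp add: per_def algebra_simps)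
next
  case (step2 i)
  have "F (\<zeta> + per i) = F ((\<zeta> + per (i - 1)) + 2 * of_real pi * \<i>)"
    by (simp add: per_def algebra_simps)
  also have "\<dots> = F (\<zeta> + per (i - 1)) + 2 * of_real pi * \<i> * of_int d"
    using step2 by (intro F_shift) simp
  finally show ?case using step2 by (simp add: per_def algebra_simps)
qed simp

section \<open>The lift on the imaginary axis\<close>

lemma line_in_strip: "\<i> * of_real t \<in> strip r R"
  using radii_facts by (simp add: strip_line)

definition g where "g t = Im (F (\<i> * of_real t))"

lemma F_line: "F (\<i> * of_real t) = \<i> * of_real (g t)"
proof -
  have "exp (Re (F (\<i> * of_real t))) = 1"
    using F_Re[OF line_in_strip, of t] circle[of "exp (\<i> * of_real t)"] by simp
  then show ?thesis by (simp add: complex_eq_iff g_def)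
qed

lemma F_line_vector_derivative:
  "((\<lambda>t. F (\<i> * of_real t)) has_vector_derivative deriv F (\<i> * of_real t) * \<i>) (at t)"
proof -
  have "((\<lambda>z. \<i> * z) has_field_derivative \<i>) (at (of_real t))" by (auto intro!: derivative_eq_intros)
  from DERIV_chain2[OF F_deriv[OF line_in_strip] this]
  have "((\<lambda>z. F (\<i> * z)) has_field_derivative deriv F (\<i> * of_real t) * \<i>) (at (of_real t))" .
  then show ?thesis by (rule has_vector_derivative_real_field)
qed

lemma F_line_deriv_real: "Im (deriv F (\<i> * of_real t)) = 0"
proof -
  have "((\<lambda>t. Re (F (\<i> * of_real t))) has_vector_derivative Re (deriv F (\<i> * of_real t) * \<i>)) (at t)"
    by (rule bounded_linear.has_vector_derivative[OF bounded_linear_Re F_line_vector_derivative])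
  moreover have "((\<lambda>t. Re (F (\<i> * of_real t))) has_vector_derivative 0) (at t)"
    by (simp add: F_line)
  ultimately have "Re (deriv F (\<i> * of_real t) * \<i>) = 0" by (rule vector_derivative_unique_at)
  then show ?thesis by simp
qed

text \<open>\<open>F\<close> preserves the imaginary axis, so its derivative there is real, of
  modulus |\<tau>'| > 1. A negative sign would move points right of the axis to its left, contrary
  to |\<tau>| >= 1 outside the unit circle.\<close>

lemma F_line_deriv_gt_1: "1 < Re (deriv F (\<i> * of_real t))"
proof -
  let ?\<zeta> = "\<i> * of_real t"
  have "cmod (deriv F ?\<zeta>) * 1 = cmod (deriv \<tau> (exp ?\<zeta>)) * 1"
  proof -
    have n1: "cmod (exp ?\<zeta>) = 1" by simp
    have "cmod (deriv F ?\<zeta> * \<tau> (exp ?\<zeta>)) = cmod (deriv \<tau> (exp ?\<zeta>) * exp ?\<zeta>)"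
      using F_deriv_eq[OF line_in_strip, of t] by (rule arg_cong)
    then show ?thesis unfolding norm_mult circle[OF n1] n1 .
  qed
  then have gt: "1 < cmod (deriv F ?\<zeta>)" using expanding[of "exp ?\<zeta>"] by simp
  have abs: "cmod (deriv F ?\<zeta>) = \<bar>Re (deriv F ?\<zeta>)\<bar>"
    using F_line_deriv_real[of t] by (simp add: cmod_def)
  have "\<not> Re (deriv F ?\<zeta>) < 0"
  proof
    assume neg: "Re (deriv F ?\<zeta>) < 0"
    have "((\<lambda>z. z + ?\<zeta>) has_field_derivative 1) (at (of_real 0))" by (auto intro!: derivative_eq_intros)
    from DERIV_chain2[OF _ this, of F "deriv F ?\<zeta>"] F_deriv[OF line_in_strip, of t]
    have "((\<lambda>z. F (z + ?\<zeta>)) has_field_derivative deriv F ?\<zeta>) (at (of_real 0))" by simp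
    then have "((\<lambda>x. F (of_real x + ?\<zeta>)) has_vector_derivative deriv F ?\<zeta>) (at 0)"
      by (rule has_vector_derivative_real_field)
    then have "((\<lambda>x. Re (F (of_real x + ?\<zeta>))) has_vector_derivative Re (deriv F ?\<zeta>)) (at 0)"
      by (rule bounded_linear.has_vector_derivative[OF bounded_linear_Re])
    then have "((\<lambda>x. Re (F (of_real x + ?\<zeta>))) has_field_derivative Re (deriv F ?\<zeta>)) (at 0)"
      by (simp add: has_real_derivative_iff_has_vector_derivative)
    from DERIV_neg_dec_right[OF this neg] obtain e where e: "e > 0"
      "\<And>h. 0 < h \<Longrightarrow> h < e \<Longrightarrow> Re (F (of_real h + ?\<zeta>)) < Re (F ?\<zeta>)" by auto
    \<comment> \<open>Small enough both for the monotonicity near 0 and for the shifted point to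
      stay in the strip.\<close>
    define h where "h = min (e / 2) (ln R / 2)"
    have lnR: "0 < ln R" using radii_facts by simp
    have h: "0 < h" "h < e" "h < ln R" using e lnR by (auto simp: h_def)
    have in_strip: "of_real h + ?\<zeta> \<in> strip r R"
    proof -
      have "exp h < R" using h radii_facts by (metis exp_less_cancel_iff exp_ln)
      moreover have "1 < exp h" using h by simp
      moreover from this have "r < exp h" using radii_facts(2) by linarith
      ultimately show ?thesis by (simp add: strip_def)
    qed
    have "1 \<le> cmod (\<tau> (exp (of_real h + ?\<zeta>)))"
      using in_strip h by (intro tau_ge_1) (auto simp: strip_def)
    then have "1 \<le> exp (Re (F (of_real h + ?\<zeta>)))" using F_Re[OF in_strip] by simp
    then have "0 \<le> Re (F (of_real h + ?\<zeta>))" by simp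
    then show False using e(2)[OF h(1,2)] by (simp add: F_line)
  qed
  then show ?thesis using gt abs by simp
qed

lemma g_mono: assumes "a < b" shows "g a < g b"
proof (rule DERIV_pos_imp_increasing[OF assms])
  fix t
  have "((\<lambda>t. Im (F (\<i> * of_real t))) has_vector_derivative Im (deriv F (\<i> * of_real t) * \<i>)) (at t)"
    by (rule bounded_linear.has_vector_derivative[OF bounded_linear_Im F_line_vector_derivative])
  then have "(g has_field_derivative Re (deriv F (\<i> * of_real t))) (at t)"
    unfolding g_def[abs_def] by (simp add: has_real_derivative_iff_has_vector_derivative)
  then show "\<exists>y. DERIV g t :> y \<and> 0 < y" using F_line_deriv_gt_1[of t] by (intro exI conjI) auto
qed

lemma g_inj: "g a = g b \<Longrightarrow> a = b"
  using g_mono[of a b] g_mono[of b a] by (metis less_irrefl linorder_neqE)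

text \<open>Over one period the increasing function \<open>g\<close> grows by 2 pi d.\<close>

lemma d_pos: "0 < d"
proof -
  have "\<i> * of_real (g (2 * pi)) = F (\<i> * of_real 0 + 2 * of_real pi * \<i>)"
    unfolding F_line[symmetric] by (simp add: mult_ac)
  also have "\<dots> = \<i> * of_real (g 0) + 2 * of_real pi * \<i> * of_int d"
    unfolding F_shift[OF line_in_strip] F_line ..
  finally have "g (2 * pi) = g 0 + 2 * pi * of_int d" by (simp add: complex_eq_iff)
  moreover have "g 0 < g (2 * pi)" by (rule g_mono) simp
  ultimately have "0 < 2 * pi * of_int d" by linarith
  then show ?thesis by (simp add: zero_less_mult_iff)
qed

lemma F_imaginary_preimage:
  assumes "\<zeta> \<in> strip r R" "Re (F \<zeta>) = 0"
  shows "\<zeta> = \<i> * of_real (Im \<zeta>)"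
proof -
  have "cmod (\<tau> (exp \<zeta>)) = 1" using F_Re[OF assms(1)] assms(2) by simp
  with assms(1) have "cmod (exp \<zeta>) = 1" unfolding strip_iff by (rule tau_circle_only)
  then have "Re \<zeta> = 0" unfolding norm_exp_eq_Re by (simp only: exp_eq_one_iff)
  then show ?thesis by (intro complex_eqI) simp_all
qed

end

section \<open>The global inverse of the lift\<close>

text \<open>A topological condition under which the zeros of the derivative of \<open>F\<close> are
  countable.\<close>

lemma fsigma_strip: "fsigma (strip a b)"
proof -
  define K where "K = (\<lambda>n::nat. {\<zeta>. a + inverse (real (Suc n)) \<le> exp (Re \<zeta>) \<and> exp (Re \<zeta>) \<le> b - inverse (real (Suc n))})"
  have "strip a b = \<Union> (range K)"
  proof (intro subset_antisym subsetI)
    fix \<zeta> assume z: "\<zeta> \<in> strip a b"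
    then have "0 < min (exp (Re \<zeta>) - a) (b - exp (Re \<zeta>))" by (simp add: strip_def)
    then obtain n where "inverse (real (Suc n)) < min (exp (Re \<zeta>) - a) (b - exp (Re \<zeta>))"
      using reals_Archimedean by blast
    then have "\<zeta> \<in> K n" unfolding K_def by simp
    then show "\<zeta> \<in> \<Union> (range K)" by blast
  next
    fix \<zeta> assume "\<zeta> \<in> \<Union> (range K)"
    then obtain n where n: "a + inverse (real (Suc n)) \<le> exp (Re \<zeta>)" "exp (Re \<zeta>) \<le> b - inverse (real (Suc n))"
      by (auto simp: K_def)
    have "0 < inverse (real (Suc n))" by simp
    then show "\<zeta> \<in> strip a b" using n unfolding strip_def by (intro CollectI conjI) linarith+
  qed
  moreover have "closed (K n)" for n
    unfolding K_def by (intro closed_Collect_conj closed_Collect_le continuous_intros)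
  ultimately show ?thesis by (simp add: fsigma.intros)
qed

context expanding_annulus
begin

definition S1 where "S1 = strip r1 R1"

text \<open>Because the boundary lines of \<open>C\<close> are mapped outside \<open>S1\<close>,
  this open set is at the same time the whole preimage of \<open>S1\<close> in the closed strip
  \<open>C\<close>.\<close>

definition V1 where "V1 = {\<zeta> \<in> strip r0 R0. F \<zeta> \<in> S1}"

definition C where "C = {\<zeta>. r0 \<le> exp (Re \<zeta>) \<and> exp (Re \<zeta>) \<le> R0}"

lemma C_strip: "C \<subseteq> strip r R"
  using radii_order by (auto simp: C_def strip_def)

lemma V1_C: "V1 \<subseteq> C"
  by (auto simp: V1_def C_def strip_def)

lemma V1_strip: "V1 \<subseteq> strip r R"
  using V1_C C_strip by blast

lemma C_S1_V1: assumes "\<zeta> \<in> C" "F \<zeta> \<in> S1" shows "\<zeta> \<in> V1"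
proof -
  have z: "\<zeta> \<in> strip r R" using assms C_strip by blast
  have "r1 < cmod (\<tau> (exp \<zeta>))" "cmod (\<tau> (exp \<zeta>)) < R1"
    using assms(2) F_Re[OF z] by (auto simp: S1_def strip_def)
  then have "exp (Re \<zeta>) \<noteq> r0" "exp (Re \<zeta>) \<noteq> R0"
    using r1R1(4)[of "exp \<zeta>"] r1R1(5)[of "exp \<zeta>"] by auto
  then show ?thesis using assms by (auto simp: V1_def C_def strip_def)
qed

lemma open_S1: "open S1" and connected_S1: "connected S1" and convex_S1: "convex S1"
  unfolding S1_def using r1R1 radii_facts by (auto intro!: open_strip convex_strip convex_connected)

lemma open_V1: "open V1"
proof -
  have "V1 = strip r0 R0 \<inter> (F -` S1 \<inter> strip r R)"
    using V1_strip by (auto simp: V1_def)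
  moreover have "open (F -` S1 \<inter> strip r R)"
    using holomorphic_on_imp_continuous_on[OF F_hol] open_S1
    unfolding continuous_on_open_vimage[OF open_strip] by blast
  ultimately show ?thesis by (simp add: open_Int open_strip)
qed

lemma line_S1: "\<i> * of_real t \<in> S1" and line_C: "\<i> * of_real t \<in> C"
  using r1R1(1-3) radii_order by (auto simp: S1_def strip_line C_def)

lemma F_not_constant: "\<not> F constant_on strip r R"
proof
  assume "F constant_on strip r R"
  then obtain c where "\<And>\<zeta>. \<zeta> \<in> strip r R \<Longrightarrow> F \<zeta> = c" by (auto simp: constant_on_def)
  then have "\<i> * of_real (g 0) = \<i> * of_real (g 1)" unfolding F_line[symmetric] using line_in_strip by metis
  then have "g 0 = g 1" by simp
  then show False using g_mono[of 0 1] by simp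
qed

lemma F_open: "open U \<Longrightarrow> U \<subseteq> strip r R \<Longrightarrow> open (F ` U)"
  by (rule open_mapping_thm[OF F_hol open_strip convex_connected[OF convex_strip] _ _ F_not_constant])
     (use radii_order radii_facts in auto)

text \<open>The difference is periodic, so its bound on one compact period box holds on all of
  \<open>C\<close>.\<close>

lemma F_minus_linear_bounded: "\<exists>M. \<forall>\<zeta>\<in>C. cmod (F \<zeta> - of_int d * \<zeta>) \<le> M"
proof -
  define K where "K = C \<inter> {\<zeta>. 0 \<le> Im \<zeta> \<and> Im \<zeta> \<le> 2 * pi}"
  have "K = cbox (Complex (ln r0) 0) (Complex (ln R0) (2 * pi))"
  proof -
    have "r0 \<le> exp x \<longleftrightarrow> ln r0 \<le> x" "exp x \<le> R0 \<longleftrightarrow> x \<le> ln R0" for x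
      using radii_facts by (metis exp_le_cancel_iff exp_ln)+
    then show ?thesis by (auto simp: K_def C_def in_cbox_complex_iff)
  qed
  then have "compact K" by simp
  moreover have "continuous_on K (\<lambda>\<zeta>. F \<zeta> - of_int d * \<zeta>)"
    by (intro continuous_intros continuous_on_subset[OF holomorphic_on_imp_continuous_on[OF F_hol]])
       (use C_strip in \<open>auto simp: K_def\<close>)
  ultimately have "bounded ((\<lambda>\<zeta>. F \<zeta> - of_int d * \<zeta>) ` K)"
    by (intro compact_imp_bounded compact_continuous_image)
  then obtain M where M: "\<And>\<zeta>. \<zeta> \<in> K \<Longrightarrow> cmod (F \<zeta> - of_int d * \<zeta>) \<le> M"
    unfolding bounded_iff by auto
  show ?thesis
  proof (intro exI[of _ M] ballI)
    fix \<zeta> assume z: "\<zeta> \<in> C"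
    define n where "n = \<lfloor>Im \<zeta> / (2 * pi)\<rfloor>"
    have n: "2 * pi * of_int n \<le> Im \<zeta>" "Im \<zeta> \<le> 2 * pi * of_int n + 2 * pi"
    proof -
      have "of_int n \<le> Im \<zeta> / (2 * pi)" "Im \<zeta> / (2 * pi) \<le> of_int n + 1"
        unfolding n_def by linarith+
      then show "2 * pi * of_int n \<le> Im \<zeta>" "Im \<zeta> \<le> 2 * pi * of_int n + 2 * pi"
        by (simp_all add: field_simps)
    qed
    have z': "\<zeta> - per n \<in> K" using z n by (simp add: K_def C_def)
    have "F \<zeta> = F ((\<zeta> - per n) + per n)" by simp
    also have "\<dots> = F (\<zeta> - per n) + per (d * n)"
      by (rule F_per) (use z C_strip in auto)
    finally have "F \<zeta> - of_int d * \<zeta> = F (\<zeta> - per n) - of_int d * (\<zeta> - per n)"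
      by (simp add: per_def algebra_simps)
    then show "cmod (F \<zeta> - of_int d * \<zeta>) \<le> M" using M[OF z'] by simp
  qed
qed

lemma closed_C: "closed C"
  unfolding C_def by (intro closed_Collect_conj closed_Collect_le continuous_intros)

text \<open>\<open>F\<close> is proper on the closed strip \<open>C\<close>, since it differs from \<open>d \<zeta>\<close> by a bounded function.\<close>

lemma F_closed: assumes K: "closed K" "K \<subseteq> C" shows "closed (F ` K)"
  unfolding closed_sequential_limits
proof (intro allI impI, elim conjE)
  fix w l assume w: "\<forall>n. w n \<in> F ` K" and l: "w \<longlonglongrightarrow> l"
  obtain M where M: "\<And>\<zeta>. \<zeta> \<in> C \<Longrightarrow> cmod (F \<zeta> - of_int d * \<zeta>) \<le> M"
    using F_minus_linear_bounded by blast
  from w obtain z where z: "\<And>n. z n \<in> K" "\<And>n. w n = F (z n)"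
    unfolding image_iff by metis
  obtain B where B: "\<And>n. cmod (w n) \<le> B"
    using convergent_imp_bounded[OF l] by (auto simp: bounded_iff)
  have "cmod (z n) \<le> M + B" for n
  proof -
    have zC: "z n \<in> C" using z K by blast
    have "of_int d * z n = w n - (F (z n) - of_int d * z n)" using z(2) by simp
    then have "cmod (of_int d * z n) \<le> B + M"
      using norm_triangle_ineq4[of "w n" "F (z n) - of_int d * z n"] B[of n] M[OF zC] by simp
    moreover have "cmod (z n) \<le> cmod (of_int d * z n)"
      using d_pos by (simp add: norm_mult mult_le_cancel_right1)
    ultimately show ?thesis by simp
  qed
  then have "\<forall>n. z n \<in> K \<inter> cball 0 (M + B)" using z by simp
  moreover have "compact (K \<inter> cball 0 (M + B))" using K by (simp add: closed_Int_compact)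
  ultimately obtain \<zeta> q where q: "\<zeta> \<in> K \<inter> cball 0 (M + B)" "strict_mono (q :: nat \<Rightarrow> nat)" "(z \<circ> q) \<longlonglongrightarrow> \<zeta>"
    unfolding compact_def by blast
  have "\<zeta> \<in> strip r R" using q(1) K C_strip by blast
  then have "isCont F \<zeta>" using F_deriv DERIV_isCont by blast
  then have "(\<lambda>n. F ((z \<circ> q) n)) \<longlonglongrightarrow> F \<zeta>" using q(3) by (rule isCont_tendsto_compose)
  moreover have "(\<lambda>n. F ((z \<circ> q) n)) = w \<circ> q" using z by auto
  moreover have "(w \<circ> q) \<longlonglongrightarrow> l" using l q(2) by (rule LIMSEQ_subseq_LIMSEQ)
  ultimately have "F \<zeta> = l" using LIMSEQ_unique by metis
  then show "l \<in> F ` K" using q(1) by blast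
qed

lemma F_image: "F ` V1 = S1"
proof -
  have eq: "F ` V1 = F ` C \<inter> S1"
    using C_S1_V1 V1_C by (auto simp: V1_def)
  have "S1 \<inter> F ` V1 = {} \<or> S1 \<inter> - (F ` C) = {}"
  proof (rule connectedD[OF connected_S1, of "F ` V1" "- (F ` C)", unfolded Int_commute[of _ S1]])
    show "open (F ` V1)" by (intro F_open open_V1 V1_strip)
    show "open (- (F ` C))" using F_closed[OF closed_C] by auto
  qed (use eq in auto)
  moreover have "F (\<i> * of_real 0) \<in> F ` C \<inter> S1" using line_S1[of "g 0"] imageI[OF line_C[of 0], of F] F_line[of 0] by simp
  ultimately show ?thesis using eq by auto
qed

definition crit where "crit = F ` {\<zeta> \<in> strip r R. deriv F \<zeta> = 0}"

lemma countable_crit: "countable crit"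
proof (cases "deriv F constant_on strip r R")
  case True
  then obtain c where c: "\<And>\<zeta>. \<zeta> \<in> strip r R \<Longrightarrow> deriv F \<zeta> = c" by (auto simp: constant_on_def)
  have "c \<noteq> 0" using c[OF line_in_strip, of 0] F_line_deriv_gt_1[of 0] by auto
  then have "crit = {}" using c by (auto simp: crit_def)
  then show ?thesis by simp
next
  case False
  have "countable {\<zeta> \<in> strip r R. deriv F \<zeta> = 0}"
    by (rule holomorphic_countable_zeros)
       (use F_hol open_strip False radii_order radii_facts in
         \<open>auto intro!: holomorphic_deriv convex_connected convex_strip fsigma_strip\<close>)
  then show ?thesis unfolding crit_def by (rule countable_image)
qed

text \<open>Only distinct preimages count here; values attained with multiplicity at one point
  belong to \<open>crit\<close>.\<close>

definition mult where "mult = {w \<in> S1. \<exists>a\<in>V1. \<exists>b\<in>V1. a \<noteq> b \<and> F a = w \<and> F b = w}"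

lemma open_mult: "open mult"
  unfolding open_subopen[of mult]
proof
  fix w assume "w \<in> mult"
  then obtain a b where ab: "a \<in> V1" "b \<in> V1" "a \<noteq> b" "F a = w" "F b = w" "w \<in> S1" by (auto simp: mult_def)
  obtain U V where UV: "open U" "open V" "a \<in> U" "b \<in> V" "U \<inter> V = {}"
    using hausdorff[OF ab(3)] by blast
  have "open (F ` (U \<inter> V1) \<inter> F ` (V \<inter> V1))"
    using UV V1_strip by (intro open_Int F_open open_V1) auto
  moreover have "F ` (U \<inter> V1) \<inter> F ` (V \<inter> V1) \<subseteq> mult"
  proof
    fix x assume "x \<in> F ` (U \<inter> V1) \<inter> F ` (V \<inter> V1)"
    then obtain a b where "a \<in> U" "a \<in> V1" "F a = x" "b \<in> V" "b \<in> V1" "F b = x" by auto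
    moreover from this have "a \<noteq> b" using UV by auto
    ultimately show "x \<in> mult" unfolding mult_def V1_def by auto
  qed
  moreover have "w \<in> F ` (U \<inter> V1)" "w \<in> F ` (V \<inter> V1)"
    using ab UV by (auto intro: image_eqI[of _ _ a] image_eqI[of _ _ b])
  ultimately show "\<exists>T. open T \<and> w \<in> T \<and> T \<subseteq> mult"
    by (intro exI[of _ "F ` (U \<inter> V1) \<inter> F ` (V \<inter> V1)"]) simp
qed

text \<open>Local injectivity excludes a second preimage near \<zeta>, and properness excludes one
  far from it for all values close to \<open>w\<close>.\<close>

lemma simple_nbhd:
  assumes w: "w \<in> S1" "w \<notin> crit" "w \<notin> mult"
  shows "\<exists>N. open N \<and> w \<in> N \<and> N \<inter> mult = {}"
proof -
  obtain \<zeta> where z: "\<zeta> \<in> V1" "F \<zeta> = w" using w(1) unfolding F_image[symmetric] by auto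
  have uniq: "\<xi> = \<zeta>" if "\<xi> \<in> C" "F \<xi> = w" for \<xi>
    using that w z C_S1_V1[of \<xi>] by (auto simp: mult_def)
  have "deriv F \<zeta> \<noteq> 0" using z w V1_strip by (auto simp: crit_def)
  then obtain e where e: "e > 0" "ball \<zeta> e \<subseteq> strip r R" "inj_on F (ball \<zeta> e)"
    using has_complex_derivative_locally_injective[OF F_hol _ open_strip] z V1_strip by blast
  \<comment> \<open>Values without any preimage in \<open>C\<close> outside the ball; open because
    \<open>F\<close> maps closed subsets of \<open>C\<close> to closed sets.\<close>
  define N where "N = - (F ` (C - ball \<zeta> e))"
  have "open N" unfolding N_def using F_closed[of "C - ball \<zeta> e"] closed_C by (auto intro: closed_Diff)
  moreover have "w \<in> N" unfolding N_def using uniq e by auto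
  moreover have "N \<inter> mult = {}"
  proof (rule ccontr)
    assume "N \<inter> mult \<noteq> {}"
    then obtain x a b where ab: "x \<in> N" "a \<in> V1" "b \<in> V1" "a \<noteq> b" "F a = x" "F b = x" by (auto simp: mult_def)
    have in_ball: "\<xi> \<in> ball \<zeta> e" if "\<xi> \<in> V1" "F \<xi> = x" for \<xi>
    proof (rule ccontr)
      assume "\<xi> \<notin> ball \<zeta> e"
      then have "\<xi> \<in> C - ball \<zeta> e" using that V1_C by blast
      then have "x \<in> F ` (C - ball \<zeta> e)" using that(2) by (metis imageI)
      then show False using ab(1) by (simp add: N_def)
    qed
    show False using inj_onD[OF e(3), of a b] in_ball[OF ab(2,5)] in_ball[OF ab(3,6)] ab(4-6) by simp
  qed
  ultimately show ?thesis by blast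
qed

text \<open>
  The multiple values of \<open>F\<close> form an open set, which is also relatively closed away from the countably
  many critical values and misses a point of the imaginary axis; hence it is empty.
\<close>

lemma F_inj: "inj_on F V1"
proof -
  define w where "w = F (\<i> * of_real 0)"
  have w: "w \<in> S1" "Re w = 0" unfolding w_def F_line[of 0] using line_S1[of "g 0"] by auto
  have line: "\<xi> = \<i> * of_real 0" if "\<xi> \<in> strip r R" "F \<xi> = w" for \<xi>
  proof -
    have 1: "\<xi> = \<i> * of_real (Im \<xi>)" by (rule F_imaginary_preimage) (use that w in auto)
    have "\<i> * of_real (g (Im \<xi>)) = \<i> * of_real (g 0)"
      unfolding F_line[symmetric] using 1 that(2) w_def by simp
    then have "g (Im \<xi>) = g 0" by simp
    then have "Im \<xi> = 0" by (rule g_inj)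
    then show ?thesis using 1 by simp
  qed
  have ncrit: "w \<notin> crit"
  proof
    assume "w \<in> crit"
    then obtain \<xi> where xi: "\<xi> \<in> strip r R" "deriv F \<xi> = 0" "F \<xi> = w" by (auto simp: crit_def)
    then show False using line[OF xi(1,3)] F_line_deriv_gt_1[of 0] by auto
  qed
  have nmult: "w \<notin> mult" using line V1_strip unfolding mult_def by blast
  define B where "B = \<Union> {N. open N \<and> N \<inter> mult = {}}"
  \<comment> \<open>Deleting a countable set does not disconnect an open connected set of the
    plane.\<close>
  have conn: "connected (S1 - crit)"
    by (rule connected_open_diff_countable) (use open_S1 connected_S1 countable_crit in auto)
  have "mult \<inter> (S1 - crit) = {} \<or> B \<inter> (S1 - crit) = {}"
  proof (rule connectedD[OF conn open_mult])
    show "open B" unfolding B_def by auto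
    show "mult \<inter> B \<inter> (S1 - crit) = {}" unfolding B_def by auto
    show "S1 - crit \<subseteq> mult \<union> B" using simple_nbhd unfolding B_def by blast
  qed
  moreover have "w \<in> B \<inter> (S1 - crit)" using simple_nbhd[OF w(1) ncrit nmult] w ncrit unfolding B_def by blast
  ultimately have "mult \<inter> (S1 - crit) = {}" by blast
  then have "mult \<subseteq> crit" unfolding mult_def by blast
  then have cm: "countable mult" using countable_crit countable_subset by blast
  have "mult = {}"
  proof (rule ccontr)
    assume "mult \<noteq> {}"
    then obtain x where "x \<in> mult" by blast
    then obtain e where "e > 0" "ball x e \<subseteq> mult" using open_mult open_contains_ball by blast
    then show False using cm uncountable_ball countable_subset by blast
  qed
  then show ?thesis unfolding inj_on_def mult_def V1_def by blast
qed

lemma inverse_exists: "\<exists>G. G holomorphic_on S1 \<and> (\<forall>\<zeta>\<in>V1. G (F \<zeta>) = \<zeta>)"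
proof -
  have "F holomorphic_on V1" using F_hol V1_strip by (rule holomorphic_on_subset)
  then obtain h where "h holomorphic_on F ` V1" "\<And>z. z \<in> V1 \<Longrightarrow> deriv F z * deriv h (F z) = 1"
    "\<And>z. z \<in> V1 \<Longrightarrow> h (F z) = z"
    using holomorphic_has_inverse[OF _ open_V1 F_inj] by blast
  then show ?thesis unfolding F_image by blast
qed

section \<open>The inverse \<open>G\<close> and the covering degree\<close>

definition G where "G = (SOME G. G holomorphic_on S1 \<and> (\<forall>\<zeta>\<in>V1. G (F \<zeta>) = \<zeta>))"

lemma G_hol: "G holomorphic_on S1" and G_F: "\<zeta> \<in> V1 \<Longrightarrow> G (F \<zeta>) = \<zeta>"
  using someI_ex[OF inverse_exists] unfolding G_def by auto

lemma F_G: "w \<in> S1 \<Longrightarrow> F (G w) = w" and G_V1: "w \<in> S1 \<Longrightarrow> G w \<in> V1"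
proof -
  show "F (G w) = w" "G w \<in> V1" if w: "w \<in> S1"
  proof -
    obtain \<zeta> where "\<zeta> \<in> V1" "w = F \<zeta>" using w unfolding F_image[symmetric] by blast
    then show "F (G w) = w" "G w \<in> V1" by (simp_all add: G_F)
  qed
qed

lemma V1_per [simp]: "\<zeta> + per n \<in> V1 \<longleftrightarrow> \<zeta> \<in> V1"
proof -
  have 1: "\<zeta> + per n \<in> V1" if "\<zeta> \<in> V1" for \<zeta> n
    using that V1_strip F_per[of \<zeta> n] by (auto simp: V1_def S1_def)
  show ?thesis using 1[of \<zeta> n] 1[of "\<zeta> + per n" "- n"] by (auto simp: per_add[symmetric] add.assoc)
qed

lemma S1_per [simp]: "w + per n \<in> S1 \<longleftrightarrow> w \<in> S1"
  by (simp add: S1_def)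

text \<open>\<open>F\<close> turns one period into \<open>d\<close> of them, so its inverse advances
  by one period when the argument advances by \<open>d\<close>.\<close>

lemma G_per: assumes "w \<in> S1" shows "G (w + per (d * n)) = G w + per n"
proof -
  have "F (G w + per n) = w + per (d * n)"
    using F_per[of "G w" n] G_V1[OF assms] V1_strip F_G[OF assms] by auto
  then show ?thesis using G_F[of "G w + per n"] G_V1[OF assms] by simp
qed

lemma G_line: "\<exists>t. G (\<i> * of_real s) = \<i> * of_real t"
proof -
  have "G (\<i> * of_real s) = \<i> * of_real (Im (G (\<i> * of_real s)))"
    by (rule F_imaginary_preimage) (use G_V1[OF line_S1] V1_strip F_G[OF line_S1] in auto)
  then show ?thesis by blast
qed

lemma G_deriv: "w \<in> S1 \<Longrightarrow> (G has_field_derivative deriv G w) (at w)"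
  by (rule holomorphic_derivI[OF G_hol open_S1])

lemma strip_S1: "strip r R \<subseteq> S1"
  using r1R1(1-3) by (auto simp: S1_def strip_def)

definition K where "K = nat d"

lemma K_d: "int K = d" "0 < K"
  using d_pos by (simp_all add: K_def)

lemma G_strip: "w \<in> S1 \<Longrightarrow> G w \<in> strip r R"
  using G_V1 V1_strip by blast

lemma tau_exp_G: "w \<in> S1 \<Longrightarrow> \<tau> (exp (G w)) = exp w"
  using F_exp[OF G_strip] F_G by metis

lemma exp_eq_per: "exp a = exp b \<Longrightarrow> \<exists>n. a = b + per n"
proof -
  assume "exp a = exp b"
  then obtain n :: int where "a = b + (of_int (2 * n) * pi) * \<i>" unfolding exp_eq by blast
  then have "a = b + per n" by (simp add: per_def mult_ac)
  then show ?thesis by blast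
qed

text \<open>The logarithms of exp w are w + 2 pi i n. Changing n by \<open>d\<close> moves
  \<open>G\<close> by a full period and leaves \<open>exp\<close> of it unchanged, so the residues
  modulo \<open>d\<close> enumerate the preimages.\<close>

lemma preimage_bij:
  assumes w: "Re w = 0"
  shows "bij_betw (\<lambda>k::nat. exp (G (w + per (int k)))) {..<K} {v \<in> sphere 0 1. \<tau> v = exp w}"
proof -
  have w_line: "w + per n = \<i> * of_real (Im w + 2 * pi * of_int n)" for n
    using w by (simp add: complex_eq_iff)
  then have wS: "w + per n \<in> S1" for n using line_S1 by metis
  show ?thesis unfolding bij_betw_def
  proof
    show "inj_on (\<lambda>k::nat. exp (G (w + per (int k)))) {..<K}"
    proof (rule inj_onI)
      fix k l assume kl: "k \<in> {..<K}" "l \<in> {..<K}" and eq: "exp (G (w + per (int k))) = exp (G (w + per (int l)))"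
      obtain m where m: "G (w + per (int k)) = G (w + per (int l)) + per m" using exp_eq_per[OF eq] by blast
      have "w + per (int k) = F (G (w + per (int l)) + per m)" using F_G[OF wS] m by metis
      also have "\<dots> = w + per (int l) + per (d * m)"
        using F_per[OF G_strip[OF wS]] F_G[OF wS] by metis
      finally have "per (int k) = per (int l + d * m)" by (simp add: per_add)
      then have km: "int k = int l + d * m" by simp
      have "m = 0"
      proof (rule ccontr)
        assume "m \<noteq> 0"
        then have "d \<le> \<bar>d * m\<bar>" using d_pos by (simp add: abs_mult mult_le_cancel_left1)
        moreover have "\<bar>d * m\<bar> < d" using km kl K_d by auto
        ultimately show False by simp
      qed
      then show "k = l" using km by simp
    qed
    show "(\<lambda>k::nat. exp (G (w + per (int k)))) ` {..<K} = {v \<in> sphere 0 1. \<tau> v = exp w}"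
    proof (intro subset_antisym subsetI)
      fix v assume "v \<in> (\<lambda>k::nat. exp (G (w + per (int k)))) ` {..<K}"
      then obtain k where k: "v = exp (G (w + per (int k)))" by blast
      obtain t where "G (w + per (int k)) = \<i> * of_real t" unfolding w_line using G_line by blast
      then have "cmod v = 1" unfolding k by simp
      moreover have "\<tau> v = exp w" unfolding k tau_exp_G[OF wS] by (simp add: exp_add)
      ultimately show "v \<in> {v \<in> sphere 0 1. \<tau> v = exp w}" by simp
    next
      fix v assume v: "v \<in> {v \<in> sphere 0 1. \<tau> v = exp w}"
      then have v1: "cmod v = 1" by simp
      define \<zeta> where "\<zeta> = \<i> * of_real (Im (Ln v))"
      have "v \<noteq> 0" using v1 by auto
      then have ez: "exp \<zeta> = v"
      proof -
        have "exp (Re (Ln v)) = 1" using v1 \<open>v \<noteq> 0\<close> by (metis exp_Ln norm_exp_eq_Re)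
        then have "Re (Ln v) = 0" by simp
        then have "\<zeta> = Ln v" by (simp add: \<zeta>_def complex_eq_iff)
        then show ?thesis using \<open>v \<noteq> 0\<close> by simp
      qed
      have zs: "\<zeta> \<in> strip r R" unfolding \<zeta>_def by (rule line_in_strip)
      have "exp (F \<zeta>) = exp w" using F_exp[OF zs] ez v by simp
      then obtain n where n: "F \<zeta> = w + per n" using exp_eq_per by blast
      \<comment> \<open>The residue selects the branch; the quotient \<open>m\<close> is the number
        of periods by which \<zeta> has to be moved back.\<close>
      define k where "k = nat (n mod d)"
      have k: "int k = n mod d" "k < K" using d_pos by (simp_all add: k_def K_def nat_less_iff)
      define m where "m = n div d"
      have nm: "n - d * m = int k" using k by (simp add: m_def minus_mult_div_eq_mod)
      have "\<zeta> \<in> V1"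
      proof (rule C_S1_V1)
        show "\<zeta> \<in> C" unfolding \<zeta>_def by (rule line_C)
        show "F \<zeta> \<in> S1" unfolding n by (rule wS)
      qed
      then have "\<zeta> - per m \<in> V1" using V1_per[of "\<zeta> - per m" m] by simp
      moreover have "F (\<zeta> - per m) = w + per (int k)"
        using F_per[OF zs, of "- m"] n nm by (simp add: per_add[symmetric] per_def algebra_simps)
      ultimately have "G (w + per (int k)) = \<zeta> - per m" using G_F by metis
      then have "exp (G (w + per (int k))) = v" using ez by (simp add: exp_diff)
      then show "v \<in> (\<lambda>k::nat. exp (G (w + per (int k)))) ` {..<K}" using k(2) by blast
    qed
  qed
qed

lemma degree: "covering_degree \<tau> = K"
  using bij_betw_same_card[OF preimage_bij[of 0]] by (simp add: covering_degree_def)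

section \<open>The transfer operator through the global inverse lift\<close>

text \<open>The transfer operator in the coordinate w = log z. By the chain rule the branch
  \<open>exp (G (w + per k))\<close> has the z-derivative
  \<open>exp (G (w + per k)) * deriv G (w + per k) / exp w\<close>.\<close>

definition tsum :: "(complex \<Rightarrow> complex) \<Rightarrow> complex \<Rightarrow> complex" where
  "tsum f w = (\<Sum>k<K. exp (G (w + per (int k))) * deriv G (w + per (int k)) * f (exp (G (w + per (int k))))) / exp w"

definition transf :: "(complex \<Rightarrow> complex) \<Rightarrow> complex \<Rightarrow> complex" where
  "transf f z = tsum f (Ln z)"

lemma deriv_G_per: assumes "w \<in> S1" shows "deriv G (w + per (d * n)) = deriv G w"
proof -
  have "((\<lambda>x. G (x + per (d * n))) has_field_derivative deriv G (w + per (d * n)) * 1) (at w)"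
    by (rule DERIV_chain2[OF G_deriv]) (use assms in \<open>auto intro!: derivative_eq_intros\<close>)
  then have "((\<lambda>x. G (x + per (d * n))) has_field_derivative deriv G (w + per (d * n))) (at w)" by simp
  then have "((\<lambda>x. G x + per n) has_field_derivative deriv G (w + per (d * n))) (at w)"
    by (rule has_field_derivative_transform_within_open[OF _ open_S1 assms]) (simp_all add: G_per)
  moreover have "((\<lambda>x. G x + per n) has_field_derivative deriv G w) (at w)"
    using G_deriv[OF assms] by (auto intro!: derivative_eq_intros)
  ultimately show ?thesis by (rule DERIV_unique)
qed

text \<open>A turn around the origin permutes the branches cyclically: the branch with index
  \<open>K\<close> is again the one with index 0.\<close>

lemma tsum_step: assumes w: "w \<in> S1" shows "tsum f (w + per 1) = tsum f w"
proof -
  define q where "q = (\<lambda>x. exp (G x) * deriv G x * f (exp (G x)))"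
  have "q (w + per (int K)) = q w"
    using G_per[OF w, of 1] deriv_G_per[OF w, of 1] K_d by (simp add: q_def exp_add)
  moreover have "(\<Sum>k<K. q (w + per (int (Suc k)))) + q (w + per 0) = (\<Sum>k<K. q (w + per (int k))) + q (w + per (int K))"
    using sum.lessThan_Suc_shift[of "\<lambda>k. q (w + per (int k))" K] by (simp add: add.commute)
  ultimately have "(\<Sum>k<K. q (w + per (int (Suc k)))) = (\<Sum>k<K. q (w + per (int k)))" by simp
  moreover have "w + per 1 + per (int k) = w + per (int (Suc k))" for k
  proof -
    have "per 1 + per (int k) = per (int (Suc k))" unfolding per_add(1)[symmetric] by simp
    then show ?thesis by (simp only: add.assoc)
  qed
  ultimately have "(\<Sum>k<K. q (w + per 1 + per (int k))) = (\<Sum>k<K. q (w + per (int k)))"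
    by (simp only:)
  then show ?thesis unfolding tsum_def q_def by (simp add: exp_add)
qed

lemma tsum_per: "w \<in> S1 \<Longrightarrow> tsum f (w + per n) = tsum f w"
proof (induction n rule: int_induct[where k=0])
  case (step1 i)
  have "w + per (i + 1) = (w + per i) + per 1" by (simp add: per_add add.assoc)
  then have "tsum f (w + per (i + 1)) = tsum f (w + per i)"
    using tsum_step[of "w + per i" f] step1 by (simp only: S1_per)
  then show ?case using step1 by simp
next
  case (step2 i)
  have "w + per i = (w + per (i - 1)) + per 1" by (simp add: per_add algebra_simps)
  then have "tsum f (w + per i) = tsum f (w + per (i - 1))"
    using tsum_step[of "w + per (i - 1)" f] step2 by (simp only: S1_per)
  then show ?case using step2 by simp
qed simp

lemma transf_exp: assumes w: "w \<in> S1" shows "transf f (exp w) = tsum f w"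
proof -
  have "exp (Ln (exp w)) = exp w" by simp
  then obtain n where "Ln (exp w) = w + per n" using exp_eq_per by blast
  then show ?thesis unfolding transf_def using tsum_per[OF w] by simp
qed

lemma tsum_hol: assumes f: "f holomorphic_on annulus r R" shows "tsum f holomorphic_on S1"
proof -
  have 1: "(\<lambda>w. G (w + per (int k))) holomorphic_on S1" for k
    by (rule holomorphic_on_compose_gen[OF _ G_hol, unfolded o_def]) (auto intro!: holomorphic_intros)
  have 2: "(\<lambda>w. deriv G (w + per (int k))) holomorphic_on S1" for k
    by (rule holomorphic_on_compose_gen[OF _ holomorphic_deriv[OF G_hol open_S1], unfolded o_def]) (auto intro!: holomorphic_intros)
  have 3: "(\<lambda>w. f (exp (G (w + per (int k))))) holomorphic_on S1" for k
    by (rule holomorphic_on_compose_gen[OF _ f, unfolded o_def])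
       (use G_strip[of "_ + per (int k)"] in \<open>auto intro!: holomorphic_intros 1 simp: strip_iff[symmetric]\<close>)
  show ?thesis unfolding tsum_def[abs_def] by (intro holomorphic_intros 1 2 3) auto
qed

text \<open>An angular window of width 2 pi, on which \<open>exp\<close> is injective. As the centre
  \<theta> is free, every point of the annulus lies inside a slit annulus with a holomorphic
  logarithm, away from its cut.\<close>

definition sector :: "real \<Rightarrow> complex set" where
  "sector \<theta> = {\<zeta> \<in> strip r R. \<theta> - pi < Im \<zeta> \<and> Im \<zeta> < \<theta> + pi}"

lemma sector_strip: "sector \<theta> \<subseteq> strip r R" and sector_S1: "sector \<theta> \<subseteq> S1"
  using strip_S1 by (auto simp: sector_def)

lemma open_sector: "open (sector \<theta>)"
proof -
  have "sector \<theta> = strip r R \<inter> ({\<zeta>. \<theta> - pi < Im \<zeta>} \<inter> {\<zeta>. Im \<zeta> < \<theta> + pi})" by (auto simp: sector_def)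
  then show ?thesis by (simp add: open_Int open_strip open_halfspace_Im_gt open_halfspace_Im_lt)
qed

lemma connected_sector: "connected (sector \<theta>)"
proof -
  have "sector \<theta> = strip r R \<inter> ({\<zeta>. \<theta> - pi < Im \<zeta>} \<inter> {\<zeta>. Im \<zeta> < \<theta> + pi})" by (auto simp: sector_def)
  then show ?thesis using radii_order radii_facts
    by (auto intro!: convex_connected convex_Int convex_strip convex_halfspace_Im_gt convex_halfspace_Im_lt)
qed

lemma exp_inj_sector: "inj_on exp (sector \<theta>)"
proof (rule inj_onI)
  fix a b assume ab: "a \<in> sector \<theta>" "b \<in> sector \<theta>" "exp a = exp b"
  then obtain n where n: "a = b + per n" using exp_eq_per by blast
  have "\<bar>2 * pi * of_int n\<bar> < 2 * pi" using ab n by (auto simp: sector_def)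
  then have "\<bar>real_of_int n\<bar> < 1" by (simp add: abs_mult)
  then have "n = 0" by linarith
  then show "a = b" using n by simp
qed

definition slit :: "real \<Rightarrow> complex set" where
  "slit \<theta> = exp ` sector \<theta>"

lemma open_slit: "open (slit \<theta>)"
  unfolding slit_def by (rule open_mapping_thm3[OF holomorphic_on_exp open_sector exp_inj_sector])

lemma connected_slit: "connected (slit \<theta>)"
  unfolding slit_def by (intro connected_continuous_image continuous_intros connected_sector)

lemma slit_annulus: "slit \<theta> \<subseteq> annulus r R"
  unfolding slit_def by (auto simp: strip_iff[symmetric] dest: subsetD[OF sector_strip])

lemma slit_branch_exists: "\<exists>L. L holomorphic_on slit \<theta> \<and> (\<forall>\<zeta>\<in>sector \<theta>. L (exp \<zeta>) = \<zeta> \<and> exp \<zeta> * deriv L (exp \<zeta>) = 1)"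
proof -
  obtain L where L: "L holomorphic_on exp ` sector \<theta>" "\<And>z. z \<in> sector \<theta> \<Longrightarrow> deriv exp z * deriv L (exp z) = 1"
    "\<And>z. z \<in> sector \<theta> \<Longrightarrow> L (exp z) = z"
    using holomorphic_has_inverse[OF holomorphic_on_exp open_sector exp_inj_sector] by blast
  have "deriv exp z = exp z" for z :: complex by (rule DERIV_imp_deriv[OF DERIV_exp])
  then show ?thesis using L unfolding slit_def by auto
qed

definition Lg where "Lg \<theta> = (SOME L. L holomorphic_on slit \<theta> \<and> (\<forall>\<zeta>\<in>sector \<theta>. L (exp \<zeta>) = \<zeta> \<and> exp \<zeta> * deriv L (exp \<zeta>) = 1))"

lemma Lg_hol: "Lg \<theta> holomorphic_on slit \<theta>"
  and Lg_exp: "\<zeta> \<in> sector \<theta> \<Longrightarrow> Lg \<theta> (exp \<zeta>) = \<zeta>"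
  and Lg_deriv: "\<zeta> \<in> sector \<theta> \<Longrightarrow> exp \<zeta> * deriv (Lg \<theta>) (exp \<zeta>) = 1"
  using someI_ex[OF slit_branch_exists[of \<theta>]] unfolding Lg_def by auto

lemma Lg_slit: assumes "z \<in> slit \<theta>" shows "Lg \<theta> z \<in> sector \<theta>" "exp (Lg \<theta> z) = z"
  using assms Lg_exp by (auto simp: slit_def)

definition branch :: "real \<Rightarrow> nat \<Rightarrow> complex \<Rightarrow> complex" where
  "branch \<theta> k z = exp (G (Lg \<theta> z + per (int k)))"

lemma Lg_S1: "z \<in> slit \<theta> \<Longrightarrow> Lg \<theta> z + per n \<in> S1"
  using subsetD[OF sector_S1 Lg_slit(1)] by simp

lemma branch_hol: "branch \<theta> k holomorphic_on slit \<theta>"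
  unfolding branch_def[abs_def]
  by (intro holomorphic_intros holomorphic_on_compose_gen[OF _ G_hol, unfolded o_def])
     (auto intro!: holomorphic_intros Lg_hol Lg_S1)

lemma branch_annulus: "z \<in> slit \<theta> \<Longrightarrow> branch \<theta> k z \<in> annulus r R"
  unfolding branch_def strip_iff[symmetric] by (intro G_strip Lg_S1)

lemma tau_branch: "z \<in> slit \<theta> \<Longrightarrow> \<tau> (branch \<theta> k z) = z"
  unfolding branch_def using tau_exp_G[OF Lg_S1] Lg_slit(2) by (simp add: exp_add)

lemma branch_bij:
  assumes "z \<in> slit \<theta>" "cmod z = 1"
  shows "bij_betw (\<lambda>k. branch \<theta> k z) {..<K} {v \<in> sphere 0 1. \<tau> v = z}"
proof -
  have "exp (Re (Lg \<theta> z)) = 1" using assms Lg_slit(2)[OF assms(1)] by (metis norm_exp_eq_Re)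
  then have "Re (Lg \<theta> z) = 0" by simp
  from preimage_bij[OF this] show ?thesis
    unfolding branch_def using Lg_slit(2)[OF assms(1)] by simp
qed

lemma branch_sum:
  assumes z: "z \<in> slit \<theta>"
  shows "(\<Sum>k<K. deriv (branch \<theta> k) z * f (branch \<theta> k z)) = transf f z"
proof -
  have "deriv (branch \<theta> k) z = exp (G (Lg \<theta> z + per (int k))) * (deriv G (Lg \<theta> z + per (int k)) * deriv (Lg \<theta>) z)" for k
  proof -
    have 1: "((\<lambda>z. Lg \<theta> z + per (int k)) has_field_derivative deriv (Lg \<theta>) z) (at z)"
      using holomorphic_derivI[OF Lg_hol open_slit z] by (auto intro!: derivative_eq_intros)
    have "(branch \<theta> k has_field_derivative exp (G (Lg \<theta> z + per (int k))) * (deriv G (Lg \<theta> z + per (int k)) * deriv (Lg \<theta>) z)) (at z)"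
      unfolding branch_def[abs_def]
      by (rule DERIV_chain2[OF DERIV_exp DERIV_chain2[OF G_deriv[OF Lg_S1[OF z]] 1]])
    then show ?thesis by (rule DERIV_imp_deriv)
  qed
  moreover have "deriv (Lg \<theta>) z = 1 / exp (Lg \<theta> z)"
  proof -
    have "exp (Lg \<theta> z) * deriv (Lg \<theta>) z = 1"
      using Lg_deriv[OF Lg_slit(1)[OF z]] by (simp only: Lg_slit(2)[OF z])
    then show ?thesis by (metis exp_not_eq_zero nonzero_eq_divide_eq mult.commute)
  qed
  ultimately have "(\<Sum>k<K. deriv (branch \<theta> k) z * f (branch \<theta> k z)) = tsum f (Lg \<theta> z)"
    unfolding tsum_def branch_def sum_divide_distrib by (intro sum.cong) simp_all
  also have "\<dots> = transf f (exp (Lg \<theta> z))"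
    by (rule transf_exp[OF subsetD[OF sector_S1 Lg_slit(1)[OF z]], symmetric])
  finally show ?thesis using Lg_slit(2)[OF z] by simp
qed

lemma in_slit: assumes "z \<in> annulus r R" shows "z \<in> slit (Im (Ln z))"
proof -
  have "z \<noteq> 0" using assms radii_order by (auto simp: annulus_def)
  then have "exp (Ln z) = z" by simp
  moreover have "Ln z \<in> sector (Im (Ln z))"
    using assms \<open>exp (Ln z) = z\<close> by (simp add: sector_def strip_iff)
  ultimately show ?thesis unfolding slit_def by (metis imageI)
qed

lemma transf_hol: assumes f: "f holomorphic_on annulus r R" shows "transf f holomorphic_on annulus r R"
  unfolding holomorphic_on_open[OF open_annulus]
proof
  fix z assume z: "z \<in> annulus r R"
  define \<theta> where "\<theta> = Im (Ln z)"
  have zs: "z \<in> slit \<theta>" using in_slit[OF z] by (simp add: \<theta>_def)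
  have "(\<lambda>z. tsum f (Lg \<theta> z)) holomorphic_on slit \<theta>"
    by (rule holomorphic_on_compose_gen[OF Lg_hol tsum_hol[OF f], unfolded o_def]) (use subsetD[OF sector_S1 Lg_slit(1)] in auto)
  moreover have "tsum f (Lg \<theta> x) = transf f x" if "x \<in> slit \<theta>" for x
    using transf_exp[OF subsetD[OF sector_S1 Lg_slit(1)[OF that]], of f] Lg_slit(2)[OF that] by simp
  ultimately have "transf f holomorphic_on slit \<theta>" by (rule holomorphic_transform)
  then show "\<exists>f'. (transf f has_field_derivative f') (at z)"
    unfolding holomorphic_on_open[OF open_slit] using zs by blast
qed

lemma slit_local_inverses: "local_inverses \<tau> (annulus r R) (slit \<theta>) (branch \<theta>)"
  unfolding local_inverses_def degree
proof (intro conjI allI impI ballI)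
  have "\<i> * of_real \<theta> \<in> sector \<theta>" using line_in_strip by (simp add: sector_def)
  then have "exp (\<i> * of_real \<theta>) \<in> slit \<theta>" unfolding slit_def by blast
  moreover have "exp (\<i> * of_real \<theta>) \<in> sphere 0 1" by simp
  ultimately show "slit \<theta> \<inter> sphere 0 1 \<noteq> {}" by blast
  show "bij_betw (\<lambda>k. branch \<theta> k z) {..<K} {w \<in> sphere 0 1. \<tau> w = z}" if "z \<in> slit \<theta> \<inter> sphere 0 1" for z
    using that by (intro branch_bij) auto
qed (auto intro: open_slit connected_slit slit_annulus[THEN subsetD] branch_hol branch_annulus tau_branch)

text \<open>The derivative of \<tau> does not vanish on the unit circle, so \<tau> is injective near
  the common value; two continuous right inverses with this value then coincide.\<close>

lemma local_inverses_agree: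
  assumes \<phi>: "\<phi> holomorphic_on U" "open U" "z0 \<in> U" "\<And>z. z \<in> U \<Longrightarrow> \<tau> (\<phi> z) = z"
    and \<psi>: "\<psi> holomorphic_on V" "open V" "z0 \<in> V" "\<And>z. z \<in> V \<Longrightarrow> \<tau> (\<psi> z) = z"
    and eq: "\<phi> z0 = \<psi> z0" "cmod (\<phi> z0) = 1"
  shows "\<forall>\<^sub>F z in nhds z0. \<phi> z = \<psi> z"
proof -
  have v: "\<phi> z0 \<in> annulus r R" using eq radii_facts by (simp add: annulus_def)
  have "deriv \<tau> (\<phi> z0) \<noteq> 0" using expanding[OF eq(2)] by auto
  then obtain e where e: "e > 0" "inj_on \<tau> (ball (\<phi> z0) e)"
    using has_complex_derivative_locally_injective[OF hol v open_annulus] by blast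
  have "isCont \<phi> z0" "isCont \<psi> z0"
    using holomorphic_on_imp_continuous_on[OF \<phi>(1)] holomorphic_on_imp_continuous_on[OF \<psi>(1)] \<phi> \<psi>
    by (simp_all add: continuous_on_eq_continuous_at)
  then have "(\<phi> \<longlongrightarrow> \<phi> z0) (nhds z0)" "(\<psi> \<longlongrightarrow> \<psi> z0) (nhds z0)"
    by (simp_all add: isCont_def tendsto_at_iff_tendsto_nhds)
  then have "\<forall>\<^sub>F z in nhds z0. \<phi> z \<in> ball (\<phi> z0) e" "\<forall>\<^sub>F z in nhds z0. \<psi> z \<in> ball (\<phi> z0) e"
    using topological_tendstoD[OF _ open_ball, of \<phi> "\<phi> z0" "nhds z0" "\<phi> z0" e] topological_tendstoD[OF _ open_ball, of \<psi> "\<psi> z0" "nhds z0" "\<phi> z0" e] e(1) eq(1) by simp_all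
  moreover have "\<forall>\<^sub>F z in nhds z0. z \<in> U" "\<forall>\<^sub>F z in nhds z0. z \<in> V"
    using \<phi> \<psi> by (simp_all add: eventually_nhds_in_open)
  ultimately show ?thesis
  proof eventually_elim
    case (elim z)
    then show ?case using inj_onD[OF e(2), of "\<phi> z" "\<psi> z"] \<phi>(4)[of z] \<psi>(4)[of z] by simp
  qed
qed

text \<open>At a point of the unit circle both families enumerate the same preimages, so they agree
  nearby up to a permutation. The sums agree there, and the identity theorem extends this over the
  connected \<open>U\<close>, even where branches cannot be compared one by one.\<close>

lemma local_inverses_sum:
  assumes f: "f holomorphic_on annulus r R" and li: "local_inverses \<tau> (annulus r R) U \<phi>" and z: "z \<in> U"
  shows "(\<Sum>k<K. deriv (\<phi> k) z * f (\<phi> k z)) = transf f z"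
proof -
  from li have U: "open U" "connected U" "U \<subseteq> annulus r R" "U \<inter> sphere 0 1 \<noteq> {}"
    and \<phi>: "\<And>k. k < K \<Longrightarrow> \<phi> k holomorphic_on U" "\<And>k x. k < K \<Longrightarrow> x \<in> U \<Longrightarrow> \<phi> k x \<in> annulus r R"
      "\<And>k x. k < K \<Longrightarrow> x \<in> U \<Longrightarrow> \<tau> (\<phi> k x) = x"
    and bij: "\<And>x. x \<in> U \<Longrightarrow> cmod x = 1 \<Longrightarrow> bij_betw (\<lambda>k. \<phi> k x) {..<K} {w \<in> sphere 0 1. \<tau> w = x}"
    unfolding local_inverses_def degree by (auto simp: image_subset_iff)
  obtain z0 where z0: "z0 \<in> U" "cmod z0 = 1" using U(4) by auto
  define \<theta> where "\<theta> = Im (Ln z0)"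
  have z0s: "z0 \<in> slit \<theta>" using in_slit[of z0] z0 U(3) by (auto simp: \<theta>_def)
  note b1 = bij[OF z0] and b2 = branch_bij[OF z0s z0(2)]
  \<comment> \<open>The permutation that matches \<open>\<phi> k\<close> with the branch taking the
    same value at \<open>z0\<close>.\<close>
  define \<sigma> where "\<sigma> = (\<lambda>k. inv_into {..<K} (\<lambda>k. branch \<theta> k z0) (\<phi> k z0))"
  have b3: "bij_betw (inv_into {..<K} (\<lambda>k. branch \<theta> k z0)) {w \<in> sphere 0 1. \<tau> w = z0} {..<K}"
    by (rule bij_betw_inv_into[OF b2])
  have \<sigma>: "bij_betw \<sigma> {..<K} {..<K}"
    using bij_betw_trans[OF b1 b3] unfolding \<sigma>_def o_def .
  have \<sigma>eq: "branch \<theta> (\<sigma> k) z0 = \<phi> k z0" if "k < K" for k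
    unfolding \<sigma>_def
    using bij_betw_inv_into_right[OF b2] bij_betw_apply[OF b1, of k] that by simp
  have "\<forall>\<^sub>F x in nhds z0. \<forall>k\<in>{..<K}. \<forall>\<^sub>F y in nhds x. \<phi> k y = branch \<theta> (\<sigma> k) y"
  proof (intro eventually_ball_finite finite_lessThan ballI)
    fix k assume k: "k \<in> {..<K}"
    have "\<forall>\<^sub>F x in nhds z0. \<phi> k x = branch \<theta> (\<sigma> k) x"
    proof (rule local_inverses_agree[OF \<phi>(1) U(1) z0(1) \<phi>(3) branch_hol open_slit z0s tau_branch])
      show "\<phi> k z0 = branch \<theta> (\<sigma> k) z0" using \<sigma>eq k by simp
      show "cmod (\<phi> k z0) = 1" using bij_betw_apply[OF b1 k] by simp
    qed (use k in auto)
    then show "\<forall>\<^sub>F x in nhds z0. \<forall>\<^sub>F y in nhds x. \<phi> k y = branch \<theta> (\<sigma> k) y"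
      by (simp add: eventually_eventually)
  qed
  moreover have "\<forall>\<^sub>F x in nhds z0. x \<in> U \<inter> slit \<theta>"
    using U(1) z0 z0s open_slit by (intro eventually_nhds_in_open) auto
  ultimately have "\<forall>\<^sub>F x in nhds z0. x \<in> U \<and> (\<Sum>k<K. deriv (\<phi> k) x * f (\<phi> k x)) = transf f x"
  proof eventually_elim
    case (elim x)
    have "(\<Sum>k<K. deriv (\<phi> k) x * f (\<phi> k x)) = (\<Sum>k<K. deriv (branch \<theta> (\<sigma> k)) x * f (branch \<theta> (\<sigma> k) x))"
    proof (intro sum.cong refl)
      fix k assume k: "k \<in> {..<K}"
      \<comment> \<open>Agreement on a neighbourhood of \<open>x\<close> is needed, not only at
        \<open>x\<close>, because the summands contain derivatives.\<close>
      have ev: "\<forall>\<^sub>F y in nhds x. \<phi> k y = branch \<theta> (\<sigma> k) y" using elim k by blast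
      have "deriv (\<phi> k) x = deriv (branch \<theta> (\<sigma> k)) x" by (rule deriv_cong_ev[OF ev refl])
      moreover have "\<phi> k x = branch \<theta> (\<sigma> k) x" using ev by (rule eventually_nhds_x_imp_x)
      ultimately show "deriv (\<phi> k) x * f (\<phi> k x) = deriv (branch \<theta> (\<sigma> k)) x * f (branch \<theta> (\<sigma> k) x)" by simp
    qed
    also have "\<dots> = (\<Sum>k<K. deriv (branch \<theta> k) x * f (branch \<theta> k x))"
      by (rule sum.reindex_bij_betw[OF \<sigma>])
    also have "\<dots> = transf f x" using elim by (intro branch_sum) auto
    finally show ?case using elim by simp
  qed
  then obtain W where W: "open W" "z0 \<in> W" "\<And>x. x \<in> W \<Longrightarrow> x \<in> U \<and> (\<Sum>k<K. deriv (\<phi> k) x * f (\<phi> k x)) = transf f x"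
    unfolding eventually_nhds by blast
  show ?thesis
  proof (rule analytic_continuation_open[of W U "\<lambda>z. \<Sum>k<K. deriv (\<phi> k) z * f (\<phi> k z)" "transf f"])
    show "(\<lambda>z. \<Sum>k<K. deriv (\<phi> k) z * f (\<phi> k z)) holomorphic_on U"
    proof (intro holomorphic_intros holomorphic_deriv U(1) \<phi>(1))
      fix k assume "k \<in> {..<K}"
      then show "(\<lambda>x. f (\<phi> k x)) holomorphic_on U"
        by (intro holomorphic_on_compose_gen[OF _ f, unfolded o_def] \<phi>(1)) (auto intro: \<phi>(2))
    qed auto
    show "transf f holomorphic_on U" using transf_hol[OF f] U(3) by (rule holomorphic_on_subset)
  qed (use W U z in auto)
qed

theorem transfer_operator_transf:
  assumes f: "f holomorphic_on annulus r R"
  shows "transfer_operator \<tau> r R f = zero_ext (annulus r R) (transf f)"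
  unfolding transfer_operator_def
proof (rule ext)
  fix z
  show "zero_ext (annulus r R) (\<lambda>z. THE c. \<exists>U \<phi>. z \<in> U \<and> local_inverses \<tau> (annulus r R) U \<phi> \<and>
       c = (\<Sum>k<covering_degree \<tau>. deriv (\<phi> k) z * f (\<phi> k z))) z = zero_ext (annulus r R) (transf f) z"
  proof (cases "z \<in> annulus r R")
    case True
    have "(THE c. \<exists>U \<phi>. z \<in> U \<and> local_inverses \<tau> (annulus r R) U \<phi> \<and>
       c = (\<Sum>k<covering_degree \<tau>. deriv (\<phi> k) z * f (\<phi> k z))) = transf f z"
    proof (rule the_equality)
      show "\<exists>U \<phi>. z \<in> U \<and> local_inverses \<tau> (annulus r R) U \<phi> \<and>
         transf f z = (\<Sum>k<covering_degree \<tau>. deriv (\<phi> k) z * f (\<phi> k z))"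
        using in_slit[OF True] slit_local_inverses branch_sum[OF in_slit[OF True]] unfolding degree by metis
      show "c = transf f z" if "\<exists>U \<phi>. z \<in> U \<and> local_inverses \<tau> (annulus r R) U \<phi> \<and>
         c = (\<Sum>k<covering_degree \<tau>. deriv (\<phi> k) z * f (\<phi> k z))" for c
        using that local_inverses_sum[OF f] unfolding degree by auto
    qed
    then show ?thesis by (simp add: zero_ext_def)
  qed (simp add: zero_ext_def)
qed

text \<open>All branches land in \<open>C\<close>, so only values of \<open>f\<close> with moduli in
  [r0, R0] enter. The kernels are continuous on a compact period box, which fits into
  \<open>S1\<close> because r1 < r and R < R1.\<close>

lemma transf_bounded:
  "\<exists>M\<ge>0. \<forall>f B. (\<forall>z. r0 \<le> cmod z \<and> cmod z \<le> R0 \<longrightarrow> cmod (f z) \<le> B) \<longrightarrow> (\<forall>z\<in>annulus r R. cmod (transf f z) \<le> M * B)"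
proof -
  define bx where "bx = cbox (Complex (ln r) (-pi)) (Complex (ln R) pi)"
  define q where "q = (\<lambda>w. \<Sum>k<K. cmod (exp (G (w + per (int k))) * deriv G (w + per (int k)) / exp w))"
  have bxS: "bx \<subseteq> S1"
  proof
    fix w assume "w \<in> bx"
    then have "ln r \<le> Re w" "Re w \<le> ln R" by (simp_all add: bx_def in_cbox_complex_iff)
    then have "r \<le> exp (Re w)" "exp (Re w) \<le> R"
      using radii_order radii_facts by (metis exp_le_cancel_iff exp_ln)+
    then show "w \<in> S1" using r1R1(2,3) by (simp add: S1_def strip_def)
  qed
  have c1: "continuous_on bx (\<lambda>w. G (w + per (int k)))" for k
    by (rule continuous_on_compose2[OF holomorphic_on_imp_continuous_on[OF G_hol]])
       (use bxS in \<open>auto intro!: continuous_intros\<close>)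
  have c2: "continuous_on bx (\<lambda>w. deriv G (w + per (int k)))" for k
    by (rule continuous_on_compose2[OF holomorphic_on_imp_continuous_on[OF holomorphic_deriv[OF G_hol open_S1]]])
       (use bxS in \<open>auto intro!: continuous_intros\<close>)
  have "continuous_on bx q"
    unfolding q_def by (intro continuous_intros c1 c2) auto
  then have "bounded (q ` bx)"
    by (intro compact_imp_bounded compact_continuous_image) (simp_all add: bx_def)
  then obtain M0 where M0: "\<And>w. w \<in> bx \<Longrightarrow> \<bar>q w\<bar> \<le> M0" unfolding bounded_iff by auto
  show ?thesis
  proof (intro exI[of _ "\<bar>M0\<bar>"] conjI allI impI ballI)
    fix f B z assume B: "\<forall>z. r0 \<le> cmod z \<and> cmod z \<le> R0 \<longrightarrow> cmod (f z) \<le> B" and z: "z \<in> annulus r R"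
    have B0: "0 \<le> B" using B[rule_format, of 1] radii_order by (auto intro: order_trans[OF norm_ge_zero])
    have nz: "z \<noteq> 0" using z radii_order by (auto simp: annulus_def)
    define w where "w = Ln z"
    have "ln r \<le> Re w" "Re w \<le> ln R"
      using z nz radii_order by (auto simp: w_def annulus_def Re_Ln)
    then have w: "w \<in> bx"
      using nz mpi_less_Im_Ln[OF nz] Im_Ln_le_pi[OF nz] by (simp add: bx_def in_cbox_complex_iff w_def)
    have fb: "cmod (f (exp (G (w + per (int k))))) \<le> B" for k
    proof -
      have "G (w + per (int k)) \<in> C" using G_V1[of "w + per (int k)"] V1_C w bxS by auto
      then show ?thesis using B by (simp add: C_def)
    qed
    have "cmod (transf f z) \<le> (\<Sum>k<K. cmod (exp (G (w + per (int k))) * deriv G (w + per (int k)) / exp w) * B)"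
      unfolding transf_def w_def[symmetric] tsum_def sum_divide_distrib
    proof (rule sum_norm_le)
      fix k
      have "cmod (exp (G (w + per (int k))) * deriv G (w + per (int k)) * f (exp (G (w + per (int k)))) / exp w) =
        cmod (exp (G (w + per (int k))) * deriv G (w + per (int k)) / exp w) * cmod (f (exp (G (w + per (int k)))))"
        by (simp add: norm_mult norm_divide)
      also have "\<dots> \<le> cmod (exp (G (w + per (int k))) * deriv G (w + per (int k)) / exp w) * B"
        by (intro mult_left_mono fb) simp
      finally show "cmod (exp (G (w + per (int k))) * deriv G (w + per (int k)) * f (exp (G (w + per (int k)))) / exp w) \<le> \<dots>" .
    qed
    also have "\<dots> = q w * B" by (simp add: q_def sum_distrib_right)
    also have "\<dots> \<le> \<bar>M0\<bar> * B" using M0[OF w] B0 by (intro mult_right_mono) auto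
    finally show "cmod (transf f z) \<le> \<bar>M0\<bar> * B" .
  qed simp
qed

text \<open>
  The change of variables \<open>w = \<tau> z\<close> on the unit circle: a primitive \<open>H\<close> of the lifted integrand
  turns the sum over the branches into a telescoping sum of increments of \<open>H \<circ> G\<close>.
\<close>

lemma transf_change_of_variables:
  assumes f: "f holomorphic_on annulus r R" and E: "E holomorphic_on - {0}"
  shows "circ (\<lambda>t. transf f (rcis 1 t) * E (rcis 1 t) * rcis 1 t) = circ (\<lambda>t. f (rcis 1 t) * E (\<tau> (rcis 1 t)) * rcis 1 t)"
proof -
  \<comment> \<open>The differential f(z) E(\<tau> z) dz in the coordinate z = exp \<zeta>. It is
    periodic since \<open>F\<close> changes by a multiple of 2 pi i.\<close>
  define P where "P = (\<lambda>\<zeta>. exp \<zeta> * f (exp \<zeta>) * E (exp (F \<zeta>)))"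
  have P: "P holomorphic_on strip r R"
    unfolding P_def
    by (intro holomorphic_intros holomorphic_on_compose_gen[OF _ f, unfolded o_def] holomorphic_on_compose_gen[OF _ E, unfolded o_def] F_hol)
       (auto simp: strip_iff)
  have Pper: "P (\<zeta> + 2 * of_real pi * \<i>) = P \<zeta>" if "\<zeta> \<in> strip r R" for \<zeta>
    using F_per[OF that, of 1] by (simp add: P_def per_def[of 1] exp_add)
  obtain H c where H: "\<And>\<zeta>. \<zeta> \<in> strip r R \<Longrightarrow> (H has_field_derivative P \<zeta>) (at \<zeta>)"
    and Hc: "\<And>\<zeta>. \<zeta> \<in> strip r R \<Longrightarrow> H (\<zeta> + 2 * of_real pi * \<i>) = H \<zeta> + c"
    and c: "\<And>\<rho>. r < \<rho> \<Longrightarrow> \<rho> < R \<Longrightarrow> c = 2 * of_real pi * \<i> * circ (\<lambda>t. P (of_real (ln \<rho>) + \<i> * of_real t))"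
    using periodic_primitive[OF radii_order(1) radii_facts(4) P Pper] by blast
  have rc: "exp (\<i> * of_real t) = rcis 1 t" for t by (simp add: rcis_def cis_conv_exp)
  have "c = 2 * of_real pi * \<i> * circ (\<lambda>t. P (\<i> * of_real t))"
    using c[of 1] radii_facts by simp
  also have "(\<lambda>t. P (\<i> * of_real t)) = (\<lambda>t. f (rcis 1 t) * E (\<tau> (rcis 1 t)) * rcis 1 t)"
    unfolding P_def F_exp[OF line_in_strip] rc by (simp add: mult_ac)
  finally have rhs: "c = 2 * of_real pi * \<i> * circ (\<lambda>t. f (rcis 1 t) * E (\<tau> (rcis 1 t)) * rcis 1 t)" .
  \<comment> \<open>Since \<open>F (G w) = w\<close>, differentiating gives the integrand of the
    left-hand side, again in logarithmic coordinates.\<close>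
  define Q where "Q = (\<lambda>w. \<Sum>k<K. H (G (w + per (int k))))"
  have Q: "(Q has_field_derivative tsum f w * E (exp w) * exp w) (at w)" if w: "w \<in> S1" for w
  proof -
    have 1: "((\<lambda>w. G (w + per (int k))) has_field_derivative deriv G (w + per (int k)) * 1) (at w)" for k
      by (rule DERIV_chain2[OF G_deriv]) (use w in \<open>auto intro!: derivative_eq_intros\<close>)
    have "((\<lambda>w. H (G (w + per (int k)))) has_field_derivative P (G (w + per (int k))) * (deriv G (w + per (int k)) * 1)) (at w)" for k
      by (rule DERIV_chain2[OF H 1]) (use w in \<open>auto intro: G_strip\<close>)
    then have "(Q has_field_derivative (\<Sum>k<K. P (G (w + per (int k))) * (deriv G (w + per (int k)) * 1))) (at w)"
      unfolding Q_def by (intro DERIV_sum)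
    moreover have "P (G (w + per (int k))) = exp (G (w + per (int k))) * f (exp (G (w + per (int k)))) * E (exp w)" for k
      unfolding P_def using F_G[of "w + per (int k)"] w by (simp add: exp_add)
    ultimately show ?thesis
      unfolding tsum_def times_divide_eq_left by (simp add: mult_ac) (simp add: sum_distrib_left mult_ac)
  qed
  have "((\<lambda>t. transf f (rcis 1 t) * E (rcis 1 t) * rcis 1 t) has_integral
      (Q (\<i> * of_real (2 * pi)) / \<i> - Q (\<i> * of_real 0) / \<i>)) {0..2*pi}"
  proof (rule fundamental_theorem_of_calculus)
    fix t :: real
    have "((\<lambda>z. \<i> * z) has_field_derivative \<i>) (at (of_real t))" by (auto intro!: derivative_eq_intros)
    from DERIV_cdivide[OF DERIV_chain2[OF Q[OF line_S1] this], of \<i>]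
    have "((\<lambda>z. Q (\<i> * z) / \<i>) has_field_derivative tsum f (\<i> * of_real t) * E (exp (\<i> * of_real t)) * exp (\<i> * of_real t)) (at (of_real t))"
      by (simp only: nonzero_mult_div_cancel_right[OF complex_i_not_zero])
    moreover have "tsum f (\<i> * of_real t) = transf f (rcis 1 t)"
      using transf_exp[OF line_S1] rc by metis
    ultimately have "((\<lambda>z. Q (\<i> * z) / \<i>) has_field_derivative transf f (rcis 1 t) * E (rcis 1 t) * rcis 1 t) (at (of_real t))"
      by (simp only: rc)
    then have "((\<lambda>t. Q (\<i> * of_real t) / \<i>) has_vector_derivative transf f (rcis 1 t) * E (rcis 1 t) * rcis 1 t) (at t)"
      by (rule has_vector_derivative_real_field)
    then show "((\<lambda>t. Q (\<i> * of_real t) / \<i>) has_vector_derivative transf f (rcis 1 t) * E (rcis 1 t) * rcis 1 t) (at t within {0..2*pi})"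
      by (rule has_vector_derivative_at_within)
  qed simp
  moreover have "Q (\<i> * of_real (2 * pi)) - Q (\<i> * of_real 0) = c"
  proof -
    have two: "\<i> * of_real (2 * pi) = per 1" by (simp add: per_def mult_ac)
    have 0: "0 \<in> S1" using line_S1[of 0] by simp
    have "Q (per 1) = (\<Sum>k<K. H (G (per (int (Suc k)))))"
      unfolding Q_def per_add(1)[symmetric] by (simp add: add.commute)
    moreover have "Q 0 = (\<Sum>k<K. H (G (per (int k))))" by (simp add: Q_def)
    ultimately have "Q (per 1) - Q 0 = (\<Sum>k<K. H (G (per (int (Suc k)))) - H (G (per (int k))))"
      by (simp add: sum_subtractf)
    also have "\<dots> = H (G (per (int K))) - H (G (per 0))"
      using sum_lessThan_telescope[of "\<lambda>k. H (G (per (int k)))" K] by simp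
    also have "G (per (int K)) = G 0 + 2 * of_real pi * \<i>"
      using G_per[OF 0, of 1] K_d by (simp add: per_def)
    also have "H \<dots> = H (G 0) + c" by (rule Hc[OF G_strip[OF 0]])
    finally show ?thesis unfolding two by simp
  qed
  ultimately have "((\<lambda>t. transf f (rcis 1 t) * E (rcis 1 t) * rcis 1 t) has_integral (c / \<i>)) {0..2*pi}"
    by (simp only: diff_divide_distrib[symmetric])
  then have "circ (\<lambda>t. transf f (rcis 1 t) * E (rcis 1 t) * rcis 1 t) = c / \<i> / (2 * of_real pi)"
    unfolding circ_def by (simp only: integral_unique)
  also have "\<dots> = circ (\<lambda>t. f (rcis 1 t) * E (\<tau> (rcis 1 t)) * rcis 1 t)"
    unfolding rhs by simp
  finally show ?thesis .
qed

end

section \<open>Point evaluations and bounded functions\<close>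

text \<open>As the radius tends to the outer circle the damping of \<open>v\<close> disappears, and
  at the inner circle that of \<open>u\<close>; partial sums keep the bound in the limit.\<close>

lemma hann_n2_le:
  assumes r: "0 < r" "r < R" and vu: "l2 v" "l2 u"
    and B: "\<And>\<rho>. r < \<rho> \<Longrightarrow> \<rho> < R \<Longrightarrow> circle_mean_square \<rho> (hann r R v u) \<le> B"
  shows "n2 v \<le> B" "n2 u \<le> B"
proof -
  have le: "(\<Sum>n<N. (cmod (v n * of_real (\<rho> / R) ^ n))\<^sup>2) \<le> B \<and> (\<Sum>n<N. (cmod (u n * of_real (r / \<rho>) ^ Suc n))\<^sup>2) \<le> B"
    if \<rho>: "r < \<rho>" "\<rho> < R" for \<rho> N
  proof -
    have "(\<Sum>n<N. (cmod (v n * of_real (\<rho> / R) ^ n))\<^sup>2 + (cmod (u n * of_real (r / \<rho>) ^ Suc n))\<^sup>2) \<le> circle_mean_square \<rho> (hann r R v u)"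
      by (rule partial_sum_le_sums[OF tf_mean_square[OF hann_tf(2,3,1)[OF r(1) \<rho> vu]]]) simp
    also have "\<dots> \<le> B" by (rule B[OF \<rho>])
    finally have "(\<Sum>n<N. (cmod (v n * of_real (\<rho> / R) ^ n))\<^sup>2) + (\<Sum>n<N. (cmod (u n * of_real (r / \<rho>) ^ Suc n))\<^sup>2) \<le> B"
      by (simp add: sum.distrib)
    moreover have "0 \<le> (\<Sum>n<N. (cmod (v n * of_real (\<rho> / R) ^ n))\<^sup>2)" "0 \<le> (\<Sum>n<N. (cmod (u n * of_real (r / \<rho>) ^ Suc n))\<^sup>2)"
      by (intro sum_nonneg; simp)+
    ultimately show ?thesis by linarith
  qed
  show "n2 v \<le> B"
  proof (rule l2_from_bounded_sums(2))
    fix N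
    have "((\<lambda>\<rho>. \<Sum>n<N. (cmod (v n * of_real (\<rho> / R) ^ n))\<^sup>2) \<longlongrightarrow> (\<Sum>n<N. (cmod (v n * of_real (R / R) ^ n))\<^sup>2)) (at_left R)"
      using r by (intro tendsto_intros) auto
    moreover have "\<forall>\<^sub>F \<rho> in at_left R. (\<Sum>n<N. (cmod (v n * of_real (\<rho> / R) ^ n))\<^sup>2) \<le> B"
      unfolding eventually_at_left_field using le r by blast
    ultimately have "(\<Sum>n<N. (cmod (v n * of_real (R / R) ^ n))\<^sup>2) \<le> B" by (rule tendsto_upperbound) simp
    then show "(\<Sum>n<N. (cmod (v n))\<^sup>2) \<le> B" using r by simp
  qed
  show "n2 u \<le> B"
  proof (rule l2_from_bounded_sums(2))
    fix N
    have "((\<lambda>\<rho>. \<Sum>n<N. (cmod (u n * of_real (r / \<rho>) ^ Suc n))\<^sup>2) \<longlongrightarrow> (\<Sum>n<N. (cmod (u n * of_real (r / r) ^ Suc n))\<^sup>2)) (at_right r)"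
      using r by (intro tendsto_intros) auto
    moreover have "\<forall>\<^sub>F \<rho> in at_right r. (\<Sum>n<N. (cmod (u n * of_real (r / \<rho>) ^ Suc n))\<^sup>2) \<le> B"
      unfolding eventually_at_right_field using le r by blast
    ultimately have "(\<Sum>n<N. (cmod (u n * of_real (r / r) ^ Suc n))\<^sup>2) \<le> B" by (rule tendsto_upperbound) simp
    then show "(\<Sum>n<N. (cmod (u n))\<^sup>2) \<le> B" using r by simp
  qed
qed

text \<open>A supremum bound \<open>B\<close> bounds all circle means by B^2, hence both coefficient
  norms, and the norm squared by 2 (B^2 + B^2).\<close>

lemma bounded_H2_annulus:
  assumes r: "0 < r" "r < R" and zero: "\<And>z. z \<notin> annulus r R \<Longrightarrow> f z = 0"
    and hol: "f holomorphic_on annulus r R" and B: "\<And>z. z \<in> annulus r R \<Longrightarrow> cmod (f z) \<le> B"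
  shows "f \<in> H2_annulus r R" "norm_H2_annulus r R f \<le> 2 * B"
proof -
  have B0: "0 \<le> B"
  proof -
    obtain m where m: "r < m" "m < R" using r dense by blast
    then have "of_real m \<in> annulus r R" using r by (simp add: annulus_def)
    from order_trans[OF norm_ge_zero B[OF this]] show ?thesis .
  qed
  have cms: "circle_mean_square \<rho> f \<le> B\<^sup>2" if \<rho>: "r < \<rho>" "\<rho> < R" for \<rho>
  proof -
    have in_ann: "rcis \<rho> t \<in> annulus r R" for t using \<rho> r by (simp add: annulus_def)
    have c: "continuous_on {0..2*pi} (\<lambda>t. f (rcis \<rho> t))"
      by (rule circ_rcis_continuous)
         (use \<rho> r hol sphere_subset_annulus[OF \<rho>] in \<open>auto intro: holomorphic_on_imp_continuous_on holomorphic_on_subset\<close>)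
    have "cmod (circ (\<lambda>t. f (rcis \<rho> t) * cnj (f (rcis \<rho> t)))) \<le> B * B"
      by (intro circ_bound continuous_on_mult c continuous_on_cnj) (use B[OF in_ann] B0 in \<open>auto simp: norm_mult intro!: mult_mono\<close>)
    then have "\<bar>circle_mean_square \<rho> f\<bar> \<le> B * B"
      unfolding circle_mean_square_circ[symmetric] by simp
    then show ?thesis by (simp add: power2_eq_square)
  qed
  show f: "f \<in> H2_annulus r R"
    unfolding H2_annulus_def
  proof (intro CollectI conjI allI impI zero hol)
    show "\<exists>B. \<forall>\<^sub>F \<rho> in at_left R. circle_mean_square \<rho> f \<le> B"
      unfolding eventually_at_left_field using cms r by blast
    show "\<exists>B. \<forall>\<^sub>F \<rho> in at_right r. circle_mean_square \<rho> f \<le> B"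
      unfolding eventually_at_right_field using cms r by blast
  qed
  obtain v u where vu: "l2 v" "l2 u" "f = hann r R v u" using H2_annulus_cases[OF r f] .
  have "n2 v \<le> B\<^sup>2" "n2 u \<le> B\<^sup>2"
    using hann_n2_le[OF r vu(1,2)] cms unfolding vu(3) by blast+
  then have "(norm_H2_annulus r R f)\<^sup>2 \<le> (2 * B)\<^sup>2"
    using norm_hann_upper[OF r vu(1,2)] unfolding vu(3) by (simp add: power_mult_distrib)
  then show "norm_H2_annulus r R f \<le> 2 * B"
    by (rule power2_le_imp_le) (use B0 in simp)
qed

lemma l2_geometric: "0 \<le> s \<Longrightarrow> s < 1 \<Longrightarrow> l2 (\<lambda>n. of_real s ^ n)"
proof -
  assume s: "0 \<le> s" "s < 1"
  then have "s\<^sup>2 < 1" by (simp add: abs_square_less_1)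
  then have "summable (\<lambda>n. (s\<^sup>2) ^ n)" by (intro summable_geometric) simp
  then show ?thesis using s by (simp add: l2_def norm_power power_mult[symmetric] mult.commute)
qed

lemma pw_bound:
  assumes a: "l2 a" and s: "0 \<le> s" "s < 1" and z: "cmod z \<le> s"
  shows "cmod (pw a z) \<le> sqrt (n2 a) * sqrt (n2 (\<lambda>n. of_real s ^ n))"
proof -
  have z1: "cmod z < 1" using z s by simp
  have "cmod (pw a z) \<le> (\<Sum>n. cmod (a n * z ^ n))"
    unfolding pw_def by (rule summable_norm[OF pw_abs_summable[OF a z1]])
  also have "\<dots> \<le> (\<Sum>n. cmod (a n * of_real s ^ n))"
  proof (rule suminf_le)
    show "cmod (a n * z ^ n) \<le> cmod (a n * of_real s ^ n)" for n
      using z s by (auto simp: norm_mult norm_power intro!: mult_left_mono power_mono)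
    show "summable (\<lambda>n. cmod (a n * of_real s ^ n))"
      using l2_scaled_asum(1)[OF a s] by (simp add: asum_def)
  qed (rule pw_abs_summable[OF a z1])
  also have "\<dots> \<le> sqrt (n2 a) * sqrt (n2 (\<lambda>n. of_real s ^ n))"
    by (rule l2_mult(2)[OF a l2_geometric[OF s]])
  finally show ?thesis .
qed

text \<open>Cauchy-Schwarz against the geometric sequences of ratios R0 / R and r / r0, both below
  1.\<close>

lemma point_evaluation_bound:
  assumes r: "0 < r" "r < r0" "R0 < R" "r0 < R0"
  shows "\<exists>M\<ge>0. \<forall>f\<in>H2_annulus r R. \<forall>z. r0 \<le> cmod z \<and> cmod z \<le> R0 \<longrightarrow> cmod (f z) \<le> M * norm_H2_annulus r R f"
proof -
  define a where "a = sqrt (n2 (\<lambda>n. of_real (R0 / R) ^ n))"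
  define b where "b = sqrt (n2 (\<lambda>n. of_real (r / r0) ^ n))"
  have s: "0 \<le> R0 / R" "R0 / R < 1" "0 \<le> r / r0" "r / r0 < 1" using r by auto
  have ab: "0 \<le> a" "0 \<le> b" unfolding a_def b_def by (auto intro!: n2_nonneg l2_geometric s simp del: of_real_divide)
  have rR: "0 < r" "r < R" using r by auto
  show ?thesis
  proof (intro exI[of _ "a + b"] conjI ballI allI impI)
    fix f z assume f: "f \<in> H2_annulus r R" and z: "r0 \<le> cmod z \<and> cmod z \<le> R0"
    obtain v u where vu: "l2 v" "l2 u" "f = hann r R v u" using H2_annulus_cases[OF rR f] .
    define N where "N = norm_H2_annulus r R f"
    have N: "n2 v + n2 u \<le> N\<^sup>2" "0 \<le> N"
      using norm_hann_lower[OF rR vu(1,2)] unfolding N_def vu(3) by (simp_all add: norm_H2_annulus_nonneg)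
    have le: "sqrt (n2 v) \<le> N" "sqrt (n2 u) \<le> N"
      using N n2_nonneg[OF vu(1)] n2_nonneg[OF vu(2)] by (auto intro!: real_le_lsqrt)
    have z0: "0 < cmod z" using z r by linarith
    have za: "z \<in> annulus r R" using z r by (auto simp: annulus_def)
    have 1: "cmod (z / of_real R) \<le> R0 / R" using z r by (simp add: norm_divide divide_right_mono)
    have 2: "cmod (of_real r / z) \<le> r / r0" using z z0 r by (simp add: norm_divide frac_le)
    have "cmod (f z) \<le> cmod (pw v (z / of_real R)) + cmod (of_real r / z) * cmod (pw u (of_real r / z))"
      unfolding vu(3) hann_def zero_ext_def using za norm_triangle_ineq by (simp add: norm_mult[symmetric] del: norm_mult)
    also have "\<dots> \<le> N * a + 1 * (N * b)"
    proof (intro add_mono mult_mono)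
      show "cmod (pw v (z / of_real R)) \<le> N * a"
        using pw_bound[OF vu(1) s(1,2) 1] mult_right_mono[OF le(1) ab(1)] unfolding a_def by linarith
      show "cmod (pw u (of_real r / z)) \<le> N * b"
        using pw_bound[OF vu(2) s(3,4) 2] mult_right_mono[OF le(2) ab(2)] unfolding b_def by linarith
      show "cmod (of_real r / z) \<le> 1" using 2 s by linarith
    qed auto
    finally show "cmod (f z) \<le> (a + b) * norm_H2_annulus r R f" unfolding N_def by (simp add: algebra_simps)
  qed (use ab in auto)
qed

section \<open>Bessel's inequality and the projections\<close>

text \<open>The mean square of \<open>v\<close> minus its truncated Fourier polynomial
  \<open>p\<close> is nonnegative; both mixed terms and the square of \<open>p\<close> equal
  \<open>S\<close>.\<close>

lemma bessel_pos:
  assumes v: "continuous_on {0..2*pi} v"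
  shows "(\<Sum>n<N. (cmod (circ (\<lambda>t. cis (-t) ^ n * v t)))\<^sup>2) \<le> Re (circ (\<lambda>t. v t * cnj (v t)))"
proof -
  define a where "a = (\<lambda>n. circ (\<lambda>t. cis (-t) ^ n * v t))"
  define P where "P = trunc N a"
  have P: "asum P" using trunc_sums[of cmod N a] by (auto simp: asum_def P_def sums_iff)
  define p where "p = tf P (\<lambda>n. 0)"
  have pc: "continuous_on S p" for S unfolding p_def by (rule tf_continuous[OF P asum_zero])
  define S where "S = (\<Sum>n<N. (cmod (a n))\<^sup>2)"
  have pp: "circ (\<lambda>t. p t * cnj (p t)) = of_real S"
  proof -
    have "(\<lambda>n. of_real ((cmod (P n))\<^sup>2 + (cmod 0)\<^sup>2)) sums circ (\<lambda>t. p t * cnj (p t))"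
      unfolding p_def by (rule tf_parseval[OF P asum_zero])
    moreover have "(\<lambda>n. complex_of_real ((cmod (P n))\<^sup>2 + (cmod 0)\<^sup>2)) sums (\<Sum>n<N. of_real ((cmod (a n))\<^sup>2 + (cmod 0)\<^sup>2))"
      unfolding P_def by (rule trunc_sums[of "\<lambda>c. of_real ((cmod c)\<^sup>2 + (cmod 0)\<^sup>2)"]) simp
    ultimately show ?thesis unfolding S_def by (simp add: sums_unique2)
  qed
  have pv: "circ (\<lambda>t. p t * cnj (v t)) = of_real S"
  proof -
    have "(\<lambda>n. P n * circ (\<lambda>t. cis t ^ n * cnj (v t)) + 0 * circ (\<lambda>t. cis (-t) ^ Suc n * cnj (v t))) sums circ (\<lambda>t. p t * cnj (v t))"
      unfolding p_def by (intro tf_circ_sums P asum_zero continuous_on_cnj v)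
    moreover have "circ (\<lambda>t. cis t ^ n * cnj (v t)) = cnj (a n)" for n
      unfolding a_def circ_cnj[symmetric] by (simp add: cis_cnj)
    moreover have "(\<lambda>n. P n * cnj (P n)) sums (\<Sum>n<N. a n * cnj (a n))"
      unfolding P_def by (rule trunc_sums[of "\<lambda>c. c * cnj c"]) simp
    moreover have "P n * cnj (a n) = P n * cnj (P n)" for n by (simp add: P_def trunc_def)
    ultimately have "circ (\<lambda>t. p t * cnj (v t)) = (\<Sum>n<N. a n * cnj (a n))"
      by (simp add: sums_unique2)
    then show ?thesis by (simp add: S_def complex_norm_square del: of_real_power)
  qed
  have vp: "circ (\<lambda>t. v t * cnj (p t)) = of_real S"
    using circ_cnj[of "\<lambda>t. p t * cnj (v t)"] pv by (simp add: mult.commute)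
  have cc: "continuous_on {0..2*pi} (\<lambda>t. v t * cnj (v t))" "continuous_on {0..2*pi} (\<lambda>t. p t * cnj (p t))"
    "continuous_on {0..2*pi} (\<lambda>t. - (v t * cnj (p t)))" "continuous_on {0..2*pi} (\<lambda>t. - (p t * cnj (v t)))"
    by (intro continuous_intros v pc)+
  have "(\<lambda>t. (v t - p t) * cnj (v t - p t)) = (\<lambda>t. (v t * cnj (v t) + p t * cnj (p t)) + (- (v t * cnj (p t)) + - (p t * cnj (v t))))"
    by (auto simp: algebra_simps)
  then have "circ (\<lambda>t. (v t - p t) * cnj (v t - p t)) =
     (circ (\<lambda>t. v t * cnj (v t)) + circ (\<lambda>t. p t * cnj (p t))) + (circ (\<lambda>t. - (v t * cnj (p t))) + circ (\<lambda>t. - (p t * cnj (v t))))"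
    by (simp only: circ_add[OF continuous_on_add[OF cc(1,2)] continuous_on_add[OF cc(3,4)]] circ_add[OF cc(1,2)] circ_add[OF cc(3,4)])
  also have "\<dots> = circ (\<lambda>t. v t * cnj (v t)) - of_real S"
    using circ_cmult[of "-1" "\<lambda>t. v t * cnj (p t)"] circ_cmult[of "-1" "\<lambda>t. p t * cnj (v t)"] pp pv vp by simp
  finally have "Re (circ (\<lambda>t. (v t - p t) * cnj (v t - p t))) = Re (circ (\<lambda>t. v t * cnj (v t))) - S" by simp
  moreover have "0 \<le> Re (circ (\<lambda>t. (v t - p t) * cnj (v t - p t)))"
  proof -
    have "circ (\<lambda>t. (v t - p t) * cnj (v t - p t)) = circ (\<lambda>t. of_real ((cmod (v t - p t))\<^sup>2))"
      by (rule circ_cong) (simp only: complex_norm_square)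
    also have "\<dots> = of_real (integral {0..2*pi} (\<lambda>t. (cmod (v t - p t))\<^sup>2) / (2 * pi))"
      unfolding circ_def integral_of_real_complex by simp
    finally have "Re (circ (\<lambda>t. (v t - p t) * cnj (v t - p t))) = integral {0..2*pi} (\<lambda>t. (cmod (v t - p t))\<^sup>2) / (2 * pi)"
      by (simp only: Re_complex_of_real)
    moreover have "0 \<le> integral {0..2*pi} (\<lambda>t. (cmod (v t - p t))\<^sup>2)"
      by (intro integral_nonneg integrable_continuous_real continuous_intros v pc) auto
    ultimately show ?thesis by simp
  qed
  ultimately show ?thesis by (simp add: S_def a_def)
qed

lemma bessel_neg:
  assumes v: "continuous_on {0..2*pi} v"
  shows "(\<Sum>n<N. (cmod (circ (\<lambda>t. cis t ^ n * v t)))\<^sup>2) \<le> Re (circ (\<lambda>t. v t * cnj (v t)))"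
proof -
  have "circ (\<lambda>t. cis (-t) ^ n * cnj (v t)) = cnj (circ (\<lambda>t. cis t ^ n * v t))" for n
    unfolding circ_cnj[symmetric] by (simp add: cis_cnj)
  then show ?thesis
    using bessel_pos[OF continuous_on_cnj[OF v], of N] by (simp add: mult.commute)
qed

text \<open>Meant for h1 and h2 composed with \<tau> on the boundary circles of \<open>A\<close>,
  where only continuity is at hand and no Laurent expansion on both sides of the circle.\<close>

lemma lc_l2:
  assumes c: "continuous_on (sphere 0 \<rho>) g" and \<rho>: "0 < \<rho>"
  shows "l2 (\<lambda>n. lcp g \<rho> n * of_real \<rho> ^ n)" "l2 (\<lambda>n. lcn g \<rho> n * of_real (inverse \<rho>) ^ Suc n)"
proof -
  have gc: "continuous_on {0..2*pi} (\<lambda>t. g (rcis \<rho> t))"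
    using c \<rho> by (intro circ_rcis_continuous) auto
  have 1: "lcp g \<rho> n * of_real \<rho> ^ n = circ (\<lambda>t. cis (-t) ^ n * g (rcis \<rho> t))" for n
  proof -
    have "(\<lambda>t. g (rcis \<rho> t) * inverse (rcis \<rho> t) ^ n) = (\<lambda>t. inverse (of_real \<rho>) ^ n * (cis (-t) ^ n * g (rcis \<rho> t)))"
      by (simp add: rcis_def power_mult_distrib mult_ac)
    then have "lcp g \<rho> n = inverse (of_real \<rho>) ^ n * circ (\<lambda>t. cis (-t) ^ n * g (rcis \<rho> t))"
      unfolding lcp_def by (simp only: circ_cmult)
    then show ?thesis using \<rho> by (simp add: power_mult_distrib[symmetric] field_simps)
  qed
  have 2: "lcn g \<rho> n * of_real (inverse \<rho>) ^ Suc n = circ (\<lambda>t. cis t ^ n * (cis t * g (rcis \<rho> t)))" for n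
  proof -
    have "(\<lambda>t. g (rcis \<rho> t) * rcis \<rho> t ^ Suc n) = (\<lambda>t. of_real \<rho> ^ Suc n * (cis t ^ n * (cis t * g (rcis \<rho> t))))"
      by (simp add: rcis_def power_mult_distrib mult_ac)
    then have "lcn g \<rho> n = of_real \<rho> ^ Suc n * circ (\<lambda>t. cis t ^ n * (cis t * g (rcis \<rho> t)))"
      unfolding lcn_def by (simp only: circ_cmult)
    moreover have "of_real \<rho> ^ Suc n * of_real (inverse \<rho>) ^ Suc n = (1 :: complex)"
      unfolding power_mult_distrib[symmetric] using \<rho> by simp
    ultimately show ?thesis by (simp add: mult_ac del: power_Suc of_real_inverse)
  qed
  show "l2 (\<lambda>n. lcp g \<rho> n * of_real \<rho> ^ n)"
    unfolding 1 by (rule l2_from_bounded_sums(1)[OF bessel_pos[OF gc]])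
  show "l2 (\<lambda>n. lcn g \<rho> n * of_real (inverse \<rho>) ^ Suc n)"
    unfolding 2 by (rule l2_from_bounded_sums(1)[OF bessel_neg]) (intro continuous_intros gc)
qed

lemma circle_coeff_lc:
  "circle_coeff \<rho> g (int n) = lcp g \<rho> n" "circle_coeff \<rho> g (- int (Suc n)) = lcn g \<rho> n"
  unfolding circle_coeff_def lcp_def lcn_def circ_def
  by (simp_all only: power_int_minus power_int_of_nat minus_minus power_inverse)

lemma lc_cong:
  assumes "\<And>z. cmod z = \<rho> \<Longrightarrow> g z = h z" "0 \<le> \<rho>"
  shows "lcp g \<rho> n = lcp h \<rho> n" "lcn g \<rho> n = lcn h \<rho> n"
  unfolding lcp_def lcn_def using assms by (auto intro!: circ_cong)

text \<open>With \<rho> = r this is a diagonal entry of the matrix, with \<rho> = R an off-diagonal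
  one including its restriction.\<close>

lemma proj_plus_hdisc:
  assumes "0 < r" "r \<le> \<rho>"
  shows "zero_ext (ball 0 r) (proj_plus \<rho> g) = hdisc r (\<lambda>n. lcp g \<rho> n * of_real r ^ n)"
  using assms unfolding proj_plus_def zero_ext_def hdisc_def pw_def circle_coeff_lc
  by (auto simp: power_divide fun_eq_iff)

lemma proj_minus_hext:
  assumes \<rho>: "0 < \<rho>" "\<rho> \<le> R" and l: "l2 (\<lambda>n. lcn g \<rho> n * of_real (inverse R) ^ Suc n)"
  shows "zero_ext (ext_disc R) (proj_minus \<rho> g) = hext R (\<lambda>n. lcn g \<rho> n * of_real (inverse R) ^ Suc n)"
proof
  fix z
  show "zero_ext (ext_disc R) (proj_minus \<rho> g) z = hext R (\<lambda>n. lcn g \<rho> n * of_real (inverse R) ^ Suc n) z"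
  proof (cases "z \<in> ext_disc R")
    case True
    have R: "0 < R" using \<rho> by simp
    have "(\<lambda>n. (of_real R / z) * (lcn g \<rho> n * of_real (inverse R) ^ Suc n * (of_real R / z) ^ n)) sums
        ((of_real R / z) * pw (\<lambda>n. lcn g \<rho> n * of_real (inverse R) ^ Suc n) (of_real R / z))"
      by (intro sums_mult pw_sums l ext_disc_ratio R True)
    moreover have "(of_real R / z) * (lcn g \<rho> n * of_real (inverse R) ^ Suc n * (of_real R / z) ^ n) = lcn g \<rho> n * z powi (- int (Suc n))" for n
    proof -
      have "of_real (inverse R) * (of_real R / z) = inverse z"
        using R by (simp add: field_simps)
      then have "of_real (inverse R) ^ Suc n * (of_real R / z) ^ Suc n = inverse z ^ Suc n"
        by (simp only: power_mult_distrib[symmetric])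
      moreover have "(of_real R / z) * (lcn g \<rho> n * of_real (inverse R) ^ Suc n * (of_real R / z) ^ n) =
          lcn g \<rho> n * (of_real (inverse R) ^ Suc n * (of_real R / z) ^ Suc n)"
        by (simp only: power_Suc mult_ac)
      moreover have "z powi (- int (Suc n)) = inverse z ^ Suc n"
        by (simp only: power_int_minus power_int_of_nat power_inverse)
      ultimately show ?thesis by simp
    qed
    ultimately have "(\<lambda>n. lcn g \<rho> n * z powi (- int (Suc n))) sums
        ((of_real R / z) * pw (\<lambda>n. lcn g \<rho> n * of_real (inverse R) ^ Suc n) (of_real R / z))" by (simp only:)
    moreover have "z \<in> ext_disc \<rho>" using True \<rho> by (simp add: ext_disc_def)
    ultimately show ?thesis using True
      unfolding proj_minus_def zero_ext_def hext_def circle_coeff_lc by (simp add: sums_iff)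
  qed (simp add: zero_ext_def hext_def)
qed

section \<open>Circle means up to the boundary\<close>

text \<open>The mean is constant on open radii and continuous in the radius up to the ends, so
  holomorphy is used only between the two circles.\<close>

lemma circ_radius_closed:
  assumes ab: "0 < a" "a < b" and c: "continuous_on {z. a \<le> cmod z \<and> cmod z \<le> b} g" and hol: "g holomorphic_on annulus a b"
  shows "circ (\<lambda>t. g (rcis a t)) = circ (\<lambda>t. g (rcis b t))"
proof -
  define I where "I = (\<lambda>\<rho>. circ (\<lambda>t. g (rcis \<rho> t)))"
  have "continuous_on ({a..b} \<times> cbox 0 (2*pi)) (\<lambda>p. g (rcis (fst p) (snd p)))"
    by (rule continuous_on_compose2[OF c]) (use ab in \<open>auto simp: rcis_def norm_mult intro!: continuous_intros\<close>)
  then have "continuous_on {a..b} (\<lambda>\<rho>. integral (cbox 0 (2*pi)) (\<lambda>t. g (rcis \<rho> t)))"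
    by (intro integral_continuous_on_param) (simp add: case_prod_beta)
  then have Ic: "continuous_on {a..b} I"
    unfolding I_def circ_def by (intro continuous_intros) auto
  define m where "m = (a + b) / 2"
  have m: "a < m" "m < b" using ab by (auto simp: m_def)
  have const: "I \<rho> = I m" if "\<rho> \<in> {a<..<b}" for \<rho>
    unfolding I_def using that m by (intro circ_radius_independent[OF ab(1) hol]) auto
  have "I \<rho> = I m" if "\<rho> \<in> {a..b}" for \<rho>
  proof (rule continuous_constant_on_closure[of "{a<..<b}" I "I m" \<rho>])
    show "continuous_on (closure {a<..<b}) I" using Ic ab by simp
    show "\<rho> \<in> closure {a<..<b}" using that ab by simp
  qed (use const in auto)
  from this[of a] this[of b] show ?thesis using ab by (simp add: I_def)
qed

lemma lc_radius_closed:
  assumes ab: "0 < a" "a < b" and c: "continuous_on {z. a \<le> cmod z \<and> cmod z \<le> b} g" and hol: "g holomorphic_on annulus a b"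
  shows "lcp g a n = lcp g b n" "lcn g a n = lcn g b n"
proof -
  have nz: "z \<noteq> 0" if "a \<le> cmod z" for z using that ab by auto
  show "lcp g a n = lcp g b n"
    unfolding lcp_def using nz ab
    by (intro circ_radius_closed[of a b "\<lambda>z. g z * inverse z ^ n"] continuous_intros holomorphic_intros c hol)
       (auto simp: annulus_def)
  show "lcn g a n = lcn g b n"
    unfolding lcn_def using ab
    by (intro circ_radius_closed[of a b "\<lambda>z. g z * z ^ Suc n"] continuous_intros holomorphic_intros c hol)
qed

text \<open>The contour integral of f W in coefficients. On an interior circle the Laurent series of
  \<open>f\<close> is absolutely convergent and is integrated termwise, so continuity of
  \<open>W\<close> on that circle suffices.\<close>

lemma laurent_pairing:
  assumes r: "0 < r" "r < \<rho>" "\<rho> < R" "r < \<sigma>" "\<sigma> < R" and f: "f holomorphic_on annulus r R"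
    and W: "continuous_on (sphere 0 \<rho>) W"
  shows "(\<lambda>n. lcp f \<sigma> n * lcn W \<rho> n + lcn f \<sigma> n * lcp W \<rho> n) sums circ (\<lambda>t. f (rcis \<rho> t) * (W (rcis \<rho> t) * rcis \<rho> t))"
proof -
  define P where "P = (\<lambda>n. lcp f \<sigma> n * of_real \<rho> ^ n)"
  define Q where "Q = (\<lambda>n. lcn f \<sigma> n * of_real (inverse \<rho>) ^ Suc n)"
  have PQ: "asum P" "asum Q"
    using lc_summable[OF r(1) f r(2,3,4,5)] r
    by (simp_all add: asum_def P_def Q_def norm_mult norm_power norm_inverse)
  have ftf: "f (rcis \<rho> t) = tf P Q t" for t
  proof -
    have "rcis \<rho> t \<in> annulus r R" using r by (simp add: annulus_def)
    from laurent_series[OF r(1) f r(4,5) this]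
    have "f (rcis \<rho> t) = (\<Sum>n. lcp f \<sigma> n * rcis \<rho> t ^ n) + (\<Sum>n. lcn f \<sigma> n * inverse (rcis \<rho> t) ^ Suc n)" .
    also have "inverse (rcis \<rho> t) = of_real (inverse \<rho>) * cis (-t)"
      by (simp add: rcis_def)
    finally show ?thesis
      by (simp add: tf_def P_def Q_def rcis_def power_mult_distrib mult.assoc del: power_Suc of_real_inverse)
  qed
  have Wc: "continuous_on {0..2*pi} (\<lambda>t. W (rcis \<rho> t))"
    using W r by (intro circ_rcis_continuous) auto
  have \<rho>0: "\<rho> \<noteq> 0" using r by auto
  have "(\<lambda>n. P n * circ (\<lambda>t. cis t ^ n * (W (rcis \<rho> t) * rcis \<rho> t)) + Q n * circ (\<lambda>t. cis (-t) ^ Suc n * (W (rcis \<rho> t) * rcis \<rho> t)))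
      sums circ (\<lambda>t. tf P Q t * (W (rcis \<rho> t) * rcis \<rho> t))"
    by (intro tf_circ_sums PQ continuous_on_mult Wc) (simp add: rcis_def, intro continuous_intros)
  moreover have "P n * circ (\<lambda>t. cis t ^ n * (W (rcis \<rho> t) * rcis \<rho> t)) = lcp f \<sigma> n * lcn W \<rho> n" for n
  proof -
    have "(\<lambda>t. W (rcis \<rho> t) * rcis \<rho> t ^ Suc n) = (\<lambda>t. of_real \<rho> ^ n * (cis t ^ n * (W (rcis \<rho> t) * rcis \<rho> t)))"
      by (simp add: rcis_def power_mult_distrib mult_ac)
    then have "lcn W \<rho> n = of_real \<rho> ^ n * circ (\<lambda>t. cis t ^ n * (W (rcis \<rho> t) * rcis \<rho> t))"
      unfolding lcn_def by (simp only: circ_cmult)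
    then show ?thesis by (simp add: P_def)
  qed
  moreover have "Q n * circ (\<lambda>t. cis (-t) ^ Suc n * (W (rcis \<rho> t) * rcis \<rho> t)) = lcn f \<sigma> n * lcp W \<rho> n" for n
  proof -
    have "W (rcis \<rho> t) * inverse (rcis \<rho> t) ^ n = of_real (inverse \<rho>) ^ Suc n * (cis (-t) ^ Suc n * (W (rcis \<rho> t) * rcis \<rho> t))" for t
    proof -
      have "of_real (inverse \<rho>) * cis (-t) = inverse (rcis \<rho> t)" by (simp add: rcis_def)
      then have "of_real (inverse \<rho>) ^ Suc n * cis (-t) ^ Suc n = inverse (rcis \<rho> t) ^ Suc n"
        by (simp only: power_mult_distrib[symmetric])
      moreover have "inverse (rcis \<rho> t) ^ Suc n * rcis \<rho> t = inverse (rcis \<rho> t) ^ n"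
        using \<rho>0 by simp
      ultimately show ?thesis by (metis mult.assoc mult.commute)
    qed
    then have "lcp W \<rho> n = of_real (inverse \<rho>) ^ Suc n * circ (\<lambda>t. cis (-t) ^ Suc n * (W (rcis \<rho> t) * rcis \<rho> t))"
      unfolding lcp_def by (simp only: circ_cmult)
    then show ?thesis by (simp add: Q_def del: power_Suc of_real_inverse)
  qed
  ultimately show ?thesis unfolding ftf by (simp only:)
qed

lemma zero_ext_idem: "zero_ext D (zero_ext D f) = zero_ext D f"
  by (simp add: zero_ext_def fun_eq_iff)

text \<open>On the compact boundary the maximum is attained, so a strict bound there leaves a
  definite gap, which the maximum principle passes to the interior.\<close>

lemma annulus_max:
  fixes g :: "complex \<Rightarrow> complex"
  assumes ab: "0 < a" "a < b" and c: "continuous_on {z. a \<le> cmod z \<and> cmod z \<le> b} g" and hol: "g holomorphic_on annulus a b"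
    and bd: "\<And>z. cmod z = a \<or> cmod z = b \<Longrightarrow> cmod (g z) < m"
  shows "\<exists>B. 0 \<le> B \<and> B < m \<and> (\<forall>z. a \<le> cmod z \<and> cmod z \<le> b \<longrightarrow> cmod (g z) \<le> B)"
proof -
  define S where "S = sphere (0::complex) a \<union> sphere 0 b"
  have "compact S" unfolding S_def by (intro compact_Un compact_sphere)
  moreover have "of_real a \<in> S" using ab by (simp add: S_def)
  moreover have "continuous_on S (\<lambda>z. cmod (g z))"
    by (intro continuous_intros continuous_on_subset[OF c]) (use ab in \<open>auto simp: S_def\<close>)
  ultimately obtain w where w: "w \<in> S" "\<And>z. z \<in> S \<Longrightarrow> cmod (g z) \<le> cmod (g w)"
    using continuous_attains_sup[of S "\<lambda>z. cmod (g z)"] by blast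
  have cl: "closure (annulus a b) \<subseteq> {z. a \<le> cmod z \<and> cmod z \<le> b}"
    by (intro closure_minimal closed_Collect_conj closed_Collect_le continuous_intros) (auto simp: annulus_def)
  have "cmod (g z) \<le> cmod (g w)" if z: "a \<le> cmod z" "cmod z \<le> b" for z
  proof (cases "z \<in> annulus a b")
    case True
    show ?thesis
    proof (rule maximum_modulus_frontier[of g "annulus a b"])
      show "g holomorphic_on interior (annulus a b)" using hol open_annulus by (simp add: interior_open)
      show "continuous_on (closure (annulus a b)) g" using cl by (rule continuous_on_subset[OF c])
      show "bounded (annulus a b)" by (rule bounded_subset[of "cball 0 b"]) (auto simp: annulus_def)
      fix x assume "x \<in> frontier (annulus a b)"
      then have "x \<in> closure (annulus a b)" "x \<notin> annulus a b"
        using open_annulus by (auto simp: frontier_def interior_open)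
      then have "x \<in> S" using cl by (auto simp: S_def annulus_def)
      then show "cmod (g x) \<le> cmod (g w)" by (rule w(2))
    qed (rule True)
  next
    case False
    then have "z \<in> S" using z by (auto simp: S_def annulus_def)
    then show ?thesis by (rule w(2))
  qed
  moreover have "cmod (g w) < m" using bd[of w] w(1) by (auto simp: S_def)
  ultimately show ?thesis by (intro exI[of _ "cmod (g w)"]) auto
qed

context expanding_annulus
begin

text \<open>The ratio s < 1 is a safety margin: \<tau> maps the closed ring between \<open>r\<close>
  and \<open>r0\<close> to a compact part of the disc of radius \<open>r\<close>, where the series
  of \<open>h1\<close> converges absolutely.\<close>

lemma inner_contraction: "\<exists>s. 0 < s \<and> s < 1 \<and> (\<forall>z. r \<le> cmod z \<and> cmod z \<le> r0 \<longrightarrow> cmod (\<tau> z) \<le> s * r)"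
proof -
  have "\<exists>B. 0 \<le> B \<and> B < r \<and> (\<forall>z. r \<le> cmod z \<and> cmod z \<le> r0 \<longrightarrow> cmod (\<tau> z) \<le> B)"
  proof (rule annulus_max)
    show "continuous_on {z. r \<le> cmod z \<and> cmod z \<le> r0} \<tau>"
      by (rule continuous_on_subset[OF cont]) (use radii_facts in auto)
    show "\<tau> holomorphic_on annulus r r0"
      by (rule holomorphic_on_subset[OF hol]) (use radii_facts in \<open>auto simp: annulus_def\<close>)
  qed (use radii_order bdry(1) escape_inner in auto)
  then obtain B where B: "0 \<le> B" "B < r" "\<And>z. r \<le> cmod z \<and> cmod z \<le> r0 \<Longrightarrow> cmod (\<tau> z) \<le> B" by blast
  have "B / r < 1" using B radii_order by simp
  then obtain s where s: "B / r < s" "s < 1" using dense by blast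
  have "0 \<le> B / r" using B radii_order by simp
  then have "0 < s" using s by linarith
  moreover have "B \<le> s * r" using s(1) radii_order by (simp add: field_simps)
  ultimately show ?thesis using s B(3) by (meson order_trans)
qed

lemma outer_tau_nonzero: "R0 \<le> cmod z \<Longrightarrow> cmod z \<le> R \<Longrightarrow> \<tau> z \<noteq> 0"
  using tau_ge_1[of z] radii_order by auto

text \<open>The counterpart at infinity, obtained from 1 / \<tau>, which is small on the outer
  ring.\<close>

lemma outer_expansion: "\<exists>s. 0 < s \<and> s < 1 \<and> (\<forall>z. R0 \<le> cmod z \<and> cmod z \<le> R \<longrightarrow> R \<le> s * cmod (\<tau> z))"
proof -
  have "\<exists>B. 0 \<le> B \<and> B < inverse R \<and> (\<forall>z. R0 \<le> cmod z \<and> cmod z \<le> R \<longrightarrow> cmod (inverse (\<tau> z)) \<le> B)"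
  proof (rule annulus_max)
    show "continuous_on {z. R0 \<le> cmod z \<and> cmod z \<le> R} (\<lambda>z. inverse (\<tau> z))"
      by (intro continuous_on_inverse continuous_on_subset[OF cont]) (use radii_facts outer_tau_nonzero in auto)
    show "(\<lambda>z. inverse (\<tau> z)) holomorphic_on annulus R0 R"
      by (intro holomorphic_on_inverse holomorphic_on_subset[OF hol]) (use radii_facts outer_tau_nonzero in \<open>auto simp: annulus_def\<close>)
    fix z assume "cmod z = R0 \<or> cmod z = R"
    then have "R < cmod (\<tau> z)" using bdry(2)[of z] escape_outer[of z] by auto
    then show "cmod (inverse (\<tau> z)) < inverse R"
      using less_imp_inverse_less[of R "cmod (\<tau> z)"] radii_facts(1) by (simp add: norm_inverse)
  qed (use radii_order radii_facts in auto)
  then obtain B where B: "0 \<le> B" "B < inverse R" "\<And>z. R0 \<le> cmod z \<and> cmod z \<le> R \<Longrightarrow> cmod (inverse (\<tau> z)) \<le> B" by blast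
  have "B * R < 1" using B radii_facts by (simp add: field_simps)
  then obtain s where s: "B * R < s" "s < 1" using dense by blast
  have "0 \<le> B * R" using B radii_facts by simp
  then have s0: "0 < s" using s by linarith
  have "R \<le> s * cmod (\<tau> z)" if z: "R0 \<le> cmod z \<and> cmod z \<le> R" for z
  proof -
    have pos: "0 < cmod (\<tau> z)" using outer_tau_nonzero[of z] z by auto
    have "inverse (cmod (\<tau> z)) * R \<le> B * R"
      using B(3)[OF z] radii_facts by (intro mult_right_mono) (auto simp: norm_inverse)
    also have "\<dots> \<le> s" using s by simp
    finally show ?thesis using pos by (simp add: field_simps)
  qed
  then show ?thesis using s s0 by blast
qed

text \<open>Continuity includes the boundary circle of \<open>A\<close>, where the projections take
  their coefficients; this allows moving them to the circle of \<open>A0\<close>.\<close>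

lemma inner_composition:
  assumes x: "l2 x"
  shows "continuous_on {z. r \<le> cmod z \<and> cmod z \<le> r0} (\<lambda>z. hdisc r x (\<tau> z))"
    "(\<lambda>z. hdisc r x (\<tau> z)) holomorphic_on annulus r r0"
proof -
  obtain s where s: "0 < s" "s < 1" "\<And>z. r \<le> cmod z \<Longrightarrow> cmod z \<le> r0 \<Longrightarrow> cmod (\<tau> z) \<le> s * r"
    using inner_contraction by blast
  have lt: "\<tau> z \<in> ball 0 r" if "r \<le> cmod z" "cmod z \<le> r0" for z
  proof -
    have "s * r < r" using s radii_order by simp
    then show ?thesis using s(3)[OF that] by simp
  qed
  have hol': "hdisc r x holomorphic_on ball 0 r"
    using hdisc_mem[OF radii_order(1) x] by (simp add: H2_disc_def)
  show "continuous_on {z. r \<le> cmod z \<and> cmod z \<le> r0} (\<lambda>z. hdisc r x (\<tau> z))"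
    by (rule continuous_on_compose2[OF holomorphic_on_imp_continuous_on[OF hol'] continuous_on_subset[OF cont]])
       (use lt radii_facts in auto)
  show "(\<lambda>z. hdisc r x (\<tau> z)) holomorphic_on annulus r r0"
    by (rule holomorphic_on_compose_gen[OF holomorphic_on_subset[OF hol] hol', unfolded o_def])
       (use lt radii_facts in \<open>auto simp: annulus_def\<close>)
qed

lemma hext_holomorphic:
  assumes "0 < R" "l2 y" shows "hext R y holomorphic_on ext_disc R"
proof -
  have nz: "z \<noteq> 0" if "z \<in> ext_disc R" for z using that assms by (auto simp: ext_disc_def)
  have "(\<lambda>z. (of_real R / z) * pw y (of_real R / z)) holomorphic_on ext_disc R"
    using nz by (intro holomorphic_intros pw_compose_holomorphic[OF assms(2)] ext_disc_ratio assms(1)) auto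
  then show ?thesis by (rule holomorphic_transform) (simp add: hext_def zero_ext_def)
qed

lemma outer_composition:
  assumes y: "l2 y"
  shows "continuous_on {z. R0 \<le> cmod z \<and> cmod z \<le> R} (\<lambda>z. hext R y (\<tau> z))"
    "(\<lambda>z. hext R y (\<tau> z)) holomorphic_on annulus R0 R"
proof -
  obtain s where s: "0 < s" "s < 1" "\<And>z. R0 \<le> cmod z \<Longrightarrow> cmod z \<le> R \<Longrightarrow> R \<le> s * cmod (\<tau> z)"
    using outer_expansion by blast
  have lt: "\<tau> z \<in> ext_disc R" if "R0 \<le> cmod z" "cmod z \<le> R" for z
  proof -
    have "0 < cmod (\<tau> z)" using outer_tau_nonzero[OF that] by simp
    then have "s * cmod (\<tau> z) < cmod (\<tau> z)" using s by simp
    then show ?thesis using s(3)[OF that] by (simp add: ext_disc_def)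
  qed
  note hol' = hext_holomorphic[OF radii_facts(1) y]
  show "continuous_on {z. R0 \<le> cmod z \<and> cmod z \<le> R} (\<lambda>z. hext R y (\<tau> z))"
    by (rule continuous_on_compose2[OF holomorphic_on_imp_continuous_on[OF hol'] continuous_on_subset[OF cont]])
       (use lt radii_facts in auto)
  show "(\<lambda>z. hext R y (\<tau> z)) holomorphic_on annulus R0 R"
    by (rule holomorphic_on_compose_gen[OF holomorphic_on_subset[OF hol] hol', unfolded o_def])
       (use lt radii_facts in \<open>auto simp: annulus_def\<close>)
qed

section \<open>The transfer operator on the Hardy space\<close>

abbreviation "TO \<equiv> transfer_operator \<tau> r R"

lemma TO_eq: "f \<in> H2_annulus r R \<Longrightarrow> TO f = zero_ext (annulus r R) (transf f)"
  by (rule transfer_operator_transf) (simp add: H2_annulus_def)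

text \<open>The image is even a bounded function: point values of \<open>f\<close> on the closure of
  \<open>A0\<close> are controlled by its norm, and the kernels are bounded.\<close>

lemma TO_bounded: "\<exists>M\<ge>0. \<forall>f\<in>H2_annulus r R. TO f \<in> H2_annulus r R \<and> norm_H2_annulus r R (TO f) \<le> M * norm_H2_annulus r R f"
proof -
  obtain M1 where M1: "0 \<le> M1" "\<And>f B z. \<forall>z. r0 \<le> cmod z \<and> cmod z \<le> R0 \<longrightarrow> cmod (f z) \<le> B \<Longrightarrow> z \<in> annulus r R \<Longrightarrow> cmod (transf f z) \<le> M1 * B"
    using transf_bounded by blast
  obtain M2 where M2: "0 \<le> M2" "\<And>f z. f \<in> H2_annulus r R \<Longrightarrow> r0 \<le> cmod z \<and> cmod z \<le> R0 \<Longrightarrow> cmod (f z) \<le> M2 * norm_H2_annulus r R f"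
    using point_evaluation_bound[OF radii_order(1,2,5) radii_facts(7)] by blast
  show ?thesis
  proof (intro exI[of _ "2 * (M1 * M2)"] conjI ballI)
    show "0 \<le> 2 * (M1 * M2)" using M1 M2 by simp
    fix f assume f: "f \<in> H2_annulus r R"
    have fh: "f holomorphic_on annulus r R" using f by (simp add: H2_annulus_def)
    have hl: "TO f holomorphic_on annulus r R"
      unfolding TO_eq[OF f] by (rule holomorphic_transform[OF transf_hol[OF fh]]) (simp add: zero_ext_def)
    have bd: "cmod (TO f z) \<le> M1 * (M2 * norm_H2_annulus r R f)" if "z \<in> annulus r R" for z
      unfolding TO_eq[OF f] using that M1(2)[of f "M2 * norm_H2_annulus r R f" z] M2(2)[OF f] by (simp add: zero_ext_def)
    have z0: "TO f z = 0" if "z \<notin> annulus r R" for z unfolding TO_eq[OF f] using that by (simp add: zero_ext_def)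
    show "TO f \<in> H2_annulus r R" by (rule bounded_H2_annulus(1)[OF radii_order(1) radii_facts(4) z0 hl bd])
    have "norm_H2_annulus r R (TO f) \<le> 2 * (M1 * (M2 * norm_H2_annulus r R f))"
      by (rule bounded_H2_annulus(2)[OF radii_order(1) radii_facts(4) z0 hl bd])
    then show "norm_H2_annulus r R (TO f) \<le> 2 * (M1 * M2) * norm_H2_annulus r R f" by (simp add: mult_ac)
  qed
qed

lemma H2_annulus_closed:
  fixes f g :: "complex \<Rightarrow> complex"
  assumes "f \<in> H2_annulus r R"
  shows "g \<in> H2_annulus r R \<Longrightarrow> (\<lambda>z. f z + g z) \<in> H2_annulus r R" "(\<lambda>z. c * f z) \<in> H2_annulus r R"
proof -
  note rR = radii_order(1) radii_facts(4)
  obtain v u where vu: "l2 v" "l2 u" "f = hann r R v u" using H2_annulus_cases[OF rR assms] .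
  show "(\<lambda>z. c * f z) \<in> H2_annulus r R"
    unfolding vu(3) hann_cmult[OF rR vu(1,2)] by (intro hann_mem rR l2_cmult(1) vu)
  show "(\<lambda>z. f z + g z) \<in> H2_annulus r R" if g: "g \<in> H2_annulus r R"
  proof -
    obtain v' u' where vu': "l2 v'" "l2 u'" "g = hann r R v' u'" using H2_annulus_cases[OF rR g] .
    show ?thesis unfolding vu(3) vu'(3) hann_add[OF rR vu(1,2) vu'(1,2)] by (intro hann_mem rR l2_add vu vu')
  qed
qed

lemma TO_add:
  fixes f g :: "complex \<Rightarrow> complex"
  assumes "f \<in> H2_annulus r R" "g \<in> H2_annulus r R"
  shows "TO (\<lambda>z. f z + g z) = (\<lambda>z. TO f z + TO g z)"
  unfolding TO_eq[OF assms(1)] TO_eq[OF assms(2)] TO_eq[OF H2_annulus_closed(1)[OF assms]]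
  by (auto simp: zero_ext_def transf_def tsum_def distrib_left sum.distrib add_divide_distrib)

lemma TO_cmult:
  assumes "f \<in> H2_annulus r R"
  shows "TO (\<lambda>z. c * f z) = (\<lambda>z. c * TO f z)"
  unfolding TO_eq[OF assms] TO_eq[OF H2_annulus_closed(2)[OF assms]]
  by (auto simp: zero_ext_def transf_def tsum_def sum_distrib_left mult_ac)

lemma transfer_adjoint_dual:
  assumes l: "l \<in> H2_dual r R"
  shows "transfer_adjoint \<tau> r R l \<in> H2_dual r R"
proof -
  obtain M where M: "0 \<le> M" "\<And>f. f \<in> H2_annulus r R \<Longrightarrow> TO f \<in> H2_annulus r R"
    "\<And>f. f \<in> H2_annulus r R \<Longrightarrow> norm_H2_annulus r R (TO f) \<le> M * norm_H2_annulus r R f"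
    using TO_bounded by blast
  have add: "l (\<lambda>z. f z + g z) = l f + l g" if "f \<in> H2_annulus r R" "g \<in> H2_annulus r R" for f g
    using l that by (auto simp: H2_dual_def)
  have cm: "l (\<lambda>z. c * f z) = c * l f" if "f \<in> H2_annulus r R" for f c
    using l that by (auto simp: H2_dual_def)
  obtain B0 where "\<forall>f\<in>H2_annulus r R. cmod (l f) \<le> B0 * norm_H2_annulus r R f"
    using l unfolding H2_dual_def by blast
  then have B0: "cmod (l f) \<le> B0 * norm_H2_annulus r R f" if "f \<in> H2_annulus r R" for f
    using that by blast
  show ?thesis
    unfolding H2_dual_def
  proof (intro CollectI conjI allI impI ballI)
    show "transfer_adjoint \<tau> r R l f = 0" if "f \<notin> H2_annulus r R" for f
      using that by (simp add: transfer_adjoint_def zero_ext_def)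
    show "\<exists>B. \<forall>f\<in>H2_annulus r R. cmod (transfer_adjoint \<tau> r R l f) \<le> B * norm_H2_annulus r R f"
    proof (intro exI[of _ "\<bar>B0\<bar> * M"] ballI)
      fix f assume f: "f \<in> H2_annulus r R"
      have "cmod (l (TO f)) \<le> B0 * norm_H2_annulus r R (TO f)" by (rule B0[OF M(2)[OF f]])
      also have "\<dots> \<le> \<bar>B0\<bar> * norm_H2_annulus r R (TO f)"
        by (intro mult_right_mono norm_H2_annulus_nonneg) simp
      also have "\<dots> \<le> \<bar>B0\<bar> * (M * norm_H2_annulus r R f)"
        by (intro mult_left_mono M(3)[OF f]) simp
      finally show "cmod (transfer_adjoint \<tau> r R l f) \<le> \<bar>B0\<bar> * M * norm_H2_annulus r R f"
        using f by (simp add: transfer_adjoint_def zero_ext_def mult.assoc)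
    qed
    fix f assume f: "f \<in> H2_annulus r R"
    show "transfer_adjoint \<tau> r R l (\<lambda>z. c * f z) = c * transfer_adjoint \<tau> r R l f" for c
      using f M(2) by (simp add: transfer_adjoint_def zero_ext_def H2_annulus_closed TO_cmult cm)
    fix g assume g: "g \<in> H2_annulus r R"
    show "transfer_adjoint \<tau> r R l (\<lambda>z. f z + g z) = transfer_adjoint \<tau> r R l f + transfer_adjoint \<tau> r R l g"
      using f g M(2) by (simp add: transfer_adjoint_def zero_ext_def H2_annulus_closed TO_add add)
  qed
qed

section \<open>Conjugation of the adjoint\<close>

lemma TO_rcis: "f \<in> H2_annulus r R \<Longrightarrow> TO f (rcis 1 t) = transf f (rcis 1 t)"
  using radii_facts by (simp add: TO_eq zero_ext_def annulus_def)

text \<open>The change of variables needs the unit circle, which \<tau> preserves. Afterwards the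
  integrand is a holomorphic function on the annulus, and any radius may be used.\<close>

lemma TO_lcn:
  assumes f: "f \<in> H2_annulus r R" and \<rho>: "r < \<rho>" "\<rho> < R"
  shows "lcn (TO f) 1 n = circ (\<lambda>t. \<tau> (rcis \<rho> t) ^ n * (f (rcis \<rho> t) * rcis \<rho> t))"
proof -
  have fh: "f holomorphic_on annulus r R" using f by (simp add: H2_annulus_def)
  have "lcn (TO f) 1 n = circ (\<lambda>t. transf f (rcis 1 t) * (rcis 1 t) ^ n * rcis 1 t)"
    unfolding lcn_def TO_rcis[OF f] by (simp add: mult_ac)
  also have "\<dots> = circ (\<lambda>t. f (rcis 1 t) * \<tau> (rcis 1 t) ^ n * rcis 1 t)"
    by (rule transf_change_of_variables[OF fh, of "\<lambda>z. z ^ n"]) (intro holomorphic_intros)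
  also have "\<dots> = circ (\<lambda>t. f (rcis \<rho> t) * \<tau> (rcis \<rho> t) ^ n * rcis \<rho> t)"
    by (rule circ_radius_independent[of r "\<lambda>z. f z * \<tau> z ^ n * z" R])
       (use radii_order radii_facts \<rho> in \<open>auto intro!: holomorphic_intros fh hol\<close>)
  finally show ?thesis by (simp add: mult_ac)
qed

text \<open>The index \<open>n\<close> pairs with the power - n - 1, since one factor of the
  variable belongs to dz. Moving the circle uses that \<tau> has no zeros in the annulus.\<close>

lemma TO_lcp:
  assumes f: "f \<in> H2_annulus r R" and \<rho>: "r < \<rho>" "\<rho> < R"
  shows "lcp (TO f) 1 n = circ (\<lambda>t. inverse (\<tau> (rcis \<rho> t)) ^ Suc n * (f (rcis \<rho> t) * rcis \<rho> t))"
proof -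
  have fh: "f holomorphic_on annulus r R" using f by (simp add: H2_annulus_def)
  have inv: "inverse (rcis 1 t) ^ n = inverse (rcis 1 t) ^ Suc n * rcis 1 t" for t by simp
  have "lcp (TO f) 1 n = circ (\<lambda>t. transf f (rcis 1 t) * inverse (rcis 1 t) ^ Suc n * rcis 1 t)"
    unfolding lcp_def TO_rcis[OF f] inv by (simp only: mult.assoc)
  also have "\<dots> = circ (\<lambda>t. f (rcis 1 t) * inverse (\<tau> (rcis 1 t)) ^ Suc n * rcis 1 t)"
    by (rule transf_change_of_variables[OF fh, of "\<lambda>z. inverse z ^ Suc n"]) (intro holomorphic_intros, auto)
  also have "\<dots> = circ (\<lambda>t. f (rcis \<rho> t) * inverse (\<tau> (rcis \<rho> t)) ^ Suc n * rcis \<rho> t)"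
    by (rule circ_radius_independent[of r "\<lambda>z. f z * inverse (\<tau> z) ^ Suc n * z" R])
       (use radii_order radii_facts \<rho> nonzero in \<open>auto intro!: holomorphic_intros fh hol\<close>)
  finally show ?thesis by (simp add: mult_ac)
qed

lemma f_circle_continuous:
  assumes "f \<in> H2_annulus r R" "r < \<rho>" "\<rho> < R"
  shows "continuous_on S (\<lambda>t. f (rcis \<rho> t) * rcis \<rho> t)"
proof -
  have fh: "f holomorphic_on annulus r R" using assms by (simp add: H2_annulus_def)
  have "continuous_on (sphere 0 \<rho>) (\<lambda>z. f z * z)"
    using fh sphere_subset_annulus[OF assms(2,3)]
    by (intro continuous_intros) (auto intro: holomorphic_on_imp_continuous_on holomorphic_on_subset)
  then show ?thesis using assms radii_order by (intro circ_rcis_continuous[of _ "\<lambda>z. f z * z"]) auto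
qed

lemma tau_circle_continuous:
  assumes "r \<le> \<rho>" "\<rho> \<le> R"
  shows "continuous_on S (\<lambda>t. \<tau> (rcis \<rho> t))"
  using assms radii_order by (intro circ_rcis_continuous continuous_on_subset[OF cont]) auto

lemma inner_pairing:
  assumes f: "f \<in> H2_annulus r R" and x: "l2 x"
  shows "(\<lambda>n. x n * of_real (inverse r) ^ n * lcn (TO f) 1 n) sums
     circ (\<lambda>t. f (rcis r0 t) * (hdisc r x (\<tau> (rcis r0 t)) * rcis r0 t))"
proof -
  obtain s where s: "0 < s" "s < 1" "\<And>z. r \<le> cmod z \<Longrightarrow> cmod z \<le> r0 \<Longrightarrow> cmod (\<tau> z) \<le> s * r"
    using inner_contraction by blast
  have sr: "0 < s * r" using s radii_order by simp
  \<comment> \<open>The margin \<open>s\<close> is split between the factors: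
    \<open>x n * s ^ n\<close> is absolutely summable, and the remaining power of \<tau> / (s r) is
    bounded by 1, which is the form required by \<open>circ_series\<close>.\<close>
  define w where "w = (\<lambda>n t. (\<tau> (rcis r0 t) / of_real (s * r)) ^ n)"
  have tau_le: "cmod (\<tau> (rcis r0 t)) \<le> s * r" for t by (rule s(3)) (use radii_order in auto)
  have wle: "cmod (w n t) \<le> 1" for n t
  proof -
    have "cmod (\<tau> (rcis r0 t) / of_real (s * r)) \<le> 1"
      using tau_le[of t] sr by (simp add: norm_divide del: of_real_mult)
    then show ?thesis unfolding w_def norm_power by (intro power_le_one) auto
  qed
  have wc: "continuous_on {0..2*pi} (w n)" for n
    unfolding w_def using sr by (intro continuous_intros tau_circle_continuous) (use radii_order radii_facts in auto)
  have P: "summable (\<lambda>n. cmod (x n * of_real s ^ n))"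
    using l2_scaled_asum(1)[OF x, of s] s by (simp add: asum_def)
  have "(\<lambda>n. (x n * of_real s ^ n) * circ (\<lambda>t. w n t * (f (rcis r0 t) * rcis r0 t))) sums
     circ (\<lambda>t. (\<Sum>n. (x n * of_real s ^ n) * w n t) * (f (rcis r0 t) * rcis r0 t))"
    by (intro circ_series P wc wle f_circle_continuous f) (use radii_order radii_facts in auto)
  moreover have sw: "of_real s ^ n * w n t = of_real (inverse r) ^ n * \<tau> (rcis r0 t) ^ n" for n t
  proof -
    have "of_real s * (\<tau> (rcis r0 t) / of_real (s * r)) = of_real (inverse r) * \<tau> (rcis r0 t)"
      using s radii_order by (simp add: field_simps)
    then show ?thesis unfolding w_def power_mult_distrib[symmetric] by simp
  qed
  have "(x n * of_real s ^ n) * circ (\<lambda>t. w n t * (f (rcis r0 t) * rcis r0 t)) = x n * of_real (inverse r) ^ n * lcn (TO f) 1 n" for n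
  proof -
    have "of_real s ^ n * circ (\<lambda>t. w n t * (f (rcis r0 t) * rcis r0 t)) =
        circ (\<lambda>t. of_real (inverse r) ^ n * (\<tau> (rcis r0 t) ^ n * (f (rcis r0 t) * rcis r0 t)))"
      unfolding circ_cmult[symmetric] using sw by (intro circ_cong) (metis mult.assoc)
    also have "\<dots> = of_real (inverse r) ^ n * lcn (TO f) 1 n"
      unfolding circ_cmult by (subst TO_lcn[OF f, of r0]) (use radii_order radii_facts in auto)
    finally show ?thesis by (simp only: mult.assoc)
  qed
  moreover have "(\<Sum>n. (x n * of_real s ^ n) * w n t) = hdisc r x (\<tau> (rcis r0 t))" for t
  proof -
    have "s * r < r" using s radii_order by simp
    then have "\<tau> (rcis r0 t) \<in> ball 0 r" using tau_le[of t] by simp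
    then have "hdisc r x (\<tau> (rcis r0 t)) = (\<Sum>n. x n * (of_real (inverse r) ^ n * \<tau> (rcis r0 t) ^ n))"
      by (simp add: hdisc_def zero_ext_def pw_def divide_inverse power_mult_distrib mult_ac)
    then show ?thesis by (simp only: mult.assoc sw)
  qed
  ultimately show ?thesis by (simp only: mult_ac)
qed

lemma outer_pairing:
  assumes f: "f \<in> H2_annulus r R" and y: "l2 y"
  shows "(\<lambda>n. y n * of_real R ^ Suc n * lcp (TO f) 1 n) sums
     circ (\<lambda>t. f (rcis R0 t) * (hext R y (\<tau> (rcis R0 t)) * rcis R0 t))"
proof -
  obtain s where s: "0 < s" "s < 1" "\<And>z. R0 \<le> cmod z \<Longrightarrow> cmod z \<le> R \<Longrightarrow> R \<le> s * cmod (\<tau> z)"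
    using outer_expansion by blast
  \<comment> \<open>The same splitting at infinity; the exponent \<open>Suc n\<close> reflects that
    \<open>h2\<close> starts with the power - 1.\<close>
  define w where "w = (\<lambda>n t. (of_real R / (of_real s * \<tau> (rcis R0 t))) ^ Suc n)"
  have tau_ge: "R \<le> s * cmod (\<tau> (rcis R0 t))" for t by (rule s(3)) (use radii_order in auto)
  have nz: "\<tau> (rcis R0 t) \<noteq> 0" for t
    by (rule outer_tau_nonzero) (use radii_order in auto)
  have wle: "cmod (w n t) \<le> 1" for n t
  proof -
    have "0 < s * cmod (\<tau> (rcis R0 t))" using tau_ge[of t] radii_facts(1) by linarith
    then have "cmod (of_real R / (of_real s * \<tau> (rcis R0 t))) \<le> 1"
      using tau_ge[of t] s radii_facts(1) by (simp add: norm_divide norm_mult)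
    then show ?thesis unfolding w_def norm_power by (intro power_le_one) auto
  qed
  have wc: "continuous_on {0..2*pi} (w n)" for n
    unfolding w_def using s nz by (intro continuous_intros tau_circle_continuous) (use radii_order radii_facts in auto)
  have P: "summable (\<lambda>n. cmod (y n * of_real s ^ Suc n))"
    using l2_scaled_asum(2)[OF y, of s] s by (simp add: asum_def)
  have "(\<lambda>n. (y n * of_real s ^ Suc n) * circ (\<lambda>t. w n t * (f (rcis R0 t) * rcis R0 t))) sums
     circ (\<lambda>t. (\<Sum>n. (y n * of_real s ^ Suc n) * w n t) * (f (rcis R0 t) * rcis R0 t))"
    by (intro circ_series P wc wle f_circle_continuous f) (use radii_order radii_facts in auto)
  moreover have sw: "of_real s ^ Suc n * w n t = of_real R ^ Suc n * inverse (\<tau> (rcis R0 t)) ^ Suc n" for n t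
  proof -
    have "of_real s * (of_real R / (of_real s * \<tau> (rcis R0 t))) = of_real R * inverse (\<tau> (rcis R0 t))"
      using s nz[of t] by (simp add: field_simps)
    then show ?thesis unfolding w_def power_mult_distrib[symmetric] by simp
  qed
  have "(y n * of_real s ^ Suc n) * circ (\<lambda>t. w n t * (f (rcis R0 t) * rcis R0 t)) = y n * of_real R ^ Suc n * lcp (TO f) 1 n" for n
  proof -
    have "of_real s ^ Suc n * circ (\<lambda>t. w n t * (f (rcis R0 t) * rcis R0 t)) =
        circ (\<lambda>t. of_real R ^ Suc n * (inverse (\<tau> (rcis R0 t)) ^ Suc n * (f (rcis R0 t) * rcis R0 t)))"
      unfolding circ_cmult[symmetric] using sw by (intro circ_cong) (metis mult.assoc)
    also have "\<dots> = of_real R ^ Suc n * lcp (TO f) 1 n"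
      unfolding circ_cmult by (subst TO_lcp[OF f, of R0]) (use radii_order radii_facts in auto)
    finally show ?thesis by (simp only: mult.assoc)
  qed
  moreover have "(\<Sum>n. (y n * of_real s ^ Suc n) * w n t) = hext R y (\<tau> (rcis R0 t))" for t
  proof -
    have "0 < cmod (\<tau> (rcis R0 t))" using nz by simp
    then have "s * cmod (\<tau> (rcis R0 t)) < cmod (\<tau> (rcis R0 t))" using s by simp
    then have ex: "\<tau> (rcis R0 t) \<in> ext_disc R" using tau_ge[of t] by (simp add: ext_disc_def)
    have "(\<lambda>n. (of_real R / \<tau> (rcis R0 t)) * (y n * (of_real R / \<tau> (rcis R0 t)) ^ n)) sums
        ((of_real R / \<tau> (rcis R0 t)) * pw y (of_real R / \<tau> (rcis R0 t)))"
      by (intro sums_mult pw_sums y ext_disc_ratio ex radii_facts(1))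
    moreover have "(of_real R / \<tau> (rcis R0 t)) * (y n * (of_real R / \<tau> (rcis R0 t)) ^ n) = y n * (of_real s ^ Suc n * w n t)" for n
    proof -
      have "(of_real R / \<tau> (rcis R0 t)) * (y n * (of_real R / \<tau> (rcis R0 t)) ^ n) = y n * (of_real R * inverse (\<tau> (rcis R0 t))) ^ Suc n"
        unfolding divide_inverse by (simp only: power_Suc mult_ac)
      then show ?thesis unfolding sw power_mult_distrib .
    qed
    ultimately show ?thesis using ex by (simp add: hext_def zero_ext_def sums_iff mult.assoc del: power_Suc)
  qed
  ultimately show ?thesis by (simp only: mult_ac)
qed

section \<open>The matrix operator in coordinates and the intertwining relation\<close>

lemma sphere_continuous:
  assumes "l2 x" "l2 y"
  shows "continuous_on (sphere 0 r) (\<lambda>z. hdisc r x (\<tau> z))" "continuous_on (sphere 0 R) (\<lambda>z. hext R y (\<tau> z))"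
    "continuous_on (sphere 0 r0) (\<lambda>z. hdisc r x (\<tau> z))" "continuous_on (sphere 0 R0) (\<lambda>z. hext R y (\<tau> z))"
proof -
  note inner = continuous_on_subset[OF inner_composition(1)[OF assms(1)]]
  note outer = continuous_on_subset[OF outer_composition(1)[OF assms(2)]]
  show "continuous_on (sphere 0 r) (\<lambda>z. hdisc r x (\<tau> z))" by (rule inner) (use radii_order in auto)
  show "continuous_on (sphere 0 R) (\<lambda>z. hext R y (\<tau> z))" by (rule outer) (use radii_order in auto)
  show "continuous_on (sphere 0 r0) (\<lambda>z. hdisc r x (\<tau> z))" by (rule inner) (use radii_order in auto)
  show "continuous_on (sphere 0 R0) (\<lambda>z. hext R y (\<tau> z))" by (rule outer) (use radii_order in auto)
qed

lemma composition_L2: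
  assumes c: "continuous_on (sphere 0 \<rho>) (\<lambda>z. h (\<tau> z))" and \<rho>: "0 < \<rho>"
  shows "composition_operator \<tau> \<rho> h \<in> L2_circle \<rho>"
proof -
  have eq: "composition_operator \<tau> \<rho> h (rcis \<rho> t) = h (\<tau> (rcis \<rho> t))" for t
    using \<rho> by (simp add: composition_operator_def zero_ext_def)
  have gc: "continuous_on {0..2*pi} (\<lambda>t. h (\<tau> (rcis \<rho> t)))"
    using \<rho> by (intro circ_rcis_continuous[OF c]) auto
  have "(\<lambda>t. h (\<tau> (rcis \<rho> t))) \<in> borel_measurable (lebesgue_on {0..2*pi})"
    by (rule continuous_imp_measurable_on_sets_lebesgue[OF gc]) auto
  moreover have "integrable (lebesgue_on (cbox 0 (2*pi))) (\<lambda>t. (norm (h (\<tau> (rcis \<rho> t))))\<^sup>2)"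
    by (rule continuous_imp_integrable) (auto intro!: continuous_intros gc)
  ultimately show ?thesis
    unfolding L2_circle_def using \<rho> by (simp add: eq) (simp add: composition_operator_def zero_ext_def)
qed

text \<open>Restriction to the smaller disc, or to the smaller neighbourhood of infinity, only damps
  coefficients. Hence the off-diagonal entries stay square summable by comparison with their values
  on the circle of origin.\<close>

lemma L_prime_coordinates:
  assumes x: "l2 x" and y: "l2 y"
  defines "W1 \<equiv> \<lambda>z. hdisc r x (\<tau> z)" and "W2 \<equiv> \<lambda>z. hext R y (\<tau> z)"
  defines "x' \<equiv> \<lambda>n. lcp W1 r n * of_real r ^ n + lcp W2 R n * of_real r ^ n"
    and "y' \<equiv> \<lambda>n. lcn W1 r n * of_real (inverse R) ^ Suc n + lcn W2 R n * of_real (inverse R) ^ Suc n"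
  shows "l2 x'" "l2 y'" "L_prime \<tau> r R (hdisc r x, hext R y) = (hdisc r x', hext R y')"
proof -
  note r = radii_order(1) and R = radii_facts(1) and rR = radii_facts(4)
  have c1: "continuous_on (sphere 0 r) W1" and c2: "continuous_on (sphere 0 R) W2"
    unfolding W1_def W2_def using sphere_continuous[OF x y] by blast+
  have a1: "l2 (\<lambda>n. lcp W1 r n * of_real r ^ n)" by (rule lc_l2(1)[OF c1 r])
  have a2: "l2 (\<lambda>n. lcp W2 R n * of_real r ^ n)"
    by (rule l2_comparison[OF lc_l2(1)[OF c2 R]])
       (use r rR in \<open>auto simp: norm_mult norm_power intro!: mult_left_mono power_mono\<close>)
  have b1: "l2 (\<lambda>n. lcn W1 r n * of_real (inverse R) ^ Suc n)"
    by (rule l2_comparison[OF lc_l2(2)[OF c1 r]])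
       (use r R rR in \<open>auto simp: norm_mult norm_power norm_inverse intro!: mult_left_mono mult_mono power_mono le_imp_inverse_le\<close>)
  have b2: "l2 (\<lambda>n. lcn W2 R n * of_real (inverse R) ^ Suc n)" by (rule lc_l2(2)[OF c2 R])
  show "l2 x'" "l2 y'" unfolding x'_def y'_def by (intro l2_add a1 a2 b1 b2)+
  define g1 where "g1 = composition_operator \<tau> r (hdisc r x)"
  define g2 where "g2 = composition_operator \<tau> R (hext R y)"
  have lc1: "lcp g1 r n = lcp W1 r n" "lcn g1 r n = lcn W1 r n" for n
    using r by (auto intro!: lc_cong simp: g1_def W1_def composition_operator_def zero_ext_def)
  have lc2: "lcp g2 R n = lcp W2 R n" "lcn g2 R n = lcn W2 R n" for n
    using R by (auto intro!: lc_cong simp: g2_def W2_def composition_operator_def zero_ext_def)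
  have p1: "proj_plus r g1 = hdisc r (\<lambda>n. lcp W1 r n * of_real r ^ n)"
    using proj_plus_hdisc[OF r order_refl, of g1] unfolding lc1
    by (simp add: proj_plus_def zero_ext_idem)
  have p2: "zero_ext (ball 0 r) (proj_plus R g2) = hdisc r (\<lambda>n. lcp W2 R n * of_real r ^ n)"
    using proj_plus_hdisc[OF r, of R g2] rR unfolding lc2 by simp
  have m1: "zero_ext (ext_disc R) (proj_minus r g1) = hext R (\<lambda>n. lcn W1 r n * of_real (inverse R) ^ Suc n)"
    using proj_minus_hext[OF r, of R g1] rR b1 unfolding lc1 by simp
  have m2: "proj_minus R g2 = hext R (\<lambda>n. lcn W2 R n * of_real (inverse R) ^ Suc n)"
    using proj_minus_hext[OF R order_refl, of g2] b2 unfolding lc2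
    by (simp add: proj_minus_def zero_ext_idem)
  show "L_prime \<tau> r R (hdisc r x, hext R y) = (hdisc r x', hext R y')"
    unfolding L_prime_def prod.case g1_def[symmetric] g2_def[symmetric] p1 p2 m1 m2
      hdisc_add[OF r a1 a2] hext_add[OF R b1 b2] x'_def y'_def ..
qed

lemma L_prime_mem: "h \<in> H2_sum r R \<Longrightarrow> L_prime \<tau> r R h \<in> H2_sum r R"
proof -
  assume h: "h \<in> H2_sum r R"
  obtain x y where xy: "l2 x" "l2 y" "h = (hdisc r x, hext R y)"
    using H2_sum_cases[OF radii_order(1) radii_facts(1) h] .
  show ?thesis
    unfolding xy(3) L_prime_coordinates(3)[OF xy(1,2)] H2_sum_def
    by (intro SigmaI hdisc_mem hext_mem L_prime_coordinates(1,2) xy radii_order(1) radii_facts(1))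
qed

text \<open>Both sides equal \<open>I1 + I2\<close>, integrals over the circles of
  \<open>A0\<close>. The adjoint side gets there by the change of variables, the matrix side by
  Laurent coefficients; the form \<open>J L' = L* J\<close> avoids inverting
  \<open>J\<close>.\<close>

theorem J_map_conjugates:
  assumes h: "h \<in> H2_sum r R"
  shows "J_map r R (L_prime \<tau> r R h) = transfer_adjoint \<tau> r R (J_map r R h)"
proof
  fix f
  note r = radii_order(1) and R = radii_facts(1) and rR = radii_facts(4)
  have one: "r < 1" "1 < R" using radii_facts by auto
  show "J_map r R (L_prime \<tau> r R h) f = transfer_adjoint \<tau> r R (J_map r R h) f"
  proof (cases "f \<in> H2_annulus r R")
    case False
    then show ?thesis by (simp add: J_map_zero transfer_adjoint_def zero_ext_def)
  next
    case f: True
    have fh: "f holomorphic_on annulus r R" using f by (simp add: H2_annulus_def)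
    obtain x y where xy: "l2 x" "l2 y" "h = (hdisc r x, hext R y)" using H2_sum_cases[OF r R h] .
    have Tf: "TO f \<in> H2_annulus r R" using TO_bounded f by blast
    define W1 where "W1 = (\<lambda>z. hdisc r x (\<tau> z))"
    define W2 where "W2 = (\<lambda>z. hext R y (\<tau> z))"
    define x' where "x' = (\<lambda>n. lcp W1 r n * of_real r ^ n + lcp W2 R n * of_real r ^ n)"
    define y' where "y' = (\<lambda>n. lcn W1 r n * of_real (inverse R) ^ Suc n + lcn W2 R n * of_real (inverse R) ^ Suc n)"
    note L = L_prime_coordinates[OF xy(1,2), folded W1_def W2_def, folded x'_def y'_def]
    define v where "v = (\<lambda>n. lcp f 1 n * of_real R ^ n)"
    define u where "u = (\<lambda>n. lcn f 1 n * of_real (inverse r) ^ Suc n)"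
    note fr = H2_annulus_repr[OF r rR f one, folded v_def u_def]
    define v1 where "v1 = (\<lambda>n. lcp (TO f) 1 n * of_real R ^ n)"
    define u1 where "u1 = (\<lambda>n. lcn (TO f) 1 n * of_real (inverse r) ^ Suc n)"
    note tr = H2_annulus_repr[OF r rR Tf one, folded v1_def u1_def]
    have rn: "of_real (inverse r) ^ Suc n * of_real r ^ Suc n = (1::complex)" for n
      unfolding power_mult_distrib[symmetric] using r by simp
    have Rn: "of_real (inverse R) ^ Suc n * of_real R ^ Suc n = (1::complex)" for n
      unfolding power_mult_distrib[symmetric] using R by simp
    define I1 where "I1 = circ (\<lambda>t. f (rcis r0 t) * (W1 (rcis r0 t) * rcis r0 t))"
    define I2 where "I2 = circ (\<lambda>t. f (rcis R0 t) * (W2 (rcis R0 t) * rcis R0 t))"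
    have "J_map r R h (TO f) = of_real r * (\<Sum>n. u1 n * x n) + of_real R * (\<Sum>n. v1 n * y n)"
      unfolding xy(3) by (subst tr(3)) (rule J_map_hann[OF r rR tr(1,2) xy(1,2)])
    moreover have "of_real r * (\<Sum>n. u1 n * x n) = I1"
    proof -
      have "(\<lambda>n. of_real r * (u1 n * x n)) sums (of_real r * (\<Sum>n. u1 n * x n))"
        by (intro sums_mult summable_sums asum_summable l2_mult tr xy)
      moreover have "of_real r * (u1 n * x n) = x n * of_real (inverse r) ^ n * lcn (TO f) 1 n" for n
        using r by (simp add: u1_def field_simps)
      ultimately show ?thesis
        using inner_pairing[OF f xy(1)] unfolding I1_def W1_def by (simp add: sums_unique2)
    qed
    moreover have "of_real R * (\<Sum>n. v1 n * y n) = I2"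
    proof -
      have "(\<lambda>n. of_real R * (v1 n * y n)) sums (of_real R * (\<Sum>n. v1 n * y n))"
        by (intro sums_mult summable_sums asum_summable l2_mult tr xy)
      moreover have "of_real R * (v1 n * y n) = y n * of_real R ^ Suc n * lcp (TO f) 1 n" for n
        by (simp add: v1_def mult_ac)
      ultimately show ?thesis
        using outer_pairing[OF f xy(2)] unfolding I2_def W2_def by (simp add: sums_unique2 del: power_Suc)
    qed
    ultimately have rhs: "J_map r R h (TO f) = I1 + I2" by simp
    \<comment> \<open>The projections use coefficients on the boundary of \<open>A\<close>, the
      integrals those on the boundary of \<open>A0\<close>. In the ring between the circles
      \<open>W1\<close>, respectively \<open>W2\<close>, is holomorphic, so they agree.\<close>
    have shift1: "lcp W1 r n = lcp W1 r0 n" "lcn W1 r n = lcn W1 r0 n" for n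
      unfolding W1_def using lc_radius_closed[OF r radii_order(2) inner_composition[OF xy(1)]] by blast+
    have shift2: "lcp W2 R0 n = lcp W2 R n" "lcn W2 R0 n = lcn W2 R n" for n
      unfolding W2_def using lc_radius_closed[OF radii_facts(6) radii_order(5) outer_composition[OF xy(2)]] by blast+
    have "(\<lambda>n. lcp f 1 n * lcn W1 r0 n + lcn f 1 n * lcp W1 r0 n) sums I1"
      unfolding I1_def W1_def
      by (rule laurent_pairing[OF r radii_order(2) radii_facts(8) one fh sphere_continuous(3)[OF xy(1,2)]])
    moreover have "(\<lambda>n. lcp f 1 n * lcn W2 R0 n + lcn f 1 n * lcp W2 R0 n) sums I2"
      unfolding I2_def W2_def
      by (rule laurent_pairing[OF r radii_facts(9) radii_order(5) one fh sphere_continuous(4)[OF xy(1,2)]])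
    ultimately have s1: "(\<lambda>n. (lcp f 1 n * lcn W1 r n + lcn f 1 n * lcp W1 r n) + (lcp f 1 n * lcn W2 R n + lcn f 1 n * lcp W2 R n)) sums (I1 + I2)"
      unfolding shift1 shift2[symmetric] by (rule sums_add)
    have "J_map r R (L_prime \<tau> r R h) f = of_real r * (\<Sum>n. u n * x' n) + of_real R * (\<Sum>n. v n * y' n)"
      unfolding xy(3) L(3) by (subst fr(3)) (rule J_map_hann[OF r rR fr(1,2) L(1,2)])
    moreover have "(\<lambda>n. of_real r * (u n * x' n) + of_real R * (v n * y' n)) sums
       (of_real r * (\<Sum>n. u n * x' n) + of_real R * (\<Sum>n. v n * y' n))"
      by (intro sums_add sums_mult summable_sums asum_summable l2_mult fr L)
    moreover have "of_real r * (u n * x' n) + of_real R * (v n * y' n) =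
      (lcp f 1 n * lcn W1 r n + lcn f 1 n * lcp W1 r n) + (lcp f 1 n * lcn W2 R n + lcn f 1 n * lcp W2 R n)" for n
    proof -
      have "of_real r * (u n * x' n) = lcn f 1 n * (of_real (inverse r) ^ Suc n * of_real r ^ Suc n) * (lcp W1 r n + lcp W2 R n)"
        unfolding u_def x'_def power_Suc[of "of_real r"] by (simp add: algebra_simps del: power_Suc of_real_inverse)
      moreover have "of_real R * (v n * y' n) = lcp f 1 n * (of_real (inverse R) ^ Suc n * of_real R ^ Suc n) * (lcn W1 r n + lcn W2 R n)"
        unfolding v_def y'_def power_Suc[of "of_real R"] by (simp add: algebra_simps del: power_Suc of_real_inverse)
      ultimately show ?thesis unfolding rn Rn by (simp add: algebra_simps)
    qed
    ultimately have lhs: "J_map r R (L_prime \<tau> r R h) f = I1 + I2"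
      using s1 by (simp add: sums_unique2)
    show ?thesis using f by (simp add: lhs rhs transfer_adjoint_def zero_ext_def)
  qed
qed

end

section \<open>Recovering radii from inclusions of closures\<close>

lemma closed_annulus_subset_closure:
  assumes "0 < a" "a < b"
  shows "{z. a \<le> cmod z \<and> cmod z \<le> b} \<subseteq> closure (annulus a b)"
proof
  fix z assume "z \<in> {z. a \<le> cmod z \<and> cmod z \<le> b}"
  then have z: "a \<le> cmod z" "cmod z \<le> b" by auto
  have z0: "0 < cmod z" using z assms by linarith
  have lim: "((\<lambda>s. of_real s * z) \<longlongrightarrow> of_real 1 * z) (at (1::real) within S)" for S
    by (intro tendsto_intros)
  consider "z \<in> annulus a b" | "cmod z = a" | "cmod z = b" using z by (force simp: annulus_def)
  then show "z \<in> closure (annulus a b)"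
  proof cases
    case 1
    then show ?thesis using closure_subset by blast
  next
    case 2
    have "\<forall>\<^sub>F s in at_right (1::real). of_real s * z \<in> annulus a b"
      unfolding eventually_at_right_field
      using 2 assms by (intro exI[of _ "b / a"]) (auto simp: annulus_def norm_mult field_simps)
    then have "\<forall>\<^sub>F s in at_right (1::real). of_real s * z \<in> closure (annulus a b)"
      by eventually_elim (use closure_subset in blast)
    from Lim_in_closed_set[OF closed_closure this _ lim] show ?thesis by simp
  next
    case 3
    have "\<forall>\<^sub>F s in at_left (1::real). of_real s * z \<in> annulus a b"
      unfolding eventually_at_left_field
    proof (intro exI[of _ "a / b"] conjI allI impI)
      show "a / b < 1" using assms by simp
      fix s assume s: "a / b < s" "s < 1"
      have "0 < a / b" using assms by simp
      then have "0 < s" using s(1) by linarith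
      then show "of_real s * z \<in> annulus a b"
        using 3 assms s by (simp add: annulus_def norm_mult field_simps)
    qed
    then have "\<forall>\<^sub>F s in at_left (1::real). of_real s * z \<in> closure (annulus a b)"
      by eventually_elim (use closure_subset in blast)
    from Lim_in_closed_set[OF closed_closure this _ lim] show ?thesis by simp
  qed
qed

lemma annulus_subset_closure_radii:
  assumes ab: "0 < a" "a < b" and sub: "closure (annulus a b) \<subseteq> annulus c e"
  shows "c < a" "b < e"
proof -
  have "of_real a \<in> closure (annulus a b)" "of_real b \<in> closure (annulus a b)"
    using closed_annulus_subset_closure[OF ab] ab by auto
  then have "of_real a \<in> annulus c e" "of_real b \<in> annulus c e" using sub by auto
  then show "c < a" "b < e" using ab by (auto simp: annulus_def)
qed

theorem proposition4p5:
  fixes \<tau> :: "complex \<Rightarrow> complex" and r R :: real and A0 A' :: "complex set"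
  assumes "analytic_expanding_circle_map \<tau>"
    and "0 < r" and "r < 1" and "1 < R"
    and "annulus r R \<in> holomorphy_annuli \<tau>"
    and "A0 \<in> holomorphy_annuli \<tau>" and "A' \<in> holomorphy_annuli \<tau>"
    and "compactly_contained A0 A'" and "compactly_contained A' (annulus r R)"
    and "\<tau> ` frontier A0 \<inter> closure (annulus r R) = {}"
    and "continuous_on (closure (annulus r R)) \<tau>"
    and "\<tau> ` sphere 0 r \<subseteq> ball 0 r" and "\<tau> ` sphere 0 R \<subseteq> ext_disc R"
  shows "transfer_operator \<tau> r R ` H2_annulus r R \<subseteq> H2_annulus r R
    \<and> transfer_adjoint \<tau> r R ` H2_dual r R \<subseteq> H2_dual r R
    \<and> is_H2_dual_isomorphism r R (J_map r R)
    \<and> composition_operator \<tau> r ` H2_disc r \<subseteq> L2_circle r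
    \<and> composition_operator \<tau> R ` H2_0_ext R \<subseteq> L2_circle R
    \<and> L_prime \<tau> r R ` H2_sum r R \<subseteq> H2_sum r R
    \<and> (\<forall>h\<in>H2_sum r R.
         L_prime \<tau> r R h =
           inv_into (H2_sum r R) (J_map r R) (transfer_adjoint \<tau> r R (J_map r R h)))"
proof -
  obtain r0 R0 where A0: "A0 = annulus r0 R0" "0 < r0" "r0 < 1" "1 < R0"
    using assms(6) unfolding holomorphy_annuli_def by blast
  have "closure A0 \<subseteq> annulus r R"
    using assms(8,9) closure_subset[of A'] unfolding compactly_contained_def by blast
  then have rr: "r < r0" "R0 < R"
    using annulus_subset_closure_radii[of r0 R0 r R] A0 by auto
  \<comment> \<open>Membership only provides some radii describing the same set. Holomorphy and the
    absence of zeros transfer through the equality of sets, without comparing radii.\<close>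
  obtain r' R' where eq: "annulus r R = annulus r' R'" and
    hol: "\<tau> holomorphic_on annulus r' R'" and nz: "\<forall>z\<in>annulus r' R'. \<tau> z \<noteq> 0"
    using assms(5) unfolding holomorphy_annuli_def by blast
  have cl: "{z. r \<le> cmod z \<and> cmod z \<le> R} \<subseteq> closure (annulus r R)"
    by (rule closed_annulus_subset_closure) (use assms in auto)
  interpret expanding_annulus \<tau> r R r0 R0
  proof
    show "\<tau> holomorphic_on annulus r R" using hol eq by simp
    show "\<tau> z \<noteq> 0" if "z \<in> annulus r R" for z using nz eq that by simp
    show "cmod (\<tau> z) = 1" "1 < cmod (deriv \<tau> z)" if "cmod z = 1" for z
      using assms(1) that unfolding analytic_expanding_circle_map_def by (auto simp: image_subset_iff)
    show "continuous_on {z. r \<le> cmod z \<and> cmod z \<le> R} \<tau>"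
      by (rule continuous_on_subset[OF assms(11) cl])
    show "cmod (\<tau> z) < r" if "cmod z = r" for z
      using assms(12) that by (auto simp: image_subset_iff)
    show "R < cmod (\<tau> z)" if "cmod z = R" for z
      using assms(13) that by (auto simp: image_subset_iff ext_disc_def)
    show "cmod (\<tau> z) < r \<or> R < cmod (\<tau> z)" if z: "cmod z = r0 \<or> cmod z = R0" for z
    proof -
      have "z \<in> closure A0" using closed_annulus_subset_closure[of r0 R0] A0 z by auto
      moreover have "z \<notin> A0" using z A0 by (auto simp: annulus_def)
      ultimately have "z \<in> frontier A0" using open_annulus A0 by (simp add: frontier_def interior_open)
      then have "\<tau> z \<notin> closure (annulus r R)" using assms(10) by blast
      then have "\<not> (r \<le> cmod (\<tau> z) \<and> cmod (\<tau> z) \<le> R)" using cl by blast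
      then show ?thesis by linarith
    qed
  qed (use assms A0 rr in auto)
  have rR: "0 < r" "r < R" "0 < R" using assms by auto
  note iso = J_map_isomorphism[OF rR(1,2)]
  have "transfer_operator \<tau> r R ` H2_annulus r R \<subseteq> H2_annulus r R"
    using TO_bounded by blast
  moreover have "transfer_adjoint \<tau> r R ` H2_dual r R \<subseteq> H2_dual r R"
    using transfer_adjoint_dual by blast
  moreover have "composition_operator \<tau> r h \<in> L2_circle r" if h: "h \<in> H2_disc r" for h
  proof -
    obtain x where "l2 x" "h = hdisc r x" using H2_disc_repr[OF rR(1) h] .
    then show ?thesis using sphere_continuous(1)[of x "\<lambda>n. 0"] rR by (intro composition_L2) auto
  qed
  moreover have "composition_operator \<tau> R h \<in> L2_circle R" if h: "h \<in> H2_0_ext R" for h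
  proof -
    obtain y where "l2 y" "h = hext R y" using H2_0_ext_repr[OF rR(3) h] .
    then show ?thesis using sphere_continuous(2)[of "\<lambda>n. 0" y] rR by (intro composition_L2) auto
  qed
  moreover have "L_prime \<tau> r R ` H2_sum r R \<subseteq> H2_sum r R"
    using L_prime_mem by blast
  moreover have "L_prime \<tau> r R h = inv_into (H2_sum r R) (J_map r R) (transfer_adjoint \<tau> r R (J_map r R h))"
    if h: "h \<in> H2_sum r R" for h
    unfolding J_map_conjugates[OF h, symmetric]
    by (rule inv_into_f_f[OF J_map_inj[OF rR(1,2)] L_prime_mem[OF h], symmetric])
  ultimately show ?thesis using iso by blast
qed

end
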